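(* Let $\Sigma$ be an infinite-type surface for which the grand arc graph $\mathcal{G}(\Sigma)$ is $\delta$-hyperbolic for some $\delta$ and on which the mapping class group $\mathrm{Map}(\Sigma)$ acts quasi-continuously and coboundedly. Then there is a graph $\Gamma$, quasi-isometric to $\mathcal{G}(\Sigma)$ (hence Gromov hyperbolic), on which $\mathrm{Map}(\Sigma)$ acts continuously and vertex-transitively.
   Context: $\Sigma$ is a connected, orientable surface with fundamental group not finitely generated. $\mathrm{Map}(\Sigma)$ is the group of isotopy classes of (orientation-preserving) homeomorphisms of $\Sigma$, with the quotient of the compact-open topology; a neighborhood basis of the identity is given by the pointwise stabilizers of finite sets of isotopy classes of essential simple closed curves. Ends. On the space of ends $E(\Sigma)$ (with its subspace of non-planar ends) define the Mann–Rafi preorder: $y\preceq x$ if every clopen neighborhood of $x$ contains a homeomorphic copy (respecting non-planar ends) of some clopen neighborhood of $y$. Ends $x,y$ have the same type if $x\preceq y$ and $y\preceq x$; an end $x$ is maximal if $x\preceq y$ implies $y\preceq x$. The grand arc graph $\mathcal{G}(\Sigma)$ (Bar-Natan–Verberne): vertices are isotopy classes of grand arcs, i.e. simple, properly embedded bi-infinite arcs in $\Sigma$ whose two ends converge to two maximal ends of $\Sigma$ of distinct types; two vertices are joined by an edge if they have disjoint representatives. It carries the path metric with edges of length $1$, and $\mathrm{Map}(\Sigma)$ acts on it by isometries. Being $\delta$-hyperbolic includes being connected. An isometric action of a topological group $G$ on a metric space $X$ is quasi-continuous if there is $\varepsilon>0$ such that for each $x\in X$ there is an identity neighborhood $U_x\subset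 G$ with $d(x,g.x)\le\varepsilon$ for all $g\in U_x$; it is cobounded if there are $x\in X$ and $R>0$ with $G.B_R(x)=X$. An action on a graph by graph automorphisms is continuous if and only if vertex stabilizers are open. *)

theory Defs
  imports "HOL-Analysis.Analysis" "HOL-Homology.Homology"
    "HOL-Algebra.Group_Action" "HOL-Algebra.Generated_Groups"
begin

section \<open>Graphs as metric spaces\<close>

record 'v graph =
  verts :: "'v set"
  edges :: "'v set set"

definition simple_graph :: "'v graph \<Rightarrow> bool" where
  "simple_graph \<Gamma> \<longleftrightarrow> edges \<Gamma> \<subseteq> {{u, v} |u v. u \<in> verts \<Gamma> \<and> v \<in> verts \<Gamma> \<and> u \<noteq> v}"

definition adjacency :: "'v graph \<Rightarrow> ('v \<times> 'v) set" where
  "adjacency \<Gamma> = {(u, v). {u, v} \<in> edges \<Gamma>}"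

definition connected_graph :: "'v graph \<Rightarrow> bool" where
  "connected_graph \<Gamma> \<longleftrightarrow> verts \<Gamma> \<times> verts \<Gamma> \<subseteq> (adjacency \<Gamma>)\<^sup>*"

text \<open>
  A graph is regarded as the metric space formed by its vertices with the path metric. The
  distance is meaningful only between vertices joined by a walk; it is always used together with
  \<^term>\<open>connected_graph\<close>.
\<close>

definition graph_dist :: "'v graph \<Rightarrow> 'v \<Rightarrow> 'v \<Rightarrow> real" where
  "graph_dist \<Gamma> u v = real (LEAST n. (u, v) \<in> adjacency \<Gamma> ^^ n)"

definition gromov_product :: "('v \<Rightarrow> 'v \<Rightarrow> real) \<Rightarrow> 'v \<Rightarrow> 'v \<Rightarrow> 'v \<Rightarrow> real" where
  "gromov_product d w x y = (d x w + d y w - d x y) / 2"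

definition gromov_hyperbolic :: "'v set \<Rightarrow> ('v \<Rightarrow> 'v \<Rightarrow> real) \<Rightarrow> real \<Rightarrow> bool" where
  "gromov_hyperbolic X d \<delta> \<longleftrightarrow>
     (\<forall>w\<in>X. \<forall>x\<in>X. \<forall>y\<in>X. \<forall>z\<in>X.
        gromov_product d w x z \<ge> min (gromov_product d w x y) (gromov_product d w y z) - \<delta>)"

definition hyperbolic_graph :: "'v graph \<Rightarrow> real \<Rightarrow> bool" where
  "hyperbolic_graph \<Gamma> \<delta> \<longleftrightarrow>
     connected_graph \<Gamma> \<and> gromov_hyperbolic (verts \<Gamma>) (graph_dist \<Gamma>) \<delta>"

definition quasi_isometric ::
  "'v set \<Rightarrow> ('v \<Rightarrow> 'v \<Rightarrow> real) \<Rightarrow> 'w set \<Rightarrow> ('w \<Rightarrow> 'w \<Rightarrow> real) \<Rightarrow> bool" where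
  "quasi_isometric X d Y d' \<longleftrightarrow>
     (\<exists>f \<in> X \<rightarrow> Y. \<exists>L\<ge>1. \<exists>C\<ge>0.
        (\<forall>x\<in>X. \<forall>x'\<in>X. d x x' / L - C \<le> d' (f x) (f x') \<and> d' (f x) (f x') \<le> L * d x x' + C) \<and>
        (\<forall>y\<in>Y. \<exists>x\<in>X. d' y (f x) \<le> C))"


section \<open>Actions\<close>

definition graph_action :: "('g, 'm) monoid_scheme \<Rightarrow> 'v graph \<Rightarrow> ('g \<Rightarrow> 'v \<Rightarrow> 'v) \<Rightarrow> bool" where
  "graph_action G \<Gamma> \<phi> \<longleftrightarrow>
     group_action G (verts \<Gamma>) \<phi> \<and>
     (\<forall>g\<in>carrier G. \<forall>u\<in>verts \<Gamma>. \<forall>v\<in>verts \<Gamma>. {\<phi> g u, \<phi> g v} \<in> edges \<Gamma> \<longleftrightarrow> {u, v} \<in> edges \<Gamma>)"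

definition continuous_action ::
  "'g topology \<Rightarrow> 'x set \<Rightarrow> ('x \<Rightarrow> 'x \<Rightarrow> real) \<Rightarrow> ('g \<Rightarrow> 'x \<Rightarrow> 'x) \<Rightarrow> bool" where
  "continuous_action T X d \<phi> \<longleftrightarrow>
     continuous_map (prod_topology T (Metric_space.mtopology X d)) (Metric_space.mtopology X d)
       (\<lambda>(g, x). \<phi> g x)"

definition quasi_continuous_action ::
  "('g, 'm) monoid_scheme \<Rightarrow> 'g topology \<Rightarrow> 'x set \<Rightarrow> ('x \<Rightarrow> 'x \<Rightarrow> real) \<Rightarrow> ('g \<Rightarrow> 'x \<Rightarrow> 'x) \<Rightarrow> bool" where
  "quasi_continuous_action G T X d \<phi> \<longleftrightarrow>
     (\<exists>\<epsilon>>0. \<forall>x\<in>X. \<exists>U. openin T U \<and> \<one>\<^bsub>G\<^esub> \<in> U \<and> (\<forall>g\<in>U. d x (\<phi> g x) \<le> \<epsilon>))"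

definition cobounded_action ::
  "('g, 'm) monoid_scheme \<Rightarrow> 'x set \<Rightarrow> ('x \<Rightarrow> 'x \<Rightarrow> real) \<Rightarrow> ('g \<Rightarrow> 'x \<Rightarrow> 'x) \<Rightarrow> bool" where
  "cobounded_action G X d \<phi> \<longleftrightarrow>
     (\<exists>x\<in>X. \<exists>R>0. (\<Union>g\<in>carrier G. \<phi> g ` Metric_space.mball X d x R) = X)"


section \<open>The fundamental group\<close>

definition loops_at :: "'a topology \<Rightarrow> 'a \<Rightarrow> (real \<Rightarrow> 'a) set" where
  "loops_at S p = {\<gamma>. pathin S \<gamma> \<and> \<gamma> 0 = p \<and> \<gamma> 1 = p}"

definition loop_homotopy :: "'a topology \<Rightarrow> 'a \<Rightarrow> ((real \<Rightarrow> 'a) \<times> (real \<Rightarrow> 'a)) set" where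
  "loop_homotopy S p = {(\<gamma>, \<eta>). \<gamma> \<in> loops_at S p \<and> \<eta> \<in> loops_at S p \<and>
     homotopic_with (\<lambda>\<sigma>. \<sigma> 0 = p \<and> \<sigma> 1 = p) (top_of_set {0..1}) S \<gamma> \<eta>}"

text \<open>The library's \<^const>\<open>joinpaths\<close> is restricted to types of class \<^class>\<open>topological_space\<close>.\<close>

definition join_loops :: "(real \<Rightarrow> 'a) \<Rightarrow> (real \<Rightarrow> 'a) \<Rightarrow> real \<Rightarrow> 'a" where
  "join_loops \<gamma> \<eta> = (\<lambda>t. if t \<le> 1/2 then \<gamma> (2 * t) else \<eta> (2 * t - 1))"

definition fundamental_group :: "'a topology \<Rightarrow> 'a \<Rightarrow> (real \<Rightarrow> 'a) set monoid" where
  "fundamental_group S p =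
     \<lparr>carrier = loops_at S p // loop_homotopy S p,
      mult = (\<lambda>A B. loop_homotopy S p `` {join_loops \<gamma> \<eta> |\<gamma> \<eta>. \<gamma> \<in> A \<and> \<eta> \<in> B}),
      one = loop_homotopy S p `` {\<lambda>_. p}\<rparr>"

definition finitely_generated_group :: "('g, 'm) monoid_scheme \<Rightarrow> bool" where
  "finitely_generated_group G \<longleftrightarrow> (\<exists>A. finite A \<and> A \<subseteq> carrier G \<and> generate G A = carrier G)"


section \<open>Surfaces and orientations\<close>

definition surface :: "'a topology \<Rightarrow> bool" where
  "surface S \<longleftrightarrow>
     Hausdorff_space S \<and> second_countable S \<and>
     (\<forall>p\<in>topspace S. \<exists>U. openin S U \<and> p \<in> U \<and>
        subtopology S U homeomorphic_space (euclidean :: (real^2) topology))"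

text \<open>
  An orientation is a locally consistent choice of generators of the local homology groups
  \<open>H\<^sub>2(S, S - {x})\<close>.
\<close>

definition orientation :: "'a topology \<Rightarrow> ('a \<Rightarrow> 'a chain set) \<Rightarrow> bool" where
  "orientation S \<mu> \<longleftrightarrow>
     (\<forall>x\<in>topspace S.
        \<mu> x \<in> carrier (relative_homology_group 2 S (topspace S - {x})) \<and>
        generate (relative_homology_group 2 S (topspace S - {x})) {\<mu> x} =
          carrier (relative_homology_group 2 S (topspace S - {x}))) \<and>
     (\<forall>x\<in>topspace S. \<exists>U c. openin S U \<and> x \<in> U \<and>
        c \<in> carrier (relative_homology_group 2 S (topspace S - U)) \<and>
        (\<forall>y\<in>U. hom_induced 2 S (topspace S - U) S (topspace S - {y}) id c = \<mu> y))"

definition orientable :: "'a topology \<Rightarrow> bool" where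
  "orientable S \<longleftrightarrow> (\<exists>\<mu>. orientation S \<mu>)"

definition orientation_preserving :: "'a topology \<Rightarrow> ('a \<Rightarrow> 'a) \<Rightarrow> bool" where
  "orientation_preserving S f \<longleftrightarrow>
     (\<forall>\<mu>. orientation S \<mu> \<longrightarrow>
        (\<forall>x\<in>topspace S.
           hom_induced 2 S (topspace S - {x}) S (topspace S - {f x}) f (\<mu> x) = \<mu> (f x)))"

definition infinite_type_surface :: "'a topology \<Rightarrow> bool" where
  "infinite_type_surface S \<longleftrightarrow>
     surface S \<and> connected_space S \<and> orientable S \<and>
     (\<exists>p\<in>topspace S. \<not> finitely_generated_group (fundamental_group S p))"


section \<open>The mapping class group\<close>

text \<open>
  Homeomorphisms are taken extensional, as in \<^const>\<open>BijGroup\<close>, so that each is represented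
  by exactly one function.
\<close>

definition homeos :: "'a topology \<Rightarrow> ('a \<Rightarrow> 'a) set" where
  "homeos S = {f \<in> Bij (topspace S). homeomorphic_map S S f \<and> orientation_preserving S f}"

definition homeo_group :: "'a topology \<Rightarrow> ('a \<Rightarrow> 'a) monoid" where
  "homeo_group S = BijGroup (topspace S) \<lparr>carrier := homeos S\<rparr>"

definition compact_open_topology :: "'a topology \<Rightarrow> ('a \<Rightarrow> 'a) topology" where
  "compact_open_topology S =
     topology_generated_by {{f \<in> homeos S. f ` K \<subseteq> U} |K U. compactin S K \<and> openin S U}"

definition isotopy_rel :: "'a topology \<Rightarrow> (('a \<Rightarrow> 'a) \<times> ('a \<Rightarrow> 'a)) set" where
  "isotopy_rel S = {(f, g). f \<in> homeos S \<and> g \<in> homeos S \<and>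
     homotopic_with (homeomorphic_map S S) S S f g}"

definition Map :: "'a topology \<Rightarrow> ('a \<Rightarrow> 'a) set monoid" where
  "Map S =
     \<lparr>carrier = homeos S // isotopy_rel S,
      mult = set_mult (homeo_group S),
      one = isotopy_rel S `` {\<one>\<^bsub>homeo_group S\<^esub>}\<rparr>"

definition Map_topology :: "'a topology \<Rightarrow> ('a \<Rightarrow> 'a) set topology" where
  "Map_topology S = topology (\<lambda>\<U>. \<U> \<subseteq> carrier (Map S) \<and>
     openin (compact_open_topology S) {f \<in> homeos S. isotopy_rel S `` {f} \<in> \<U>})"

lemma topspace_compact_open_topology: "topspace (compact_open_topology S) = homeos S"
  unfolding compact_open_topology_def topology_generated_by_topspace
  by (rule subset_antisym) (use compactin_empty openin_empty in blast)+

lemma openin_Map_topology: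
  "openin (Map_topology S) \<U> \<longleftrightarrow> \<U> \<subseteq> carrier (Map S) \<and>
     openin (compact_open_topology S) {f \<in> homeos S. isotopy_rel S `` {f} \<in> \<U>}"
proof -
  define P where "P \<U> = {f \<in> homeos S. isotopy_rel S `` {f} \<in> \<U>}" for \<U>
  have Int: "P (\<U> \<inter> \<V>) = P \<U> \<inter> P \<V>" for \<U> \<V>
    by (auto simp: P_def)
  have Un: "P (\<Union>\<K>) = \<Union> (P ` \<K>)" for \<K>
    by (auto simp: P_def)
  have "istopology (\<lambda>\<U>. \<U> \<subseteq> carrier (Map S) \<and> openin (compact_open_topology S) (P \<U>))"
    unfolding istopology_def Int Un by (auto intro!: openin_Union)
  then show ?thesis
    by (simp add: Map_topology_def P_def topology_inverse')
qed


section \<open>Ends\<close>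

text \<open>
  An end assigns to every compact set a component of its complement, compatibly with inclusions.
  Such a component is never contained in a compact set \<open>L\<close>, by compatibility with the
  compact set \<open>K \<union> L\<close>.
\<close>

definition ends :: "'a topology \<Rightarrow> ('a set \<Rightarrow> 'a set) set" where
  "ends S =
     {e \<in> \<Pi>\<^sub>E K\<in>{K. compactin S K}. connected_components_of (subtopology S (topspace S - K)).
        \<forall>K L. compactin S K \<and> compactin S L \<and> K \<subseteq> L \<longrightarrow> e L \<subseteq> e K}"

definition ends_topology :: "'a topology \<Rightarrow> ('a set \<Rightarrow> 'a set) topology" where
  "ends_topology S = topology_generated_by {{e \<in> ends S. e K = C} |K C. compactin S K}"

definition planar_end :: "'a topology \<Rightarrow> ('a set \<Rightarrow> 'a set) \<Rightarrow> bool" where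
  "planar_end S e \<longleftrightarrow>
     (\<exists>K. compactin S K \<and>
        (\<exists>P :: (real^2) set. subtopology S (e K) homeomorphic_space top_of_set P))"

definition nonplanar_ends :: "'a topology \<Rightarrow> ('a set \<Rightarrow> 'a set) set" where
  "nonplanar_ends S = {e \<in> ends S. \<not> planar_end S e}"

definition clopen_end_nbhd ::
  "'a topology \<Rightarrow> ('a set \<Rightarrow> 'a set) \<Rightarrow> ('a set \<Rightarrow> 'a set) set \<Rightarrow> bool" where
  "clopen_end_nbhd S e U \<longleftrightarrow>
     openin (ends_topology S) U \<and> closedin (ends_topology S) U \<and> e \<in> U"

definition homeomorphic_end_sets ::
  "'a topology \<Rightarrow> ('a set \<Rightarrow> 'a set) set \<Rightarrow> ('a set \<Rightarrow> 'a set) set \<Rightarrow> bool" where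
  "homeomorphic_end_sets S V W \<longleftrightarrow>
     (\<exists>h. homeomorphic_map (subtopology (ends_topology S) V) (subtopology (ends_topology S) W) h \<and>
          h ` (V \<inter> nonplanar_ends S) = W \<inter> nonplanar_ends S)"

text \<open>
  The copy \<open>W\<close> is required to be clopen, like the neighbourhood it is a copy of: the image of a
  clopen set of ends under a homeomorphism of the surface is clopen.
\<close>

definition end_le :: "'a topology \<Rightarrow> ('a set \<Rightarrow> 'a set) \<Rightarrow> ('a set \<Rightarrow> 'a set) \<Rightarrow> bool" where
  "end_le S y x \<longleftrightarrow>
     (\<forall>U. clopen_end_nbhd S x U \<longrightarrow>
        (\<exists>V W. clopen_end_nbhd S y V \<and> W \<subseteq> U \<and>
           openin (ends_topology S) W \<and> closedin (ends_topology S) W \<and>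
           homeomorphic_end_sets S V W))"

definition same_end_type :: "'a topology \<Rightarrow> ('a set \<Rightarrow> 'a set) \<Rightarrow> ('a set \<Rightarrow> 'a set) \<Rightarrow> bool" where
  "same_end_type S x y \<longleftrightarrow> end_le S x y \<and> end_le S y x"

definition maximal_end :: "'a topology \<Rightarrow> ('a set \<Rightarrow> 'a set) \<Rightarrow> bool" where
  "maximal_end S x \<longleftrightarrow> x \<in> ends S \<and> (\<forall>y\<in>ends S. end_le S x y \<longrightarrow> end_le S y x)"


section \<open>The grand arc graph\<close>

definition converges_to_end ::
  "'a topology \<Rightarrow> (real \<Rightarrow> 'a) \<Rightarrow> ('a set \<Rightarrow> 'a set) \<Rightarrow> real filter \<Rightarrow> bool" where
  "converges_to_end S \<alpha> e F \<longleftrightarrow> (\<forall>K. compactin S K \<longrightarrow> (\<forall>\<^sub>F t in F. \<alpha> t \<in> e K))"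

text \<open>An arc is identified with its image, so it carries neither a parametrization nor a direction.\<close>

definition grand_arc :: "'a topology \<Rightarrow> 'a set \<Rightarrow> bool" where
  "grand_arc S A \<longleftrightarrow>
     (\<exists>\<alpha> x y. continuous_map euclideanreal S \<alpha> \<and> inj \<alpha> \<and> proper_map euclideanreal S \<alpha> \<and>
        A = range \<alpha> \<and> maximal_end S x \<and> maximal_end S y \<and> \<not> same_end_type S x y \<and>
        converges_to_end S \<alpha> x at_bot \<and> converges_to_end S \<alpha> y at_top)"

text \<open>Arcs are isotopic if an ambient isotopy of the surface carries one to the other.\<close>

definition arc_isotopy_rel :: "'a topology \<Rightarrow> ('a set \<times> 'a set) set" where
  "arc_isotopy_rel S = {(A, B). grand_arc S A \<and> grand_arc S B \<and>
     (\<exists>f \<in> isotopy_rel S `` {\<one>\<^bsub>homeo_group S\<^esub>}. f ` A = B)}"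

definition grand_arc_graph :: "'a topology \<Rightarrow> 'a set set graph" where
  "grand_arc_graph S =
     \<lparr>verts = {A. grand_arc S A} // arc_isotopy_rel S,
      edges = {{a, b} |a b. a \<in> {A. grand_arc S A} // arc_isotopy_rel S \<and>
                 b \<in> {A. grand_arc S A} // arc_isotopy_rel S \<and> a \<noteq> b \<and>
                 (\<exists>A\<in>a. \<exists>B\<in>b. A \<inter> B = {})}\<rparr>"

definition grand_arc_action :: "'a topology \<Rightarrow> ('a \<Rightarrow> 'a) set \<Rightarrow> 'a set set \<Rightarrow> 'a set set" where
  "grand_arc_action S g = (\<lambda>a\<in>verts (grand_arc_graph S). {f ` A |f A. f \<in> g \<and> A \<in> a})"

end

theory Submission
  imports Defs "HOL-Complex_Analysis.Complex_Analysis" "HOL-Real_Asymp.Real_Asymp"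
begin

text \<open>
  The mapping class group of a connected surface has small open subgroups: for a compact set
  \<open>K\<close>, the classes that have a representative fixing \<open>K\<close> pointwise form a subgroup
  \<open>H\<^sub>K\<close>, and these subgroups are a neighbourhood basis of the identity. Quasi-continuity at one
  vertex \<open>x\<^sub>0\<close> of the grand arc graph therefore gives an open subgroup \<open>H = H\<^sub>K\<close> that
  moves \<open>x\<^sub>0\<close> by a bounded amount. The vertices of \<open>\<Gamma>\<close> are the left cosets of
  \<open>H\<close>, with left translation as the action. It is transitive, and it is continuous because the
  stabilizers are conjugates of the open subgroup \<open>H\<close>. Two cosets are joined by an edge if they
  contain representatives \<open>a\<close>, \<open>b\<close> for which \<open>a x\<^sub>0\<close> and \<open>b x\<^sub>0\<close> are at distance
  at most \<open>2 R + 1\<close>, where \<open>R\<close> is a radius of coboundedness. Following a geodesic of the grand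
  arc graph through nearby orbit points shows that \<open>\<Gamma>\<close> is connected and that
  \<open>g H \<mapsto> g x\<^sub>0\<close> is a quasi-isometry (\<open>coset_walk\<close>,
  \<open>quasi_isometric_coset\<close>). Hyperbolicity passes to \<open>\<Gamma>\<close> by stability of quasi-geodesics
  (\<open>hyperbolic_transfer\<close>).
  
  The difficult point is that \<open>H\<^sub>K\<close> is open in the quotient of the compact-open topology: every
  homeomorphism close enough to the identity is isotopic to one that fixes \<open>K\<close>
  (\<open>near_identity_isotopic_to_fixing\<close>). Cover \<open>K\<close> by finitely many discs in charts and repair
  the homeomorphism one disc after the other, without spoiling what has been repaired. In one chart the
  task is: an embedding \<open>f\<close> of a disc in the plane, close to the identity, agrees on a smaller disc
  with a homeomorphism \<open>g\<close> of the plane that is close to the identity, is supported in the larger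
  disc, and is the identity near the points around which \<open>f\<close> is (\<open>local_correction\<close>). Alexander's trick joins \<open>g\<close> to the
  identity, so that composing with the inverse of \<open>g\<close> changes the homeomorphism of the surface only by
  an isotopy. For the construction of \<open>g\<close>, take a fine square grid. On the edges, interpolate
  between \<open>f\<close> and the identity by injective paths, and extend over each cell by the Schoenflies theorem
  (\<open>Schoenflies_extension\<close>). The cells then fit together because distinct boundary curves have
  disjoint interiors (\<open>grid_embedding_extends\<close>).
  
  The Schoenflies theorem follows from the Riemann mapping theorem once the Riemann map of the inside of
  a Jordan curve is known to extend to a homeomorphism of the closures, which is Caratheodory's theorem
  (\<open>inside_homeomorphic_disc\<close>). The extension rests on maximum modulus estimates for a holomorphic
  function that is small on an arc, or constant on a part of the boundary
  (\<open>small_on_crossing_imp_small\<close>, \<open>vanishing_near_exterior_point\<close>).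
\<close>

section \<open>Holomorphic functions that are small on an arc\<close>
text \<open>
  The Fashoda theorem, moved from \<open>real^2\<close> to the complex numbers.
\<close>
lemma crossing_paths_meet:
  fixes f g :: "real \<Rightarrow> complex"
  assumes "path f" "path g"
    and f: "path_image f \<subseteq> cbox a b" and g: "path_image g \<subseteq> cbox a b"
    and "Re (pathstart f) = Re a" "Re (pathfinish f) = Re b"
    and "Im (pathstart g) = Im a" "Im (pathfinish g) = Im b"
  shows "path_image f \<inter> path_image g \<noteq> {}"
proof -
  define T :: "complex \<Rightarrow> real^2" where "T z = Re z *\<^sub>R axis 1 1 + Im z *\<^sub>R axis 2 1" for z
  have T: "T z $ 1 = Re z" "T z $ 2 = Im z" for z
    by (auto simp: T_def axis_def)
  have "continuous_on UNIV T"
unfolding T_def by (intro continuous_intros)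
  then have p: "path (T \<circ> h)" if "path h" for h
    using that path_continuous_image continuous_on_subset by blast
  have box: "T z \<in> cbox (T a) (T b)" if "z \<in> cbox a b" for z
    using that by (auto simp: T forall_2 mem_box_cart in_cbox_complex_iff)
  have im: "path_image (T \<circ> f) \<subseteq> cbox (T a) (T b)" "path_image (T \<circ> g) \<subseteq> cbox (T a) (T b)"
    using f g box by (auto simp: path_image_compose)
  obtain z where "z \<in> path_image (T \<circ> f)" "z \<in> path_image (T \<circ> g)"
    by (rule fashoda[OF p[OF \<open>path f\<close>] p[OF \<open>path g\<close>] im])
      (simp_all add: T pathstart_compose pathfinish_compose assms)
  moreover have "inj T"
    by (metis T complex_eqI injI)
  ultimately show ?thesis
    by (auto simp: path_image_compose inj_eq)
qed

text \<open>
  The path \<open>E\<close> runs close to the imaginary axis and crosses the horizontal strip of half-width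
  \<open>4\<kappa>\<close>. Hence it shields the point \<open>s\<^sub>0 = -\<kappa> + i\<mu>\<close> from that axis: the component
  \<open>U\<close> of \<open>s\<^sub>0\<close> in a box without \<open>E\<close> stays away from the axis. Consider the mirror image
  \<open>w\<^sub>0 = \<kappa> + i\<mu>\<close>, at distance \<open>2\<kappa>\<close> from \<open>s\<^sub>0\<close>. The part of the frontier
  of \<open>U\<close> on \<open>E\<close>, where the function is at most \<open>\<epsilon>\<close>, has distance at least \<open>\<kappa>\<close>
  from \<open>w\<^sub>0\<close>; the rest, where it is at most \<open>M\<close>, has distance at least \<open>4\<kappa>\<close>. The maximum
  principle for \<open>(F s - p) / (s - w\<^sub>0)^m\<close> gives the bound. A large \<open>m\<close> makes its second term
  small, and then a small \<open>\<epsilon>\<close> the first.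
\<close>
lemma small_on_crossing_imp_small:
  fixes F :: "complex \<Rightarrow> complex"
  assumes hol: "F holomorphic_on {s. Re s < 0}"
    and M: "\<And>s. Re s < 0 \<Longrightarrow> norm (F s - p) \<le> M"
    and "0 < \<kappa>" and E: "path E"
    and ReE: "\<And>s. s \<in> path_image E \<Longrightarrow> -\<kappa> < Re s \<and> Re s < 0"
    and Im0: "Im (pathstart E) \<le> \<mu> - 4*\<kappa>" and Im1: "Im (pathfinish E) \<ge> \<mu> + 4*\<kappa>"
    and small: "\<And>s. s \<in> path_image E \<Longrightarrow> norm (F s - p) \<le> \<epsilon>"
  shows "norm (F (Complex (-\<kappa>) \<mu>) - p) \<le> max (\<epsilon> * 2^m) (M / 2^m)"
proof -
  define Er where "Er = path_image E"
  have cE: "compact Er" "Er \<noteq> {}"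
    using E by (auto simp: Er_def compact_path_image)
  obtain e0 where e0: "e0 \<in> Er" "\<And>e. e \<in> Er \<Longrightarrow> Re e \<le> Re e0"
    using continuous_attains_sup[OF cE, of Re] continuous_on_Re[OF continuous_on_id] by blast
  define \<tau> where "\<tau> = - Re e0"
  have \<tau>: "0 < \<tau>" "\<tau> < \<kappa>" "\<And>e. e \<in> Er \<Longrightarrow> Re e \<le> -\<tau>"
    using ReE e0 by (auto simp: \<tau>_def Er_def minus_less_iff)
  define a where "a = Complex (-3*\<kappa>) (\<mu> - 4*\<kappa>)"
  define b where "b = Complex 0 (\<mu> + 4*\<kappa>)"
  define s0 where "s0 = Complex (-\<kappa>) \<mu>"
  define w0 where "w0 = Complex \<kappa> \<mu>"
  have inbox: "z \<in> box a b \<longleftrightarrow> -3*\<kappa> < Re z \<and> Re z < 0 \<and> \<mu> - 4*\<kappa> < Im z \<and> Im z < \<mu> + 4*\<kappa>" for z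
    by (auto simp: in_box_complex_iff a_def b_def)
  have incbox: "z \<in> cbox a b \<longleftrightarrow> -3*\<kappa> \<le> Re z \<and> Re z \<le> 0 \<and> \<mu> - 4*\<kappa> \<le> Im z \<and> Im z \<le> \<mu> + 4*\<kappa>" for z
    by (auto simp: in_cbox_complex_iff a_def b_def)
  define U where "U = connected_component_set (box a b - Er) s0"
  have oB: "open (box a b - Er)"
    using cE by (intro open_Diff open_box compact_imp_closed)
  have s0: "s0 \<in> box a b - Er"
    using \<open>0 < \<kappa>\<close> ReE by (fastforce simp: inbox s0_def Er_def)
  have U: "open U" "connected U" "s0 \<in> U" "U \<subseteq> box a b - Er"
    using oB s0 by (auto simp: U_def open_connected_component connected_component_in dest: connected_component_in)
  have left: "Re u \<le> -\<tau>" if u: "u \<in> U" for u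
  proof (rule ccontr)
    assume "\<not> Re u \<le> -\<tau>"
    then have Reu: "Re u > -\<tau>" by simp
    obtain q where q: "path q" "path_image q \<subseteq> U" "pathstart q = s0" "pathfinish q = u"
      using U u by (meson connected_open_path_connected path_connected_def)
    have uB: "u \<in> box a b" using u U by auto
    \<comment> \<open>If \<open>U\<close> came closer to the axis than \<open>E\<close>, a path through \<open>U\<close> would connect the vertical sides of the box and meet \<open>E\<close>.\<close>
    define f where "f = linepath (Complex (-3*\<kappa>) \<mu>) s0 +++ (q +++ linepath u (Complex 0 (Im u)))"
    define clip where "clip z = Complex (Re z) (max (\<mu> - 4*\<kappa>) (min (\<mu> + 4*\<kappa>) (Im z)))" for z
    have contclip: "continuous_on UNIV clip"
      unfolding clip_def Complex_eq by (intro continuous_intros)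
    define g where "g = clip \<circ> E"
    have "path f" using q by (auto simp: f_def)
    have "path g"
      unfolding g_def using E contclip continuous_on_subset path_continuous_image by blast
    have pf: "path_image f = closed_segment (Complex (-3*\<kappa>) \<mu>) s0 \<union> path_image q \<union> closed_segment u (Complex 0 (Im u))"
      using q by (auto simp: f_def path_image_join)
    have cvx: "convex (cbox a b)" by (rule convex_box)
    have "path_image f \<subseteq> cbox a b"
    proof -
      have "closed_segment (Complex (-3*\<kappa>) \<mu>) s0 \<subseteq> cbox a b"
        using \<open>0 < \<kappa>\<close> by (intro closed_segment_subset cvx) (auto simp: incbox s0_def)
      moreover have "closed_segment u (Complex 0 (Im u)) \<subseteq> cbox a b"
        using \<open>0 < \<kappa>\<close> uB by (intro closed_segment_subset cvx) (auto simp: incbox inbox)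
      moreover have "path_image q \<subseteq> cbox a b"
        using q U box_subset_cbox by blast
      ultimately show ?thesis using pf by blast
    qed
    moreover have "path_image g \<subseteq> cbox a b"
    proof -
      have "-3*\<kappa> \<le> Re s \<and> Re s \<le> 0" if "s \<in> Er" for s
        using ReE[of s] that \<open>0 < \<kappa>\<close> by (auto simp: Er_def)
      then show ?thesis
        using \<open>0 < \<kappa>\<close> by (auto simp: g_def path_image_compose clip_def incbox Er_def)
    qed
    ultimately have "path_image f \<inter> path_image g \<noteq> {}"
      using \<open>path f\<close> \<open>path g\<close> Im0 Im1 \<open>0 < \<kappa>\<close>
      by (intro crossing_paths_meet[of f g a b])
        (auto simp: f_def g_def a_def b_def pathstart_compose pathfinish_compose clip_def)
    then obtain z e where z: "z \<in> path_image f" and e: "e \<in> Er" "z = clip e"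
      by (auto simp: g_def path_image_compose Er_def)
    have Rez: "Re z = Re e" using e by (simp add: clip_def)
    from z pf consider "z \<in> closed_segment (Complex (-3*\<kappa>) \<mu>) s0" | "z \<in> path_image q"
      | "z \<in> closed_segment u (Complex 0 (Im u))" by blast
    then show False
    proof cases
      case 1
      have "convex {z. Re z \<le> -\<kappa>}" by (rule convex_halfspace_Re_le)
      then have "closed_segment (Complex (-3*\<kappa>) \<mu>) s0 \<subseteq> {z. Re z \<le> -\<kappa>}"
        using \<open>0 < \<kappa>\<close> by (intro closed_segment_subset) (auto simp: s0_def)
      then show False using 1 ReE[of e] e Rez by (auto simp: Er_def)
    next
      case 2
      then have "z \<in> box a b" "z \<notin> Er" using q U by blast+
      then have "z = e" using e Rez by (auto simp: inbox clip_def complex_eq_iff max_def min_def split: if_splits)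
      then show False using e \<open>z \<notin> Er\<close> by simp
    next
      case 3
      have "convex {z. Re z > -\<tau>}" by (rule convex_halfspace_Re_gt)
      then have "closed_segment u (Complex 0 (Im u)) \<subseteq> {z. Re z > -\<tau>}"
        using \<open>0 < \<tau>\<close> Reu by (intro closed_segment_subset) auto
      then show False using 3 \<tau>(3)[OF e(1)] Rez by auto
    qed
  qed
  have clU: "closure U \<subseteq> {z. Re z \<le> -\<tau>}"
    using left by (intro closure_minimal closed_halfspace_Re_le) auto
  have clU2: "closure U \<subseteq> cbox a b"
    using U box_subset_cbox by (intro closure_minimal closed_cbox) blast
  have neg: "Re z < 0" if "z \<in> closure U" for z using clU that \<open>0<\<tau>\<close> by force
  have nw: "z \<noteq> w0" if "z \<in> closure U" for z using neg[OF that] \<open>0<\<kappa>\<close> by (auto simp: w0_def)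
  define k where "k s = (F s - p) / (s - w0) ^ m" for s
  have "k holomorphic_on closure U"
    unfolding k_def using neg nw by (intro holomorphic_intros holomorphic_on_subset[OF hol]) auto
  then have hk: "k holomorphic_on interior U" "continuous_on (closure U) k"
    using holomorphic_on_subset interior_subset closure_subset holomorphic_on_imp_continuous_on by blast+
  have M0: "M \<ge> 0" using M[of "-1"] by (smt (verit) norm_ge_zero one_complex.sel(1) uminus_complex.sel(1))
  have \<epsilon>0: "\<epsilon> \<ge> 0" using small cE(2) unfolding Er_def by (meson all_not_in_conv norm_ge_zero order_trans)
  define B where "B = max (\<epsilon> / \<kappa>^m) (M / (4*\<kappa>)^m)"
  have fr: "norm (k z) \<le> B" if z: "z \<in> frontier U" for z
  proof -
    have zc: "z \<in> closure U" "z \<notin> U"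
      using z U by (auto simp: frontier_def interior_open)
    have kz: "norm (k z) = norm (F z - p) / norm (z - w0) ^ m"
      by (simp add: k_def norm_divide norm_power)
    have "z \<notin> box a b - Er"
    proof
      assume zB: "z \<in> box a b - Er"
      then obtain r where r: "r > 0" "ball z r \<subseteq> box a b - Er" using oB openE by blast
      obtain u where "u \<in> U" "u \<in> ball z r" using zc r
        by (metis closure_approachable dist_commute mem_ball)
      then have "connected_component (box a b - Er) s0 u" "connected_component (box a b - Er) u z"
        using r connected_ball[of z r] unfolding U_def connected_component_def by (auto intro!: exI[of _ "ball z r"])
      then show False using zc connected_component_trans unfolding U_def by blast
    qed
    then consider "z \<in> Er" | "z \<notin> box a b" by blast
    then show ?thesis
    proof cases
      case 1
      have "norm (z - w0) \<ge> \<kappa>"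
        using neg[OF zc(1)] abs_Re_le_cmod[of "z - w0"] \<open>0 < \<kappa>\<close> by (simp add: w0_def)
      moreover have "norm (F z - p) \<le> \<epsilon>" using small 1 Er_def by blast
      ultimately have "norm (k z) \<le> \<epsilon> / \<kappa>^m" unfolding kz
        using \<open>0 < \<kappa>\<close> \<epsilon>0 by (intro frac_le power_mono) auto
      then show ?thesis by (simp add: B_def)
    next
      case 2
      have "z \<in> cbox a b" using clU2 zc by blast
      then have "Re z = -3*\<kappa> \<or> \<bar>Im z - \<mu>\<bar> = 4*\<kappa>"
        using 2 neg[OF zc(1)] \<open>0 < \<kappa>\<close> unfolding inbox incbox by auto
      then have "norm (z - w0) \<ge> 4*\<kappa>"
        using abs_Re_le_cmod[of "z - w0"] abs_Im_le_cmod[of "z - w0"] \<open>0 < \<kappa>\<close> by (auto simp: w0_def)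
      then have "norm (k z) \<le> M / (4*\<kappa>)^m" unfolding kz
        using \<open>0 < \<kappa>\<close> M0 M[OF neg[OF zc(1)]] by (intro frac_le power_mono) auto
      then show ?thesis by (simp add: B_def)
    qed
  qed
  have "bounded U" by (rule bounded_subset[OF bounded_box[of a b]]) (use U in blast)
  then have "norm (k s0) \<le> B"
    by (rule maximum_modulus_frontier[OF hk _ fr U(3)])
  moreover have "norm (s0 - w0) = 2*\<kappa>"
  proof -
    have "s0 - w0 = of_real (-2*\<kappa>)" by (simp add: s0_def w0_def complex_eq_iff)
    then show ?thesis using \<open>0 < \<kappa>\<close> by (simp only: norm_of_real)
  qed
  ultimately have "norm (F s0 - p) \<le> B * (2*\<kappa>)^m"
    using \<open>0 < \<kappa>\<close> by (simp add: k_def norm_divide norm_power pos_divide_le_eq)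
  also have "\<dots> = max (\<epsilon> * 2^m) (M / 2^m)"
  proof -
    have "B * (2*\<kappa>)^m = max (\<epsilon> / \<kappa>^m * (2*\<kappa>)^m) (M / (4*\<kappa>)^m * (2*\<kappa>)^m)"
      using \<open>0 < \<kappa>\<close> by (simp add: B_def max_mult_distrib_right)
    moreover have "\<epsilon> / \<kappa>^m * (2*\<kappa>)^m = \<epsilon> * 2^m" using \<open>0 < \<kappa>\<close> by (simp add: power_mult_distrib)
    moreover have "(4*\<kappa>)^m = (2*\<kappa>)^m * 2^m"
      using power_mult_distrib[of "2*\<kappa>" 2 m] by (simp add: mult.commute)
    ultimately show ?thesis using \<open>0 < \<kappa>\<close> by simp
  qed
  finally show ?thesis by (simp add: s0_def)
qed

section \<open>Jordan curves\<close>
lemma connected_circle_minus_ball: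
  fixes t0 :: complex
  assumes "norm t0 = 1"
  shows "connected (sphere 0 1 - ball t0 r)"
proof (cases "r \<le> 0")
  case True
  then show ?thesis by (simp add: connected_sphere ball_empty)
next
  case False
  define c where "c = 1 - r\<^sup>2 / 2"
  have cl: "c < 1" using False by (simp add: c_def)
  have d: "(dist t0 (t0 * cis \<theta>))\<^sup>2 = 2 - 2 * cos \<theta>" for \<theta>
  proof -
    have "dist t0 (t0 * cis \<theta>) = norm (t0 * (1 - cis \<theta>))"
      by (simp add: dist_norm algebra_simps)
    also have "\<dots> = norm (1 - cis \<theta>)" using assms by (simp add: norm_mult)
    also have "\<dots>\<^sup>2 = (1 - cos \<theta>)\<^sup>2 + (sin \<theta>)\<^sup>2" by (simp add: cmod_power2)
    also have "\<dots> = 1 - 2 * cos \<theta> + ((cos \<theta>)\<^sup>2 + (sin \<theta>)\<^sup>2)"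
      by (simp add: power2_eq_square algebra_simps del: sin_cos_squared_add sin_cos_squared_add2)
    also have "\<dots> = 2 - 2 * cos \<theta>" by simp
    finally show ?thesis .
  qed
  have iff: "t0 * cis \<theta> \<in> sphere 0 1 - ball t0 r \<longleftrightarrow> cos \<theta> \<le> c" for \<theta>
  proof -
    have "r \<le> dist t0 (t0 * cis \<theta>) \<longleftrightarrow> r\<^sup>2 \<le> (dist t0 (t0 * cis \<theta>))\<^sup>2"
      using False by (meson abs_le_square_iff abs_of_nonneg linear power_mono power2_le_imp_le zero_le_dist)
    then show ?thesis unfolding d using assms by (auto simp: c_def norm_mult not_less)
  qed
  have rep: "\<exists>\<theta>. 0 \<le> \<theta> \<and> \<theta> < 2*pi \<and> x = t0 * cis \<theta>" if "x \<in> sphere 0 1" for x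
  proof -
    have "norm (x / t0) = 1" using that assms by (simp add: norm_divide)
    then have "x / t0 = cis (Arg2pi (x / t0))" using Arg2pi_eq[of "x / t0"] by (simp add: cis_conv_exp)
    moreover have "t0 \<noteq> 0" using assms by auto
    ultimately show ?thesis using Arg2pi_ge_0 Arg2pi_lt_2pi by (intro exI[of _ "Arg2pi (x / t0)"]) (auto simp: field_simps)
  qed
  show ?thesis
  proof (cases "c < -1")
    case True
    have "cos \<theta> \<ge> -1" for \<theta> :: real by simp
    then have "sphere 0 1 - ball t0 r = {}" using rep iff True by (metis Diff_iff ex_in_conv not_less order_trans)
    then show ?thesis by (simp only: connected_empty)
  next
    case False
    define \<alpha> where "\<alpha> = arccos c"
    have \<alpha>: "0 \<le> \<alpha>" "\<alpha> \<le> pi" "cos \<alpha> = c" using False cl by (auto simp: \<alpha>_def arccos_lbound arccos_ubound)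
    have "sphere 0 1 - ball t0 r = (\<lambda>\<theta>. t0 * cis \<theta>) ` {\<alpha>..2*pi - \<alpha>}"
    proof (intro subset_antisym subsetI)
      fix x assume x: "x \<in> sphere 0 1 - ball t0 r"
      then obtain \<theta> where \<theta>: "0 \<le> \<theta>" "\<theta> < 2*pi" "x = t0 * cis \<theta>" using rep by blast
      then have le: "cos \<theta> \<le> cos \<alpha>" using x iff \<alpha> by simp
      have "\<alpha> \<le> \<theta> \<and> \<theta> \<le> 2*pi - \<alpha>"
      proof (cases "\<theta> \<le> pi")
        case True
        then have "\<alpha> \<le> \<theta>" using le \<theta> \<alpha> cos_mono_le_eq[of \<theta> \<alpha>] by auto
        then show ?thesis using True \<alpha> by auto
      next
        case False
        have "cos (2*pi - \<theta>) \<le> cos \<alpha>" using le by (simp add: cos_diff)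
        then have "\<alpha> \<le> 2*pi - \<theta>" using False \<theta> \<alpha> cos_mono_le_eq[of "2*pi - \<theta>" \<alpha>] by auto
        then show ?thesis using False \<alpha> by auto
      qed
      then show "x \<in> (\<lambda>\<theta>. t0 * cis \<theta>) ` {\<alpha>..2*pi - \<alpha>}" using \<theta> by auto
    next
      fix x assume "x \<in> (\<lambda>\<theta>. t0 * cis \<theta>) ` {\<alpha>..2*pi - \<alpha>}"
      then obtain \<theta> where \<theta>: "\<alpha> \<le> \<theta>" "\<theta> \<le> 2*pi - \<alpha>" "x = t0 * cis \<theta>" by auto
      have "cos \<theta> \<le> cos \<alpha>"
      proof (cases "\<theta> \<le> pi")
        case True
        then show ?thesis using \<theta> \<alpha> cos_mono_le_eq[of \<theta> \<alpha>] by auto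
      next
        case False
        then have "cos (2*pi - \<theta>) \<le> cos \<alpha>" using \<theta> \<alpha> cos_mono_le_eq[of "2*pi - \<theta>" \<alpha>] by auto
        then show ?thesis by (simp add: cos_diff)
      qed
      then show "x \<in> sphere 0 1 - ball t0 r" using iff \<alpha> \<theta> by simp
    qed
    moreover have "connected ((\<lambda>\<theta>. t0 * cis \<theta>) ` {\<alpha>..2*pi - \<alpha>})"
      by (intro connected_continuous_image continuous_intros) auto
    ultimately show ?thesis by simp
  qed
qed

text \<open>
  A Jordan curve, given by an injective parametrization on the unit circle.
\<close>
locale jordan_circle =
  fixes \<phi> :: "complex \<Rightarrow> complex"
  assumes cont: "continuous_on (sphere 0 1) \<phi>" and inj: "inj_on \<phi> (sphere 0 1)"
begin

definition "J = \<phi> ` sphere 0 1"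

lemma compact_J: "compact J"
  unfolding J_def by (intro compact_continuous_image cont) simp

lemma simple_loop: "\<exists>c. simple_path c \<and> pathfinish c = pathstart c \<and> path_image c = J"
proof -
  define c where "c = \<phi> \<circ> (\<lambda>t. exp (2 * of_real pi * \<i> * of_real t))"
  have c0: "c = \<phi> \<circ> circlepath 0 1" by (auto simp: c_def circlepath fun_eq_iff)
  have "simple_path c" unfolding c0
    by (rule simple_path_continuous_image) (use cont inj in \<open>auto simp: simple_path_circlepath path_image_circlepath\<close>)
  moreover have "path_image c = J" unfolding c0 J_def by (simp add: path_image_compose)
  moreover have "pathfinish c = pathstart c" unfolding c0 by (simp add: pathstart_compose pathfinish_compose)
  ultimately show ?thesis by blast
qed

lemma Jordan:
  shows "inside J \<noteq> {}" "open (inside J)" "connected (inside J)" "open (outside J)"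
    "bounded (inside J)" "inside J \<inter> outside J = {}" "inside J \<union> outside J = -J"
    "frontier (inside J) = J" "frontier (outside J) = J" "simply_connected (inside J)"
    "closure (inside J) = J \<union> inside J"
proof -
  obtain c where c: "simple_path c" "pathfinish c = pathstart c" "path_image c = J"
    using simple_loop by blast
  note * = Jordan_inside_outside[OF c(1,2), unfolded c(3)]
  show "inside J \<noteq> {}" "open (inside J)" "connected (inside J)" "open (outside J)"
    "bounded (inside J)" "inside J \<inter> outside J = {}" "inside J \<union> outside J = -J"
    "frontier (inside J) = J" "frontier (outside J) = J"
    using * by blast+
  then show "closure (inside J) = J \<union> inside J"
    by (metis closure_Un_frontier sup_commute)
  show "simply_connected (inside J)"
    using simply_connected_inside_simple_path[OF c(1)] c(3) by simp
qed

lemma connected_in_inside: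
  assumes "connected C" "C \<inter> J = {}" "z \<in> C" "z \<in> inside J"
  shows "C \<subseteq> inside J"
  using assms inside_same_component[of J z] unfolding connected_component_def
  by (metis Compl_iff disjoint_iff subset_eq)

text \<open>
  Uniform local connectedness of the inside, by Janiszewski's theorem. Two points at small distance are not
  separated by the curve, and they are not separated by the union of a far away subarc of the curve with a circle
  around one of them, because the segment between them avoids that union. The intersection of the two closed
  sets is the subarc, which is connected; so the union of the two does not separate the points either.
\<close>
lemma inside_ulc:
  assumes "0 < \<epsilon>"
  shows "\<exists>\<delta>>0. \<forall>z\<in>inside J. \<forall>z'\<in>inside J. dist z z' < \<delta> \<longrightarrow>
           (\<exists>\<gamma>. path \<gamma> \<and> pathstart \<gamma> = z \<and> pathfinish \<gamma> = z' \<and> path_image \<gamma> \<subseteq> inside J \<inter> ball z \<epsilon>)"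
proof -
  have "uniformly_continuous_on (sphere 0 1) \<phi>"
    by (intro compact_uniformly_continuous cont) simp
  then obtain \<eta> where \<eta>: "0 < \<eta>" "\<And>s t. s \<in> sphere 0 1 \<Longrightarrow> t \<in> sphere 0 1 \<Longrightarrow> dist s t < \<eta> \<Longrightarrow> dist (\<phi> s) (\<phi> t) < \<epsilon>/2"
    unfolding uniformly_continuous_on_def by (metis assms half_gt_zero)
  obtain \<psi> where hom: "homeomorphism (sphere 0 1) J \<phi> \<psi>"
    using homeomorphism_compact[OF compact_sphere cont _ inj] J_def by metis
  then have "uniformly_continuous_on J \<psi>"
    using compact_J compact_uniformly_continuous homeomorphism_cont2 by blast
  then obtain \<delta>0 where \<delta>0: "0 < \<delta>0" "\<And>x y. x \<in> J \<Longrightarrow> y \<in> J \<Longrightarrow> dist x y < \<delta>0 \<Longrightarrow> dist (\<psi> x) (\<psi> y) < \<eta>"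
    unfolding uniformly_continuous_on_def using \<eta> by metis
  define \<delta> where "\<delta> = min (\<delta>0/2) (\<epsilon>/2)"
  have \<delta>: "0 < \<delta>" "2*\<delta> \<le> \<delta>0" "2*\<delta> \<le> \<epsilon>" using \<delta>0 assms by (auto simp: \<delta>_def)
  have "\<exists>\<gamma>. path \<gamma> \<and> pathstart \<gamma> = z \<and> pathfinish \<gamma> = z' \<and> path_image \<gamma> \<subseteq> inside J \<inter> ball z \<epsilon>"
    if z: "z \<in> inside J" "z' \<in> inside J" "dist z z' < \<delta>" for z z'
  proof (cases "closed_segment z z' \<inter> J = {}")
    case True
    have "closed_segment z z' \<subseteq> ball z \<epsilon>"
      using z \<delta> by (intro closed_segment_subset) (auto simp: convex_ball)
    moreover have "closed_segment z z' \<subseteq> inside J"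
      using True z connected_in_inside by (metis connected_segment(1) ends_in_segment(1))
    ultimately show ?thesis
      by (intro exI[of _ "linepath z z'"]) auto
  next
    case False
    have seg: "closed_segment z z' \<subseteq> ball z \<delta>"
      using z \<delta> by (intro closed_segment_subset) (auto simp: convex_ball)
    obtain t0 where t0: "t0 \<in> sphere 0 1" "\<phi> t0 \<in> ball z \<delta>"
    proof -
      have "\<exists>t0\<in>sphere 0 1. \<phi> t0 \<in> closed_segment z z'" using False by (auto simp: J_def)
      then show ?thesis using that seg by blast
    qed
    define B where "B = \<phi> ` (sphere 0 1 - ball t0 \<eta>)"
    \<comment> \<open>The part of \<open>J\<close> in the \<open>\<epsilon>\<close>-ball that is not near \<open>t0\<close> belongs to \<open>B\<close>, so \<open>T\<close> meets \<open>J\<close> exactly in \<open>B\<close>.\<close>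
    define T where "T = B \<union> sphere z \<epsilon>"
    have cB: "compact B" unfolding B_def
      by (intro compact_continuous_image continuous_on_subset[OF cont] compact_diff) auto
    have conB: "connected B" unfolding B_def
      using t0 by (intro connected_continuous_image continuous_on_subset[OF cont] connected_circle_minus_ball) auto
    have Bball: "B \<inter> ball z \<delta> = {}"
    proof -
      have "\<phi> t \<notin> ball z \<delta>" if t: "t \<in> sphere 0 1 - ball t0 \<eta>" for t
      proof
        assume "\<phi> t \<in> ball z \<delta>"
        then have "dist (\<phi> t0) (\<phi> t) < \<delta>0"
          using t0 \<delta> by (smt (verit) dist_commute dist_triangle mem_ball)
        then have "dist (\<psi> (\<phi> t0)) (\<psi> (\<phi> t)) < \<eta>"
          using t t0 by (intro \<delta>0) (auto simp: J_def)
        then show False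
          using t t0 hom by (auto simp: homeomorphism_apply1)
      qed
      then show ?thesis by (auto simp: B_def)
    qed
    have JT: "J \<inter> T = B"
    proof -
      have "\<phi> t \<in> B" if t: "t \<in> sphere 0 1" "dist z (\<phi> t) = \<epsilon>" for t
      proof (rule ccontr)
        assume "\<phi> t \<notin> B"
        then have "dist t0 t < \<eta>" using t by (auto simp: B_def)
        then have "dist (\<phi> t0) (\<phi> t) < \<epsilon>/2" using \<eta> t t0 by blast
        then show False using t0 t \<delta> by (smt (verit) dist_triangle mem_ball field_sum_of_halves)
      qed
      moreover have "B \<subseteq> J" by (auto simp: B_def J_def)
      ultimately show ?thesis by (auto simp: T_def J_def)
    qed
    have "closed_segment z z' \<inter> T = {}"
      using seg Bball \<delta> by (auto simp: T_def)
    then have "connected_component (-T) z z'"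
      unfolding connected_component_def by (intro exI[of _ "closed_segment z z'"]) auto
    moreover have "connected_component (-J) z z'"
      unfolding connected_component_def
      using z Jordan(3) inside_no_overlap[of J] by blast
    moreover have "closed T" using cB by (auto simp: T_def compact_imp_closed)
    ultimately have "connected_component (- (J \<union> T)) z z'"
      using JT conB compact_J by (intro Janiszewski) auto
    moreover have "open (- (J \<union> T))"
      using \<open>closed T\<close> compact_imp_closed[OF compact_J] by (intro open_Compl closed_Un)
    ultimately have "path_component (- (J \<union> T)) z z'"
      by (simp add: open_path_connected_component)
    then obtain \<gamma> where \<gamma>: "path \<gamma>" "path_image \<gamma> \<subseteq> - (J \<union> T)" "pathstart \<gamma> = z" "pathfinish \<gamma> = z'"
      by (auto simp: path_component_def)
    then have "connected (path_image \<gamma>)" "z \<in> path_image \<gamma>" by auto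
    moreover have "path_image \<gamma> \<inter> sphere z \<epsilon> = {}" using \<gamma> by (auto simp: T_def)
    ultimately have "path_image \<gamma> \<subseteq> ball z \<epsilon>"
      using connected_Int_frontier[of "path_image \<gamma>" "ball z \<epsilon>"] assms
      by (metis centre_in_ball disjoint_iff frontier_ball Diff_eq_empty_iff)
    moreover have "path_image \<gamma> \<subseteq> inside J"
      using \<gamma> z connected_in_inside[of "path_image \<gamma>" z] by auto
    ultimately show ?thesis using \<gamma> by blast
  qed
  then show ?thesis using \<delta>(1) by blast
qed

end

section \<open>Uniform continuity of the inverse Riemann map\<close>
text \<open>
  The exponential map has derivative of modulus at most 1 on the left half-plane.
\<close>
lemma norm_exp_diff_le:
  fixes x y :: complex
  assumes "Re x \<le> 0" "Re y \<le> 0"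
  shows "norm (exp x - exp y) \<le> norm (x - y)"
proof -
  have "norm (exp x - exp y) \<le> 1 * norm (x - y)"
    by (rule field_differentiable_bound[where S = "{z. Re z \<le> 0}" and f' = exp])
      (use assms in \<open>auto simp: convex_halfspace_Re_le intro!: DERIV_exp has_field_derivative_at_within\<close>)
  then show ?thesis by simp
qed

context jordan_circle
begin

lemma bounded_closure: "bounded (J \<union> inside J)"
  using compact_J Jordan(5) by (simp add: compact_imp_bounded)

text \<open>
  A long path in the disc whose image under \<open>f\<close> is close to a point of \<open>J\<close> has to stay near
  the unit circle. In logarithmic coordinates it then contains a crossing of a strip, and \<open>f\<close> would be
  close to \<open>J\<close> at a point at a definite distance from the circle, where \<open>f\<close> has values
  in a compact subset of the inside.
\<close>
lemma short_image_of_short_path: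
  assumes holf: "f holomorphic_on ball 0 1" and fim: "f ` ball 0 1 \<subseteq> inside J" and "0 < c"
  shows "\<exists>\<epsilon>>0. \<forall>p\<in>J. \<forall>\<gamma>. path \<gamma> \<and> path_image \<gamma> \<subseteq> ball 0 1 \<and>
            (\<forall>z\<in>path_image \<gamma>. norm (f z - p) \<le> \<epsilon>) \<longrightarrow> dist (pathstart \<gamma>) (pathfinish \<gamma>) < c"
proof -
  define \<kappa> where "\<kappa> = c / 16"
  have \<kappa>: "0 < \<kappa>" using \<open>0 < c\<close> by (simp add: \<kappa>_def)
  define K where "K = f ` cball 0 (exp (-\<kappa>))"
  have sub: "cball 0 (exp (-\<kappa>)) \<subseteq> ball (0::complex) 1"
    using \<kappa> by (simp add: cball_subset_ball_iff)
  have "compact K" unfolding K_def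
    using sub by (intro compact_continuous_image holomorphic_on_imp_continuous_on holomorphic_on_subset[OF holf]) auto
  moreover have "K \<inter> J = {}" proof -
    have "K \<subseteq> inside J" using fim sub by (auto simp: K_def)
    then show ?thesis using inside_no_overlap[of J] by blast
  qed
  ultimately obtain d where d: "0 < d" "\<And>x p. x \<in> K \<Longrightarrow> p \<in> J \<Longrightarrow> d \<le> dist x p"
    using separate_compact_closed[of K J] compact_J by (metis compact_imp_closed)
  obtain M where M: "\<And>x y. x \<in> J \<union> inside J \<Longrightarrow> y \<in> J \<union> inside J \<Longrightarrow> dist x y \<le> M"
    using bounded_closure unfolding bounded_two_points by blast
  obtain m where m: "M / 2^m < d"
  proof -
    obtain m where "(1/2)^m < d / (\<bar>M\<bar> + 1)"
      using real_arch_pow_inv[of "d / (\<bar>M\<bar> + 1)" "1/2"] d by (auto simp: add_pos_nonneg)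
    then have "(\<bar>M\<bar> + 1) / 2^m < d" by (simp add: divide_simps mult.commute power_one_over split: if_splits)
    moreover have "M / 2^m \<le> (\<bar>M\<bar> + 1) / 2^m" by (intro divide_right_mono) auto
    ultimately show ?thesis using that[of m] by linarith
  qed
  define \<epsilon> where "\<epsilon> = d / 2 ^ (m+1)"
  have \<epsilon>: "0 < \<epsilon>" "\<epsilon> * 2^m < d" "\<epsilon> < d"
  proof -
    have "(1::real) < 2 ^ (m+1)" by (rule one_less_power) auto
    then show "0 < \<epsilon>" "\<epsilon> * 2^m < d" "\<epsilon> < d"
      using d by (auto simp: \<epsilon>_def divide_simps mult_less_cancel_left1)
  qed
  have no_crossing: False
    if p: "p \<in> J" and E: "path E" "\<And>s. s \<in> path_image E \<Longrightarrow> -\<kappa> < Re s \<and> Re s < 0"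
      "\<And>s. s \<in> path_image E \<Longrightarrow> norm (f (exp s) - p) \<le> \<epsilon>"
      and far: "Im (pathfinish E) - Im (pathstart E) \<ge> 8*\<kappa>" for p E
  proof -
    define \<mu> where "\<mu> = Im (pathstart E) + 4*\<kappa>"
    have "(\<lambda>s. f (exp s)) holomorphic_on {s. Re s < 0}"
      by (rule holomorphic_on_compose_gen[OF _ holf, unfolded o_def]) (auto intro!: holomorphic_intros)
    moreover have "norm (f (exp s) - p) \<le> M" if "Re s < 0" for s
    proof -
      have "f (exp s) \<in> inside J" using fim that by (auto simp: image_subset_iff)
      then show ?thesis using M[of "f (exp s)" p] p by (simp add: dist_norm)
    qed
    ultimately have "norm (f (exp (Complex (-\<kappa>) \<mu>)) - p) \<le> max (\<epsilon> * 2^m) (M / 2^m)"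
      by (rule small_on_crossing_imp_small[OF _ _ \<kappa> E(1)]) (use E far in \<open>auto simp: \<mu>_def\<close>)
    moreover have "d \<le> norm (f (exp (Complex (-\<kappa>) \<mu>)) - p)"
      using d(2)[of "f (exp (Complex (-\<kappa>) \<mu>))" p] p by (auto simp: K_def dist_norm)
    ultimately show False using \<epsilon> m by auto
  qed
  have "dist (pathstart \<gamma>) (pathfinish \<gamma>) < c"
    if p: "p \<in> J" and \<gamma>: "path \<gamma>" "path_image \<gamma> \<subseteq> ball 0 1" "\<And>z. z \<in> path_image \<gamma> \<Longrightarrow> norm (f z - p) \<le> \<epsilon>" for p \<gamma>
  proof -
    have low: "exp (-\<kappa>) < norm z" if "z \<in> path_image \<gamma>" for z
    proof (rule ccontr)
      assume "\<not> exp (-\<kappa>) < norm z"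
      then have "f z \<in> K" by (auto simp: K_def)
      then show False using d(2)[of "f z" p] p \<gamma>(3)[OF that] \<epsilon> by (simp add: dist_norm)
    qed
    have nz: "z \<noteq> 0" if "z \<in> path_image \<gamma>" for z using low[OF that] by (auto simp: not_less)
    obtain s where s: "continuous_on {0..1} s" "\<And>t. t \<in> {0..1} \<Longrightarrow> \<gamma> t = exp (s t)"
      using continuous_logarithm_on_contractible[of "{0..1::real}" \<gamma>] \<gamma> nz
      by (metis convex_imp_contractible convex_real_interval(5) image_eqI path_def path_image_def)
    have Re: "-\<kappa> < Re z \<and> Re z < 0" if "z \<in> path_image s" for z
    proof -
      obtain t where t: "t \<in> {0..1}" "z = s t" using \<open>z \<in> path_image s\<close> unfolding path_image_def by blast
      have "\<gamma> t \<in> path_image \<gamma>" using t by (auto simp: path_image_def)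
      then have "exp (-\<kappa>) < norm (exp z)" "norm (exp z) < 1" using low \<gamma> s t by force+
      then show ?thesis by simp
    qed
    have sm: "norm (f (exp z) - p) \<le> \<epsilon>" if "z \<in> path_image s" for z
      using that \<gamma>(3) s by (force simp: path_image_def)
    have ps: "path s" using s by (simp add: path_def)
    have ReE: "-\<kappa> < Re (pathstart s)" "Re (pathstart s) < 0" "-\<kappa> < Re (pathfinish s)" "Re (pathfinish s) < 0"
      using Re[OF pathstart_in_path_image] Re[OF pathfinish_in_path_image] by auto
    have "\<not> Im (pathfinish s) - Im (pathstart s) \<ge> 8*\<kappa>"
      using no_crossing[OF p ps Re sm] by blast
    moreover have "\<not> Im (pathstart s) - Im (pathfinish s) \<ge> 8*\<kappa>"
      using no_crossing[OF p, of "reversepath s"] ps Re sm by auto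
    moreover have "\<bar>Re (pathfinish s) - Re (pathstart s)\<bar> < \<kappa>"
      using ReE by (auto simp: abs_less_iff)
    ultimately have "norm (pathstart s - pathfinish s) < 9 * \<kappa>"
      using cmod_le[of "pathstart s - pathfinish s"] by (auto simp: abs_less_iff)
    moreover have "norm (exp (pathstart s) - exp (pathfinish s)) \<le> norm (pathstart s - pathfinish s)"
      using ReE by (intro norm_exp_diff_le) auto
    moreover have "pathstart \<gamma> = exp (pathstart s)" "pathfinish \<gamma> = exp (pathfinish s)"
      using s by (auto simp: pathstart_def pathfinish_def)
    ultimately show ?thesis using \<kappa> by (simp add: dist_norm \<kappa>_def)
  qed
  then show ?thesis using \<epsilon>(1) by blast
qed

text \<open>
  Away from \<open>J\<close> this is compactness. Two close points near \<open>J\<close> are joined inside by a short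
  path, and \<open>g\<close> maps its ends to close points by the preceding estimate.
\<close>
lemma riemann_uniformly_continuous:
  assumes holf: "f holomorphic_on ball 0 1" and holg: "g holomorphic_on inside J"
    and g: "\<And>z. z \<in> inside J \<Longrightarrow> g z \<in> ball 0 1 \<and> f (g z) = z"
    and f: "\<And>z. z \<in> ball 0 1 \<Longrightarrow> f z \<in> inside J \<and> g (f z) = z"
  shows "uniformly_continuous_on (inside J) g"
  unfolding uniformly_continuous_on_def
proof (intro allI impI)
  fix c :: real assume "0 < c"
  obtain \<epsilon> where \<epsilon>: "0 < \<epsilon>" "\<And>p \<gamma>. p \<in> J \<Longrightarrow> path \<gamma> \<Longrightarrow> path_image \<gamma> \<subseteq> ball 0 1 \<Longrightarrow>
      (\<And>z. z \<in> path_image \<gamma> \<Longrightarrow> norm (f z - p) \<le> \<epsilon>) \<Longrightarrow> dist (pathstart \<gamma>) (pathfinish \<gamma>) < c"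
    using short_image_of_short_path[OF holf _ \<open>0 < c\<close>] f by (metis image_subsetI)
  obtain \<delta>1 where \<delta>1: "0 < \<delta>1" "\<And>z z'. z \<in> inside J \<Longrightarrow> z' \<in> inside J \<Longrightarrow> dist z z' < \<delta>1 \<Longrightarrow>
      \<exists>\<gamma>. path \<gamma> \<and> pathstart \<gamma> = z \<and> pathfinish \<gamma> = z' \<and> path_image \<gamma> \<subseteq> inside J \<inter> ball z (\<epsilon>/2)"
    using inside_ulc[of "\<epsilon>/2"] \<epsilon> by (metis half_gt_zero)
  define K where "K = {z \<in> J \<union> inside J. infdist z J \<ge> \<epsilon>/4}"
  have "K = closure (inside J) \<inter> {z. infdist z J \<ge> \<epsilon>/4}" by (auto simp: K_def Jordan)
  moreover have "closed {z. infdist z J \<ge> \<epsilon>/4}"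
    by (intro closed_Collect_le continuous_intros continuous_on_infdist continuous_on_id)
  ultimately have "compact K"
    using compact_Int_closed[of "closure (inside J)"] Jordan(5) by (metis compact_closure)
  have KJ: "K \<subseteq> inside J" using \<epsilon> by (auto simp: K_def)
  have "uniformly_continuous_on K g"
    using \<open>compact K\<close> holomorphic_on_imp_continuous_on[OF holg] KJ
    by (intro compact_uniformly_continuous) (auto intro: continuous_on_subset)
  then obtain \<delta>2 where \<delta>2: "0 < \<delta>2" "\<And>x y. x \<in> K \<Longrightarrow> y \<in> K \<Longrightarrow> dist x y < \<delta>2 \<Longrightarrow> dist (g x) (g y) < c"
    using \<open>0 < c\<close> unfolding uniformly_continuous_on_def by metis
  have Jne: "J \<noteq> {}" "closed J" using compact_J by (auto simp: J_def compact_imp_closed)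
  have "dist (g z) (g z') < c" if z: "z \<in> inside J" "z' \<in> inside J" "dist z z' < min (\<epsilon>/4) (min \<delta>1 \<delta>2)" for z z'
  proof (cases "infdist z J < \<epsilon>/2")
    case True
    obtain p where p: "p \<in> J" "infdist z J = dist z p" using infdist_attains_inf[OF Jne(2,1)] by blast
    obtain \<gamma> where \<gamma>: "path \<gamma>" "pathstart \<gamma> = z" "pathfinish \<gamma> = z'" "path_image \<gamma> \<subseteq> inside J \<inter> ball z (\<epsilon>/2)"
      using \<delta>1(2)[OF z(1,2)] z(3) by auto
    have "path (g \<circ> \<gamma>)"
      using \<gamma> holomorphic_on_imp_continuous_on[OF holg] by (intro path_continuous_image) (auto intro: continuous_on_subset)
    moreover have "path_image (g \<circ> \<gamma>) \<subseteq> ball 0 1"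
      using \<gamma> g by (auto simp: path_image_compose)
    moreover have "norm (f w - p) \<le> \<epsilon>" if "w \<in> path_image (g \<circ> \<gamma>)" for w
    proof -
      obtain u where u: "u \<in> path_image \<gamma>" "w = g u" using \<open>w \<in> _\<close> by (auto simp: path_image_compose)
      then have "f w = u" "dist z u < \<epsilon>/2" using g \<gamma> by auto
      then show ?thesis using p True dist_triangle[of u p z] by (simp add: dist_norm norm_minus_commute)
    qed
    ultimately have "dist (pathstart (g \<circ> \<gamma>)) (pathfinish (g \<circ> \<gamma>)) < c" using \<epsilon>(2)[OF p(1)] by blast
    then show ?thesis using \<gamma> by (simp add: pathstart_compose pathfinish_compose)
  next
    case False
    have "infdist z J \<le> infdist z' J + dist z z'" by (rule infdist_triangle)
    then have "z \<in> K" "z' \<in> K" using False z \<epsilon> by (auto simp: K_def)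
    then show ?thesis using \<delta>2 z by auto
  qed
  then show "\<exists>d>0. \<forall>x\<in>inside J. \<forall>x'\<in>inside J. dist x' x < d \<longrightarrow> dist (g x') (g x) < c"
    using \<epsilon>(1) \<delta>1(1) \<delta>2(1) by (intro exI[of _ "min (\<epsilon>/4) (min \<delta>1 \<delta>2)"]) auto
qed

end

section \<open>The theorems of Caratheodory and Schoenflies\<close>
text \<open>
  A substitute for boundary uniqueness: with a pole of high order at the exterior point \<open>w\<^sub>0\<close>, the
  maximum principle on the part of \<open>W\<close> near \<open>w\<^sub>0\<close> bounds \<open>k z\<^sub>0\<close> by \<open>M / 2^m\<close>
  for every \<open>m\<close>.
\<close>
lemma vanishing_near_exterior_point:
  fixes k :: "complex \<Rightarrow> complex"
  assumes "open W" and cont: "continuous_on (closure W) k" and hol: "k holomorphic_on W"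
    and M: "\<And>z. z \<in> W \<Longrightarrow> norm (k z) \<le> M"
    and w0: "w0 \<notin> closure W" and "0 < r"
    and zero: "\<And>z. z \<in> frontier W \<Longrightarrow> dist w0 z < r \<Longrightarrow> k z = 0"
    and z0: "z0 \<in> W" "2 * dist w0 z0 < r"
  shows "k z0 = 0"
proof -
  define V where "V = W \<inter> ball w0 r"
  have V: "open V" "bounded V" "V \<subseteq> W" "closure V \<subseteq> closure W" "z0 \<in> V"
    using \<open>open W\<close> z0 \<open>0 < r\<close> closure_mono[of V W] zero_le_dist[of w0 z0] bounded_subset[OF bounded_ball[of w0 r], of V]
    by (auto simp: V_def open_Int simp del: zero_le_dist)
  have clV: "closure V \<subseteq> cball w0 r"
    by (intro closure_minimal) (auto simp: V_def)
  have Mcl: "norm (k z) \<le> M" if "z \<in> closure W" for z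
    by (rule continuous_on_closure_norm_le[OF cont]) (use M that in auto)
  have M0: "0 \<le> M" using M[OF z0(1)] norm_ge_zero order_trans by blast
  have le: "norm (k z0) \<le> M * (1/2)^m" for m :: nat
  proof -
    define h where "h z = k z / (z - w0)^m" for z
    have "norm (h z0) \<le> M / r^m"
    proof (rule maximum_modulus_frontier[of h V])
      have "h holomorphic_on V"
        unfolding h_def using w0 V by (intro holomorphic_intros holomorphic_on_subset[OF hol]) (auto simp: closure_def)
      then show "h holomorphic_on interior V" using V by (simp add: interior_open)
      show "continuous_on (closure V) h"
        unfolding h_def using w0 V by (intro continuous_intros continuous_on_subset[OF cont]) auto
      show "norm (h z) \<le> M / r^m" if z: "z \<in> frontier V" for z
      proof (cases "dist w0 z < r")
        case True
        have "z \<notin> W"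
        proof
          assume "z \<in> W"
          then have "z \<in> V" using True by (simp add: V_def)
          then show False using z V by (simp add: frontier_def interior_open)
        qed
        moreover have "z \<in> closure W" using z V by (auto simp: frontier_def)
        ultimately have "z \<in> frontier W" using \<open>open W\<close> by (simp add: frontier_def interior_open)
        then show ?thesis using zero[of z] True M0 \<open>0 < r\<close> by (simp add: h_def)
      next
        case False
        have zc: "z \<in> closure V" using z by (simp add: frontier_def)
        then have "norm (z - w0) = r" using False clV by (auto simp: dist_norm norm_minus_commute subset_iff)
        then show ?thesis using Mcl[of z] zc V \<open>0 < r\<close>
          by (auto simp: h_def norm_divide norm_power intro!: divide_right_mono)
      qed
    qed (use V in auto)
    have "norm (k z0) \<le> M / r^m * norm (z0 - w0)^m"
    proof -
      have "0 < norm (z0 - w0)" using w0 z0 closure_subset[of W] by auto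
      then show ?thesis using \<open>norm (h z0) \<le> M / r^m\<close>
        by (simp add: h_def norm_divide norm_power pos_divide_le_eq)
    qed
    also have "\<dots> = M * (norm (z0 - w0) / r)^m" by (simp add: power_divide)
    also have "\<dots> \<le> M * (1/2)^m"
      using z0 \<open>0 < r\<close> M0 by (intro mult_left_mono power_mono) (auto simp: dist_norm norm_minus_commute field_simps)
    finally show ?thesis .
  qed
  have "(\<lambda>m. M * (1/2::real)^m) \<longlonglongrightarrow> M * 0"
    by (intro tendsto_intros LIMSEQ_realpow_zero) auto
  then have "norm (k z0) \<le> 0"
    using le by (intro LIMSEQ_le_const[of "\<lambda>m. M * (1/2)^m"]) auto
  then show ?thesis by simp
qed

context jordan_circle
begin

text \<open>
  Remove a point \<open>c\<close> outside \<open>L\<close> from the curve and use the angle seen from \<open>c\<close> as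
  a coordinate; a connected set with two points contains an interval of angles.
\<close>
lemma subcontinuum_contains_arc:
  assumes "connected L" "L \<subseteq> J" "p \<in> L" "q \<in> L" "p \<noteq> q"
  shows "\<exists>x\<in>L. \<exists>\<rho>>0. J \<inter> ball x \<rho> \<subseteq> L"
proof (cases "L = J")
  case True
  then show ?thesis using assms by (intro bexI[of _ p] exI[of _ 1]) auto
next
  case False
  then obtain c where c: "c \<in> J" "c \<notin> L" using assms by blast
  obtain \<psi> where hom: "homeomorphism (sphere 0 1) J \<phi> \<psi>"
    using homeomorphism_compact[OF compact_sphere cont _ inj] J_def by metis
  have \<psi>: "norm (\<psi> x) = 1" "\<phi> (\<psi> x) = x" if "x \<in> J" for x
    using hom that by (auto simp: homeomorphism_def)
  define a where "a x = Arg (- (\<psi> x / \<psi> c))" for x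
  have nonneg: "- (\<psi> x / \<psi> c) \<notin> \<real>\<^sub>\<le>\<^sub>0" if x: "x \<in> J - {c}" for x
  proof
    assume "- (\<psi> x / \<psi> c) \<in> \<real>\<^sub>\<le>\<^sub>0"
    then have u: "Im (\<psi> x / \<psi> c) = 0" "Re (\<psi> x / \<psi> c) \<ge> 0"
      by (simp_all only: complex_nonpos_Reals_iff uminus_complex.sel) auto
    have "norm (\<psi> x / \<psi> c) = 1" using \<psi> x c by (simp add: norm_divide)
    then have "Re (\<psi> x / \<psi> c) = 1" using u cmod_eq_Re[OF u(1)] by simp
    then have "\<psi> x / \<psi> c = 1" using u by (simp add: complex_eq_iff)
    then have "\<psi> x = \<psi> c" by (simp add: divide_eq_1_iff)
    then show False using \<psi>(2) x c by (metis DiffD1 DiffD2 singletonI)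
  qed
  have nz: "\<psi> c \<noteq> 0" using \<psi>[OF c(1)] by auto
  have conta: "continuous_on (J - {c}) a"
    unfolding a_def
    using nonneg nz homeomorphism_cont2[OF hom] by (intro continuous_intros) (auto intro: continuous_on_subset)
  have inja: "inj_on a (J - {c})"
  proof (rule inj_onI)
    fix x y assume xy: "x \<in> J - {c}" "y \<in> J - {c}" "a x = a y"
    have n: "norm (- (\<psi> z / \<psi> c)) = 1" if "z \<in> J" for z using \<psi> that c by (simp add: norm_divide)
    have "- (\<psi> z / \<psi> c) = exp (\<i> * of_real (a z))" if "z \<in> J" for z
      proof -
      have "- (\<psi> z / \<psi> c) \<noteq> 0" using n[OF that] by (metis norm_zero zero_neq_one)
      from Arg_eq[OF this] show ?thesis unfolding n[OF that] by (simp add: a_def)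
    qed
    then have "- (\<psi> x / \<psi> c) = - (\<psi> y / \<psi> c)" using xy by simp
    then have "\<psi> x = \<psi> y" using nz by simp
    then show "x = y" using \<psi>(2) xy by (metis DiffD1)
  qed
  have LJ: "L \<subseteq> J - {c}" using assms c by auto
  have conn: "connected (a ` L)"
    using assms conta LJ by (intro connected_continuous_image) (auto intro: continuous_on_subset)
  have ne: "a p \<noteq> a q" using inja LJ assms by (auto dest: inj_onD)
  define l u where "l = min (a p) (a q)" and "u = max (a p) (a q)"
  have lu: "l < u" "l \<in> a ` L" "u \<in> a ` L" using ne assms by (auto simp: l_def u_def min_def max_def)
  have sub: "{l..u} \<subseteq> a ` L" using connected_contains_Icc[OF conn lu(2,3)] .
  have "(l + u)/2 \<in> {l..u}" using lu by simp
  then obtain x where x: "x \<in> L" "a x = (l + u)/2" using sub by (metis imageE subsetD)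
  have xJ: "x \<in> J - {c}" using x LJ by auto
  obtain \<rho>1 where \<rho>1: "0 < \<rho>1" "\<And>y. y \<in> J - {c} \<Longrightarrow> dist y x < \<rho>1 \<Longrightarrow> dist (a y) (a x) < (u - l)/2"
    using conta xJ lu unfolding continuous_on_iff by (metis diff_gt_0_iff_gt half_gt_zero)
  have "J \<inter> ball x (min \<rho>1 (dist x c)) \<subseteq> L"
  proof
    fix y assume y: "y \<in> J \<inter> ball x (min \<rho>1 (dist x c))"
    then have yJ: "y \<in> J - {c}" by auto
    then have "\<bar>a y - (l+u)/2\<bar> < (u-l)/2"
      using y \<rho>1(2)[of y] x by (auto simp: dist_real_def dist_commute)
    then have "a y \<in> {l..u}" unfolding abs_less_iff by (auto simp: field_simps)
    then obtain z where "z \<in> L" "a z = a y" using sub by (metis imageE subsetD)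
    then show "y \<in> L" using inja yJ LJ by (metis inj_onD subsetD)
  qed
  moreover have "0 < min \<rho>1 (dist x c)" using \<rho>1 xJ by auto
  ultimately show ?thesis using x by blast
qed

text \<open>
  Caratheodory's theorem. The inverse Riemann map extends continuously to the closure because it is uniformly
  continuous. Suppose the extension takes the same value \<open>\<zeta>\<close> at two points of \<open>J\<close>. The cluster set of the
  Riemann map at \<open>\<zeta>\<close> is a continuum in \<open>J\<close> that contains both points, so it contains a piece of
  \<open>J\<close> near one of its points; as such a point is also a limit of exterior points, the extension minus \<open>\<zeta>\<close>
  would vanish at a point inside.
\<close>
theorem inside_homeomorphic_disc:
  obtains G G' :: "complex \<Rightarrow> complex" where "homeomorphism (J \<union> inside J) (cball 0 1) G G'" "G ` J = sphere 0 1"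
proof -
  define \<Omega> where "\<Omega> = inside J"
  have "open \<Omega> \<and> simply_connected \<Omega>" using Jordan by (simp add: \<Omega>_def)
  moreover have "\<Omega> \<noteq> {}" "\<Omega> \<noteq> UNIV" using Jordan(1,5) by (auto simp: \<Omega>_def)
  ultimately obtain g f where fg: "g holomorphic_on \<Omega>" "f holomorphic_on ball 0 1"
      "\<And>z. z \<in> \<Omega> \<Longrightarrow> g z \<in> ball 0 1 \<and> f (g z) = z"
      "\<And>z. z \<in> ball 0 1 \<Longrightarrow> f z \<in> \<Omega> \<and> g (f z) = z"
    unfolding Riemann_mapping_theorem by blast
  have "uniformly_continuous_on \<Omega> g"
    unfolding \<Omega>_def using riemann_uniformly_continuous[OF fg(2) fg(1)[unfolded \<Omega>_def]] fg(3,4) \<Omega>_def by blast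
  then obtain G where G: "uniformly_continuous_on (closure \<Omega>) G" "\<And>x. x \<in> \<Omega> \<Longrightarrow> g x = G x"
    using uniformly_continuous_on_extension_on_closure by metis
  have contG: "continuous_on (closure \<Omega>) G" using G(1) by (rule uniformly_continuous_imp_continuous)
  have cl: "closure \<Omega> = J \<union> \<Omega>" using Jordan(11) by (simp add: \<Omega>_def)
  have cpt: "compact (closure \<Omega>)" using Jordan(5) by (simp add: \<Omega>_def)
  have disj: "J \<inter> \<Omega> = {}" unfolding \<Omega>_def using inside_no_overlap[of J] by blast
  have contf: "continuous_on (ball 0 1) f" using fg(2) by (rule holomorphic_on_imp_continuous_on)
  have GO: "G x \<in> ball 0 1" "f (G x) = x" if "x \<in> \<Omega>" for x using fg(3) G(2) that by auto
  have Gcl: "G ` closure A \<subseteq> closure (G ` A)" if "A \<subseteq> \<Omega>" for A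
    using continuous_image_closure_subset[OF contG] that closure_mono[OF that] by auto
  have G1: "norm (G x) \<le> 1" if "x \<in> closure \<Omega>" for x
  proof -
    have "closure (G ` \<Omega>) \<subseteq> cball 0 1" using GO by (intro closure_minimal) force+
    then have "G x \<in> cball 0 1" using Gcl[of \<Omega>] that by blast
    then show ?thesis by simp
  qed
  have GJ: "norm (G x) = 1" if x: "x \<in> J" for x
  proof (rule ccontr)
    assume "norm (G x) \<noteq> 1"
    then have lt: "G x \<in> ball 0 1" using G1[of x] x cl by auto
    have "x \<in> closure \<Omega>" using x cl by blast
    then obtain s where s: "\<And>n. s n \<in> \<Omega>" "s \<longlonglongrightarrow> x" by (auto simp: closure_sequential)
    have "(\<lambda>n. G (s n)) \<longlonglongrightarrow> G x"
      using continuous_on_tendsto_compose[OF contG s(2)] s(1) \<open>x \<in> closure \<Omega>\<close> closure_subset by (auto intro!: eventuallyI)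
    then have "(\<lambda>n. f (G (s n))) \<longlonglongrightarrow> f (G x)"
      by (rule continuous_on_tendsto_compose[OF contf _ lt]) (use GO(1) s(1) in auto)
    then have "s \<longlonglongrightarrow> f (G x)" using GO s(1) by simp
    then have "f (G x) = x" using s(2) LIMSEQ_unique by blast
    then show False using fg(4)[OF lt] x disj by auto
  qed
  have injJ: "p = q" if pq: "p \<in> J" "q \<in> J" "G p = G q" for p q
  proof (rule ccontr)
    assume "p \<noteq> q"
    define \<zeta> where "\<zeta> = G p"
    define D where "D n = f ` (ball 0 1 \<inter> ball \<zeta> (1 / Suc n))" for n
    \<comment> \<open>the cluster set of the Riemann map at \<open>\<zeta>\<close>\<close>
    define L where "L = (\<Inter>n. closure (D n))"
    have DO: "D n \<subseteq> \<Omega>" for n using fg(4) by (auto simp: D_def)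
    have anti: "D n \<subseteq> D m" if "m \<le> n" for m n
    proof -
      have "1 / real (Suc n) \<le> 1 / real (Suc m)" using that by (simp add: frac_le)
      then show ?thesis unfolding D_def by (intro image_mono Int_mono subset_ball) auto
    qed
    have "connected L" unfolding L_def
    proof (rule connected_nest)
      show "compact (closure (D n))" for n
        using DO Jordan(5) by (metis \<Omega>_def bounded_subset compact_closure)
      show "connected (closure (D n))" for n
        unfolding D_def
        by (intro connected_imp_connected_closure connected_continuous_image continuous_on_subset[OF contf] convex_connected convex_Int convex_ball) auto
      show "closure (D n) \<subseteq> closure (D m)" if "m \<le> n" for m n
        using anti that closure_mono by blast
    qed
    have inL: "x \<in> L" if x: "x \<in> J" "G x = \<zeta>" for x
    proof -
      have xc: "x \<in> closure \<Omega>" using x cl by blast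
      then obtain s where s: "\<And>n. s n \<in> \<Omega>" "s \<longlonglongrightarrow> x" by (auto simp: closure_sequential)
      have lim: "(\<lambda>n. G (s n)) \<longlonglongrightarrow> \<zeta>"
        using continuous_on_tendsto_compose[OF contG s(2)] s(1) xc closure_subset x(2) by (auto intro!: eventuallyI)
      have "x \<in> closure (D n)" for n
      proof (rule Lim_in_closed_set[OF closed_closure _ _ s(2)])
        have "eventually (\<lambda>k. G (s k) \<in> ball \<zeta> (1 / Suc n)) sequentially"
          using lim by (auto simp: tendsto_iff dist_commute)
        then show "eventually (\<lambda>k. s k \<in> closure (D n)) sequentially"
        proof eventually_elim
          case (elim k)
          then have "f (G (s k)) \<in> D n" using GO(1)[OF s(1)] by (auto simp: D_def)
          then show ?case using GO(2)[OF s(1)] closure_subset by auto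
        qed
      qed simp
      then show ?thesis by (simp add: L_def)
    qed
    have GL: "G x = \<zeta>" if x: "x \<in> L" for x
    proof -
      have "dist \<zeta> (G x) \<le> 1 / Suc n" for n
      proof -
        have "G x \<in> closure (G ` D n)" using Gcl[OF DO] x by (auto simp: L_def)
        moreover have "G ` D n \<subseteq> cball \<zeta> (1 / Suc n)"
          using fg(4) G(2) by (force simp: D_def)
        ultimately show ?thesis using closure_minimal[OF _ closed_cball] by (metis mem_cball subsetD)
      qed
      then have "dist \<zeta> (G x) \<le> 0"
        by (intro LIMSEQ_le_const[OF LIMSEQ_Suc[OF lim_1_over_n]]) blast
      then show ?thesis by simp
    qed
    have LJ: "L \<subseteq> J"
    proof
      fix x assume x: "x \<in> L"
      then have "x \<in> closure (D 0)" unfolding L_def by blast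
      then have "x \<in> closure \<Omega>" using closure_mono[OF DO[of 0]] by blast
      moreover have "norm (G x) = 1" using GL[OF x] GJ pq by (simp add: \<zeta>_def)
      then have "x \<notin> \<Omega>" using GO by force
      ultimately show "x \<in> J" using cl by blast
    qed
    have "p \<in> L" "q \<in> L" using inL pq by (auto simp: \<zeta>_def)
    then have "\<exists>x\<in>L. \<exists>\<rho>>0. J \<inter> ball x \<rho> \<subseteq> L"
      by (rule subcontinuum_contains_arc[OF \<open>connected L\<close> LJ _ _ \<open>p \<noteq> q\<close>])
    then obtain x \<rho> where x: "x \<in> L" "0 < \<rho>" "J \<inter> ball x \<rho> \<subseteq> L" by (elim bexE exE conjE)
    have "x \<in> closure \<Omega>" "x \<in> closure (outside J)"
      using x(1) LJ Jordan(8,9) unfolding \<Omega>_def by (metis DiffD1 frontier_def subsetD)+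
    moreover have "0 < \<rho>/8" using x by simp
    ultimately obtain z0 w0 where zw: "z0 \<in> \<Omega>" "dist z0 x < \<rho>/8" "w0 \<in> outside J" "dist w0 x < \<rho>/8"
      unfolding closure_approachable by (metis (no_types))
    have "G z0 - \<zeta> = 0"
    proof (rule vanishing_near_exterior_point[of \<Omega> "\<lambda>z. G z - \<zeta>" 2 w0 "\<rho>/2"])
      show "open \<Omega>" using Jordan by (simp add: \<Omega>_def)
      show "continuous_on (closure \<Omega>) (\<lambda>z. G z - \<zeta>)" by (intro continuous_intros contG)
      have "G holomorphic_on \<Omega>" using fg(1) G(2) by (metis holomorphic_transform)
      then show "(\<lambda>z. G z - \<zeta>) holomorphic_on \<Omega>" by (intro holomorphic_intros)
      show "norm (G z - \<zeta>) \<le> 2" if "z \<in> \<Omega>" for z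
        using norm_triangle_ineq4[of "G z" \<zeta>] G1[of z] GJ[OF pq(1)] that closure_subset[of \<Omega>] by (auto simp: \<zeta>_def)
      have "w0 \<notin> inside J" using zw(3) inside_Int_outside[of J] by (metis IntI empty_iff)
      moreover have "w0 \<notin> J" using zw(3) outside_no_overlap[of J] by (metis IntI empty_iff)
      ultimately show "w0 \<notin> closure \<Omega>" unfolding cl by (simp add: \<Omega>_def)
      show "G z - \<zeta> = 0" if "z \<in> frontier \<Omega>" "dist w0 z < \<rho>/2" for z
      proof -
        have "dist x z < \<rho>" using that zw x(2) dist_triangle[of x z w0] by (simp add: dist_commute)
        then show ?thesis using that x GL[of z] Jordan(8) by (auto simp: \<Omega>_def)
      qed
      show "2 * dist w0 z0 < \<rho>/2"
        using zw dist_triangle[of w0 z0 x] by (simp add: dist_commute)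
    qed (use x zw in auto)
    then show False using GO(1)[OF zw(1)] GJ[OF pq(1)] by (auto simp: \<zeta>_def)
  qed
  have injG: "inj_on G (closure \<Omega>)"
  proof (rule inj_onI)
    fix x y assume xy: "x \<in> closure \<Omega>" "y \<in> closure \<Omega>" "G x = G y"
    show "x = y"
    proof (cases "norm (G x) = 1")
      case True
      then have "x \<in> J" "y \<in> J" using xy GO(1)[of x] GO(1)[of y] by (auto simp: cl)
      then show ?thesis using injJ xy by blast
    next
      case False
      then have "x \<in> \<Omega>" "y \<in> \<Omega>" using xy GJ[of x] GJ[of y] by (auto simp: cl)
      then show ?thesis using GO(2) xy by metis
    qed
  qed
  have im: "G ` closure \<Omega> = cball 0 1"
  proof
    show "G ` closure \<Omega> \<subseteq> cball 0 1" using G1 by auto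
    have "ball 0 1 \<subseteq> G ` closure \<Omega>"
    proof
      fix z :: complex assume "z \<in> ball 0 1"
      then show "z \<in> G ` closure \<Omega>" using fg(4)[of z] G(2) closure_subset[of \<Omega>] by (metis image_eqI subsetD)
    qed
    moreover have "closed (G ` closure \<Omega>)"
      using cpt contG by (simp add: compact_continuous_image compact_imp_closed)
    ultimately have "closure (ball 0 1) \<subseteq> G ` closure \<Omega>" by (rule closure_minimal)
    then show "cball 0 1 \<subseteq> G ` closure \<Omega>" by simp
  qed
  obtain G' where G': "homeomorphism (closure \<Omega>) (cball 0 1) G G'"
    using homeomorphism_compact[OF cpt contG im injG] by blast
  have "G ` J = sphere 0 1"
  proof
    show "G ` J \<subseteq> sphere 0 1" using GJ by auto
    show "sphere 0 1 \<subseteq> G ` J"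
    proof
      fix z :: complex assume z: "z \<in> sphere 0 1"
      then have "z \<in> G ` closure \<Omega>" using im by auto
      then show "z \<in> G ` J" using z GO(1) cl by force
    qed
  qed
  then show ?thesis using that G' cl by (simp add: \<Omega>_def)
qed

end

text \<open>
  Extend the boundary homeomorphism of the disc radially and compose with the homeomorphism of
  Caratheodory's theorem.
\<close>
theorem Schoenflies_extension:
  fixes \<phi> :: "complex \<Rightarrow> complex"
  assumes "continuous_on (sphere 0 1) \<phi>" "inj_on \<phi> (sphere 0 1)"
  obtains \<Phi> where "continuous_on (cball 0 1) \<Phi>" "inj_on \<Phi> (cball 0 1)"
    "\<Phi> ` ball 0 1 = inside (\<phi> ` sphere 0 1)" "\<And>z. z \<in> sphere 0 1 \<Longrightarrow> \<Phi> z = \<phi> z"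
proof -
  interpret jordan_circle \<phi> using assms by unfold_locales
  obtain G G' :: "complex \<Rightarrow> complex" where G: "homeomorphism (J \<union> inside J) (cball 0 1) G G'" "G ` J = sphere 0 1"
    by (rule inside_homeomorphic_disc)
  define \<theta> where "\<theta> = G \<circ> \<phi>"
  have \<theta>im: "\<theta> ` sphere 0 1 = sphere 0 1" using G(2) by (simp add: \<theta>_def image_image J_def)
  have cG: "continuous_on J G" using homeomorphism_cont1[OF G(1)] by (rule continuous_on_subset) auto
  have c\<theta>: "continuous_on (sphere 0 1) \<theta>"
    unfolding \<theta>_def using cG by (intro continuous_on_compose cont) (simp add: J_def)
  have inj\<theta>: "inj_on \<theta> (sphere 0 1)"
  proof -
    have "inj_on G (\<phi> ` sphere 0 1)"
      using G(1) unfolding J_def by (intro inj_on_inverseI[of _ G']) (auto simp: homeomorphism_def)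
    then show ?thesis unfolding \<theta>_def by (rule comp_inj_on[OF inj])
  qed
  define H where "H z = of_real (norm z) * \<theta> (z / of_real (norm z))" for z
  have n\<theta>: "norm (\<theta> z) = 1" if "norm z = 1" for z using \<theta>im that by (metis imageI mem_sphere_0)
  have nn: "norm (z / of_real (norm z)) = 1" if "z \<noteq> 0" for z :: complex using that by (simp add: norm_divide)
  have nH: "norm (H z) = norm z" for z
    using n\<theta>[OF nn] by (cases "z = 0") (auto simp: H_def norm_mult)
  have cH: "continuous_on (cball 0 1) H"
  proof -
    have "continuous (at z within cball 0 1) H" if "z \<in> cball 0 1" for z
    proof (cases "z = 0")
      case True
      have "(norm \<longlongrightarrow> 0) (at (0::complex) within cball 0 1)"
        by (intro tendsto_norm_zero tendsto_ident_at)
      then have "(H \<longlongrightarrow> 0) (at 0 within cball 0 1)"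
        by (rule Lim_null_comparison[rotated]) (simp add: nH)
      moreover have "H 0 = 0" by (simp add: H_def)
      ultimately show ?thesis using True by (simp add: continuous_within)
    next
      case False
      have "continuous_on (-{0}) H"
        unfolding H_def
        by (intro continuous_intros continuous_on_compose2[OF c\<theta>]) (use nn in \<open>auto simp: norm_divide split: if_splits\<close>)
      then have "isCont H z" using False by (auto simp: continuous_on_eq_continuous_at open_Compl)
      then show ?thesis by (simp add: continuous_at_imp_continuous_at_within)
    qed
    then show ?thesis by (simp add: continuous_on_eq_continuous_within)
  qed
  have injH: "inj_on H (cball 0 1)"
  proof (rule inj_onI)
    fix x y :: complex assume xy: "H x = H y"
    then have n: "norm x = norm y" using nH by metis
    show "x = y"
    proof (cases "x = 0")
      case True then show ?thesis using n by simp
    next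
      case False
      then have y: "y \<noteq> 0" using n by auto
      have "\<theta> (x / of_real (norm x)) = \<theta> (y / of_real (norm y))" using xy False y n by (simp add: H_def)
      then have "x / of_real (norm x) = y / of_real (norm y)"
        using inj\<theta> nn[OF False] nn[OF y] by (auto dest!: inj_onD)
      then show ?thesis using n False y by simp
    qed
  qed
  have Hs: "H ` sphere 0 1 = sphere 0 1"
  proof -
    have "H z = \<theta> z" if "z \<in> sphere 0 1" for z using that by (simp add: H_def)
    then show ?thesis using \<theta>im by (metis image_cong)
  qed
  have Hb: "H ` ball 0 1 = ball 0 1"
  proof
    show "H ` ball 0 1 \<subseteq> ball 0 1" using nH by auto
    show "ball 0 1 \<subseteq> H ` ball 0 1"
    proof
      fix w :: complex assume w: "w \<in> ball 0 1"
      show "w \<in> H ` ball 0 1"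
      proof (cases "w = 0")
        case True then show ?thesis by (intro image_eqI[of _ _ 0]) (auto simp: H_def)
      next
        case False
        then obtain u where u: "norm u = 1" "\<theta> u = w / of_real (norm w)"
          using nn[OF False] \<theta>im by (metis imageE mem_sphere_0)
        have "H (of_real (norm w) * u) = w"
          using u False by (simp add: H_def norm_mult)
        then show ?thesis using w u by (intro image_eqI[of _ _ "of_real (norm w) * u"]) (auto simp: norm_mult)
      qed
    qed
  qed
  define \<Phi> where "\<Phi> = G' \<circ> H"
  have cb: "H ` cball 0 1 \<subseteq> cball 0 1" using nH by auto
  have hG': "continuous_on (cball 0 1) G'" "inj_on G' (cball 0 1)"
    using G(1) by (auto simp: homeomorphism_def intro: inj_on_inverseI)
  show ?thesis
  proof
    show "continuous_on (cball 0 1) \<Phi>"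
      unfolding \<Phi>_def using hG' cb by (intro continuous_on_compose cH) (auto intro: continuous_on_subset)
    show "inj_on \<Phi> (cball 0 1)"
      unfolding \<Phi>_def using hG' cb by (intro comp_inj_on injH) (auto intro: inj_on_subset)
    have Gi: "G ` inside J = ball 0 1"
    proof -
      have "G ` (J \<union> inside J) = cball 0 1" "inj_on G (J \<union> inside J)"
        using G(1) by (auto simp: homeomorphism_def intro: inj_on_inverseI)
      then have "G ` (J \<union> inside J - J) = cball 0 1 - sphere 0 1"
        using G(2) by (subst inj_on_image_set_diff) auto
      moreover have "J \<union> inside J - J = inside J" using inside_no_overlap[of J] by blast
      ultimately show ?thesis by auto
    qed
    have "G' ` ball 0 1 = inside J"
    proof -
      have "G' (G x) = x" if "x \<in> inside J" for x using G(1) that by (auto simp: homeomorphism_def)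
      then have "G' ` G ` inside J = inside J" by (simp add: image_image)
      then show ?thesis by (simp only: Gi)
    qed
    then show "\<Phi> ` ball 0 1 = inside (\<phi> ` sphere 0 1)"
      unfolding \<Phi>_def image_comp[symmetric] Hb by (simp add: J_def)
    show "\<Phi> z = \<phi> z" if "z \<in> sphere 0 1" for z
      using that G(1) by (auto simp: \<Phi>_def H_def \<theta>_def homeomorphism_def J_def)
  qed
qed

section \<open>Gluing embeddings of the cells of a square grid\<close>
text \<open>
  Near each point only finitely many of the sets matter, and for finitely many closed sets it is the pasting
  lemma.
\<close>
lemma continuous_on_locally_finite_closed:
  fixes C :: "'i \<Rightarrow> 'a::metric_space set"
  assumes "\<And>i. closed (C i)" "\<And>i. continuous_on (C i) f"
    and fin: "\<And>x. finite {i. C i \<inter> ball x 1 \<noteq> {}}"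
  shows "continuous_on (\<Union>i. C i) f"
proof -
  have "continuous (at x within (\<Union>i. C i)) f" if x: "x \<in> (\<Union>i. C i)" for x
  proof -
    define I where "I = {i. C i \<inter> ball x 1 \<noteq> {}}"
    have "continuous_on (\<Union>i\<in>I. C i) f"
      using fin assms by (intro continuous_on_closed_Union) (auto simp: I_def)
    moreover have sub: "(\<Union>i. C i) \<inter> ball x 1 \<subseteq> (\<Union>i\<in>I. C i)" by (auto simp: I_def)
    ultimately have "continuous_on ((\<Union>i. C i) \<inter> ball x 1) f" by (rule continuous_on_subset)
    moreover have "x \<in> (\<Union>i. C i) \<inter> ball x 1" using x by simp
    ultimately have "continuous (at x within (\<Union>i. C i) \<inter> ball x 1) f"
      by (metis continuous_on_eq_continuous_within)
    moreover have "at x within (\<Union>i. C i) \<inter> ball x 1 = at x within (\<Union>i. C i)"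
      by (rule at_within_nhd[of x "ball x 1"]) auto
    ultimately show ?thesis by simp
  qed
  then show ?thesis by (simp add: continuous_on_eq_continuous_within)
qed

text \<open>
  The image is open by invariance of domain, and closed because bounded displacement makes the map proper.
\<close>
lemma bounded_displacement_homeomorphism:
  fixes g :: "'a::euclidean_space \<Rightarrow> 'a"
  assumes cont: "continuous_on UNIV g" and "inj g" and disp: "\<And>x. dist (g x) x \<le> B"
  shows "\<exists>g'. homeomorphism UNIV UNIV g g'"
proof -
  have "open (range g)" using invariance_of_domain[OF cont] \<open>inj g\<close> by simp
  moreover have "closed (range g)"
  proof -
    have "y \<in> range g" if y: "y \<in> closure (range g)" for y
    proof -
      define K where "K = g ` cball y (B + 1)"
      have "compact K" unfolding K_def
        by (intro compact_continuous_image continuous_on_subset[OF cont]) auto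
      have "range g \<inter> ball y 1 \<subseteq> K"
      proof clarify
        fix x assume "g x \<in> ball y 1"
        then have "dist y x \<le> B + 1" using disp[of x] dist_triangle[of y x "g x"] by simp
        then show "g x \<in> K" by (auto simp: K_def)
      qed
      moreover have "y \<in> closure (range g \<inter> ball y 1)"
        using y open_Int_closure_subset[of "ball y 1" "range g"] by (auto simp: Int_commute)
      ultimately have "y \<in> K" using \<open>compact K\<close> by (metis closure_closed closure_mono compact_imp_closed subsetD)
      then show ?thesis by (auto simp: K_def)
    qed
    then show ?thesis using closure_subset_eq by blast
  qed
  ultimately have "range g = UNIV" using clopen[of "range g"] by auto
  then show ?thesis
    using invariance_of_domain_homeomorphism[of UNIV g] cont \<open>inj g\<close> by (metis open_UNIV order_refl)
qed

text \<open>
  The boundary of a box is parametrized by the circle through a homeomorphism of the box with the disc.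
\<close>
lemma jordan_circle_box:
  fixes a b :: complex and \<phi> :: "complex \<Rightarrow> complex"
  assumes box: "box a b \<noteq> {}" and cont: "continuous_on (frontier (cbox a b)) \<phi>" and inj: "inj_on \<phi> (frontier (cbox a b))"
  obtains k k' where "homeomorphism (cbox a b) (cball (0::complex) 1) k k'"
    "k ` frontier (cbox a b) = sphere 0 1" "k ` box a b = ball 0 1"
    "jordan_circle (\<phi> \<circ> k')" "(\<phi> \<circ> k') ` sphere 0 1 = \<phi> ` frontier (cbox a b)"
proof -
  have int: "interior (cbox a b) = box a b" by simp
  have "cbox a b homeomorphic cball (0::complex) 1"
    using box by (intro homeomorphic_convex_compact_cball) auto
  then obtain k k' where k: "homeomorphism (cbox a b) (cball (0::complex) 1) k k'"
    by (auto simp: homeomorphic_def)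
  then have kk: "continuous_on (cbox a b) k" "continuous_on (cball 0 1) k'" "k ` cbox a b = cball 0 1"
    "k' ` cball 0 1 = cbox a b" "inj_on k (cbox a b)" "inj_on k' (cball 0 1)"
    by (auto simp: homeomorphism_def intro: inj_on_inverseI)
  have "k ` box a b \<subseteq> ball 0 1"
    using continuous_image_subset_interior[OF kk(1,5)] kk(3) by (auto simp: Pi_iff)
  moreover have k'b: "k' ` ball 0 1 \<subseteq> box a b"
    using continuous_image_subset_interior[OF kk(2,6)] kk(4) by (auto simp: Pi_iff)
  then have "ball 0 1 \<subseteq> k ` box a b"
    using k by (force simp: homeomorphism_def)
  ultimately have kb: "k ` box a b = ball 0 1" by blast
  have fr: "frontier (cbox a b) = cbox a b - box a b" by (simp add: frontier_def)
  have "k ` (cbox a b - box a b) = cball 0 1 - ball 0 1"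
    using kk kb box_subset_cbox[of a b] by (subst inj_on_image_set_diff) auto
  then have ks: "k ` frontier (cbox a b) = sphere 0 1" using fr by auto
  have k's: "k' ` sphere 0 1 = frontier (cbox a b)"
  proof -
    have "k' ` k ` frontier (cbox a b) = frontier (cbox a b)"
      using k fr by (force simp: homeomorphism_def image_iff)
    then show ?thesis using ks by simp
  qed
  have "jordan_circle (\<phi> \<circ> k')"
  proof
    have "continuous_on (sphere 0 1) k'" using kk(2) by (rule continuous_on_subset) auto
    then show "continuous_on (sphere 0 1) (\<phi> \<circ> k')"
      using k's cont by (intro continuous_on_compose) auto
    have "inj_on k' (sphere 0 1)" using kk(6) by (rule inj_on_subset) auto
    then show "inj_on (\<phi> \<circ> k') (sphere 0 1)"
      using k's inj by (intro comp_inj_on) auto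
  qed
  then show ?thesis
    using that k ks kb k's by (metis image_comp)
qed

lemma Schoenflies_box:
  fixes a b :: complex and \<phi> :: "complex \<Rightarrow> complex"
  assumes box: "box a b \<noteq> {}" and cont: "continuous_on (frontier (cbox a b)) \<phi>" and inj: "inj_on \<phi> (frontier (cbox a b))"
  obtains \<Phi> where "continuous_on (cbox a b) \<Phi>" "inj_on \<Phi> (cbox a b)"
    "\<Phi> ` box a b = inside (\<phi> ` frontier (cbox a b))" "\<And>z. z \<in> frontier (cbox a b) \<Longrightarrow> \<Phi> z = \<phi> z"
proof -
  obtain k k' where k: "homeomorphism (cbox a b) (cball (0::complex) 1) k k'"
    "k ` frontier (cbox a b) = sphere 0 1" "k ` box a b = ball 0 1"
    "jordan_circle (\<phi> \<circ> k')" "(\<phi> \<circ> k') ` sphere 0 1 = \<phi> ` frontier (cbox a b)"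
    using jordan_circle_box[OF assms] by blast
  obtain \<Phi> where \<Phi>: "continuous_on (cball 0 1) \<Phi>" "inj_on \<Phi> (cball 0 1)"
    "\<Phi> ` ball 0 1 = inside ((\<phi> \<circ> k') ` sphere 0 1)" "\<And>z. z \<in> sphere 0 1 \<Longrightarrow> \<Phi> z = (\<phi> \<circ> k') z"
    using Schoenflies_extension[of "\<phi> \<circ> k'"] k(4) unfolding jordan_circle_def by metis
  show ?thesis
  proof
    show "continuous_on (cbox a b) (\<Phi> \<circ> k)"
      using k(1) \<Phi>(1) by (intro continuous_on_compose) (auto simp: homeomorphism_def)
    show "inj_on (\<Phi> \<circ> k) (cbox a b)"
      using k(1) \<Phi>(2) by (intro comp_inj_on) (auto simp: homeomorphism_def intro: inj_on_inverseI)
    show "(\<Phi> \<circ> k) ` box a b = inside (\<phi> ` frontier (cbox a b))"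
      using k(3,5) \<Phi>(3) by (metis image_comp)
    show "(\<Phi> \<circ> k) z = \<phi> z" if "z \<in> frontier (cbox a b)" for z
    proof -
      have "k z \<in> sphere 0 1" using k(2) that by blast
      moreover have "z \<in> cbox a b" using that by (auto simp: frontier_def)
      ultimately show ?thesis using \<Phi>(4) k(1) by (simp add: homeomorphism_def)
    qed
  qed
qed

text \<open>
  An embedding of the closed box maps its interior to an open connected set that is bounded by, and disjoint
  from, the image of the boundary; so the image of the interior is the bounded component of the complement.
\<close>
lemma embedding_box_inside:
  fixes a b :: complex and f :: "complex \<Rightarrow> complex"
  assumes box: "box a b \<noteq> {}" and contf: "continuous_on (cbox a b) f" and injf: "inj_on f (cbox a b)"
  shows "f ` box a b = inside (f ` frontier (cbox a b))"
proof -
  have fr: "frontier (cbox a b) = cbox a b - box a b" by (simp add: frontier_def)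
  have fsub: "frontier (cbox a b) \<subseteq> cbox a b" by (auto simp: fr)
  obtain k k' where k: "jordan_circle (f \<circ> k')" "(f \<circ> k') ` sphere 0 1 = f ` frontier (cbox a b)"
    using jordan_circle_box[OF box continuous_on_subset[OF contf fsub] inj_on_subset[OF injf fsub]] by metis
  interpret jordan_circle "f \<circ> k'" by fact
  have J: "J = f ` frontier (cbox a b)" using k(2) by (simp add: J_def)
  define A where "A = f ` box a b"
  have oA: "open A"
    unfolding A_def using contf injf box_subset_cbox[of a b]
    by (intro invariance_of_domain) (auto intro: continuous_on_subset inj_on_subset)
  have AJ: "A \<inter> J = {}"
    using injf box_subset_cbox[of a b] fr by (auto simp: A_def J inj_on_def)
  have AuJ: "A \<union> J = f ` cbox a b"
    using box_subset_cbox[of a b] by (auto simp: A_def J fr)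
  have cA: "closed (A \<union> J)"
    unfolding AuJ using contf by (simp add: compact_continuous_image compact_imp_closed)
  have bA: "bounded A"
    using AuJ compact_continuous_image[OF contf compact_cbox] by (metis bounded_subset compact_imp_bounded sup_ge1)
  have conn_sub: "C \<subseteq> A" if C: "connected C" "C \<inter> J = {}" "C \<inter> A \<noteq> {}" for C
  proof -
    have "C \<subseteq> A \<or> C \<subseteq> - (A \<union> J)"
      using connectedD[OF C(1) oA open_Compl[OF cA]] C(2) by blast
    then show ?thesis using C(3) by blast
  qed
  have Ane: "A \<noteq> {}" using box by (simp add: A_def)
  have "A \<inter> outside J = {}"
  proof (rule ccontr)
    assume *: "A \<inter> outside J \<noteq> {}"
    obtain c where c: "simple_path c" "pathfinish c = pathstart c" "path_image c = J"
      using simple_loop by blast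
    have "connected (outside J)" "\<not> bounded (outside J)"
      using Jordan_inside_outside[OF c(1,2)] c(3) by auto
    moreover have "outside J \<subseteq> A"
      using \<open>connected (outside J)\<close> * outside_no_overlap[of J] by (intro conn_sub) blast+
    ultimately show False using bA bounded_subset by blast
  qed
  then have "A \<subseteq> inside J" using AJ Jordan(7) by blast
  moreover have "inside J \<subseteq> A"
    using Jordan(3) Ane \<open>A \<subseteq> inside J\<close> inside_no_overlap[of J] by (intro conn_sub) blast+
  ultimately show ?thesis by (simp add: A_def J)
qed

definition pt :: "int \<Rightarrow> int \<Rightarrow> complex" where "pt i j = Complex (of_int i) (of_int j)"

definition cell :: "int \<times> int \<Rightarrow> complex set" where
  "cell c = cbox (pt (fst c) (snd c)) (pt (fst c + 1) (snd c + 1))"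

definition cell_interior :: "int \<times> int \<Rightarrow> complex set" where
  "cell_interior c = box (pt (fst c) (snd c)) (pt (fst c + 1) (snd c + 1))"

definition grid :: "complex set" where "grid = {z. Re z \<in> \<int> \<or> Im z \<in> \<int>}"

definition cell_of :: "complex \<Rightarrow> int \<times> int" where "cell_of z = (\<lfloor>Re z\<rfloor>, \<lfloor>Im z\<rfloor>)"

lemma in_cell: "z \<in> cell (i,j) \<longleftrightarrow> of_int i \<le> Re z \<and> Re z \<le> of_int i + 1 \<and> of_int j \<le> Im z \<and> Im z \<le> of_int j + 1"
  by (auto simp: cell_def pt_def in_cbox_complex_iff)

lemma in_cell_interior: "z \<in> cell_interior (i,j) \<longleftrightarrow> of_int i < Re z \<and> Re z < of_int i + 1 \<and> of_int j < Im z \<and> Im z < of_int j + 1"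
  by (auto simp: cell_interior_def pt_def in_box_complex_iff)

lemma cell_of_in: "z \<in> cell (cell_of z)"
  unfolding cell_of_def in_cell by (simp add: le_floor_iff floor_le_iff)

lemma frontier_cell: "frontier (cell c) = cell c - cell_interior c"
  by (simp add: cell_def cell_interior_def frontier_def)

lemma cell_interior_nonempty: "cell_interior c \<noteq> {}"
proof -
  obtain i j where c: "c = (i,j)" by fastforce
  have "pt i j + Complex (1/2) (1/2) \<in> cell_interior c"
    unfolding c in_cell_interior by (simp add: pt_def)
  then show ?thesis by blast
qed

lemma Ints_between: "(x::real) \<in> \<int> \<Longrightarrow> of_int i \<le> x \<Longrightarrow> x \<le> of_int i + 1 \<Longrightarrow> x = of_int i \<or> x = of_int i + 1"
proof -
  assume "x \<in> \<int>" "of_int i \<le> x" "x \<le> of_int i + 1"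
  then obtain z where z: "x = of_int z" by (elim Ints_cases)
  moreover have "i \<le> z" "z \<le> i + 1"
    using \<open>of_int i \<le> x\<close> \<open>x \<le> of_int i + 1\<close> unfolding z by linarith+
  then have "z = i \<or> z = i + 1" by linarith
  ultimately show ?thesis by auto
qed

lemma frontier_cell_eq: "frontier (cell c) = cell c \<inter> grid"
proof -
  obtain i j where c: "c = (i,j)" by fastforce
  show ?thesis
    unfolding frontier_cell c
  proof (intro subset_antisym subsetI)
    fix z assume "z \<in> cell (i,j) - cell_interior (i,j)"
    then have "Re z = of_int i \<or> Re z = of_int (i+1) \<or> Im z = of_int j \<or> Im z = of_int (j+1)" "z \<in> cell (i,j)"
      by (auto simp: in_cell in_cell_interior)
    then show "z \<in> cell (i,j) \<inter> grid" by (auto simp: grid_def)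
  next
    fix z assume z: "z \<in> cell (i,j) \<inter> grid"
    then show "z \<in> cell (i,j) - cell_interior (i,j)"
      using Ints_between[of "Re z" i] Ints_between[of "Im z" j]
      by (auto simp: in_cell in_cell_interior grid_def)
  qed
qed

lemma interior_cell_unique: "z \<in> cell c \<Longrightarrow> z \<notin> grid \<Longrightarrow> c = cell_of z"
proof -
  assume z: "z \<in> cell c" "z \<notin> grid"
  obtain i j where c: "c = (i,j)" by fastforce
  have "z \<in> cell_interior c" using z frontier_cell[of c] frontier_cell_eq[of c] by blast
  then show ?thesis unfolding c in_cell_interior cell_of_def by (auto intro!: floor_unique[symmetric])
qed

lemma frontier_cell_inj: "frontier (cell c) = frontier (cell d) \<Longrightarrow> c = d"
proof -
  assume eq: "frontier (cell c) = frontier (cell d)"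
  obtain i j k l where cd: "c = (i,j)" "d = (k,l)" by fastforce
  have "pt i j \<in> frontier (cell c)" "pt (i+1) (j+1) \<in> frontier (cell c)"
    unfolding frontier_cell cd by (auto simp: in_cell in_cell_interior pt_def)
  then have "pt i j \<in> cell d" "pt (i+1) (j+1) \<in> cell d"
    unfolding eq by (auto simp: frontier_cell)
  then have "real_of_int k \<le> real_of_int i" "real_of_int i + 1 \<le> real_of_int k + 1"
     "real_of_int l \<le> real_of_int j" "real_of_int j + 1 \<le> real_of_int l + 1"
    unfolding cd in_cell by (simp_all add: pt_def)
  then show ?thesis by (simp add: cd)
qed

lemma finite_cells_near: "finite {c. cell c \<inter> ball x 1 \<noteq> {}}"
proof (rule finite_subset)
  show "{c. cell c \<inter> ball x 1 \<noteq> {}} \<subseteq> {\<lfloor>Re x\<rfloor> - 3..\<lfloor>Re x\<rfloor> + 3} \<times> {\<lfloor>Im x\<rfloor> - 3..\<lfloor>Im x\<rfloor> + 3}"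
  proof
    fix c assume "c \<in> {c. cell c \<inter> ball x 1 \<noteq> {}}"
    then obtain z where "z \<in> cell c" "z \<in> ball x 1" by blast
    moreover obtain i j where c: "c = (i,j)" by fastforce
    ultimately have z: "z \<in> cell (i,j)" "z \<in> ball x 1" by auto
    have "\<bar>Re x - Re z\<bar> < 1" "\<bar>Im x - Im z\<bar> < 1"
      using z(2) abs_Re_le_cmod[of "x - z"] abs_Im_le_cmod[of "x - z"] by (auto simp: dist_norm)
    then show "c \<in> {\<lfloor>Re x\<rfloor> - 3..\<lfloor>Re x\<rfloor> + 3} \<times> {\<lfloor>Im x\<rfloor> - 3..\<lfloor>Im x\<rfloor> + 3}"
      using z(1) unfolding in_cell atLeastAtMost_iff c mem_Times_iff fst_conv snd_conv by linarith
  qed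
qed simp

text \<open>
  From a point of the grid off the boundary of a cell, one can walk to infinity along the grid without
  meeting that boundary.
\<close>
lemma grid_ray:
  assumes p: "p \<in> grid" "p \<notin> frontier (cell c)"
  obtains d where "norm d = 1" "\<And>t. 0 \<le> t \<Longrightarrow> p + of_real t * d \<in> grid - frontier (cell c)"
proof -
  obtain i j where c: "c = (i,j)" by fastforce
  have nc: "p \<notin> cell c" using p frontier_cell_eq by blast
  have "\<exists>d. norm d = 1 \<and> (\<forall>t\<ge>0. p + of_real t * d \<in> grid \<and> p + of_real t * d \<notin> cell c)"
  proof (cases "Re p \<in> \<int>")
    case True
    show ?thesis
    proof (cases "Im p < of_int j")
      case True
      then show ?thesis using \<open>Re p \<in> \<int>\<close> by (intro exI[of _ "-\<i>"]) (auto simp: c in_cell grid_def)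
    next
      case False
      then show ?thesis using \<open>Re p \<in> \<int>\<close> nc by (intro exI[of _ "\<i>"]) (auto simp: c in_cell grid_def)
    qed
  next
    case False
    then have "Im p \<in> \<int>" using p by (simp add: grid_def)
    show ?thesis
    proof (cases "Re p < of_int i")
      case True
      then show ?thesis using \<open>Im p \<in> \<int>\<close> by (intro exI[of _ "-1"]) (auto simp: c in_cell grid_def)
    next
      case False
      then show ?thesis using \<open>Im p \<in> \<int>\<close> nc by (intro exI[of _ 1]) (auto simp: c in_cell grid_def)
    qed
  qed
  then show ?thesis using that frontier_cell_eq by (metis DiffI IntD1)
qed

text \<open>
  A map of bounded displacement sends the rays of the previous lemma to unbounded sets. So points of the grid off the
  boundary of a cell are mapped to the outside of the image curve. Hence no image curve enters the inside of
  another, and distinct curves have disjoint insides. This makes the union of the maps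
  \<open>\<Psi> c\<close> injective; it is surjective by its bounded displacement.
\<close>
theorem grid_embedding_extends:
  fixes \<phi> :: "complex \<Rightarrow> complex" and \<Psi> :: "int \<times> int \<Rightarrow> complex \<Rightarrow> complex"
  assumes cont: "continuous_on grid \<phi>" and inj: "inj_on \<phi> grid"
    and disp: "\<And>x. x \<in> grid \<Longrightarrow> dist (\<phi> x) x \<le> B"
    and \<Psi>: "\<And>c. continuous_on (cell c) (\<Psi> c)" "\<And>c. inj_on (\<Psi> c) (cell c)"
      "\<And>c. \<Psi> c ` cell_interior c = inside (\<phi> ` frontier (cell c))"
      "\<And>c x. x \<in> frontier (cell c) \<Longrightarrow> \<Psi> c x = \<phi> x"
  obtains g g' where "homeomorphism UNIV UNIV g g'" "\<And>c x. x \<in> cell c \<Longrightarrow> g x = \<Psi> c x"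
    "\<And>x. dist (g x) x \<le> B + 4"
proof -
  define Jc where "Jc c = \<phi> ` frontier (cell c)" for c
  have fg: "frontier (cell c) \<subseteq> grid" for c using frontier_cell_eq by blast
  have jc: "\<exists>k. jordan_circle k \<and> k ` sphere 0 1 = Jc c" for c
    using jordan_circle_box[of "pt (fst c) (snd c)" "pt (fst c + 1) (snd c + 1)" \<phi>]
      cell_interior_nonempty[of c, unfolded cell_interior_def]
      continuous_on_subset[OF cont fg[of c, unfolded cell_def]] inj_on_subset[OF inj fg[of c, unfolded cell_def]]
    unfolding Jc_def cell_def by metis
  have far: "\<phi> p \<in> outside (Jc c)" if p: "p \<in> grid" "p \<notin> frontier (cell c)" for p c
  proof -
    obtain d where d: "norm d = 1" "\<And>t. 0 \<le> t \<Longrightarrow> p + of_real t * d \<in> grid - frontier (cell c)"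
      using grid_ray[OF p] by blast
    define R where "R = (\<lambda>t. p + of_real t * d) ` {0..}"
    have RN: "R \<subseteq> grid - frontier (cell c)" using d by (auto simp: R_def)
    have "connected (\<phi> ` R)"
      unfolding R_def using d(2)
      by (intro connected_continuous_image continuous_on_subset[OF cont] continuous_intros convex_connected) auto
    moreover have "\<not> bounded (\<phi> ` R)"
    proof
      assume "bounded (\<phi> ` R)"
      then obtain K where K: "\<And>x. x \<in> R \<Longrightarrow> norm (\<phi> x) \<le> K" by (auto simp: bounded_iff)
      define t where "t = \<bar>K\<bar> + \<bar>B\<bar> + norm p + 1"
      define x where "x = p + of_real t * d"
      have "x \<in> R" unfolding x_def R_def by (rule image_eqI[of _ _ t]) (auto simp: t_def)
      then have "norm x \<le> K + B" using K[of x] disp[of x] RN norm_triangle_sub[of x "\<phi> x"]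
        by (auto simp: dist_norm norm_minus_commute)
      moreover have "norm x \<ge> t - norm p"
      proof -
        have "norm (of_real t * d) = t" using d(1) by (simp only: norm_mult norm_of_real) (simp add: t_def)
        then show ?thesis using norm_triangle_ineq2[of "of_real t * d" "-p"] by (simp add: x_def add.commute)
      qed
      ultimately show False by (simp add: t_def)
    qed
    moreover have RJ: "\<phi> ` R \<subseteq> - Jc c"
    proof -
      have "\<phi> x \<notin> Jc c" if "x \<in> R" for x
      proof -
        have x: "x \<in> grid" "x \<notin> frontier (cell c)" using RN that by auto
        show ?thesis unfolding Jc_def using inj_on_image_mem_iff[OF inj x(1) fg] x(2) by blast
      qed
      then show ?thesis by blast
    qed
    moreover have pR: "\<phi> p \<in> \<phi> ` R"
      unfolding R_def by (intro imageI image_eqI[of _ _ 0]) auto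
    ultimately have "\<phi> ` R \<subseteq> connected_component_set (- Jc c) (\<phi> p)"
      by (intro connected_component_maximal)
    then have "\<not> bounded (connected_component_set (- Jc c) (\<phi> p))"
      using \<open>\<not> bounded (\<phi> ` R)\<close> bounded_subset by blast
    then show ?thesis using RJ pR by (auto simp: outside_def)
  qed
  have in_grid: "inside (Jc c) \<inter> \<phi> ` grid = {}" for c
  proof -
    have "\<phi> p \<notin> inside (Jc c)" if "p \<in> grid" for p
    proof (cases "p \<in> frontier (cell c)")
      case True
      then have "\<phi> p \<in> Jc c" by (simp add: Jc_def)
      then show ?thesis using inside_no_overlap[of "Jc c"] by blast
    next
      case False
      then show ?thesis using far that inside_Int_outside[of "Jc c"] by blast
    qed
    then show ?thesis by blast
  qed
  have in_in: "inside (Jc c) \<inter> inside (Jc d) = {}" if "c \<noteq> d" for c d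
  proof (rule ccontr)
    assume ne: "inside (Jc c) \<inter> inside (Jc d) \<noteq> {}"
    have sub: "inside (Jc c) \<subseteq> inside (Jc d)" if "inside (Jc c) \<inter> inside (Jc d) \<noteq> {}" for c d
    proof -
      obtain k where k: "jordan_circle k" "k ` sphere 0 1 = Jc c" using jc by blast
      obtain l where l: "jordan_circle l" "l ` sphere 0 1 = Jc d" using jc by blast
      have "connected (inside (Jc c))" using jordan_circle.Jordan(3)[OF k(1)] jordan_circle.J_def[OF k(1)] k(2) by simp
      moreover have "inside (Jc c) \<inter> Jc d = {}" using in_grid[of c] fg[of d] by (auto simp: Jc_def)
      ultimately show ?thesis
        using jordan_circle.connected_in_inside[OF l(1)] jordan_circle.J_def[OF l(1)] l(2) that by (metis disjoint_iff)
    qed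
    then have "inside (Jc c) = inside (Jc d)" using ne by blast
    moreover have "frontier (inside (Jc c)) = Jc c" for c
    proof -
      obtain k where k: "jordan_circle k" "k ` sphere 0 1 = Jc c" using jc by blast
      then show ?thesis using jordan_circle.Jordan(8)[OF k(1)] jordan_circle.J_def[OF k(1)] by simp
    qed
    ultimately have "Jc c = Jc d" by metis
    then have "frontier (cell c) = frontier (cell d)"
      unfolding Jc_def using inj fg by (meson inj_on_image_eq_iff)
    then show False using frontier_cell_inj that by blast
  qed
  define g where "g x = (if x \<in> grid then \<phi> x else \<Psi> (cell_of x) x)" for x
  have g\<Psi>: "g x = \<Psi> c x" if "x \<in> cell c" for x c
    using that \<Psi>(4)[of x c] frontier_cell_eq[of c] interior_cell_unique[of x c] by (auto simp: g_def)
  have Un: "(\<Union>c. cell c) = UNIV" using cell_of_in by blast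
  have contg: "continuous_on UNIV g"
    unfolding Un[symmetric]
  proof (rule continuous_on_locally_finite_closed)
    show "continuous_on (cell c) g" for c
      using \<Psi>(1)[of c] g\<Psi>[of _ c] by (metis continuous_on_cong)
    show "closed (cell c)" for c unfolding cell_def by (rule closed_cbox)
    show "finite {c. cell c \<inter> ball x 1 \<noteq> {}}" for x by (rule finite_cells_near)
  qed
  have g_in: "g x \<in> inside (Jc (cell_of x))" if "x \<notin> grid" for x
  proof -
    have "x \<in> cell_interior (cell_of x)"
      using that cell_of_in[of x] frontier_cell[of "cell_of x"] frontier_cell_eq[of "cell_of x"] by blast
    then show ?thesis using \<Psi>(3)[of "cell_of x"] g\<Psi>[OF cell_of_in, of x] by (auto simp: Jc_def)
  qed
  have injg: "inj g"
  proof (rule injI)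
    fix x y assume eq: "g x = g y"
    consider "x \<in> grid" "y \<in> grid" | "x \<in> grid" "y \<notin> grid" | "x \<notin> grid" "y \<in> grid" | "x \<notin> grid" "y \<notin> grid" by blast
    then show "x = y"
    proof cases
      case 1
      then show ?thesis using eq inj by (auto simp: g_def inj_on_def)
    next
      case 2
      then have "g x = \<phi> x" by (simp add: g_def)
      then show ?thesis using g_in[OF 2(2)] in_grid eq 2 by (metis IntI empty_iff imageI)
    next
      case 3
      then have "g y = \<phi> y" by (simp add: g_def)
      then show ?thesis using g_in[OF 3(1)] in_grid eq 3 by (metis IntI empty_iff imageI)
    next
      case 4
      then have same: "cell_of x = cell_of y" using g_in[of x] g_in[of y] in_in eq by (metis IntI empty_iff)
      then have "\<Psi> (cell_of x) x = \<Psi> (cell_of x) y" using eq g\<Psi> cell_of_in by metis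
      then show ?thesis using \<Psi>(2)[of "cell_of x"] cell_of_in same by (metis inj_onD)
    qed
  qed
  have dispg: "dist (g x) x \<le> B + 4" for x
  proof -
    define c where "c = cell_of x"
    have diam: "dist y z \<le> 2" if "y \<in> cell c" "z \<in> cell c" for y z
    proof -
      have "\<bar>Re (y - z)\<bar> \<le> 1" "\<bar>Im (y - z)\<bar> \<le> 1"
        using that by (cases c; auto simp: in_cell)+
      then show ?thesis using cmod_le[of "y - z"] by (simp add: dist_norm)
    qed
    have x: "x \<in> cell c" using cell_of_in by (simp add: c_def)
    have "Jc c \<subseteq> cball x (B + 2)"
    proof (clarsimp simp: Jc_def)
      fix y assume "y \<in> frontier (cell c)"
      then have "y \<in> grid" "y \<in> cell c" using frontier_cell_eq by auto
      then show "dist x (\<phi> y) \<le> B + 2"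
        using disp[of y] diam[OF x, of y] dist_triangle[of x "\<phi> y" y] by (simp add: dist_commute)
    qed
    then have "inside (Jc c) \<subseteq> cball x (B + 2)"
      using outside_subset_convex[of "cball x (B+2)" "Jc c"] inside_Int_outside[of "Jc c"] by blast
    moreover have "g x \<in> inside (Jc c)" if "x \<notin> grid" using g_in[OF that] by (simp add: c_def)
    ultimately have "dist (g x) x \<le> B + 2" if "x \<notin> grid" using that by (auto simp: dist_commute subset_iff)
    moreover have "dist (g x) x \<le> B" if "x \<in> grid" using disp[OF that] that by (simp add: g_def)
    ultimately show ?thesis by fastforce
  qed
  obtain g' where "homeomorphism UNIV UNIV g g'"
    using bounded_displacement_homeomorphism[OF contg injg dispg] by blast
  then show ?thesis using that g\<Psi> dispg by blast
qed

section \<open>Correcting an embedding close to the identity\<close>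
text \<open>
  The lower or left end point of an edge, and whether the edge is vertical.
\<close>
type_synonym edge_index = "int \<times> int \<times> bool"

definition src :: "edge_index \<Rightarrow> complex" where "src e = (case e of (i, j, b) \<Rightarrow> pt i j)"

definition tgt :: "edge_index \<Rightarrow> complex" where
  "tgt e = (case e of (i, j, b) \<Rightarrow> if b then pt i (j + 1) else pt (i + 1) j)"

definition edge :: "edge_index \<Rightarrow> complex set" where "edge e = closed_segment (src e) (tgt e)"

lemma in_edge:
  "z \<in> edge (i,j,b) \<longleftrightarrow>
     (if b then Re z = of_int i \<and> of_int j \<le> Im z \<and> Im z \<le> of_int j + 1
      else Im z = of_int j \<and> of_int i \<le> Re z \<and> Re z \<le> of_int i + 1)"
proof (cases b)
  case True
  have "edge (i,j,b) = {z. Re z = of_int i \<and> Im z \<in> closed_segment (of_int j) (of_int (j+1))}"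
    unfolding edge_def src_def tgt_def pt_def using True by (simp add: closed_segment_same_Re)
  then show ?thesis using True by (simp add: closed_segment_eq_real_ivl)
next
  case False
  have "edge (i,j,b) = {z. Im z = of_int j \<and> Re z \<in> closed_segment (of_int i) (of_int (i+1))}"
    unfolding edge_def src_def tgt_def pt_def using False by (simp add: closed_segment_same_Im)
  then show ?thesis using False by (simp add: closed_segment_eq_real_ivl)
qed

lemma dist_src_tgt: "dist (src e) (tgt e) = 1"
  by (cases e) (auto simp: src_def tgt_def pt_def dist_norm cmod_def)

lemma edge_diam: "p \<in> edge e \<Longrightarrow> q \<in> edge e \<Longrightarrow> dist p q \<le> 1"
proof -
  assume pq: "p \<in> edge e" "q \<in> edge e"
  obtain i j b where e: "e = (i,j,b)" by (cases e)
  show "dist p q \<le> 1"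
  proof (cases b)
    case True
    then have "Re (p - q) = 0" "\<bar>Im (p - q)\<bar> \<le> 1" using pq by (auto simp: e in_edge)
    then show ?thesis using cmod_eq_Im[of "p - q"] by (simp add: dist_norm)
  next
    case False
    then have "Im (p - q) = 0" "\<bar>Re (p - q)\<bar> \<le> 1" using pq by (auto simp: e in_edge)
    then show ?thesis using cmod_eq_Re[of "p - q"] by (simp add: dist_norm)
  qed
qed

lemma Union_edge: "(\<Union>e. edge e) = grid"
proof (intro subset_antisym subsetI)
  fix z assume "z \<in> (\<Union>e. edge e)"
  then obtain i j b where "z \<in> edge (i,j,b)" by auto
  then show "z \<in> grid" by (auto simp: in_edge grid_def split: if_splits)
next
  fix z assume z: "z \<in> grid"
  have fl: "of_int \<lfloor>x\<rfloor> \<le> x" "x \<le> of_int \<lfloor>x\<rfloor> + 1" for x :: real by linarith+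
  have "z \<in> edge (\<lfloor>Re z\<rfloor>, \<lfloor>Im z\<rfloor>, Re z \<in> \<int>)"
    using z fl by (auto simp: in_edge grid_def elim!: Ints_cases)
  then show "z \<in> (\<Union>e. edge e)" by blast
qed

lemma finite_edges_near: "finite {e. edge e \<inter> ball x 1 \<noteq> {}}"
proof (rule finite_subset)
  show "{e. edge e \<inter> ball x 1 \<noteq> {}} \<subseteq> (\<lambda>(c,b). (fst c, snd c, b)) ` ({c. cell c \<inter> ball x 1 \<noteq> {}} \<times> UNIV)"
  proof
    fix e assume e: "e \<in> {e. edge e \<inter> ball x 1 \<noteq> {}}"
    obtain i j b where ijb: "e = (i,j,b)" by (cases e)
    have "edge (i,j,b) \<subseteq> cell (i,j)" by (auto simp: in_edge in_cell split: if_splits)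
    then have "((i,j),b) \<in> {c. cell c \<inter> ball x 1 \<noteq> {}} \<times> UNIV" using e ijb by auto
    then show "e \<in> (\<lambda>(c,b). (fst c, snd c, b)) ` ({c. cell c \<inter> ball x 1 \<noteq> {}} \<times> UNIV)"
      unfolding ijb by (rule rev_image_eqI) simp
  qed
  show "finite ((\<lambda>(c,b). (fst c, snd c, b)) ` ({c. cell c \<inter> ball x 1 \<noteq> {}} \<times> (UNIV :: bool set)))"
    using finite_cells_near by (intro finite_imageI finite_cartesian_product) auto
qed

lemma frontier_cell_edge:
  assumes "x \<in> frontier (cell c)"
  shows "\<exists>e. x \<in> edge e \<and> edge e \<subseteq> cell c"
proof -
  obtain i j where c: "c = (i,j)" by fastforce
  have x: "x \<in> cell (i,j)" "x \<notin> cell_interior (i,j)" using assms by (auto simp: frontier_cell c)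
  then consider "Re x = of_int i" | "Re x = of_int i + 1" | "Im x = of_int j" | "Im x = of_int j + 1"
    by (auto simp: in_cell in_cell_interior)
  then show ?thesis
  proof cases
    case 1
    then show ?thesis using x by (intro exI[of _ "(i,j,True)"]) (auto simp: c in_edge in_cell)
  next
    case 2
    then show ?thesis using x by (intro exI[of _ "(i+1,j,True)"]) (auto simp: c in_edge in_cell)
  next
    case 3
    then show ?thesis using x by (intro exI[of _ "(i,j,False)"]) (auto simp: c in_edge in_cell)
  next
    case 4
    then show ?thesis using x by (intro exI[of _ "(i,j+1,False)"]) (auto simp: c in_edge in_cell)
  qed
qed

lemma common_point_integral:
  assumes "e \<noteq> e'" "p \<in> edge e" "p \<in> edge e'"
  shows "Re p \<in> \<int> \<and> Im p \<in> \<int>"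
proof -
  obtain i j b where e: "e = (i,j,b)" by (cases e)
  obtain k l c where e': "e' = (k,l,c)" by (cases e')
  have *: "x \<in> \<int>" if "of_int i \<le> x" "x \<le> of_int i + 1" "of_int k \<le> x" "x \<le> of_int k + 1" "i \<noteq> k" for x :: real and i k
  proof -
    have "i + 1 = k \<or> k + 1 = i" using that by linarith
    then have "x = of_int i \<or> x = of_int k" using that by auto
    then show ?thesis by auto
  qed
  show ?thesis using assms *[of i "Re p" k] *[of j "Im p" l] unfolding e e' in_edge by (auto split: if_splits)
qed

lemma close_points_share_vertex:
  assumes "e \<noteq> e'" "p \<in> edge e" "p' \<in> edge e'" "dist p p' \<le> 1/4"
  shows "\<exists>v. v \<in> {src e, tgt e} \<and> v \<in> {src e', tgt e'} \<and> dist p v \<le> 1/4 \<and> dist p' v \<le> 1/4"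
proof -
  obtain i j b where e: "e = (i,j,b)" by (cases e)
  obtain k l c where e': "e' = (k,l,c)" by (cases e')
  have d: "\<bar>Re p - Re p'\<bar> \<le> 1/4" "\<bar>Im p - Im p'\<bar> \<le> 1/4"
    using assms(4) abs_Re_le_cmod[of "p - p'"] abs_Im_le_cmod[of "p - p'"] by (auto simp: dist_norm)
  have dR: "dist z v \<le> 1/4" if "Im z = Im v" "\<bar>Re z - Re v\<bar> \<le> 1/4" for z v
    using that by (simp add: dist_norm cmod_eq_Re)
  have dI: "dist z v \<le> 1/4" if "Re z = Re v" "\<bar>Im z - Im v\<bar> \<le> 1/4" for z v
    using that by (simp add: dist_norm cmod_eq_Im)
  show ?thesis
  proof (cases b; cases c)
    assume bc: "b" "c"
    have p: "Re p = of_int i" "of_int j \<le> Im p" "Im p \<le> of_int j + 1" "Re p' = of_int k" "of_int l \<le> Im p'" "Im p' \<le> of_int l + 1"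
      using assms(2,3) bc unfolding e e' in_edge by auto
    have "i = k" using p d by linarith
    then have "j \<noteq> l" using assms(1) e e' bc by auto
    then have "l = j + 1 \<or> j = l + 1" using p d by linarith
    then show ?thesis
    proof
      assume l: "l = j + 1"
      then show ?thesis using p d \<open>i = k\<close> bc
        by (intro exI[of _ "pt i l"] conjI dI) (auto simp: e e' src_def tgt_def pt_def)
    next
      assume l: "j = l + 1"
      then show ?thesis using p d \<open>i = k\<close> bc
        by (intro exI[of _ "pt i j"] conjI dI) (auto simp: e e' src_def tgt_def pt_def)
    qed
  next
    assume bc: "\<not> b" "\<not> c"
    have p: "Im p = of_int j" "of_int i \<le> Re p" "Re p \<le> of_int i + 1" "Im p' = of_int l" "of_int k \<le> Re p'" "Re p' \<le> of_int k + 1"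
      using assms(2,3) bc unfolding e e' in_edge by auto
    have "j = l" using p d by linarith
    then have "i \<noteq> k" using assms(1) e e' bc by auto
    then have "k = i + 1 \<or> i = k + 1" using p d by linarith
    then show ?thesis
    proof
      assume l: "k = i + 1"
      then show ?thesis using p d \<open>j = l\<close> bc
        by (intro exI[of _ "pt k j"] conjI dR) (auto simp: e e' src_def tgt_def pt_def)
    next
      assume l: "i = k + 1"
      then show ?thesis using p d \<open>j = l\<close> bc
        by (intro exI[of _ "pt i j"] conjI dR) (auto simp: e e' src_def tgt_def pt_def)
    qed
  next
    assume bc: "b" "\<not> c"
    have p: "Re p = of_int i" "of_int j \<le> Im p" "Im p \<le> of_int j + 1" "Im p' = of_int l" "of_int k \<le> Re p'" "Re p' \<le> of_int k + 1"
      using assms(2,3) bc unfolding e e' in_edge by auto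
    have "i = k \<or> i = k + 1" "l = j \<or> l = j + 1" using p d by linarith+
    then show ?thesis using p d bc
      by (intro exI[of _ "pt i l"] conjI dI[of p] dR[of p']) (auto simp: e e' src_def tgt_def pt_def)
  next
    assume bc: "\<not> b" "c"
    have p: "Re p' = of_int k" "of_int l \<le> Im p'" "Im p' \<le> of_int l + 1" "Im p = of_int j" "of_int i \<le> Re p" "Re p \<le> of_int i + 1"
      using assms(2,3) bc unfolding e e' in_edge by auto
    have "k = i \<or> k = i + 1" "j = l \<or> j = l + 1" using p d by linarith+
    then show ?thesis using p d bc
      by (intro exI[of _ "pt k j"] conjI dR[of p] dI[of p']) (auto simp: e e' src_def tgt_def pt_def)
  qed
qed

text \<open>
  Here the grid has mesh 1. Vertices within \<open>\<rho>\<close> of the origin follow \<open>f\<close> and all other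
  vertices stay fixed.
\<close>
locale near_identity_embedding =
  fixes f :: "complex \<Rightarrow> complex" and \<rho> R :: real
  assumes contf: "continuous_on (cball 0 R) f" and injf: "inj_on f (cball 0 R)"
    and close: "\<And>x. x \<in> cball 0 R \<Longrightarrow> dist (f x) x \<le> 1/8" and \<rho>R: "\<rho> + 2 \<le> R"
begin

text \<open>
  The map that the vertex \<open>v\<close> asks for; around each vertex it is an embedding close to the identity.
\<close>
definition F :: "complex \<Rightarrow> complex \<Rightarrow> complex" where "F v = (if norm v \<le> \<rho> then f else id)"

lemma near_labelled: "norm v \<le> \<rho> \<Longrightarrow> dist p v \<le> 1 \<Longrightarrow> p \<in> cball 0 R"
  using \<rho>R norm_triangle_ineq2[of p v] by (simp add: dist_norm)

lemma F_close: "dist p v \<le> 1 \<Longrightarrow> dist (F v p) p \<le> 1/8"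
  using close near_labelled by (auto simp: F_def)

lemma F_inj: "dist p v \<le> 1 \<Longrightarrow> dist q v \<le> 1 \<Longrightarrow> F v p = F v q \<Longrightarrow> p = q"
  using inj_onD[OF injf] near_labelled by (auto simp: F_def split: if_splits)

lemma F_cont: "continuous_on (cball v 1) (F v)"
proof (cases "norm v \<le> \<rho>")
  case True
  then have "cball v 1 \<subseteq> cball 0 R" using near_labelled[of v] by (auto simp: dist_commute)
  then show ?thesis using True contf continuous_on_subset by (auto simp: F_def)
qed (simp add: F_def)

definition mid :: "edge_index \<Rightarrow> complex" where "mid e = midpoint (src e) (tgt e)"

text \<open>
  Each half of an edge follows the map of its own end, and a segment joins the two images of the midpoint.
  This set need not be an arc, but a path in it can be shortened to one.
\<close>
definition Z :: "edge_index \<Rightarrow> complex set" where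
  "Z e = F (src e) ` closed_segment (src e) (mid e) \<union>
         closed_segment (F (src e) (mid e)) (F (tgt e) (mid e)) \<union>
         F (tgt e) ` closed_segment (mid e) (tgt e)"

lemma mid_dist: "dist (src e) (mid e) = 1/2" "dist (mid e) (tgt e) = 1/2"
  using dist_midpoint[of "src e" "tgt e"] dist_src_tgt[of e] by (simp_all add: mid_def dist_commute)

lemma mid_in: "mid e \<in> edge e" by (simp add: mid_def edge_def)

lemma half_edge:
  shows "p \<in> closed_segment (src e) (mid e) \<Longrightarrow> p \<in> edge e \<and> dist p (src e) \<le> 1/2"
    and "p \<in> closed_segment (mid e) (tgt e) \<Longrightarrow> p \<in> edge e \<and> dist p (tgt e) \<le> 1/2"
proof -
  have sub: "closed_segment (src e) (mid e) \<subseteq> edge e" "closed_segment (mid e) (tgt e) \<subseteq> edge e"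
    using mid_in unfolding edge_def by (auto simp: subset_closed_segment)
  show "p \<in> closed_segment (src e) (mid e) \<Longrightarrow> p \<in> edge e \<and> dist p (src e) \<le> 1/2"
    using sub dist_in_closed_segment[of p "src e" "mid e"] mid_dist[of e] by (auto simp: dist_commute)
  show "p \<in> closed_segment (mid e) (tgt e) \<Longrightarrow> p \<in> edge e \<and> dist p (tgt e) \<le> 1/2"
    using sub dist_in_closed_segment[of p "mid e" "tgt e"] mid_dist[of e] by (auto simp: dist_commute)
qed

lemma Z_cases:
  assumes "z \<in> Z e"
  obtains p where "p \<in> edge e" "dist z p \<le> 1/8"
    "(dist p (src e) \<le> 1/2 \<and> z = F (src e) p) \<or> (dist p (tgt e) \<le> 1/2 \<and> z = F (tgt e) p) \<or> p = mid e"
proof -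
  consider p where "p \<in> closed_segment (src e) (mid e)" "z = F (src e) p"
    | p where "p \<in> closed_segment (mid e) (tgt e)" "z = F (tgt e) p"
    | "z \<in> closed_segment (F (src e) (mid e)) (F (tgt e) (mid e))"
    using assms by (auto simp: Z_def)
  then show ?thesis
  proof cases
    case 1
    then show ?thesis using that[of p] half_edge(1)[of p e] F_close[of p "src e"] by auto
  next
    case 2
    then show ?thesis using that[of p] half_edge(2)[of p e] F_close[of p "tgt e"] by auto
  next
    case 3
    have "closed_segment (F (src e) (mid e)) (F (tgt e) (mid e)) \<subseteq> cball (mid e) (1/8)"
      using F_close[of "mid e" "src e"] F_close[of "mid e" "tgt e"] mid_dist[of e]
      by (intro closed_segment_subset) (auto simp: dist_commute)
    then show ?thesis using 3 that[of "mid e"] mid_in by (auto simp: dist_commute)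
  qed
qed

lemma Z_near_vertex:
  assumes "p \<in> edge e" and c: "(dist p (src e) \<le> 1/2 \<and> z = F (src e) p) \<or> (dist p (tgt e) \<le> 1/2 \<and> z = F (tgt e) p) \<or> p = mid e"
    and v: "v \<in> {src e, tgt e}" "dist p v \<le> 1/4"
  shows "z = F v p"
proof -
  have "dist (src e) (tgt e) \<le> dist p (src e) + dist p (tgt e)" by (metis dist_commute dist_triangle)
  then show ?thesis using assms mid_dist[of e] dist_src_tgt[of e] by (auto simp: dist_commute)
qed

text \<open>
  Points of the two sets are within \<open>1/8\<close> of their edges. So the underlying points of the two edges are within
  \<open>1/4\<close>, and close points of distinct edges are near a common vertex, where both sets are images under
  the same injective map.
\<close>
lemma Z_Int:
  assumes "e \<noteq> e'" "z \<in> Z e" "z \<in> Z e'"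
  shows "\<exists>v. v \<in> {src e, tgt e} \<and> v \<in> {src e', tgt e'} \<and> z = F v v"
proof -
  obtain p where p: "p \<in> edge e" "dist z p \<le> 1/8"
    "(dist p (src e) \<le> 1/2 \<and> z = F (src e) p) \<or> (dist p (tgt e) \<le> 1/2 \<and> z = F (tgt e) p) \<or> p = mid e"
    using Z_cases[OF assms(2)] by blast
  obtain p' where p': "p' \<in> edge e'" "dist z p' \<le> 1/8"
    "(dist p' (src e') \<le> 1/2 \<and> z = F (src e') p') \<or> (dist p' (tgt e') \<le> 1/2 \<and> z = F (tgt e') p') \<or> p' = mid e'"
    using Z_cases[OF assms(3)] by blast
  have "dist p p' \<le> 1/4" using p(2) p'(2) dist_triangle[of p p' z] by (simp add: dist_commute)
  then obtain v where v: "v \<in> {src e, tgt e}" "v \<in> {src e', tgt e'}" "dist p v \<le> 1/4" "dist p' v \<le> 1/4"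
    using close_points_share_vertex[OF assms(1) p(1) p'(1)] by blast
  have z: "z = F v p" "z = F v p'"
    using Z_near_vertex[OF p(1,3) v(1,3)] Z_near_vertex[OF p'(1,3) v(2,4)] by auto
  then have "F v p = F v p'" by metis
  then have "p = p'" by (rule F_inj[rotated 2]) (use v(3,4) in linarith)+
  have *: "x = y" if "x \<in> \<int>" "y \<in> \<int>" "\<bar>x - y\<bar> \<le> 1/4" for x y :: real
  proof -
    obtain k where k: "x = of_int k" using \<open>x \<in> \<int>\<close> by (rule Ints_cases)
    obtain l where l: "y = of_int l" using \<open>y \<in> \<int>\<close> by (rule Ints_cases)
    have "k = l" using that(3) unfolding k l by linarith
    then show ?thesis using k l by simp
  qed
  have "Re p \<in> \<int>" "Im p \<in> \<int>"
    using common_point_integral[OF assms(1) p(1)] p'(1) \<open>p = p'\<close> by auto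
  moreover have "Re v \<in> \<int>" "Im v \<in> \<int>"
    using v(1) unfolding src_def tgt_def pt_def by (cases e; force)+
  moreover have "\<bar>Re p - Re v\<bar> \<le> 1/4" "\<bar>Im p - Im v\<bar> \<le> 1/4"
    using v(3) abs_Re_le_cmod[of "p - v"] abs_Im_le_cmod[of "p - v"] by (auto simp: dist_norm)
  ultimately have "p = v" using * by (simp add: complex_eq_iff)
  then show ?thesis using v z by blast
qed

text \<open>
  On edges where \<open>F\<close> is \<open>f\<close>, or the identity, at both ends, the map itself is prescribed; otherwise
  any arc in \<open>Z e\<close> between the images of the ends will do.
\<close>
lemma edge_map_exists:
  "\<exists>\<epsilon>. continuous_on {0..1} \<epsilon> \<and> inj_on \<epsilon> {0..1} \<and> \<epsilon> ` {0..1} \<subseteq> Z e \<and>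
     \<epsilon> 0 = F (src e) (src e) \<and> \<epsilon> 1 = F (tgt e) (tgt e) \<and>
     (norm (src e) \<le> \<rho> \<and> norm (tgt e) \<le> \<rho> \<longrightarrow> (\<forall>t\<in>{0..1}. \<epsilon> t = f (linepath (src e) (tgt e) t))) \<and>
     ((norm (src e) > \<rho> \<and> norm (tgt e) > \<rho>) \<or> (\<forall>x\<in>edge e. f x = x) \<longrightarrow>
        (\<forall>t\<in>{0..1}. \<epsilon> t = linepath (src e) (tgt e) t))"
proof -
  let ?u = "src e" and ?w = "tgt e" and ?m = "mid e"
  have ne: "?u \<noteq> ?w" using dist_src_tgt[of e] by auto
  have lp: "linepath ?u ?w t \<in> edge e" if "t \<in> {0..1}" for t
    using that unfolding edge_def linepath_image_01[symmetric] by blast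
  have injl: "inj_on (linepath ?u ?w) {0..1}" using ne arc_linepath[of ?u ?w] by (simp add: arc_def)
  have split: "edge e = closed_segment ?u ?m \<union> closed_segment ?m ?w"
    using mid_in[of e] unfolding edge_def by (metis Un_closed_segment)
  consider "norm ?u \<le> \<rho>" "norm ?w \<le> \<rho>" | "(norm ?u > \<rho> \<and> norm ?w > \<rho>) \<or> (\<forall>x\<in>edge e. f x = x)" "\<not> (norm ?u \<le> \<rho> \<and> norm ?w \<le> \<rho>)"
    | "\<not> (norm ?u \<le> \<rho> \<and> norm ?w \<le> \<rho>)" "\<not> ((norm ?u > \<rho> \<and> norm ?w > \<rho>) \<or> (\<forall>x\<in>edge e. f x = x))" by blast
  then show ?thesis
  proof cases
    case 1
    have F: "F ?u = f" "F ?w = f" using 1 by (auto simp: F_def)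
    have sub: "edge e \<subseteq> cball 0 R"
      using near_labelled[OF 1(1)] edge_diam[of _ e ?u] by (auto simp: edge_def)
    show ?thesis
    proof (intro exI[of _ "\<lambda>t. f (linepath ?u ?w t)"] conjI impI ballI)
      show "continuous_on {0..1} (\<lambda>t. f (linepath ?u ?w t))"
        using sub lp by (intro continuous_on_compose2[OF contf] continuous_on_linepath) blast
      have "inj_on f (linepath ?u ?w ` {0..1})" using injf sub lp by (meson image_subsetI inj_on_subset order_trans subsetD)
      then show "inj_on (\<lambda>t. f (linepath ?u ?w t)) {0..1}"
        using comp_inj_on[OF injl] by (simp add: o_def)
      have "f ` edge e \<subseteq> Z e" unfolding split Z_def F by auto
      then show "(\<lambda>t. f (linepath ?u ?w t)) ` {0..1} \<subseteq> Z e" using lp by blast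
      fix t :: real assume "norm ?u > \<rho> \<and> norm ?w > \<rho> \<or> (\<forall>x\<in>edge e. f x = x)" "t \<in> {0..1}"
      then show "f (linepath ?u ?w t) = linepath ?u ?w t" using 1 lp by auto
    qed (auto simp: F linepath_0' linepath_1')
  next
    case 2
    have F: "F v x = x" if "x \<in> edge e" "v \<in> {?u, ?w}" for x v
      using 2 that by (auto simp: F_def)
    have ends: "?u \<in> edge e" "?w \<in> edge e" by (auto simp: edge_def)
    show ?thesis
    proof (intro exI[of _ "linepath ?u ?w"] conjI impI ballI injl continuous_on_linepath)
      show "linepath ?u ?w ` {0..1} \<subseteq> Z e"
      proof
        fix x assume "x \<in> linepath ?u ?w ` {0..1}"
        then have x: "x \<in> edge e" using lp by blast
        then have "F ?u x = x" "F ?w x = x" using F by auto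
        then show "x \<in> Z e" using x unfolding split Z_def by (metis UnCI UnE image_eqI)
      qed
    qed (use 2 F ends in \<open>auto simp: linepath_0' linepath_1'\<close>)
  next
    case 3
    have d: "dist (F ?u ?u) ?u \<le> 1/8" "dist (F ?w ?w) ?w \<le> 1/8" using F_close by auto
    then have neF: "F ?u ?u \<noteq> F ?w ?w"
      using dist_src_tgt[of e] dist_triangle2[of ?u ?w "F ?u ?u"] by (auto simp: dist_commute)
    define P where "P = (F ?u \<circ> linepath ?u ?m) +++ (linepath (F ?u ?m) (F ?w ?m) +++ (F ?w \<circ> linepath ?m ?w))"
    have cu: "closed_segment ?u ?m \<subseteq> cball ?u 1" "closed_segment ?m ?w \<subseteq> cball ?w 1"
      using half_edge[of _ e] by (fastforce simp: dist_commute)+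
    have pu: "path (F ?u \<circ> linepath ?u ?m)" "path (F ?w \<circ> linepath ?m ?w)"
      using cu by (auto intro!: path_continuous_image continuous_on_subset[OF F_cont])
    have "path P" unfolding P_def using pu by (simp add: pathstart_compose pathfinish_compose)
    moreover have "path_image P \<subseteq> Z e" unfolding P_def using pu
      by (simp add: path_image_join pathstart_compose pathfinish_compose path_image_compose Z_def Un_assoc)
    moreover have "pathstart P = F ?u ?u" "pathfinish P = F ?w ?w"
      by (simp_all add: P_def pathstart_compose pathfinish_compose)
    ultimately obtain q where q: "arc q" "path_image q \<subseteq> Z e" "pathstart q = F ?u ?u" "pathfinish q = F ?w ?w"
      using path_contains_arc[OF _ _ _ neF] by (metis order_trans)
    show ?thesis
      using q 3 by (intro exI[of _ q]) (auto simp: arc_def path_def path_image_def pathstart_def pathfinish_def)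
  qed
qed

definition \<epsilon> :: "edge_index \<Rightarrow> real \<Rightarrow> complex" where
  "\<epsilon> e = (SOME \<epsilon>. continuous_on {0..1} \<epsilon> \<and> inj_on \<epsilon> {0..1} \<and> \<epsilon> ` {0..1} \<subseteq> Z e \<and>
     \<epsilon> 0 = F (src e) (src e) \<and> \<epsilon> 1 = F (tgt e) (tgt e) \<and>
     (norm (src e) \<le> \<rho> \<and> norm (tgt e) \<le> \<rho> \<longrightarrow> (\<forall>t\<in>{0..1}. \<epsilon> t = f (linepath (src e) (tgt e) t))) \<and>
     ((norm (src e) > \<rho> \<and> norm (tgt e) > \<rho>) \<or> (\<forall>x\<in>edge e. f x = x) \<longrightarrow>
        (\<forall>t\<in>{0..1}. \<epsilon> t = linepath (src e) (tgt e) t)))"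

lemma \<epsilon>: "continuous_on {0..1} (\<epsilon> e)" "inj_on (\<epsilon> e) {0..1}" "\<epsilon> e ` {0..1} \<subseteq> Z e"
  "\<epsilon> e 0 = F (src e) (src e)" "\<epsilon> e 1 = F (tgt e) (tgt e)"
  "norm (src e) \<le> \<rho> \<Longrightarrow> norm (tgt e) \<le> \<rho> \<Longrightarrow> t \<in> {0..1} \<Longrightarrow> \<epsilon> e t = f (linepath (src e) (tgt e) t)"
  "(norm (src e) > \<rho> \<and> norm (tgt e) > \<rho>) \<or> (\<forall>x\<in>edge e. f x = x) \<Longrightarrow> t \<in> {0..1} \<Longrightarrow> \<epsilon> e t = linepath (src e) (tgt e) t"
proof -
  note * = someI_ex[OF edge_map_exists[of e], folded \<epsilon>_def]
  show "continuous_on {0..1} (\<epsilon> e)" "inj_on (\<epsilon> e) {0..1}" "\<epsilon> e ` {0..1} \<subseteq> Z e"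
    "\<epsilon> e 0 = F (src e) (src e)" "\<epsilon> e 1 = F (tgt e) (tgt e)"
    using * by - (elim conjE, assumption)+
  show "\<epsilon> e t = f (linepath (src e) (tgt e) t)" if "norm (src e) \<le> \<rho>" "norm (tgt e) \<le> \<rho>" "t \<in> {0..1}"
    using * that by (elim conjE) simp
  show "\<epsilon> e t = linepath (src e) (tgt e) t"
    if "(norm (src e) > \<rho> \<and> norm (tgt e) > \<rho>) \<or> (\<forall>x\<in>edge e. f x = x)" "t \<in> {0..1}"
    using *[THEN conjunct2, THEN conjunct2, THEN conjunct2, THEN conjunct2, THEN conjunct2, THEN conjunct2] that by blast
qed

text \<open>
  If both coordinates are integers, the point is a vertex and its horizontal edge is taken; \<open>\<phi>_edge\<close>
  shows that the choice does not matter.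
\<close>
definition \<phi> :: "complex \<Rightarrow> complex" where
  "\<phi> x = (if Im x \<in> \<int> then \<epsilon> (\<lfloor>Re x\<rfloor>, \<lfloor>Im x\<rfloor>, False) (Re x - of_int \<lfloor>Re x\<rfloor>)
          else \<epsilon> (\<lfloor>Re x\<rfloor>, \<lfloor>Im x\<rfloor>, True) (Im x - of_int \<lfloor>Im x\<rfloor>))"

definition param :: "edge_index \<Rightarrow> complex \<Rightarrow> real" where
  "param e x = (case e of (i, j, b) \<Rightarrow> if b then Im x - of_int j else Re x - of_int i)"

lemma param: "x \<in> edge e \<Longrightarrow> param e x \<in> {0..1} \<and> linepath (src e) (tgt e) (param e x) = x"
  by (cases e) (auto simp: param_def in_edge src_def tgt_def pt_def linepath_def complex_eq_iff algebra_simps split: if_splits)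

lemma \<phi>_edge:
  assumes "x \<in> edge e" shows "\<phi> x = \<epsilon> e (param e x)"
proof -
  obtain i j b where e: "e = (i,j,b)" by (cases e)
  show ?thesis
  proof (cases b)
    case False
    have x: "Im x = of_int j" "of_int i \<le> Re x" "Re x \<le> of_int i + 1" using assms False by (auto simp: e in_edge)
    show ?thesis
    proof (cases "Re x = of_int i + 1")
      case True
      then have "\<lfloor>Re x\<rfloor> = i + 1" by simp
      then have "\<phi> x = F (pt (i+1) j) (pt (i+1) j)" using x True \<epsilon>(4)[of "(i+1,j,False)"] by (simp add: \<phi>_def src_def)
      also have "\<dots> = \<epsilon> e 1" using \<epsilon>(5)[of e] False by (simp add: e tgt_def)
      finally show ?thesis using True False by (simp add: e param_def)
    next
      case 1: False
      then have "\<lfloor>Re x\<rfloor> = i" using x by (intro floor_unique) auto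
      then show ?thesis using x False by (simp add: \<phi>_def e param_def)
    qed
  next
    case True
    have x: "Re x = of_int i" "of_int j \<le> Im x" "Im x \<le> of_int j + 1" using assms True by (auto simp: e in_edge)
    show ?thesis
    proof (cases "Im x \<in> \<int>")
      case int: True
      then consider "Im x = of_int j" | "Im x = of_int (j+1)" using Ints_between[OF int x(2,3)] by auto
      then show ?thesis
      proof cases
        case 1
        then have "\<phi> x = F (pt i j) (pt i j)" using x \<epsilon>(4)[of "(i,j,False)"] by (simp add: \<phi>_def src_def)
        then show ?thesis using 1 True \<epsilon>(4)[of e] by (simp add: e param_def src_def)
      next
        case 2
        then have "\<phi> x = F (pt i (j+1)) (pt i (j+1))" using x \<epsilon>(4)[of "(i,j+1,False)"] by (simp add: \<phi>_def src_def)
        then show ?thesis using 2 True \<epsilon>(5)[of e] by (simp add: e param_def tgt_def)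
      qed
    next
      case False
      then have "Im x \<noteq> of_int j + 1" by (metis Ints_1 Ints_add Ints_of_int)
      then have "\<lfloor>Im x\<rfloor> = j" using x by (intro floor_unique) auto
      then show ?thesis using x False True by (simp add: \<phi>_def e param_def)
    qed
  qed
qed

lemma \<phi>_in_Z: "x \<in> edge e \<Longrightarrow> \<phi> x \<in> Z e"
  using \<phi>_edge[of x e] param[of x e] \<epsilon>(3)[of e] by auto

lemma \<phi>_vertex: "v \<in> {src e, tgt e} \<Longrightarrow> \<phi> v = F v v"
proof -
  assume v: "v \<in> {src e, tgt e}"
  obtain i j b where e: "e = (i,j,b)" by (cases e)
  have "src e \<in> edge e" "tgt e \<in> edge e" by (auto simp: edge_def)
  moreover have "param e (src e) = 0" "param e (tgt e) = 1"
    by (auto simp: e param_def src_def tgt_def pt_def)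
  ultimately have "\<phi> (src e) = F (src e) (src e)" "\<phi> (tgt e) = F (tgt e) (tgt e)"
    by (simp_all add: \<phi>_edge[of _ e] \<epsilon>(4,5))
  then show ?thesis using v by blast
qed

lemma \<phi>_cont: "continuous_on grid \<phi>"
  unfolding Union_edge[symmetric]
proof (rule continuous_on_locally_finite_closed)
  fix e
  have "continuous_on (edge e) (param e)"
  proof -
    obtain i j b where e: "e = (i,j,b)" by (cases e)
    show ?thesis by (cases b) (auto simp: param_def[abs_def] e intro!: continuous_intros)
  qed
  then have "continuous_on (edge e) (\<lambda>x. \<epsilon> e (param e x))"
    using param[of _ e] by (intro continuous_on_compose2[OF \<epsilon>(1)]) auto
  then show "continuous_on (edge e) \<phi>" using \<phi>_edge[of _ e] by (metis (no_types, lifting) continuous_on_cong)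
  show "closed (edge e)" for e unfolding edge_def by simp
  show "finite {e. edge e \<inter> ball x 1 \<noteq> {}}" for x by (rule finite_edges_near)
qed

lemma \<phi>_inj: "inj_on \<phi> grid"
proof (rule inj_onI)
  fix x y assume "x \<in> grid" "y \<in> grid" and eq: "\<phi> x = \<phi> y"
  then obtain e e' where e: "x \<in> edge e" "y \<in> edge e'" unfolding Union_edge[symmetric] by blast
  have same: "p = q" if "p \<in> edge e" "q \<in> edge e" "\<phi> p = \<phi> q" for p q e
  proof -
    have "param e p = param e q" using that param \<phi>_edge inj_onD[OF \<epsilon>(2)] by metis
    then show ?thesis using param that by metis
  qed
  show "x = y"
  proof (cases "e = e'")
    case True
    then show ?thesis using same e eq by blast
  next
    case False
    obtain v where v: "v \<in> {src e, tgt e}" "v \<in> {src e', tgt e'}" "\<phi> x = F v v"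
      using Z_Int[OF False \<phi>_in_Z[OF e(1)]] \<phi>_in_Z[OF e(2)] eq by auto
    have "v \<in> edge e" "v \<in> edge e'" using v(1,2) by (auto simp: edge_def)
    then show ?thesis using same[OF e(1)] same[OF e(2)] \<phi>_vertex[OF v(1)] v(3) eq by metis
  qed
qed

lemma \<phi>_disp: "x \<in> grid \<Longrightarrow> dist (\<phi> x) x \<le> 2"
proof -
  assume "x \<in> grid"
  then obtain e where e: "x \<in> edge e" unfolding Union_edge[symmetric] by blast
  obtain p where "p \<in> edge e" "dist (\<phi> x) p \<le> 1/8" using Z_cases[OF \<phi>_in_Z[OF e]] by blast
  then show ?thesis using edge_diam[OF _ e, of p] dist_triangle[of "\<phi> x" x p] by linarith
qed

lemma cell_diam: "x \<in> cell c \<Longrightarrow> y \<in> cell c \<Longrightarrow> dist x y \<le> 2"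
proof -
  assume xy: "x \<in> cell c" "y \<in> cell c"
  have "\<bar>Re (x - y)\<bar> \<le> 1" "\<bar>Im (x - y)\<bar> \<le> 1"
    using xy by (cases c; auto simp: in_cell)+
  then show ?thesis using cmod_le[of "x - y"] by (simp add: dist_norm)
qed

lemma cell_map_exists:
  "\<exists>\<Psi>. continuous_on (cell c) \<Psi> \<and> inj_on \<Psi> (cell c) \<and>
      \<Psi> ` cell_interior c = inside (\<phi> ` frontier (cell c)) \<and> (\<forall>x\<in>frontier (cell c). \<Psi> x = \<phi> x) \<and>
      (cell c \<subseteq> cball 0 \<rho> \<longrightarrow> \<Psi> = f) \<and>
      (cell c \<inter> cball 0 \<rho> = {} \<or> cell c \<subseteq> cball 0 R \<and> (\<forall>x\<in>cell c. f x = x) \<longrightarrow> (\<forall>x\<in>cell c. \<Psi> x = x))"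
proof -
  have bne: "box (pt (fst c) (snd c)) (pt (fst c + 1) (snd c + 1)) \<noteq> {}"
    using cell_interior_nonempty[of c] by (simp add: cell_interior_def)
  have fr: "frontier (cell c) \<subseteq> cell c" using frontier_cell by blast
  have emb: "h ` cell_interior c = inside (\<phi> ` frontier (cell c))"
    if "continuous_on (cell c) h" "inj_on h (cell c)" "\<forall>x\<in>frontier (cell c). h x = \<phi> x" for h
    using embedding_box_inside[OF bne that(1,2)[unfolded cell_def]] that(3)
    by (metis cell_def cell_interior_def image_cong)
  consider "cell c \<subseteq> cball 0 \<rho>"
    | "\<not> cell c \<subseteq> cball 0 \<rho>" "cell c \<inter> cball 0 \<rho> = {} \<or> cell c \<subseteq> cball 0 R \<and> (\<forall>x\<in>cell c. f x = x)"
    | "\<not> cell c \<subseteq> cball 0 \<rho>" "\<not> (cell c \<inter> cball 0 \<rho> = {} \<or> cell c \<subseteq> cball 0 R \<and> (\<forall>x\<in>cell c. f x = x))" by blast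
  then show ?thesis
  proof cases
    case 1
    have sub: "cell c \<subseteq> cball 0 R" using 1 \<rho>R by (auto simp: subset_iff)
    have f: "\<forall>x\<in>frontier (cell c). f x = \<phi> x"
    proof
      fix x assume "x \<in> frontier (cell c)"
      then obtain e where e: "x \<in> edge e" "edge e \<subseteq> cell c" using frontier_cell_edge by blast
      have "src e \<in> edge e" "tgt e \<in> edge e" by (auto simp: edge_def)
      then have "norm (src e) \<le> \<rho>" "norm (tgt e) \<le> \<rho>" using e 1 by auto
      then show "f x = \<phi> x" using \<phi>_edge[OF e(1)] \<epsilon>(6) param[OF e(1)] by metis
    qed
    have "continuous_on (cell c) f" "inj_on f (cell c)"
      using contf injf sub continuous_on_subset inj_on_subset by blast+
    moreover have "cell c \<inter> cball 0 \<rho> \<noteq> {}"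
      using 1 cell_interior_nonempty[of c] box_subset_cbox by (fastforce simp: cell_def cell_interior_def)
    ultimately show ?thesis using f emb[of f] by (intro exI[of _ f]) blast
  next
    case 2
    have id: "\<forall>x\<in>frontier (cell c). x = \<phi> x"
    proof
      fix x assume "x \<in> frontier (cell c)"
      then obtain e where e: "x \<in> edge e" "edge e \<subseteq> cell c" using frontier_cell_edge by blast
      have "src e \<in> edge e" "tgt e \<in> edge e" by (auto simp: edge_def)
      then have "(norm (src e) > \<rho> \<and> norm (tgt e) > \<rho>) \<or> (\<forall>x\<in>edge e. f x = x)" using e 2(2)
        by (auto simp: disjoint_iff subset_iff not_le)
      then show "x = \<phi> x" using \<phi>_edge[OF e(1)] \<epsilon>(7) param[OF e(1)] by metis
    qed
    show ?thesis using id emb[of "\<lambda>x. x"] 2 by (intro exI[of _ "\<lambda>x. x"]) (auto simp: continuous_on_id)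
  next
    case 3
    have "frontier (cbox (pt (fst c) (snd c)) (pt (fst c + 1) (snd c + 1))) \<subseteq> grid"
      using frontier_cell_eq[of c] by (auto simp: cell_def)
    then obtain \<Phi> where "continuous_on (cell c) \<Phi>" "inj_on \<Phi> (cell c)"
      "\<Phi> ` cell_interior c = inside (\<phi> ` frontier (cell c))" "\<And>z. z \<in> frontier (cell c) \<Longrightarrow> \<Phi> z = \<phi> z"
      using Schoenflies_box[OF bne continuous_on_subset[OF \<phi>_cont] inj_on_subset[OF \<phi>_inj]]
      by (metis cell_def cell_interior_def)
    then show ?thesis using 3 by (intro exI[of _ \<Phi>]) auto
  qed
qed

end

text \<open>
  A cell near the origin gets \<open>f\<close>, a cell far away the identity, and a cell in between the
  Schoenflies extension of the map on its boundary. Displacements are bounded by the diameter of the cells.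
\<close>
theorem unit_correction:
  fixes f :: "complex \<Rightarrow> complex"
  assumes "0 \<le> r" "r + 8 \<le> R" and contf: "continuous_on (cball 0 R) f" and injf: "inj_on f (cball 0 R)"
    and close: "\<And>x. x \<in> cball 0 R \<Longrightarrow> dist (f x) x \<le> 1/8"
  obtains g g' where "homeomorphism UNIV UNIV g g'" "\<And>x. x \<in> cball 0 r \<Longrightarrow> g x = f x"
    "\<And>x. x \<notin> ball 0 R \<Longrightarrow> g x = x" "\<And>x. dist (g x) x \<le> 6"
    "\<And>x. (\<And>y. y \<in> ball x 6 \<Longrightarrow> y \<in> cball 0 R \<Longrightarrow> f y = y) \<Longrightarrow> g x = x"
proof -
  define \<rho> where "\<rho> = r + 3"
  interpret near_identity_embedding f \<rho> R
    by unfold_locales (use assms in \<open>auto simp: \<rho>_def\<close>)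
  have "\<exists>\<Psi>. \<forall>c. continuous_on (cell c) (\<Psi> c) \<and> inj_on (\<Psi> c) (cell c) \<and>
      \<Psi> c ` cell_interior c = inside (\<phi> ` frontier (cell c)) \<and> (\<forall>x\<in>frontier (cell c). \<Psi> c x = \<phi> x) \<and>
      (cell c \<subseteq> cball 0 \<rho> \<longrightarrow> \<Psi> c = f) \<and>
      (cell c \<inter> cball 0 \<rho> = {} \<or> cell c \<subseteq> cball 0 R \<and> (\<forall>x\<in>cell c. f x = x) \<longrightarrow> (\<forall>x\<in>cell c. \<Psi> c x = x))"
    by (rule choice) (rule allI, rule cell_map_exists)
  then obtain \<Psi> where all: "\<forall>c. continuous_on (cell c) (\<Psi> c) \<and> inj_on (\<Psi> c) (cell c) \<and>
      \<Psi> c ` cell_interior c = inside (\<phi> ` frontier (cell c)) \<and> (\<forall>x\<in>frontier (cell c). \<Psi> c x = \<phi> x) \<and>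
      (cell c \<subseteq> cball 0 \<rho> \<longrightarrow> \<Psi> c = f) \<and>
      (cell c \<inter> cball 0 \<rho> = {} \<or> cell c \<subseteq> cball 0 R \<and> (\<forall>x\<in>cell c. f x = x) \<longrightarrow> (\<forall>x\<in>cell c. \<Psi> c x = x))"
    by (rule exE)
  note \<Psi> = spec[OF all]
  have \<Psi>f: "\<Psi> c = f" if "cell c \<subseteq> cball 0 \<rho>" for c using \<Psi>[of c] that by (elim conjE) (erule mp)
  have \<Psi>id: "\<Psi> c x = x"
    if "cell c \<inter> cball 0 \<rho> = {} \<or> cell c \<subseteq> cball 0 R \<and> (\<forall>x\<in>cell c. f x = x)" "x \<in> cell c" for c x
  proof -
    have "\<forall>x\<in>cell c. \<Psi> c x = x" using \<Psi>[of c] that(1) by (elim conjE) (erule mp)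
    then show ?thesis using that(2) by blast
  qed
  obtain g g' where g: "homeomorphism UNIV UNIV g g'" "\<And>c x. x \<in> cell c \<Longrightarrow> g x = \<Psi> c x" "\<And>x. dist (g x) x \<le> 2 + 4"
  proof (rule grid_embedding_extends[OF \<phi>_cont \<phi>_inj \<phi>_disp, of \<Psi>])
    fix c
    show "continuous_on (cell c) (\<Psi> c)" "inj_on (\<Psi> c) (cell c)"
      "\<Psi> c ` cell_interior c = inside (\<phi> ` frontier (cell c))"
      using \<Psi>[of c] by - (elim conjE, assumption)+
    show "\<Psi> c x = \<phi> x" if "x \<in> frontier (cell c)" for x
      using \<Psi>[of c] that by (elim conjE) (erule bspec)
  qed (assumption, rule that)
  have gx: "g x = \<Psi> (cell_of x) x" for x using g(2) cell_of_in by blast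
  have near: "norm y \<le> norm x + 2 \<and> norm x \<le> norm y + 2 \<and> dist x y \<le> 2" if "y \<in> cell (cell_of x)" for x y
  proof -
    have "dist x y \<le> 2" using cell_diam[OF cell_of_in that] .
    then show ?thesis
      using norm_triangle_sub[of x y] norm_triangle_sub[of y x] by (auto simp: dist_norm norm_minus_commute)
  qed
  show ?thesis
  proof (rule that[OF g(1)])
    show "g x = f x" if "x \<in> cball 0 r" for x
    proof -
      have "cell (cell_of x) \<subseteq> cball 0 \<rho>" using near[of _ x] that by (fastforce simp: \<rho>_def)
      then show ?thesis using gx \<Psi>f by simp
    qed
    show "g x = x" if "x \<notin> ball 0 R" for x
    proof -
      have "cell (cell_of x) \<inter> cball 0 \<rho> = {}" using near[of _ x] that assms(2) by (fastforce simp: \<rho>_def)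
      then show ?thesis using gx \<Psi>id cell_of_in by metis
    qed
    show "dist (g x) x \<le> 6" for x using g(3)[of x] by simp
    show "g x = x" if f: "\<And>y. y \<in> ball x 6 \<Longrightarrow> y \<in> cball 0 R \<Longrightarrow> f y = y" for x
    proof (cases "cell (cell_of x) \<inter> cball 0 \<rho> = {}")
      case True
      then show ?thesis using gx \<Psi>id cell_of_in by metis
    next
      case False
      then obtain z where z: "z \<in> cell (cell_of x)" "norm z \<le> \<rho>" by auto
      have "cell (cell_of x) \<subseteq> cball 0 R"
      proof
        fix y assume "y \<in> cell (cell_of x)"
        then show "y \<in> cball 0 R" using near[of y x] near[OF z(1)] z(2) assms(2) by (simp add: \<rho>_def)
      qed
      moreover have "f y = y" if "y \<in> cell (cell_of x)" for y
        using f[of y] near[OF that] calculation that by fastforce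
      ultimately show ?thesis using gx \<Psi>id cell_of_in by metis
    qed
  qed
qed

text \<open>
  Rescale so that the mesh of the grid is small compared with \<open>\<eta>\<close> and \<open>R - r\<close>.
\<close>
theorem local_correction:
  fixes r R \<eta> :: real
  assumes "0 \<le> r" "r < R" "0 < \<eta>"
  obtains \<delta> where "0 < \<delta>"
    "\<And>f. continuous_on (cball 0 R) f \<Longrightarrow> inj_on f (cball 0 R) \<Longrightarrow> (\<And>x. x \<in> cball 0 R \<Longrightarrow> dist (f x) x \<le> \<delta>) \<Longrightarrow>
       \<exists>g g'. homeomorphism UNIV UNIV g g' \<and> (\<forall>x\<in>cball 0 r. g x = f x) \<and> (\<forall>x. x \<notin> ball (0::complex) R \<longrightarrow> g x = x) \<and>
         (\<forall>x. dist (g x) x \<le> \<eta>) \<and> (\<forall>x. (\<forall>y\<in>ball x \<eta> \<inter> cball 0 R. f y = y) \<longrightarrow> g x = x)"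
proof -
  \<comment> \<open>\<open>8\<close> and \<open>6\<close> are the margin and the displacement in the correction with mesh 1.\<close>
  define h where "h = min ((R - r) / 8) (\<eta> / 6)"
  have h: "0 < h" "8 * h \<le> R - r" "6 * h \<le> \<eta>" using assms by (auto simp: h_def min_def field_simps)
  show ?thesis
  proof (rule that[of "h / 8"])
    show "0 < h / 8" using h by simp
    fix f :: "complex \<Rightarrow> complex"
    assume f: "continuous_on (cball 0 R) f" "inj_on f (cball 0 R)" "\<And>x. x \<in> cball 0 R \<Longrightarrow> dist (f x) x \<le> h / 8"
    define f1 where "f1 x = f (of_real h * x) / of_real h" for x
    have inR: "of_real h * x \<in> cball 0 R" if "x \<in> cball 0 (R / h)" for x :: complex
      using that h by (simp add: norm_mult field_simps)
    have sc: "dist (of_real h * x) (of_real h * y) = h * dist x y" for x y :: complex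
      using h by (simp add: dist_norm norm_mult flip: right_diff_distrib)
    have f1h: "of_real h * f1 x = f (of_real h * x)" for x using h by (simp add: f1_def)
    obtain g g' where g: "homeomorphism UNIV UNIV g g'" "\<And>x. x \<in> cball 0 (r / h) \<Longrightarrow> g x = f1 x"
      "\<And>x. x \<notin> ball 0 (R / h) \<Longrightarrow> g x = x" "\<And>x. dist (g x) x \<le> 6"
      "\<And>x. (\<And>y. y \<in> ball x 6 \<Longrightarrow> y \<in> cball 0 (R / h) \<Longrightarrow> f1 y = y) \<Longrightarrow> g x = x"
    proof (rule unit_correction[of "r / h" "R / h" f1])
      show "0 \<le> r / h" using assms h by simp
      have "r / h + 8 = (r + 8 * h) / h" using h by (simp add: add_divide_distrib)
      also have "\<dots> \<le> R / h" using h by (intro divide_right_mono) auto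
      finally show "r / h + 8 \<le> R / h" .
      show "continuous_on (cball 0 (R / h)) f1"
        unfolding f1_def using inR h by (intro continuous_intros continuous_on_compose2[OF f(1)]) auto
      show "inj_on f1 (cball 0 (R / h))"
      proof (rule inj_onI)
        fix x y assume xy: "x \<in> cball 0 (R / h)" "y \<in> cball 0 (R / h)" "f1 x = f1 y"
        then have "f (of_real h * x) = f (of_real h * y)" using f1h by metis
        then have "of_real h * x = of_real h * y" using inj_onD[OF f(2)] inR xy by blast
        then show "x = y" using h by simp
      qed
      show "dist (f1 x) x \<le> 1/8" if "x \<in> cball 0 (R / h)" for x
      proof -
        have "h * dist (f1 x) x \<le> h / 8" using f(3)[OF inR[OF that]] sc[of "f1 x" x] f1h by metis
        then show ?thesis using h by simp
      qed
    qed (use that in blast)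
    define G where "G x = of_real h * g (x / of_real h)" for x
    define G' where "G' x = of_real h * g' (x / of_real h)" for x
    have gg: "continuous_on UNIV g" "continuous_on UNIV g'" "\<And>x. g' (g x) = x" "\<And>x. g (g' x) = x"
      using g(1) by (auto simp: homeomorphism_def)
    have "homeomorphism UNIV UNIV G G'"
    proof (rule homeomorphismI)
      show "continuous_on UNIV G" "continuous_on UNIV G'" unfolding G_def G'_def
        using h by (intro continuous_intros continuous_on_compose2[OF gg(1)] continuous_on_compose2[OF gg(2)]; simp)+
    qed (use gg h in \<open>auto simp: G_def G'_def\<close>)
    moreover have "G x = f x" if "x \<in> cball 0 r" for x
    proof -
      have "x / of_real h \<in> cball 0 (r / h)" using that h by (simp add: norm_divide divide_right_mono)
      then show ?thesis using g(2) f1h[of "x / of_real h"] h by (simp add: G_def)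
    qed
    moreover have "G x = x" if "x \<notin> ball 0 R" for x
    proof -
      have "x / of_real h \<notin> ball 0 (R / h)" using that h by (simp add: norm_divide divide_less_cancel)
      then show ?thesis using g(3) h by (simp add: G_def)
    qed
    moreover have "dist (G x) x \<le> \<eta>" for x
    proof -
      have "dist (G x) x = h * dist (g (x / of_real h)) (x / of_real h)"
        using sc[of "g (x / of_real h)" "x / of_real h"] h by (simp add: G_def)
      also have "\<dots> \<le> h * 6" using g(4) h by (intro mult_left_mono) auto
      finally show ?thesis using h by simp
    qed
    moreover have "G x = x" if id: "\<forall>y\<in>ball x \<eta> \<inter> cball 0 R. f y = y" for x
    proof -
      have "g (x / of_real h) = x / of_real h"
      proof (rule g(5))
        fix y assume y: "y \<in> ball (x / of_real h) 6" "y \<in> cball 0 (R / h)"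
        have "dist x (of_real h * y) = h * dist (x / of_real h) y" using sc[of "x / of_real h" y] h by simp
        also have "\<dots> < h * 6" using y h by (intro mult_strict_left_mono) auto
        finally have "of_real h * y \<in> ball x \<eta> \<inter> cball 0 R" using h inR[OF y(2)] by auto
        then have "f (of_real h * y) = of_real h * y" using id by blast
        then show "f1 y = y" using h by (simp add: f1_def)
      qed
      then show ?thesis using h by (simp add: G_def)
    qed
    ultimately show "\<exists>g g'. homeomorphism UNIV UNIV g g' \<and> (\<forall>x\<in>cball 0 r. g x = f x) \<and> (\<forall>x. x \<notin> ball (0::complex) R \<longrightarrow> g x = x) \<and>
         (\<forall>x. dist (g x) x \<le> \<eta>) \<and> (\<forall>x. (\<forall>y\<in>ball x \<eta> \<inter> cball 0 R. f y = y) \<longrightarrow> g x = x)"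
      by blast
  qed
qed

section \<open>Homeomorphisms supported in a chart\<close>
text \<open>
  A chart onto the whole plane. The Hausdorff property makes the images of closed discs closed, so that maps
  supported in a disc extend by the identity.
\<close>
locale hausdorff_chart =
  fixes S :: "'a topology" and U :: "'a set" and \<psi> :: "'a \<Rightarrow> complex" and \<kappa> :: "complex \<Rightarrow> 'a"
  assumes haus: "Hausdorff_space S" and openU: "openin S U"
    and maps: "homeomorphic_maps (subtopology S U) (euclidean :: complex topology) \<psi> \<kappa>"
begin

lemma US: "U \<subseteq> topspace S" using openU openin_subset by blast

lemma cont_\<psi>: "continuous_map (subtopology S U) euclidean \<psi>"
  and cont_\<kappa>U: "continuous_map euclidean (subtopology S U) \<kappa>"
  and \<kappa>\<psi>: "x \<in> U \<Longrightarrow> \<kappa> (\<psi> x) = x" and \<psi>\<kappa>[simp]: "\<psi> (\<kappa> z) = z"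
  using maps US by (auto simp: homeomorphic_maps_def topspace_subtopology)

lemma \<kappa>_in[simp]: "\<kappa> z \<in> U"
  using continuous_map_image_subset_topspace[OF cont_\<kappa>U] by (auto simp: topspace_subtopology)

lemma cont_\<kappa>: "continuous_map euclidean S \<kappa>"
  using cont_\<kappa>U continuous_map_in_subtopology by blast

lemma \<kappa>_inj[simp]: "\<kappa> z = \<kappa> w \<longleftrightarrow> z = w"
  using \<psi>\<kappa> by metis

lemma image_\<kappa>: "\<kappa> ` A = {y \<in> U. \<psi> y \<in> A}"
  using \<kappa>\<psi> by (auto simp: image_iff) metis

lemma open_\<kappa>: "open A \<Longrightarrow> openin S (\<kappa> ` A)"
proof -
  assume "open A"
  then have "openin (subtopology S U) {y \<in> topspace (subtopology S U). \<psi> y \<in> A}"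
    using openin_continuous_map_preimage[OF cont_\<psi>] by simp
  moreover have "{y \<in> topspace (subtopology S U). \<psi> y \<in> A} = \<kappa> ` A"
    using US by (auto simp: image_\<kappa>)
  ultimately show ?thesis using openU openin_trans_full by auto
qed

lemma closed_\<kappa>: "closedin S (\<kappa> ` cball q R)"
  using image_compactin[OF _ cont_\<kappa>, of "cball q R"] compactin_imp_closedin[OF haus] by simp

definition lift :: "(complex \<Rightarrow> complex) \<Rightarrow> 'a \<Rightarrow> 'a" where
  "lift g x = (if x \<in> U then \<kappa> (g (\<psi> x)) else x)"

lemma lift_in: "x \<in> topspace S \<Longrightarrow> lift g x \<in> topspace S"
  using US \<kappa>_in by (auto simp: lift_def)

lemma lift_compose: "lift g (lift g' x) = lift (\<lambda>z. g (g' z)) x"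
  by (simp add: lift_def)

lemma lift_id: "(\<And>z. g z = z) \<Longrightarrow> lift g x = x"
  by (simp add: lift_def \<kappa>\<psi>)

lemma lift_outside: "(\<And>z. z \<notin> A \<Longrightarrow> g z = z) \<Longrightarrow> x \<notin> \<kappa> ` A \<Longrightarrow> lift g x = x"
  by (auto simp: lift_def image_\<kappa> \<kappa>\<psi>)

text \<open>
  Stated for families on an open subset \<open>V\<close>, because the radial homotopy below is only continuous
  away from the centre of a disc.
\<close>
lemma continuous_map_lift:
  assumes V: "openin S V" and contH: "continuous_on (I \<times> {z. \<kappa> z \<in> V}) (\<lambda>(t, z). H t z)"
    and H: "\<And>t z. t \<in> I \<Longrightarrow> \<kappa> z \<in> V \<Longrightarrow> z \<notin> ball q R \<Longrightarrow> H t z = z"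
  shows "continuous_map (prod_topology (top_of_set I) (subtopology S V)) S (\<lambda>(t, x). lift (H t) x)"
proof -
  let ?X = "prod_topology (top_of_set I) (subtopology S V)"
  define T where "T b = I \<times> (if b then V \<inter> U else V - \<kappa> ` cball q R)" for b :: bool
  define f where "f b = (\<lambda>(t, x). if b then \<kappa> (H t (\<psi> x)) else x)" for b
  have VS: "V \<subseteq> topspace S" using V openin_subset by blast
  have oV: "openin (subtopology S V) (V \<inter> U)" "openin (subtopology S V) (V - \<kappa> ` cball q R)"
    using openU closed_\<kappa>[of q R] V by (auto simp: openin_subtopology_alt openin_diff intro: openin_open_subtopology[THEN iffD2])
  show ?thesis
  proof (rule pasting_lemma[of UNIV ?X T S f])
    show "openin ?X (T b)" for b
      using oV by (auto simp: T_def openin_prod_Times_iff)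
    show "continuous_map (subtopology ?X (T b)) S (f b)" for b
    proof (cases b)
      case True
      have eq: "subtopology ?X (T b) = prod_topology (top_of_set I) (subtopology S (V \<inter> U))"
        using True by (simp add: T_def subtopology_Times subtopology_subtopology)
      have c\<psi>: "continuous_map (subtopology S (V \<inter> U)) euclidean \<psi>"
        using continuous_map_from_subtopology_mono[OF cont_\<psi>] by blast
      have "continuous_map (subtopology ?X (T b)) (prod_topology euclidean euclidean) (\<lambda>(t, x). (t, \<psi> x))"
        unfolding eq
        by (subst continuous_map_prod_top) (use c\<psi> continuous_map_from_subtopology in \<open>auto simp: continuous_map_iff_continuous continuous_on_id\<close>)
      then have c1: "continuous_map (subtopology ?X (T b)) (top_of_set (I \<times> {z. \<kappa> z \<in> V})) (\<lambda>(t, x). (t, \<psi> x))"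
        using VS US True by (auto simp: continuous_map_in_subtopology euclidean_product_topology T_def \<kappa>\<psi>)
      have c2: "continuous_map (top_of_set (I \<times> {z. \<kappa> z \<in> V})) euclidean (\<lambda>(t, z). H t z)"
        using contH by simp
      have "continuous_map (subtopology ?X (T b)) S (\<kappa> \<circ> ((\<lambda>(t, z). H t z) \<circ> (\<lambda>(t, x). (t, \<psi> x))))"
        by (rule continuous_map_compose[OF continuous_map_compose[OF c1 c2] cont_\<kappa>])
      moreover have "\<kappa> \<circ> ((\<lambda>(t, z). H t z) \<circ> (\<lambda>(t, x). (t, \<psi> x))) = f b"
        using True by (auto simp: f_def fun_eq_iff)
      ultimately show ?thesis by simp
    next
      case False
      have "continuous_map ?X (subtopology S V) snd" by (rule continuous_map_snd)
      then have "continuous_map (subtopology ?X (T b)) S snd"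
        using continuous_map_from_subtopology continuous_map_in_subtopology by blast
      moreover have "f b = snd" using False by (auto simp: f_def)
      ultimately show ?thesis by simp
    qed
    show "f i x = f j x" if "x \<in> topspace ?X \<inter> T i \<inter> T j" for i j x
    proof -
      obtain t y where x: "x = (t, y)" by fastforce
      have "\<kappa> (H t (\<psi> y)) = y" if "t \<in> I" "y \<in> V" "y \<in> U" "y \<notin> \<kappa> ` cball q R" for t y
      proof -
        have "\<psi> y \<notin> ball q R" using that by (auto simp: image_\<kappa>)
        then have "H t (\<psi> y) = \<psi> y" using H[of t "\<psi> y"] that \<kappa>\<psi> by simp
        then show ?thesis using \<kappa>\<psi> that by simp
      qed
      then show ?thesis using that unfolding x by (auto simp: T_def f_def split: if_splits)
    qed
    show "\<exists>j. j \<in> UNIV \<and> x \<in> T j \<and> (\<lambda>(t, x). lift (H t) x) x = f j x" if x: "x \<in> topspace ?X" for x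
    proof (cases "snd x \<in> U")
      case True
      then show ?thesis using x by (intro exI[of _ True]) (auto simp: T_def f_def lift_def)
    next
      case False
      then have "snd x \<notin> \<kappa> ` cball q R" by (auto simp: image_\<kappa>)
      then show ?thesis using x False by (intro exI[of _ False]) (auto simp: T_def f_def lift_def)
    qed
  qed
qed

lemma homeomorphic_maps_lift:
  assumes "homeomorphism UNIV UNIV g g'" and id: "\<And>z. z \<notin> ball q R \<Longrightarrow> g z = z"
  shows "homeomorphic_maps S S (lift g) (lift g')"
proof -
  have gg: "continuous_on UNIV g" "continuous_on UNIV g'" "\<And>x. g' (g x) = x" "\<And>x. g (g' x) = x"
    using assms(1) by (auto simp: homeomorphism_def)
  have id': "g' z = z" if "z \<notin> ball q R" for z using id[OF that] gg by metis
  have "continuous_map S S (lift k)" if k: "continuous_on UNIV k" "\<And>z. z \<notin> ball q R \<Longrightarrow> k z = z" for k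
  proof -
    have c1: "continuous_map (prod_topology (top_of_set {0::real}) (subtopology S (topspace S))) S (\<lambda>(t, x). lift k x)"
    proof (rule continuous_map_lift[where q = q and R = R])
      show "continuous_on ({0::real} \<times> {z. \<kappa> z \<in> topspace S}) (\<lambda>(t, z). k z)"
        unfolding split_def by (intro continuous_on_compose2[OF k(1)] continuous_intros) auto
    qed (use k in auto)
    have c2: "continuous_map S (prod_topology (top_of_set {0::real}) (subtopology S (topspace S))) (\<lambda>x. (0, x))"
      by (simp add: continuous_map_pairwise o_def)
    have "continuous_map S S ((\<lambda>(t, x). lift k x) \<circ> (\<lambda>x. (0::real, x)))"
      by (rule continuous_map_compose[OF c2 c1])
    then show ?thesis by (simp add: o_def)
  qed
  then show ?thesis
    using gg id id' by (auto simp: homeomorphic_maps_def lift_compose lift_id)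
qed

text \<open>
  The complement of the centre of a disc retracts radially to the complement of the open disc, so the relative homology of
  this pair is trivial, and the exact sequence of the triple gives injectivity.
\<close>
lemma inj_local_homology:
  assumes "0 < \<rho>"
  shows "inj_on (hom_induced p S (topspace S - \<kappa> ` ball q \<rho>) S (topspace S - {\<kappa> q}) id)
           (carrier (relative_homology_group p S (topspace S - \<kappa> ` ball q \<rho>)))"
proof -
  define V where "V = topspace S - {\<kappa> q}"
  define T where "T = topspace S - \<kappa> ` ball q \<rho>"
  have TV: "T \<subseteq> V" using \<open>0 < \<rho>\<close> by (auto simp: T_def V_def)
  have oV: "openin S V"
    unfolding V_def using haus by (intro openin_diff closedin_Hausdorff_singleton) (use US \<kappa>_in in auto)
  have \<kappa>V: "{z. \<kappa> z \<in> V} = - {q}" using US \<kappa>_in by (auto simp: V_def)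
  \<comment> \<open>Points at distance less than \<open>t\<rho>\<close> from \<open>q\<close> are pushed radially to that distance.\<close>
  define H where "H t z = q + of_real (max (norm (z - q)) (t * \<rho>) / norm (z - q)) * (z - q)" for t z
  have Hid: "H t z = z" if "t \<in> {0..1}" "z \<notin> ball q \<rho>" for t z
  proof -
    have "t * \<rho> \<le> 1 * \<rho>" using that \<open>0 < \<rho>\<close> by (intro mult_right_mono) auto
    moreover have n: "\<rho> \<le> norm (z - q)" using that by (simp add: dist_norm norm_minus_commute)
    ultimately have "max (norm (z - q)) (t * \<rho>) = norm (z - q)" by (intro max_absorb1) simp
    moreover have "norm (z - q) \<noteq> 0" using n \<open>0 < \<rho>\<close> by linarith
    ultimately show ?thesis by (simp add: H_def)
  qed
  have Hne: "H t z \<noteq> q" if "z \<noteq> q" for t z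
    using that by (auto simp: H_def max_def)
  have H0: "H 0 z = z" for z by (simp add: H_def)
  have H1: "H 1 z \<notin> ball q \<rho>" if "z \<noteq> q" for z
  proof -
    have "norm (H 1 z - q) = max (norm (z - q)) \<rho>"
    proof -
      have "0 \<le> max (norm (z - q)) \<rho>" by (simp add: le_max_iff_disj)
      then show ?thesis using that by (simp add: H_def norm_mult norm_divide)
    qed
    then show ?thesis by (simp add: dist_norm norm_minus_commute)
  qed
  have contH: "continuous_on ({0..1} \<times> {z. \<kappa> z \<in> V}) (\<lambda>(t, z). H t z)"
    unfolding \<kappa>V H_def split_def by (intro continuous_intros) auto
  have cont: "continuous_map (prod_topology (top_of_set {0..1}) (subtopology S V)) S (\<lambda>(t, x). lift (H t) x)"
    by (rule continuous_map_lift[OF oV contH]) (use Hid in auto)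
  have inV: "lift (H t) x \<in> V" if "x \<in> V" for t x
  proof -
    have "x \<in> U \<Longrightarrow> \<psi> x \<noteq> q" using that \<kappa>\<psi>[of x] by (auto simp: V_def)
    then have "lift (H t) x \<noteq> \<kappa> q" using that Hne[of "\<psi> x" t] by (auto simp: V_def lift_def)
    then show ?thesis using that lift_in[of x "H t"] by (auto simp: V_def)
  qed
  have inT: "lift (H 1) x \<in> T" if "x \<in> V" for x
  proof -
    have "x \<in> U \<Longrightarrow> \<psi> x \<noteq> q" using that \<kappa>\<psi>[of x] by (auto simp: V_def)
    then show ?thesis using that H1[of "\<psi> x"] lift_in[of x "H 1"] by (auto simp: T_def V_def lift_def image_\<kappa>)
  qed
  have fixT: "lift (H t) x = x" if "x \<in> T" "t \<in> {0..1}" for t x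
    using that lift_outside[of "ball q \<rho>" "H t" x] Hid by (auto simp: T_def)
  have contV: "continuous_map (prod_topology (top_of_set {0..1}) (subtopology S V)) (subtopology S V) (\<lambda>(t, x). lift (H t) x)"
    using cont inV by (auto simp: continuous_map_in_subtopology)
  have hom: "homotopic_with (\<lambda>_. True) (subtopology S V) (subtopology S V) (lift (H 0)) (lift (H 1))"
    unfolding homotopic_with_def using contV by (intro exI[of _ "\<lambda>(t, x). lift (H t) x"]) auto
  have "lift (H 0) = id" using H0 lift_id by (auto simp: fun_eq_iff)
  then have hom': "homotopic_with (\<lambda>_. True) (subtopology S V) (subtopology S V) (lift (H 1)) id"
    using hom homotopic_with_symD by metis
  have c1: "continuous_map (subtopology S V) (subtopology S V) (lift (H 1))"
    using homotopic_with_imp_continuous_maps[OF hom] by blast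
  have "trivial_group (relative_homology_group p (subtopology S V) T)"
  proof (rule trivial_relative_homology_group_gen[of _ _ "lift (H 1)"])
    show "continuous_map (subtopology S V) (subtopology (subtopology S V) T) (lift (H 1))"
      using c1 inT by (auto simp: continuous_map_in_subtopology)
    show "homotopic_with (\<lambda>k. True) (subtopology S V) (subtopology S V) (lift (H 1)) id" by (rule hom')
    show "homotopic_with (\<lambda>h. True) (subtopology (subtopology S V) T) (subtopology (subtopology S V) T) (lift (H 1)) id"
    proof (rule homotopic_with_equal)
      show "continuous_map (subtopology (subtopology S V) T) (subtopology (subtopology S V) T) (lift (H 1))"
        using c1 inT by (auto simp: continuous_map_in_subtopology intro: continuous_map_from_subtopology)
      show "lift (H 1) x = id x" if "x \<in> topspace (subtopology (subtopology S V) T)" for x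
        using that fixT by simp
    qed auto
  qed
  moreover have ex: "exact_seq ([relative_homology_group p S V, relative_homology_group p S T,
       relative_homology_group p (subtopology S V) T],
     [hom_induced p S T S V id, hom_induced p (subtopology S V) T S T id])"
    by (rule homology_exactness_triple_3[OF TV])
  ultimately have ker: "kernel (relative_homology_group p S T) (relative_homology_group p S V) (hom_induced p S T S V id)
      = {\<one>\<^bsub>relative_homology_group p S T\<^esub>}"
  proof -
    have "hom_induced p (subtopology S V) T S T id ` carrier (relative_homology_group p (subtopology S V) T)
      = kernel (relative_homology_group p S T) (relative_homology_group p S V) (hom_induced p S T S V id)"
      using ex by simp
    moreover have "carrier (relative_homology_group p (subtopology S V) T) = {\<one>\<^bsub>relative_homology_group p (subtopology S V) T\<^esub>}"
      using \<open>trivial_group _\<close> by (auto simp: trivial_group_def)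
    moreover have "hom_induced p (subtopology S V) T S T id \<one>\<^bsub>relative_homology_group p (subtopology S V) T\<^esub> = \<one>\<^bsub>relative_homology_group p S T\<^esub>"
      by (rule hom_one[OF hom_induced_hom]) auto
    ultimately show ?thesis by simp
  qed
  interpret gh: group_hom "relative_homology_group p S T" "relative_homology_group p S V" "hom_induced p S T S V id"
    by (simp add: group_hom_def group_hom_axioms_def hom_induced_hom)
  show ?thesis using gh.inj_iff_trivial_ker ker by (simp add: T_def V_def)
qed

end

text \<open>
  Alexander's trick: \<open>A t z = t g (z / t)\<close>. Its distance from the identity is at most \<open>t B\<close>,
  which gives continuity at \<open>t = 0\<close>.
\<close>
lemma Alexander_isotopy:
  fixes g :: "complex \<Rightarrow> complex"
  assumes g: "homeomorphism UNIV UNIV g g'" and id: "\<And>z. z \<notin> ball 0 R \<Longrightarrow> g z = z"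
    and disp: "\<And>z. dist (g z) z \<le> B"
  obtains A A' where "continuous_on ({0..1} \<times> UNIV) (\<lambda>(t, z). A t z)" "\<And>z. A 0 z = z" "A 1 = g"
    "\<And>t::real. t \<in> {0..1} \<Longrightarrow> homeomorphism UNIV UNIV (A t) (A' t)"
    "\<And>t z. t \<in> {0..1} \<Longrightarrow> z \<notin> ball 0 R \<Longrightarrow> A t z = z"
proof -
  define Q where "Q k t z = (if t \<le> 0 then z else of_real t * k (z / of_real t))" for k :: "complex \<Rightarrow> complex" and t :: real and z
  have gg: "continuous_on UNIV g" "continuous_on UNIV g'" "\<And>x. g' (g x) = x" "\<And>x. g (g' x) = x"
    using g by (auto simp: homeomorphism_def)
  have B0: "0 \<le> B" using disp[of 0] zero_le_dist order_trans by blast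
  have d: "dist (Q g t z) z \<le> t * B" if "0 \<le> t" for t z
  proof (cases "t = 0")
    case False
    then have t: "0 < t" using that by simp
    have "Q g t z - z = of_real t * (g (z / of_real t) - z / of_real t)"
      using t by (simp add: Q_def right_diff_distrib)
    then have "dist (Q g t z) z = t * dist (g (z / of_real t)) (z / of_real t)"
      using t by (simp add: dist_norm norm_mult)
    then show ?thesis using disp t by (simp add: mult_left_mono)
  qed (simp add: Q_def)
  have "continuous_on ({0..1} \<times> UNIV) (\<lambda>(t, z). Q g t z)"
    unfolding continuous_on_eq_continuous_within
  proof clarify
    fix t :: real and z :: complex assume t: "t \<in> {0..1}"
    show "continuous (at (t, z) within {0..1} \<times> UNIV) (\<lambda>(t, z). Q g t z)"
    proof (cases "t = 0")
      case True
      let ?F = "at (0, z) within {0..1} \<times> (UNIV :: complex set)"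
      have ev: "eventually (\<lambda>x. norm (Q g (fst x) (snd x) - z) \<le> fst x * B + norm (snd x - z)) ?F"
      proof (rule eventually_at_topological[THEN iffD2], intro exI[of _ UNIV] conjI ballI impI)
        fix x :: "real \<times> complex" assume "x \<in> {0..1} \<times> UNIV"
        then have "dist (Q g (fst x) (snd x)) (snd x) \<le> fst x * B" by (intro d) auto
        then show "norm (Q g (fst x) (snd x) - z) \<le> fst x * B + norm (snd x - z)"
          using norm_triangle_ineq[of "Q g (fst x) (snd x) - snd x" "snd x - z"] by (simp add: dist_norm)
      qed auto
      have "((\<lambda>x. fst x * B + norm (snd x - z)) \<longlongrightarrow> 0 * B + norm (z - z)) ?F"
        by (intro tendsto_intros tendsto_fst[of _ "(0, z)", simplified] tendsto_snd[of _ "(0, z)", simplified] tendsto_ident_at)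
      then have "((\<lambda>x. Q g (fst x) (snd x) - z) \<longlongrightarrow> 0) ?F"
        by (intro Lim_null_comparison[OF ev]) simp
      then have "((\<lambda>x. Q g (fst x) (snd x)) \<longlongrightarrow> z) ?F" by (rule Lim_null[THEN iffD2])
      then show ?thesis using True by (simp add: continuous_within split_def Q_def)
    next
      case False
      then have "0 < t" using t by simp
      have "continuous_on ({0<..} \<times> UNIV) (\<lambda>x. of_real (fst x) * g (snd x / of_real (fst x)))"
        by (intro continuous_intros continuous_on_compose2[OF gg(1)]) auto
      then have "continuous_on ({0<..} \<times> UNIV) (\<lambda>(t, z). Q g t z)"
        by (rule continuous_on_eq) (auto simp: Q_def)
      then have "isCont (\<lambda>(t, z). Q g t z) (t, z)"
        using \<open>0 < t\<close> by (auto simp: continuous_on_eq_continuous_at open_Times)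
      then show ?thesis by (rule continuous_at_imp_continuous_at_within)
    qed
  qed
  moreover have "homeomorphism UNIV UNIV (Q g t) (Q g' t)" if t: "t \<in> {0..1}" for t
  proof (cases "t = 0")
    case True
    then have "Q g t = (\<lambda>z. z)" "Q g' t = (\<lambda>z. z)" by (auto simp: Q_def)
    then show ?thesis by (simp add: homeomorphism_ident)
  next
    case False
    then have t: "0 < t" using t by simp
    then have "Q g t = (\<lambda>z. of_real t * g (z / of_real t))" "Q g' t = (\<lambda>z. of_real t * g' (z / of_real t))"
      by (auto simp: Q_def)
    moreover have "homeomorphism UNIV UNIV (\<lambda>z. of_real t * g (z / of_real t)) (\<lambda>z. of_real t * g' (z / of_real t))"
    proof (rule homeomorphismI)
      show "continuous_on UNIV (\<lambda>z. of_real t * g (z / of_real t))" "continuous_on UNIV (\<lambda>z. of_real t * g' (z / of_real t))"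
        using t by (intro continuous_intros continuous_on_compose2[OF gg(1)] continuous_on_compose2[OF gg(2)]; simp)+
    qed (use gg t in auto)
    ultimately show ?thesis by simp
  qed
  moreover have "Q g t z = z" if "t \<in> {0..1}" "z \<notin> ball 0 R" for t z
  proof (cases "t = 0")
    case False
    then have t: "0 < t" "t \<le> 1" using that by auto
    have "norm z \<le> norm z / t" using t by (simp add: pos_le_divide_eq mult_left_le)
    then have "z / of_real t \<notin> ball 0 R" using that t by (simp add: norm_divide)
    then show ?thesis using id t by (simp add: Q_def)
  qed (simp add: Q_def)
  moreover have "Q g 0 z = z" "Q g 1 = g" for z by (auto simp: Q_def)
  ultimately show ?thesis by (rule_tac that[of "Q g" "Q g'"])
qed

section \<open>Orientations\<close>
lemma surface_chart:
  assumes S: "surface S" and "x \<in> topspace S"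
  obtains U \<psi> \<kappa> where "hausdorff_chart S U \<psi> \<kappa>" "x \<in> U"
proof -
  obtain U where U: "openin S U" "x \<in> U" "subtopology S U homeomorphic_space (euclidean :: (real^2) topology)"
    using assms unfolding surface_def by blast
  obtain a b where ab: "homeomorphic_maps (subtopology S U) (euclidean :: (real^2) topology) a b"
    using U(3) by (auto simp: homeomorphic_space_def)
  define T :: "real^2 \<Rightarrow> complex" where "T v = Complex (v $ 1) (v $ 2)" for v
  define T' :: "complex \<Rightarrow> real^2" where "T' z = Re z *\<^sub>R axis 1 1 + Im z *\<^sub>R axis 2 1" for z
  have "continuous_on UNIV T" unfolding T_def Complex_eq by (intro continuous_intros)
  moreover have "continuous_on UNIV T'" unfolding T'_def by (intro continuous_intros)
  moreover have "T (T' z) = z" for z by (simp add: T_def T'_def axis_def)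
  moreover have "T' (T v) = v" for v by (simp add: T_def T'_def vec_eq_iff forall_2 axis_def)
  ultimately have "homeomorphic_maps (euclidean :: (real^2) topology) (euclidean :: complex topology) T T'"
    by (simp add: homeomorphic_maps_def)
  then have "homeomorphic_maps (subtopology S U) (euclidean :: complex topology) (T \<circ> a) (b \<circ> T')"
    using homeomorphic_maps_compose[OF conjI[OF ab]] by blast
  moreover have "Hausdorff_space S" using S by (simp add: surface_def)
  ultimately show ?thesis using that U by (auto simp: hausdorff_chart_def)
qed

definition orientation_preserving_at :: "'a topology \<Rightarrow> ('a \<Rightarrow> 'a chain set) \<Rightarrow> ('a \<Rightarrow> 'a) \<Rightarrow> 'a \<Rightarrow> bool" where
  "orientation_preserving_at S \<mu> k x \<longleftrightarrow>
     hom_induced 2 S (topspace S - {x}) S (topspace S - {k x}) k (\<mu> x) = \<mu> (k x)"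

text \<open>
  On a small disc both the orientation and its image come from classes relative to the complement of the disc;
  restriction to the centre is injective on these, so the classes agree everywhere if they agree at one point.
\<close>
lemma orientation_preserving_locally_constant:
  assumes S: "surface S" and \<mu>: "orientation S \<mu>" and k: "homeomorphic_map S S k" and x0: "x0 \<in> topspace S"
  shows "\<exists>O'. openin S O' \<and> x0 \<in> O' \<and> (\<forall>x\<in>O'. orientation_preserving_at S \<mu> k x \<longleftrightarrow> orientation_preserving_at S \<mu> k x0)"
proof -
  have ck: "continuous_map S S k" and injk: "inj_on k (topspace S)" and imk: "k ` topspace S = topspace S"
    using k by (auto simp: homeomorphic_eq_everything_map)
  have kx0: "k x0 \<in> topspace S" using imk x0 by blast
  have loc: "\<exists>V c. openin S V \<and> x \<in> V \<and> c \<in> carrier (relative_homology_group 2 S (topspace S - V)) \<and>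
      (\<forall>y\<in>V. hom_induced 2 S (topspace S - V) S (topspace S - {y}) id c = \<mu> y)" if "x \<in> topspace S" for x
    using \<mu> that unfolding orientation_def by blast
  obtain N cN where N: "openin S N" "x0 \<in> N" "cN \<in> carrier (relative_homology_group 2 S (topspace S - N))"
    "\<And>y. y \<in> N \<Longrightarrow> hom_induced 2 S (topspace S - N) S (topspace S - {y}) id cN = \<mu> y"
    using loc[OF x0] by blast
  obtain V cV where V: "openin S V" "k x0 \<in> V" "cV \<in> carrier (relative_homology_group 2 S (topspace S - V))"
    "\<And>y. y \<in> V \<Longrightarrow> hom_induced 2 S (topspace S - V) S (topspace S - {y}) id cV = \<mu> y"
    using loc[OF kx0] by blast
  obtain U \<psi> \<kappa> where "hausdorff_chart S U \<psi> \<kappa>" "k x0 \<in> U" using surface_chart[OF S kx0] by blast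
  then interpret hausdorff_chart S U \<psi> \<kappa> by simp
  have okN: "openin S (k ` N)"
    using k N(1) homeomorphic_imp_open_map open_map_def by blast
  define q0 where "q0 = \<psi> (k x0)"
  have "openin euclidean {z \<in> topspace euclidean. \<kappa> z \<in> V \<inter> k ` N}"
    by (rule openin_continuous_map_preimage[OF cont_\<kappa>]) (use V okN in auto)
  then have "open {z. \<kappa> z \<in> V \<inter> k ` N}" by simp
  moreover have "q0 \<in> {z. \<kappa> z \<in> V \<inter> k ` N}" using \<kappa>\<psi> \<open>k x0 \<in> U\<close> V N by (auto simp: q0_def)
  ultimately obtain r where r: "0 < r" "ball q0 r \<subseteq> {z. \<kappa> z \<in> V \<inter> k ` N}" using openE by blast
  define \<rho> where "\<rho> = r / 2"
  define O' where "O' = {x \<in> topspace S. k x \<in> \<kappa> ` ball q0 \<rho>} \<inter> N"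
  have "openin S O'" unfolding O'_def
    using open_\<kappa>[of "ball q0 \<rho>"] N(1) by (intro openin_Int openin_continuous_map_preimage[OF ck]) auto
  moreover have "x0 \<in> O'"
    using x0 N(2) \<kappa>\<psi>[OF \<open>k x0 \<in> U\<close>] r by (auto simp: O'_def q0_def \<rho>_def image_iff intro!: bexI[of _ "\<psi> (k x0)"])
  moreover have transfer: "orientation_preserving_at S \<mu> k x2"
    if x: "x1 \<in> N" "x2 \<in> N" "k x1 = \<kappa> q1" "k x2 = \<kappa> q2" "dist q0 q1 < \<rho>" "dist q1 q2 < \<rho>"
      and at1: "orientation_preserving_at S \<mu> k x1" for x1 x2 q1 q2
  proof -
    define W where "W = \<kappa> ` ball q1 \<rho>"
    have sub: "ball q1 \<rho> \<subseteq> ball q0 r"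
    proof
      fix z assume "z \<in> ball q1 \<rho>"
      then show "z \<in> ball q0 r" using x(5) dist_triangle[of q0 z q1] by (simp add: \<rho>_def)
    qed
    have W: "W \<subseteq> V" "W \<subseteq> k ` N" "k x1 \<in> W" "k x2 \<in> W"
      using sub r x by (auto simp: W_def \<rho>_def)
    have NS: "N \<subseteq> topspace S" using N(1) openin_subset by blast
    have kW: "k \<in> (topspace S - N) \<rightarrow> (topspace S - W)"
    proof
      fix z assume z: "z \<in> topspace S - N"
      then have "k z \<in> topspace S" using imk by blast
      moreover have "k z \<notin> k ` N" using z NS injk inj_on_image_mem_iff[OF injk _ NS] by blast
      ultimately show "k z \<in> topspace S - W" using W by blast
    qed
    define \<alpha> where "\<alpha> = hom_induced 2 S (topspace S - N) S (topspace S - W) k cN"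
    define \<beta> where "\<beta> = hom_induced 2 S (topspace S - V) S (topspace S - W) id cV"
    have \<alpha>: "hom_induced 2 S (topspace S - W) S (topspace S - {k x}) id \<alpha>
        = hom_induced 2 S (topspace S - {x}) S (topspace S - {k x}) k (\<mu> x)" if "x \<in> N" "k x \<in> W" for x
    proof -
      have kx: "k \<in> (topspace S - {x}) \<rightarrow> (topspace S - {k x})"
        using injk imk that NS by (auto simp: inj_on_def)
      have "hom_induced 2 S (topspace S - W) S (topspace S - {k x}) id \<alpha> = hom_induced 2 S (topspace S - N) S (topspace S - {k x}) (id \<circ> k) cN"
        unfolding \<alpha>_def by (rule hom_induced_compose') (use ck kW that in auto)
      also have "\<dots> = hom_induced 2 S (topspace S - N) S (topspace S - {k x}) (k \<circ> id) cN" by simp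
      also have "\<dots> = hom_induced 2 S (topspace S - {x}) S (topspace S - {k x}) k (hom_induced 2 S (topspace S - N) S (topspace S - {x}) id cN)"
        by (rule hom_induced_compose'[symmetric]) (use ck kx that in auto)
      finally show ?thesis using N(4)[OF that(1)] by simp
    qed
    have \<beta>: "hom_induced 2 S (topspace S - W) S (topspace S - {y}) id \<beta> = \<mu> y" if "y \<in> W" for y
    proof -
      have "hom_induced 2 S (topspace S - W) S (topspace S - {y}) id \<beta> = hom_induced 2 S (topspace S - V) S (topspace S - {y}) (id \<circ> id) cV"
        unfolding \<beta>_def by (rule hom_induced_compose') (use W that in auto)
      then show ?thesis using V(4) W that by auto
    qed
    have "\<alpha> = \<beta>"
    proof (rule inj_onD[OF inj_local_homology[of \<rho> 2 q1]])
      show "0 < \<rho>" using r by (simp add: \<rho>_def)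
      show "\<alpha> \<in> carrier (relative_homology_group 2 S (topspace S - \<kappa> ` ball q1 \<rho>))"
        "\<beta> \<in> carrier (relative_homology_group 2 S (topspace S - \<kappa> ` ball q1 \<rho>))"
        by (simp_all add: \<alpha>_def \<beta>_def W_def hom_induced_carrier)
      show "hom_induced 2 S (topspace S - \<kappa> ` ball q1 \<rho>) S (topspace S - {\<kappa> q1}) id \<alpha> =
            hom_induced 2 S (topspace S - \<kappa> ` ball q1 \<rho>) S (topspace S - {\<kappa> q1}) id \<beta>"
        using \<alpha>[OF x(1) W(3)] \<beta>[OF W(3)] at1 x(3) by (simp add: orientation_preserving_at_def W_def)
    qed
    then show ?thesis using \<alpha>[OF x(2) W(4)] \<beta>[OF W(4)] by (simp add: orientation_preserving_at_def)
  qed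
  moreover have "orientation_preserving_at S \<mu> k x \<longleftrightarrow> orientation_preserving_at S \<mu> k x0" if "x \<in> O'" for x
  proof -
    obtain q where q: "k x = \<kappa> q" "dist q0 q < \<rho>" "x \<in> N" using \<open>x \<in> O'\<close> by (auto simp: O'_def)
    have k0: "k x0 = \<kappa> q0" using \<kappa>\<psi>[OF \<open>k x0 \<in> U\<close>] by (simp add: q0_def)
    have \<rho>: "0 < \<rho>" using r by (simp add: \<rho>_def)
    show ?thesis
      using transfer[OF q(3) N(2) q(1) k0 q(2)] transfer[OF N(2) q(3) k0 q(1)] q(2) \<rho> by (auto simp: dist_commute)
  qed
  ultimately show ?thesis by blast
qed

text \<open>
  The set of points where an orientation is preserved is open and closed.
\<close>
lemma orientation_preserving_if_at_point:
  assumes S: "surface S" "connected_space S" and k: "homeomorphic_map S S k" and x0: "x0 \<in> topspace S"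
    and at: "\<And>\<mu>. orientation S \<mu> \<Longrightarrow> orientation_preserving_at S \<mu> k x0"
  shows "orientation_preserving S k"
proof -
  have "orientation_preserving_at S \<mu> k x" if \<mu>: "orientation S \<mu>" and x: "x \<in> topspace S" for \<mu> x
  proof (rule ccontr)
    assume no: "\<not> orientation_preserving_at S \<mu> k x"
    define P where "P b = {x \<in> topspace S. orientation_preserving_at S \<mu> k x = b}" for b
    have "openin S (P b)" for b
    proof (subst openin_subopen, intro ballI)
      fix y assume y: "y \<in> P b"
      then have "y \<in> topspace S" by (simp add: P_def)
      from orientation_preserving_locally_constant[OF S(1) \<mu> k this] obtain O'
        where O': "openin S O'" "y \<in> O'" "\<forall>z\<in>O'. orientation_preserving_at S \<mu> k z \<longleftrightarrow> orientation_preserving_at S \<mu> k y" by blast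
      have "O' \<subseteq> P b"
      proof
        fix z assume z: "z \<in> O'"
        have "z \<in> topspace S" using openin_subset[OF O'(1)] z by (rule subsetD)
        moreover have "orientation_preserving_at S \<mu> k z = b" using bspec[OF O'(3) z] y by (simp add: P_def)
        ultimately show "z \<in> P b" by (simp add: P_def)
      qed
      then show "\<exists>T. openin S T \<and> y \<in> T \<and> T \<subseteq> P b" using O' by blast
    qed
    moreover have "x0 \<in> P True" "x \<in> P False" using at[OF \<mu>] x0 x no by (auto simp: P_def)
    moreover have "topspace S \<subseteq> P True \<union> P False" "P True \<inter> P False = {}" unfolding P_def by blast+
    ultimately show False using S(2) unfolding connected_space_def by (metis empty_iff)
  qed
  then show ?thesis by (auto simp: orientation_preserving_def orientation_preserving_at_def)
qed

context hausdorff_chart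
begin

lemma lift_isotopy:
  assumes g: "homeomorphism UNIV UNIV g g'" and id: "\<And>z. z \<notin> ball 0 R \<Longrightarrow> g z = z"
    and disp: "\<And>z. dist (g z) z \<le> B"
  shows "homotopic_with (\<lambda>h. homeomorphic_map S S h \<and> (\<forall>x. x \<notin> \<kappa> ` ball 0 R \<longrightarrow> h x = x)) S S id (lift g)"
proof -
  obtain A A' where A: "continuous_on ({0..1} \<times> UNIV) (\<lambda>(t, z). A t z)" "\<And>z. A 0 z = z" "A 1 = g"
    "\<And>t::real. t \<in> {0..1} \<Longrightarrow> homeomorphism UNIV UNIV (A t) (A' t)"
    "\<And>t z. t \<in> {0..1} \<Longrightarrow> z \<notin> ball 0 R \<Longrightarrow> A t z = z"
    using Alexander_isotopy[OF assms] by blast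
  have "continuous_map (prod_topology (top_of_set {0..1}) (subtopology S (topspace S))) S (\<lambda>(t, x). lift (A t) x)"
    by (rule continuous_map_lift[where q = 0 and R = R]) (use A in \<open>auto intro: continuous_on_subset\<close>)
  moreover have "lift (A 0) = id" using A(2) lift_id by (auto simp: fun_eq_iff)
  moreover have "homeomorphic_map S S (lift (A t))" if "t \<in> {0..1}" for t
    using homeomorphic_maps_lift[OF A(4)[OF that], of 0 R] A(5)[OF that] homeomorphic_maps_map by blast
  moreover have "lift (A t) x = x" if "t \<in> {0..1}" "x \<notin> \<kappa> ` ball 0 R" for t x
    using lift_outside[of "ball 0 R" "A t" x] A(5) that by blast
  ultimately show ?thesis
    unfolding homotopic_with_def using A(3) by (intro exI[of _ "\<lambda>(t, x). lift (A t) x"]) auto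
qed

text \<open>
  By connectedness one point suffices. A point on the boundary of the supporting disc stays fixed during the isotopy
  to the identity, so the map induced on its local homology is the identity.
\<close>
lemma lift_orientation_preserving:
  assumes S: "surface S" "connected_space S"
    and g: "homeomorphism UNIV UNIV g g'" and id: "\<And>z. z \<notin> ball 0 R \<Longrightarrow> g z = z"
    and disp: "\<And>z. dist (g z) z \<le> B"
  shows "orientation_preserving S (lift g)"
proof -
  note hom = lift_isotopy[OF g id disp]
  define x0 where "x0 = \<kappa> (of_real \<bar>R\<bar>)"
  have x0: "x0 \<in> topspace S" "x0 \<notin> \<kappa> ` ball 0 R" using US by (auto simp: x0_def)
  have maps: "homeomorphic_map S S (lift g)" "lift g x0 = x0"
    using homotopic_with_imp_property[OF hom] x0 by auto
  have "homotopic_with (\<lambda>h. h \<in> (topspace S - {x0}) \<rightarrow> (topspace S - {x0})) S S id (lift g)"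
  proof (rule homotopic_with_mono[OF hom])
    fix h assume h: "homeomorphic_map S S h \<and> (\<forall>x. x \<notin> \<kappa> ` ball 0 R \<longrightarrow> h x = x)"
    then have "h x0 = x0" "inj_on h (topspace S)" "h ` topspace S = topspace S"
      using x0 by (auto simp: homeomorphic_eq_everything_map)
    then show "h \<in> (topspace S - {x0}) \<rightarrow> (topspace S - {x0})" using x0(1) by (auto simp: inj_on_def)
  qed
  then have eq: "hom_induced 2 S (topspace S - {x0}) S (topspace S - {x0}) id = hom_induced 2 S (topspace S - {x0}) S (topspace S - {x0}) (lift g)"
    by (rule homology_homotopy_axiom)
  show ?thesis
  proof (rule orientation_preserving_if_at_point[OF S maps(1) x0(1)])
    fix \<mu> assume "orientation S \<mu>"
    then have "\<mu> x0 \<in> carrier (relative_homology_group 2 S (topspace S - {x0}))"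
      using x0 by (auto simp: orientation_def)
    then show "orientation_preserving_at S \<mu> (lift g) x0"
      unfolding orientation_preserving_at_def maps(2) eq[symmetric] by (rule hom_induced_id)
  qed
qed

end

section \<open>The mapping class group\<close>
abbreviation cls :: "'a topology \<Rightarrow> ('a \<Rightarrow> 'a) \<Rightarrow> ('a \<Rightarrow> 'a) set" where
  "cls S f \<equiv> isotopy_rel S `` {f}"

lemma orientation_preserving_cong:
  assumes "\<And>x. x \<in> topspace S \<Longrightarrow> f x = g x"
  shows "orientation_preserving S f \<longleftrightarrow> orientation_preserving S g"
  unfolding orientation_preserving_def using assms hom_induced_eq[of S f g] by (metis (no_types, lifting))

lemma homeosI:
  assumes "f \<in> extensional (topspace S)" "homeomorphic_map S S f" "orientation_preserving S f"
  shows "f \<in> homeos S"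
  using assms by (auto simp: homeos_def Bij_def homeomorphic_eq_everything_map bij_betw_def)

lemma homeosD:
  assumes "f \<in> homeos S"
  shows "f \<in> extensional (topspace S)" "homeomorphic_map S S f" "orientation_preserving S f" "continuous_map S S f"
    "inj_on f (topspace S)" "f ` topspace S = topspace S" "\<And>x. x \<in> topspace S \<Longrightarrow> f x \<in> topspace S"
    "f \<in> Bij (topspace S)"
  using assms by (auto simp: homeos_def Bij_def homeomorphic_eq_everything_map)

lemma restrict_homeos:
  assumes "homeomorphic_map S S f" "orientation_preserving S f"
  shows "restrict f (topspace S) \<in> homeos S"
proof (rule homeosI)
  show "homeomorphic_map S S (restrict f (topspace S))"
    using assms(1) by (rule homeomorphic_map_eq) auto
  show "orientation_preserving S (restrict f (topspace S))"
    using assms(2) orientation_preserving_cong[of S f "restrict f (topspace S)"] by auto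
qed auto

lemma orientation_preserving_id: "orientation_preserving S id"
  unfolding orientation_preserving_def orientation_def by (auto simp: hom_induced_id)

lemma orientation_preserving_compose:
  assumes f: "f \<in> homeos S" and g: "g \<in> homeos S"
  shows "orientation_preserving S (f \<circ> g)"
  unfolding orientation_preserving_def
proof (intro allI impI ballI)
  fix \<mu> x assume \<mu>: "orientation S \<mu>" and x: "x \<in> topspace S"
  have gx: "g x \<in> topspace S" using homeosD(7)[OF g x] .
  have "hom_induced 2 S (topspace S - {x}) S (topspace S - {f (g x)}) (f \<circ> g) (\<mu> x)
      = hom_induced 2 S (topspace S - {g x}) S (topspace S - {f (g x)}) f (hom_induced 2 S (topspace S - {x}) S (topspace S - {g x}) g (\<mu> x))"
  proof (rule hom_induced_compose'[symmetric, OF homeosD(4)[OF g] _ homeosD(4)[OF f]])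
    have pi: "k \<in> (topspace S - {y}) \<rightarrow> (topspace S - {k y})" if "k \<in> homeos S" "y \<in> topspace S" for k y
      using homeosD(5,7)[OF that(1)] that(2) unfolding inj_on_def by blast
    show "g \<in> (topspace S - {x}) \<rightarrow> (topspace S - {g x})" "f \<in> (topspace S - {g x}) \<rightarrow> (topspace S - {f (g x)})"
      using pi f g x gx by blast+
  qed
  also have "\<dots> = \<mu> (f (g x))"
    using homeosD(3)[OF f] homeosD(3)[OF g] \<mu> x gx by (simp add: orientation_preserving_def)
  finally show "hom_induced 2 S (topspace S - {x}) S (topspace S - {(f \<circ> g) x}) (f \<circ> g) (\<mu> x) = \<mu> ((f \<circ> g) x)" by simp
qed

lemma compose_homeos: "f \<in> homeos S \<Longrightarrow> g \<in> homeos S \<Longrightarrow> compose (topspace S) f g \<in> homeos S"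
proof -
  assume fg: "f \<in> homeos S" "g \<in> homeos S"
  have "homeomorphic_map S S (f \<circ> g)" using homeosD(2) fg homeomorphic_map_compose by blast
  moreover have "compose (topspace S) f g = restrict (f \<circ> g) (topspace S)" by (auto simp: compose_def)
  ultimately show ?thesis using restrict_homeos orientation_preserving_compose[OF fg] by metis
qed

lemma one_homeos: "(\<lambda>x\<in>topspace S. x) \<in> homeos S"
  using restrict_homeos[OF homeomorphic_map_id[THEN iffD2, OF refl] orientation_preserving_id] unfolding id_def .

abbreviation hinv :: "'a topology \<Rightarrow> ('a \<Rightarrow> 'a) \<Rightarrow> ('a \<Rightarrow> 'a)" where
  "hinv S f \<equiv> (\<lambda>x\<in>topspace S. inv_into (topspace S) f x)"

text \<open>
  That an inverse preserves the orientation follows by applying it to the equation for \<open>f\<close>, by functoriality of homology.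
\<close>
lemma hinv_homeos: "f \<in> homeos S \<Longrightarrow> hinv S f \<in> homeos S"
proof (rule restrict_homeos)
  assume f: "f \<in> homeos S"
  let ?g = "inv_into (topspace S) f"
  obtain g where g: "homeomorphic_maps S S f g" using homeosD(2)[OF f] homeomorphic_map_maps by blast
  have eq: "g x = ?g x" if "x \<in> topspace S" for x
    using g that homeosD(5)[OF f] inv_into_f_eq[of f "topspace S" "g x" x]
    by (auto simp: homeomorphic_maps_def continuous_map_def Pi_iff)
  have "homeomorphic_map S S g" using g homeomorphic_maps_map by blast
  then show hg: "homeomorphic_map S S ?g" using eq by (rule homeomorphic_map_eq)
  have fg: "f (?g y) = y" "?g y \<in> topspace S" if "y \<in> topspace S" for y
    using that homeosD(6)[OF f] by (metis f_inv_into_f, metis inv_into_into)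
  have gf: "?g (f x) = x" if "x \<in> topspace S" for x using that homeosD(5)[OF f] by simp
  show "orientation_preserving S ?g"
    unfolding orientation_preserving_def
  proof (intro allI impI ballI)
    fix \<mu> y assume \<mu>: "orientation S \<mu>" and y: "y \<in> topspace S"
    let ?x = "?g y"
    have carr: "\<mu> ?x \<in> carrier (relative_homology_group 2 S (topspace S - {?x}))"
      using \<mu> fg[OF y] by (simp add: orientation_def)
    have "hom_induced 2 S (topspace S - {?x}) S (topspace S - {f ?x}) f (\<mu> ?x) = \<mu> (f ?x)"
      using homeosD(3)[OF f] \<mu> fg(2)[OF y] unfolding orientation_preserving_def by blast
    then have "\<mu> y = hom_induced 2 S (topspace S - {?x}) S (topspace S - {y}) f (\<mu> ?x)"
      unfolding fg(1)[OF y] by (rule sym)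
    then have "hom_induced 2 S (topspace S - {y}) S (topspace S - {?x}) ?g (\<mu> y)
      = hom_induced 2 S (topspace S - {y}) S (topspace S - {?x}) ?g (hom_induced 2 S (topspace S - {?x}) S (topspace S - {y}) f (\<mu> ?x))"
      by simp
    also have "\<dots> = hom_induced 2 S (topspace S - {?x}) S (topspace S - {?x}) (?g \<circ> f) (\<mu> ?x)"
    proof (rule hom_induced_compose')
      show "continuous_map S S f" "continuous_map S S ?g"
        using homeosD(4)[OF f] hg homeomorphic_imp_continuous_map by blast+
      show "f \<in> (topspace S - {?x}) \<rightarrow> (topspace S - {y})"
      proof
        fix z assume z: "z \<in> topspace S - {?x}"
        then have "f z \<noteq> y" using gf by auto
        then show "f z \<in> topspace S - {y}" using z homeosD(7)[OF f] by auto
      qed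
      show "?g \<in> (topspace S - {y}) \<rightarrow> (topspace S - {?x})"
      proof
        fix z assume z: "z \<in> topspace S - {y}"
        then have "?g z \<noteq> ?g y" using fg(1)[of z] fg(1)[OF y] by auto
        then show "?g z \<in> topspace S - {?x}" using z fg(2) by auto
      qed
    qed
    also have "\<dots> = \<mu> ?x"
    proof (rule hom_induced_id_gen[OF _ _ carr])
      show "continuous_map S S (?g \<circ> f)"
        using homeosD(4)[OF f] hg homeomorphic_imp_continuous_map continuous_map_compose by blast
    qed (use gf in auto)
    finally show "hom_induced 2 S (topspace S - {y}) S (topspace S - {?g y}) ?g (\<mu> y) = \<mu> (?g y)" .
  qed
qed

lemma hinv_apply: "f \<in> homeos S \<Longrightarrow> x \<in> topspace S \<Longrightarrow> hinv S f (f x) = x"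
  "f \<in> homeos S \<Longrightarrow> x \<in> topspace S \<Longrightarrow> f (hinv S f x) = x"
  using homeosD[of f S] by (auto simp: f_inv_into_f)

lemma homeo_group_simps:
  "carrier (homeo_group S) = homeos S" "\<one>\<^bsub>homeo_group S\<^esub> = (\<lambda>x\<in>topspace S. x)"
  "f \<in> homeos S \<Longrightarrow> g \<in> homeos S \<Longrightarrow> f \<otimes>\<^bsub>homeo_group S\<^esub> g = compose (topspace S) f g"
  by (auto simp: homeo_group_def BijGroup_def dest: homeosD(8))

lemma group_homeo_group: "group (homeo_group S)"
proof (rule groupI)
  fix f assume f: "f \<in> carrier (homeo_group S)"
  show "\<exists>g\<in>carrier (homeo_group S). g \<otimes>\<^bsub>homeo_group S\<^esub> f = \<one>\<^bsub>homeo_group S\<^esub>"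
    using f hinv_homeos[of f S] hinv_apply(1)[of f S]
    by (intro bexI[of _ "hinv S f"]) (auto simp: homeo_group_simps compose_def fun_eq_iff)
  show "\<one>\<^bsub>homeo_group S\<^esub> \<otimes>\<^bsub>homeo_group S\<^esub> f = f"
    using f one_homeos[of S] homeosD(1,7)[of f S]
    by (auto simp: homeo_group_simps compose_def fun_eq_iff extensional_def)
next
  fix f g h assume "f \<in> carrier (homeo_group S)" "g \<in> carrier (homeo_group S)" "h \<in> carrier (homeo_group S)"
  then show "f \<otimes>\<^bsub>homeo_group S\<^esub> g \<otimes>\<^bsub>homeo_group S\<^esub> h = f \<otimes>\<^bsub>homeo_group S\<^esub> (g \<otimes>\<^bsub>homeo_group S\<^esub> h)"
    using compose_homeos[of _ S] homeosD(7)[of h S]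
    by (auto simp: homeo_group_simps compose_def fun_eq_iff)
qed (auto simp: homeo_group_simps compose_homeos one_homeos)

lemma isotopic_iff: "(f, g) \<in> isotopy_rel S \<longleftrightarrow> f \<in> homeos S \<and> g \<in> homeos S \<and> homotopic_with (homeomorphic_map S S) S S f g"
  by (simp add: isotopy_rel_def)

lemma homotopic_homeos_eq:
  assumes "homotopic_with (homeomorphic_map S S) S S f g"
    "\<And>x. x \<in> topspace S \<Longrightarrow> f' x = f x" "\<And>x. x \<in> topspace S \<Longrightarrow> g' x = g x"
  shows "homotopic_with (homeomorphic_map S S) S S f' g'"
proof -
  have fg: "homeomorphic_map S S f" "homeomorphic_map S S g" using homotopic_with_imp_property[OF assms(1)] by auto
  then have fg': "homeomorphic_map S S f'" "homeomorphic_map S S g'"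
    using assms(2,3) homeomorphic_map_eq by metis+
  have "homotopic_with (homeomorphic_map S S) S S f' f"
    using fg fg' assms(2) homeomorphic_imp_continuous_map by (intro homotopic_with_equal) auto
  moreover have "homotopic_with (homeomorphic_map S S) S S g g'"
    using fg fg' assms(3) homeomorphic_imp_continuous_map by (intro homotopic_with_equal) auto
  ultimately show ?thesis using assms(1) homotopic_with_trans by blast
qed

lemma equiv_isotopy: "equiv (homeos S) (isotopy_rel S)"
proof (rule equivI)
  show "isotopy_rel S \<subseteq> homeos S \<times> homeos S" by (auto simp: isotopic_iff)
  show "refl_on (homeos S) (isotopy_rel S)"
    using homeosD(2,4) by (auto simp: refl_on_def isotopic_iff)
  show "sym (isotopy_rel S)" by (auto simp: sym_def isotopic_iff homotopic_with_symD)
  show "trans (isotopy_rel S)" by (rule transI) (auto simp: isotopic_iff intro: homotopic_with_trans)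
qed

lemma isotopic_compose:
  assumes "(f, f') \<in> isotopy_rel S" "(g, g') \<in> isotopy_rel S"
  shows "(compose (topspace S) f g, compose (topspace S) f' g') \<in> isotopy_rel S"
proof -
  have h: "f \<in> homeos S" "f' \<in> homeos S" "g \<in> homeos S" "g' \<in> homeos S" using assms by (auto simp: isotopic_iff)
  have "homotopic_with (homeomorphic_map S S) S S (f \<circ> g) (f' \<circ> g)"
    using assms(1) h homeosD(2,4) by (intro homotopic_with_compose_continuous_map_right[where p = "homeomorphic_map S S"])
      (auto simp: isotopic_iff intro: homeomorphic_map_compose)
  moreover have "homotopic_with (homeomorphic_map S S) S S (f' \<circ> g) (f' \<circ> g')"
    using assms(2) h homeosD(2,4) by (intro homotopic_with_compose_continuous_map_left[where p = "homeomorphic_map S S"])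
      (auto simp: isotopic_iff intro: homeomorphic_map_compose)
  ultimately have "homotopic_with (homeomorphic_map S S) S S (f \<circ> g) (f' \<circ> g')" by (rule homotopic_with_trans)
  then have "homotopic_with (homeomorphic_map S S) S S (compose (topspace S) f g) (compose (topspace S) f' g')"
    by (rule homotopic_homeos_eq) (auto simp: compose_def)
  then show ?thesis using h compose_homeos by (auto simp: isotopic_iff)
qed

lemma cls_eq_iff: "f \<in> homeos S \<Longrightarrow> g \<in> homeos S \<Longrightarrow> cls S f = cls S g \<longleftrightarrow> (f, g) \<in> isotopy_rel S"
  using eq_equiv_class_iff[OF equiv_isotopy] by metis

lemma self_in_cls: "f \<in> homeos S \<Longrightarrow> f \<in> cls S f"
  by (rule equiv_class_self[OF equiv_isotopy])

lemma in_cls_homeos: "f \<in> cls S g \<Longrightarrow> f \<in> homeos S \<and> cls S f = cls S g \<and> g \<in> homeos S"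
proof -
  assume "f \<in> cls S g"
  then have "(g, f) \<in> isotopy_rel S" by blast
  then show ?thesis using cls_eq_iff by (metis isotopic_iff)
qed

text \<open>
  Its cosets are the isotopy classes, so that the mapping class group is a quotient group and inherits the group
  laws.
\<close>
lemma isotopy_normal: "cls S \<one>\<^bsub>homeo_group S\<^esub> \<lhd> homeo_group S"
proof -
  let ?G = "homeo_group S"
  interpret G: group ?G by (rule group_homeo_group)
  have mem: "f \<in> cls S \<one>\<^bsub>?G\<^esub> \<longleftrightarrow> (\<one>\<^bsub>?G\<^esub>, f) \<in> isotopy_rel S" for f by simp
  have h: "f \<in> homeos S" if "f \<in> cls S \<one>\<^bsub>?G\<^esub>" for f using that in_cls_homeos by blast
  have refl: "(f, f) \<in> isotopy_rel S" if "f \<in> homeos S" for f using self_in_cls[OF that] by blast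
  have mult: "(f \<otimes>\<^bsub>?G\<^esub> g, f' \<otimes>\<^bsub>?G\<^esub> g') \<in> isotopy_rel S" if "(f, f') \<in> isotopy_rel S" "(g, g') \<in> isotopy_rel S" for f f' g g'
    using isotopic_compose[OF that] that by (auto simp: isotopic_iff homeo_group_simps(3))
  have one: "\<one>\<^bsub>?G\<^esub> \<in> homeos S" using one_homeos by (simp add: homeo_group_simps)
  have "subgroup (cls S \<one>\<^bsub>?G\<^esub>) ?G"
  proof
    show "cls S \<one>\<^bsub>?G\<^esub> \<subseteq> carrier ?G" using h by (auto simp: homeo_group_simps(1))
    show "\<one>\<^bsub>?G\<^esub> \<in> cls S \<one>\<^bsub>?G\<^esub>" using self_in_cls one by blast
    show "f \<otimes>\<^bsub>?G\<^esub> g \<in> cls S \<one>\<^bsub>?G\<^esub>" if "f \<in> cls S \<one>\<^bsub>?G\<^esub>" "g \<in> cls S \<one>\<^bsub>?G\<^esub>" for f g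
      using mult[of "\<one>\<^bsub>?G\<^esub>" f "\<one>\<^bsub>?G\<^esub>" g] that by (simp add: mem)
    show "inv\<^bsub>?G\<^esub> f \<in> cls S \<one>\<^bsub>?G\<^esub>" if "f \<in> cls S \<one>\<^bsub>?G\<^esub>" for f
    proof -
      have f: "f \<in> carrier ?G" using h[OF that] by (simp add: homeo_group_simps(1))
      then have "inv\<^bsub>?G\<^esub> f \<in> homeos S" using G.inv_closed by (simp add: homeo_group_simps(1))
      from mult[OF refl[OF this], of "\<one>\<^bsub>?G\<^esub>" f] have "(inv\<^bsub>?G\<^esub> f, \<one>\<^bsub>?G\<^esub>) \<in> isotopy_rel S"
        using that f by (simp add: mem)
      then show ?thesis using equiv_isotopy[of S] by (auto simp: equiv_def dest: symD)
    qed
  qed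
  moreover have "f \<otimes>\<^bsub>?G\<^esub> k \<otimes>\<^bsub>?G\<^esub> inv\<^bsub>?G\<^esub> f \<in> cls S \<one>\<^bsub>?G\<^esub>" if f: "f \<in> carrier ?G" and k: "k \<in> cls S \<one>\<^bsub>?G\<^esub>" for f k
  proof -
    have f': "f \<in> homeos S" "inv\<^bsub>?G\<^esub> f \<in> homeos S" using f G.inv_closed[OF f] by (auto simp: homeo_group_simps(1))
    have "(f \<otimes>\<^bsub>?G\<^esub> \<one>\<^bsub>?G\<^esub> \<otimes>\<^bsub>?G\<^esub> inv\<^bsub>?G\<^esub> f, f \<otimes>\<^bsub>?G\<^esub> k \<otimes>\<^bsub>?G\<^esub> inv\<^bsub>?G\<^esub> f) \<in> isotopy_rel S"
      using k f' by (intro mult refl) auto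
    then show ?thesis using f by (simp add: mem)
  qed
  ultimately show ?thesis using G.normal_inv_iff by blast
qed

lemma cls_coset: "f \<in> homeos S \<Longrightarrow> cls S \<one>\<^bsub>homeo_group S\<^esub> #>\<^bsub>homeo_group S\<^esub> f = cls S f"
proof -
  let ?G = "homeo_group S"
  assume f: "f \<in> homeos S"
  interpret G: group ?G by (rule group_homeo_group)
  have carr: "carrier ?G = homeos S" by (rule homeo_group_simps)
  have one: "\<one>\<^bsub>?G\<^esub> \<in> homeos S" using G.one_closed carr by simp
  have refl: "(f, f) \<in> isotopy_rel S" if "f \<in> homeos S" for f using self_in_cls[OF that] by blast
  have mult: "(f \<otimes>\<^bsub>?G\<^esub> g, f' \<otimes>\<^bsub>?G\<^esub> g') \<in> isotopy_rel S" if "(f, f') \<in> isotopy_rel S" "(g, g') \<in> isotopy_rel S" for f f' g g'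
    using isotopic_compose[OF that] that by (auto simp: isotopic_iff homeo_group_simps(3))
  show ?thesis
  proof (intro subset_antisym subsetI)
    fix k assume "k \<in> cls S \<one>\<^bsub>?G\<^esub> #>\<^bsub>?G\<^esub> f"
    then obtain n where n: "(\<one>\<^bsub>?G\<^esub>, n) \<in> isotopy_rel S" "k = n \<otimes>\<^bsub>?G\<^esub> f" by (auto simp: r_coset_def)
    then show "k \<in> cls S f" using mult[OF n(1) refl[OF f]] f carr by simp
  next
    fix k assume k: "k \<in> cls S f"
    then have kc: "k \<in> carrier ?G" "f \<in> carrier ?G" "inv\<^bsub>?G\<^esub> f \<in> homeos S"
      using in_cls_homeos f carr G.inv_closed by blast+
    have "(f \<otimes>\<^bsub>?G\<^esub> inv\<^bsub>?G\<^esub> f, k \<otimes>\<^bsub>?G\<^esub> inv\<^bsub>?G\<^esub> f) \<in> isotopy_rel S"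
      using k kc by (intro mult refl) auto
    then have "k \<otimes>\<^bsub>?G\<^esub> inv\<^bsub>?G\<^esub> f \<in> cls S \<one>\<^bsub>?G\<^esub>" using kc by simp
    moreover have "k = k \<otimes>\<^bsub>?G\<^esub> inv\<^bsub>?G\<^esub> f \<otimes>\<^bsub>?G\<^esub> f" using kc G.inv_solve_right' by (simp add: G.m_assoc)
    ultimately show "k \<in> cls S \<one>\<^bsub>?G\<^esub> #>\<^bsub>?G\<^esub> f" unfolding r_coset_def by blast
  qed
qed

lemma Map_eq_quotient: "Map S = homeo_group S Mod cls S \<one>\<^bsub>homeo_group S\<^esub>"
proof -
  have "homeos S // isotopy_rel S = rcosets\<^bsub>homeo_group S\<^esub> cls S \<one>\<^bsub>homeo_group S\<^esub>"
    unfolding RCOSETS_def quotient_def homeo_group_simps(1) using cls_coset[of _ S] by simp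
  then show ?thesis by (simp add: Map_def FactGroup_def)
qed

lemma group_Map: "group (Map S)"
  unfolding Map_eq_quotient by (rule normal.factorgroup_is_group[OF isotopy_normal])

lemma carrier_Map: "carrier (Map S) = cls S ` homeos S"
  by (auto simp: Map_def quotient_def)

lemma cls_hom: "cls S \<in> hom (homeo_group S) (Map S)"
proof -
  have "(\<lambda>f. cls S \<one>\<^bsub>homeo_group S\<^esub> #>\<^bsub>homeo_group S\<^esub> f) \<in> hom (homeo_group S) (Map S)"
    unfolding Map_eq_quotient by (rule normal.r_coset_hom_Mod[OF isotopy_normal])
  then show ?thesis
    unfolding hom_def homeo_group_simps(1)
    using cls_coset[of _ S] compose_homeos[of _ S] homeo_group_simps(3)[of _ S] carrier_Map[of S] by auto
qed

lemma cls_mult: "f \<in> homeos S \<Longrightarrow> g \<in> homeos S \<Longrightarrow> cls S f \<otimes>\<^bsub>Map S\<^esub> cls S g = cls S (compose (topspace S) f g)"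
  using hom_mult[OF cls_hom, of f S g] homeo_group_simps(3)[of f S g] by (simp only: homeo_group_simps(1))

lemma one_Map: "\<one>\<^bsub>Map S\<^esub> = cls S (\<lambda>x\<in>topspace S. x)"
  by (simp add: Map_def homeo_group_simps)

section \<open>Homeomorphisms close to the identity\<close>
abbreviation (input) idS :: "'a topology \<Rightarrow> 'a \<Rightarrow> 'a" where "idS S \<equiv> (\<lambda>x\<in>topspace S. x)"

text \<open>
  Finite intersections of subbasic sets of the compact-open topology; the pairs are the compact and open sets.
\<close>
definition co_basic :: "'a topology \<Rightarrow> ('a set \<times> 'a set) set \<Rightarrow> ('a \<Rightarrow> 'a) set" where
  "co_basic S F = {h \<in> homeos S. \<forall>p\<in>F. h ` fst p \<subseteq> snd p}"

definition co_pairs :: "'a topology \<Rightarrow> ('a set \<times> 'a set) set \<Rightarrow> bool" where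
  "co_pairs S F \<longleftrightarrow> finite F \<and> (\<forall>p\<in>F. compactin S (fst p) \<and> openin S (snd p))"

lemma co_basic_Un: "co_basic S (F \<union> F') = co_basic S F \<inter> co_basic S F'"
  unfolding co_basic_def ball_Un by blast

lemma co_pairs_Un: "co_pairs S F \<Longrightarrow> co_pairs S F' \<Longrightarrow> co_pairs S (F \<union> F')"
  unfolding co_pairs_def ball_Un by blast

lemma Union_subbasis: "\<Union> {{f \<in> homeos S. f ` K \<subseteq> U} |K U. compactin S K \<and> openin S U} = homeos S"
  using topspace_compact_open_topology[of S] unfolding compact_open_topology_def topology_generated_by_topspace .

lemma openin_co_basic:
  assumes "co_pairs S F" shows "openin (compact_open_topology S) (co_basic S F)"
proof -
  have fin: "finite F" and F: "\<And>p. p \<in> F \<Longrightarrow> compactin S (fst p) \<and> openin S (snd p)" using assms by (auto simp: co_pairs_def)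
  have sub: "openin (compact_open_topology S) {f \<in> homeos S. f ` fst p \<subseteq> snd p}" if "p \<in> F" for p
    unfolding compact_open_topology_def using F[OF that] by (intro topology_generated_by_Basis) blast
  have "openin (compact_open_topology S) (homeos S \<inter> (\<Inter>p\<in>F. {f \<in> homeos S. f ` fst p \<subseteq> snd p}))"
  proof (cases "F = {}")
    case True
    then show ?thesis using openin_topspace[of "compact_open_topology S"] by (simp add: topspace_compact_open_topology)
  next
    case False
    have "openin (compact_open_topology S) (\<Inter>p\<in>F. {f \<in> homeos S. f ` fst p \<subseteq> snd p})"
      by (rule openin_INT2[OF fin False]) (rule sub)
    moreover have "openin (compact_open_topology S) (homeos S)"
      using openin_topspace[of "compact_open_topology S"] unfolding topspace_compact_open_topology .
    ultimately show ?thesis by (intro openin_Int)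
  qed
  moreover have "co_basic S F = homeos S \<inter> (\<Inter>p\<in>F. {f \<in> homeos S. f ` fst p \<subseteq> snd p})"
    by (auto simp: co_basic_def)
  ultimately show ?thesis by simp
qed

lemma co_basic_nbhd:
  assumes "openin (compact_open_topology S) W" "f \<in> W"
  shows "\<exists>F. co_pairs S F \<and> f \<in> co_basic S F \<and> co_basic S F \<subseteq> W"
proof -
  have "generate_topology_on {{f \<in> homeos S. f ` K \<subseteq> U} |K U. compactin S K \<and> openin S U} W"
    using assms(1) by (simp add: compact_open_topology_def openin_topology_generated_by_iff)
  then show ?thesis using assms(2)
  proof induction
    case Empty
    then show ?case by simp
  next
    case (Int A B)
    then obtain F1 F2 where "co_pairs S F1 \<and> f \<in> co_basic S F1 \<and> co_basic S F1 \<subseteq> A"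
      "co_pairs S F2 \<and> f \<in> co_basic S F2 \<and> co_basic S F2 \<subseteq> B" by blast
    then show ?case
      using co_pairs_Un[of S F1 F2] co_basic_Un[of S F1 F2] by (intro exI[of _ "F1 \<union> F2"]) blast
  next
    case (UN K)
    then show ?case by blast
  next
    case (Basis A)
    then obtain K U where KU: "A = {f \<in> homeos S. f ` K \<subseteq> U}" "compactin S K" "openin S U" by blast
    then show ?case using Basis by (intro exI[of _ "{(K, U)}"]) (auto simp: co_pairs_def co_basic_def)
  qed
qed

lemma left_translation_continuous:
  assumes a: "a \<in> homeos S"
  shows "continuous_map (compact_open_topology S) (compact_open_topology S) (\<lambda>f. compose (topspace S) a f)"
  unfolding compact_open_topology_def[of S] 
proof (rule continuous_on_generated_topo, fold compact_open_topology_def[of S], unfold topspace_compact_open_topology)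
  fix A assume "A \<in> {{f \<in> homeos S. f ` K \<subseteq> U} |K U. compactin S K \<and> openin S U}"
  then obtain K U where KU: "A = {f \<in> homeos S. f ` K \<subseteq> U}" "compactin S K" "openin S U" by blast
  have KS: "K \<subseteq> topspace S" using KU compactin_subset_topspace by blast
  define U' where "U' = {x \<in> topspace S. a x \<in> U}"
  have U': "openin S U'" unfolding U'_def by (rule openin_continuous_map_preimage[OF homeosD(4)[OF a] KU(3)])
  have "(\<lambda>f. compose (topspace S) a f) -` A \<inter> homeos S = co_basic S {(K, U')}"
    using KS compose_homeos[OF a] homeosD(7)[of _ S]
    by (auto simp: KU(1) co_basic_def U'_def compose_def image_subset_iff subset_iff)
  then show "openin (compact_open_topology S) ((\<lambda>f. compose (topspace S) a f) -` A \<inter> homeos S)"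
    using openin_co_basic[of S "{(K, U')}"] U' KU(2) by (simp add: co_pairs_def)
next
  show "(\<lambda>f. compose (topspace S) a f) ` homeos S \<subseteq> \<Union> {{f \<in> homeos S. f ` K \<subseteq> U} |K U. compactin S K \<and> openin S U}"
    unfolding Union_subbasis using compose_homeos[OF a] by blast
qed

lemma right_translation_continuous:
  assumes a: "a \<in> homeos S"
  shows "continuous_map (compact_open_topology S) (compact_open_topology S) (\<lambda>f. compose (topspace S) f a)"
  unfolding compact_open_topology_def[of S] 
proof (rule continuous_on_generated_topo, fold compact_open_topology_def[of S], unfold topspace_compact_open_topology)
  fix A assume "A \<in> {{f \<in> homeos S. f ` K \<subseteq> U} |K U. compactin S K \<and> openin S U}"
  then obtain K U where KU: "A = {f \<in> homeos S. f ` K \<subseteq> U}" "compactin S K" "openin S U" by blast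
  have KS: "K \<subseteq> topspace S" using KU compactin_subset_topspace by blast
  have K': "compactin S (a ` K)" using image_compactin[OF KU(2) homeosD(4)[OF a]] .
  have "(\<lambda>f. compose (topspace S) f a) -` A \<inter> homeos S = co_basic S {(a ` K, U)}"
    using KS compose_homeos[OF _ a]
    by (auto simp: KU(1) co_basic_def compose_def image_subset_iff subset_iff)
  then show "openin (compact_open_topology S) ((\<lambda>f. compose (topspace S) f a) -` A \<inter> homeos S)"
    using openin_co_basic[of S "{(a ` K, U)}"] K' KU(3) by (simp add: co_pairs_def)
next
  show "(\<lambda>f. compose (topspace S) f a) ` homeos S \<subseteq> \<Union> {{f \<in> homeos S. f ` K \<subseteq> U} |K U. compactin S K \<and> openin S U}"
    unfolding Union_subbasis using compose_homeos[OF _ a] by blast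
qed

context hausdorff_chart
begin

lemma translate_chart: "hausdorff_chart S U (\<lambda>x. \<psi> x - c) (\<lambda>z. \<kappa> (z + c))"
proof
  have "homeomorphic_maps (euclidean :: complex topology) euclidean (\<lambda>z. z - c) (\<lambda>z. z + c)"
    by (simp add: homeomorphic_maps_def continuous_intros)
  from homeomorphic_maps_compose[OF conjI[OF maps this]]
  show "homeomorphic_maps (subtopology S U) (euclidean :: complex topology) (\<lambda>x. \<psi> x - c) (\<lambda>z. \<kappa> (z + c))"
    by (simp add: o_def)
qed (use haus openU in auto)

lemma compact_\<kappa>: "compact A \<Longrightarrow> compactin S (\<kappa> ` A)"
  using image_compactin[OF _ cont_\<kappa>] by simp

lemma open_preimage_\<kappa>: "openin S O' \<Longrightarrow> open {z. \<kappa> z \<in> O'}"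
  using openin_continuous_map_preimage[OF cont_\<kappa>, of O'] by simp

text \<open>
  A Lebesgue number in the chart.
\<close>
lemma compact_margin:
  assumes C: "compactin S C" and O': "openin S O'" "C \<subseteq> O'"
  shows "\<exists>\<eta>>0. \<forall>z\<in>cball 0 R. \<kappa> z \<in> C \<longrightarrow> (\<forall>w. dist z w \<le> \<eta> \<longrightarrow> \<kappa> w \<in> O')"
proof -
  define C' where "C' = {z. \<kappa> z \<in> C} \<inter> cball 0 R"
  have "closedin S C" using C compactin_imp_closedin[OF haus] by blast
  then have "closed {z. \<kappa> z \<in> C}" using closedin_continuous_map_preimage[OF cont_\<kappa>, of C] by simp
  then have "compact C'" unfolding C'_def by (intro closed_Int_compact) auto
  moreover have "C' \<subseteq> {z. \<kappa> z \<in> O'}" using O' by (auto simp: C'_def)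
  ultimately obtain e where e: "0 < e" "(\<Union>x\<in>C'. ball x e) \<subseteq> {z. \<kappa> z \<in> O'}"
    using compact_subset_open_imp_ball_epsilon_subset[OF _ open_preimage_\<kappa>[OF O'(1)]] by metis
  have "\<kappa> w \<in> O'" if "z \<in> cball 0 R" "\<kappa> z \<in> C" "dist z w \<le> e / 2" for z w
  proof -
    have "z \<in> C'" using that by (simp add: C'_def)
    moreover have "w \<in> ball z e" using that(3) e(1) by simp
    ultimately show ?thesis using e(2) by blast
  qed
  then show ?thesis using e(1) by (intro exI[of _ "e / 2"]) auto
qed

end

lemma surface_centered_chart:
  assumes S: "surface S" and x: "x \<in> topspace S"
  obtains U \<psi> \<kappa> where "hausdorff_chart S U \<psi> \<kappa>" "x = \<kappa> 0"
proof -
  obtain U \<psi> \<kappa> where c: "hausdorff_chart S U \<psi> \<kappa>" "x \<in> U" using surface_chart[OF S x] by blast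
  then interpret hausdorff_chart S U \<psi> \<kappa> by simp
  show ?thesis using that[OF translate_chart[of "\<psi> x"]] \<kappa>\<psi>[OF c(2)] by simp
qed

lemma finite_subcover_by_nbhds:
  assumes "compactin S K" "\<And>x. x \<in> K \<Longrightarrow> openin S (A x) \<and> x \<in> A x"
  shows "\<exists>T. finite T \<and> T \<subseteq> K \<and> K \<subseteq> (\<Union>x\<in>T. A x)"
proof -
  have "(\<forall>V\<in>A ` K. openin S V) \<and> K \<subseteq> \<Union> (A ` K)" using assms(2) by blast
  then obtain \<F> where F: "finite \<F>" "\<F> \<subseteq> A ` K" "K \<subseteq> \<Union>\<F>"
    using assms(1)[unfolded compactin_def, THEN conjunct2, THEN spec[of _ "A ` K"]] by (elim impE exE conjE) blast+
  obtain T where "T \<subseteq> K" "finite T" "\<F> = A ` T" using finite_subset_image[OF F(1,2)] by blast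
  then show ?thesis using F(3) by blast
qed

lemma surface_compact_nbhd:
  assumes S: "surface S" and K: "compactin S K" and U: "openin S U" "K \<subseteq> U"
  shows "\<exists>O' L. openin S O' \<and> compactin S L \<and> K \<subseteq> O' \<and> O' \<subseteq> L \<and> L \<subseteq> U"
proof -
  have "\<exists>O' L. openin S O' \<and> compactin S L \<and> x \<in> O' \<and> O' \<subseteq> L \<and> L \<subseteq> U" if "x \<in> K" for x
  proof -
    have xS: "x \<in> topspace S" using that K compactin_subset_topspace by blast
    obtain V \<psi> \<kappa> where "hausdorff_chart S V \<psi> \<kappa>" and x: "x = \<kappa> 0" using surface_centered_chart[OF S xS] by blast
    then interpret hausdorff_chart S V \<psi> \<kappa> by simp
    have "0 \<in> {z. \<kappa> z \<in> U}" using that U x by auto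
    then obtain r where r: "0 < r" "cball 0 r \<subseteq> {z. \<kappa> z \<in> U}"
      using open_preimage_\<kappa>[OF U(1)] open_contains_cball by blast
    show ?thesis
      using r x open_\<kappa>[of "ball 0 r"] compact_\<kappa>[of "cball 0 r"]
      by (intro exI[of _ "\<kappa> ` ball 0 r"] exI[of _ "\<kappa> ` cball 0 r"]) auto
  qed
  then have "\<forall>x\<in>K. \<exists>O' L. openin S O' \<and> compactin S L \<and> x \<in> O' \<and> O' \<subseteq> L \<and> L \<subseteq> U" by (rule ballI)
  from bchoice[OF this] obtain A where
    "\<forall>x\<in>K. \<exists>L. openin S (A x) \<and> compactin S L \<and> x \<in> A x \<and> A x \<subseteq> L \<and> L \<subseteq> U" by (elim exE)
  from bchoice[OF this] obtain L where
    "\<forall>x\<in>K. openin S (A x) \<and> compactin S (L x) \<and> x \<in> A x \<and> A x \<subseteq> L x \<and> L x \<subseteq> U" by (elim exE)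
  note AL = bspec[OF this]
  have nb: "openin S (A x) \<and> x \<in> A x" if "x \<in> K" for x using AL[OF that] by simp
  have "\<exists>T. finite T \<and> T \<subseteq> K \<and> K \<subseteq> (\<Union>x\<in>T. A x)" by (rule finite_subcover_by_nbhds[OF K nb])
  then
  obtain T where T: "finite T" "T \<subseteq> K" "K \<subseteq> (\<Union>x\<in>T. A x)" by (elim exE conjE)
  have TK: "x \<in> K" if "x \<in> T" for x using T(2) that by (rule subsetD)
  show ?thesis
  proof (intro exI conjI)
    show "openin S (\<Union>x\<in>T. A x)" using AL[OF TK] by (intro openin_Union) auto
    show "compactin S (\<Union>(L ` T))" using T(1) AL[OF TK] by (intro compactin_Union) auto
    show "K \<subseteq> (\<Union>x\<in>T. A x)" by (rule T)
    show "(\<Union>x\<in>T. A x) \<subseteq> \<Union>(L ` T)" using AL[OF TK] by (intro UN_mono) auto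
    show "\<Union>(L ` T) \<subseteq> U" using AL[OF TK] by (intro UN_least) auto
  qed
qed

lemma one_in_co_basic: "co_pairs S F \<Longrightarrow> idS S \<in> co_basic S F \<longleftrightarrow> (\<forall>p\<in>F. fst p \<subseteq> snd p)"
proof -
  assume F: "co_pairs S F"
  have "idS S ` fst p = fst p" if "p \<in> F" for p
  proof -
    have "fst p \<subseteq> topspace S" using F that compactin_subset_topspace unfolding co_pairs_def by blast
    then show ?thesis by (auto simp: image_iff subset_iff)
  qed
  then show ?thesis using one_homeos[of S] by (simp add: co_basic_def)
qed

text \<open>
  Composition is jointly continuous at the identity: insert compact neighbourhoods between the compact and open sets.
\<close>
lemma co_compose_nbhd:
  assumes S: "surface S" and F: "co_pairs S F" "idS S \<in> co_basic S F"
  shows "\<exists>F1 F2. co_pairs S F1 \<and> idS S \<in> co_basic S F1 \<and> co_pairs S F2 \<and> idS S \<in> co_basic S F2 \<and>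
     (\<forall>f\<in>co_basic S F1. \<forall>k\<in>co_basic S F2. compose (topspace S) k f \<in> co_basic S F)"
proof -
  have sub: "\<forall>p\<in>F. fst p \<subseteq> snd p" using F(2) one_in_co_basic[OF F(1)] by (rule iffD1[rotated])
  have fin: "finite F" and F': "\<And>p. p \<in> F \<Longrightarrow> compactin S (fst p) \<and> openin S (snd p) \<and> fst p \<subseteq> snd p"
    using F(1) sub unfolding co_pairs_def by simp_all
  have "\<forall>p\<in>F. \<exists>O' L. openin S O' \<and> compactin S L \<and> fst p \<subseteq> O' \<and> O' \<subseteq> L \<and> L \<subseteq> snd p"
  proof
    fix p assume "p \<in> F"
    from F'[OF this] show "\<exists>O' L. openin S O' \<and> compactin S L \<and> fst p \<subseteq> O' \<and> O' \<subseteq> L \<and> L \<subseteq> snd p"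
      by (intro surface_compact_nbhd[OF S]) simp_all
  qed
  from bchoice[OF this] obtain A where
    "\<forall>p\<in>F. \<exists>L. openin S (A p) \<and> compactin S L \<and> fst p \<subseteq> A p \<and> A p \<subseteq> L \<and> L \<subseteq> snd p" by (elim exE)
  from bchoice[OF this] obtain L where
    "\<forall>p\<in>F. openin S (A p) \<and> compactin S (L p) \<and> fst p \<subseteq> A p \<and> A p \<subseteq> L p \<and> L p \<subseteq> snd p" by (elim exE)
  note AL = bspec[OF this]
  define F1 where "F1 = (\<lambda>p. (fst p, A p)) ` F"
  define F2 where "F2 = (\<lambda>p. (L p, snd p)) ` F"
  have F12: "co_pairs S F1" "co_pairs S F2" using fin F' AL by (simp_all add: co_pairs_def F1_def F2_def)
  moreover have "idS S \<in> co_basic S F1" "idS S \<in> co_basic S F2"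
    unfolding one_in_co_basic[OF F12(1)] one_in_co_basic[OF F12(2)] using AL by (simp_all add: F1_def F2_def)
  moreover have "compose (topspace S) k f \<in> co_basic S F" if f: "f \<in> co_basic S F1" and k: "k \<in> co_basic S F2" for f k
  proof -
    have fk: "f \<in> homeos S" "k \<in> homeos S" using f k by (auto simp: co_basic_def)
    have "compose (topspace S) k f ` fst p \<subseteq> snd p" if p: "p \<in> F" for p
    proof
      fix y assume "y \<in> compose (topspace S) k f ` fst p"
      then obtain x where x: "x \<in> fst p" "y = compose (topspace S) k f x" by blast
      have xS: "x \<in> topspace S" using x F'[OF p] compactin_subset_topspace by blast
      have "f ` fst p \<subseteq> A p" using f p by (auto simp: co_basic_def F1_def)
      then have "f x \<in> L p" using x AL[OF p] by blast
      moreover have "k ` L p \<subseteq> snd p" using k p by (auto simp: co_basic_def F2_def)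
      ultimately show "y \<in> snd p" using x xS by (auto simp: compose_def)
    qed
    then show ?thesis using compose_homeos[OF fk(2,1)] by (auto simp: co_basic_def)
  qed
  ultimately show ?thesis by blast
qed

lemma finite_common_margin:
  fixes P :: "'i \<Rightarrow> real \<Rightarrow> bool"
  assumes "finite F" "\<And>p. p \<in> F \<Longrightarrow> \<exists>\<eta>>0. P p \<eta>" "\<And>p \<eta> \<eta>'. P p \<eta> \<Longrightarrow> \<eta>' \<le> \<eta> \<Longrightarrow> P p \<eta>'"
  shows "\<exists>\<eta>>0. \<forall>p\<in>F. P p \<eta>"
  using assms(1,2)
proof (induction F rule: finite_induct)
  case empty
  show ?case by (rule exI[of _ 1]) simp
next
  case (insert q F)
  then obtain \<eta>1 \<eta>2 where "0 < \<eta>1" "\<forall>p\<in>F. P p \<eta>1" "0 < \<eta>2" "P q \<eta>2" by blast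
  then show ?case using assms(3) by (intro exI[of _ "min \<eta>1 \<eta>2"]) (auto intro: assms(3))
qed

context hausdorff_chart
begin

text \<open>
  A small displacement in the chart is a small displacement in the compact-open topology.
\<close>
lemma lift_in_co_basic:
  assumes F: "co_pairs S F" "idS S \<in> co_basic S F"
  shows "\<exists>\<eta>>0. \<forall>g. (\<forall>z. dist (g z) z \<le> \<eta>) \<and> (\<forall>z. z \<notin> ball 0 R \<longrightarrow> g z = z) \<and> restrict (lift g) (topspace S) \<in> homeos S
     \<longrightarrow> restrict (lift g) (topspace S) \<in> co_basic S F"
proof -
  have sub: "\<forall>p\<in>F. fst p \<subseteq> snd p" using F(2) one_in_co_basic[OF F(1)] by (rule iffD1[rotated])
  have fin: "finite F" and F': "\<And>p. p \<in> F \<Longrightarrow> compactin S (fst p) \<and> openin S (snd p) \<and> fst p \<subseteq> snd p"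
    using F(1) sub unfolding co_pairs_def by simp_all
  have "\<exists>\<eta>>0. \<forall>p\<in>F. \<forall>z\<in>cball 0 R. \<kappa> z \<in> fst p \<longrightarrow> (\<forall>w. dist z w \<le> \<eta> \<longrightarrow> \<kappa> w \<in> snd p)"
  proof (rule finite_common_margin[OF fin])
    fix p assume "p \<in> F"
    from F'[OF this] show "\<exists>\<eta>>0. \<forall>z\<in>cball 0 R. \<kappa> z \<in> fst p \<longrightarrow> (\<forall>w. dist z w \<le> \<eta> \<longrightarrow> \<kappa> w \<in> snd p)"
      by (intro compact_margin) simp_all
  next
    fix p and \<eta> \<eta>' :: real
    assume *: "\<forall>z\<in>cball 0 R. \<kappa> z \<in> fst p \<longrightarrow> (\<forall>w. dist z w \<le> \<eta> \<longrightarrow> \<kappa> w \<in> snd p)" and "\<eta>' \<le> \<eta>"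
    then have "dist z w \<le> \<eta>" if "dist z w \<le> \<eta>'" for z w :: complex using that by linarith
    then show "\<forall>z\<in>cball 0 R. \<kappa> z \<in> fst p \<longrightarrow> (\<forall>w. dist z w \<le> \<eta>' \<longrightarrow> \<kappa> w \<in> snd p)" using * by simp
  qed
  then obtain \<eta> where \<eta>: "0 < \<eta>" "\<And>p z w. p \<in> F \<Longrightarrow> z \<in> cball 0 R \<Longrightarrow> \<kappa> z \<in> fst p \<Longrightarrow> dist z w \<le> \<eta> \<Longrightarrow> \<kappa> w \<in> snd p"
    by blast
  have "restrict (lift g) (topspace S) \<in> co_basic S F"
    if g: "\<And>z. dist (g z) z \<le> \<eta>" "\<And>z. z \<notin> ball 0 R \<Longrightarrow> g z = z" "restrict (lift g) (topspace S) \<in> homeos S" for g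
  proof -
    have "lift g x \<in> snd p" if p: "p \<in> F" "x \<in> fst p" for p x
    proof (cases "x \<in> U \<and> \<psi> x \<in> ball 0 R")
      case True
      then have "\<kappa> (\<psi> x) = x" using \<kappa>\<psi> by blast
      then have "\<kappa> (g (\<psi> x)) \<in> snd p" using True p g(1)[of "\<psi> x"] by (intro \<eta>(2)[OF p(1), of "\<psi> x"]) (auto simp: dist_commute)
      then show ?thesis using True by (simp add: lift_def)
    next
      case False
      then have "lift g x = x" using lift_outside[of "ball 0 R" g x] g(2) by (auto simp: image_\<kappa>)
      then show ?thesis using F'[OF p(1)] p(2) by auto
    qed
    moreover have "fst p \<subseteq> topspace S" if "p \<in> F" for p using F'[OF that] compactin_subset_topspace by blast
    ultimately show ?thesis using g(3) by (fastforce simp: co_basic_def)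
  qed
  then show ?thesis using \<eta>(1) by blast
qed

lemma chart_close_nbhd:
  assumes "0 < \<delta>"
  shows "\<exists>F. co_pairs S F \<and> idS S \<in> co_basic S F \<and>
     (\<forall>f\<in>co_basic S F. \<forall>z\<in>cball 0 R. f (\<kappa> z) \<in> U \<and> dist (\<psi> (f (\<kappa> z))) z \<le> \<delta>)"
proof -
  have "cball 0 R \<subseteq> (\<Union>c\<in>cball 0 R. ball c (\<delta>/4))" using assms by auto
  then obtain T where T: "T \<subseteq> cball (0::complex) R" "finite T" "cball 0 R \<subseteq> (\<Union>c\<in>T. ball c (\<delta>/4))"
    using compactE_image[OF compact_cball, of "cball 0 R" "\<lambda>c. ball c (\<delta>/4)" "0::complex" R] by (metis open_ball)
  define F where "F = (\<lambda>c. (\<kappa> ` cball c (\<delta>/4), \<kappa> ` ball c (\<delta>/2))) ` T"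
  have F: "co_pairs S F" using T compact_\<kappa> open_\<kappa> by (auto simp: co_pairs_def F_def)
  moreover have "idS S \<in> co_basic S F"
    unfolding one_in_co_basic[OF F] using assms by (auto simp: F_def)
  moreover have "f (\<kappa> z) \<in> U \<and> dist (\<psi> (f (\<kappa> z))) z \<le> \<delta>" if f: "f \<in> co_basic S F" and z: "z \<in> cball 0 R" for f z
  proof -
    obtain c where c: "c \<in> T" "z \<in> ball c (\<delta>/4)" using T z by blast
    have "f ` \<kappa> ` cball c (\<delta>/4) \<subseteq> \<kappa> ` ball c (\<delta>/2)" using f c by (auto simp: co_basic_def F_def)
    then have "f (\<kappa> z) \<in> \<kappa> ` ball c (\<delta>/2)" using c by (auto simp: image_subset_iff)
    then obtain w where w: "f (\<kappa> z) = \<kappa> w" "dist c w < \<delta>/2" by auto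
    then show ?thesis using c dist_triangle[of w z c] assms by (simp add: dist_commute)
  qed
  ultimately show ?thesis by blast
qed

text \<open>
  Read \<open>f\<close> in the chart, correct it by \<open>g\<close> with \<open>g = f\<close> on the small disc, and put
  \<open>f' = g\<^sup>-\<^sup>1 f\<close>. By Alexander's trick this is isotopic to \<open>f\<close>. Points of \<open>C\<close> stay fixed, since
  \<open>f\<close> is the identity on the neighbourhood \<open>O'\<close> of \<open>C\<close> and therefore so is \<open>g\<close> near
  \<open>C\<close>.
\<close>
lemma chart_correction:
  assumes S: "surface S" "connected_space S" and r: "0 \<le> r" "r < R"
    and C: "compactin S C" and O': "openin S O'" "C \<subseteq> O'"
    and W: "co_pairs S W" "idS S \<in> co_basic S W"
  shows "\<exists>V. co_pairs S V \<and> idS S \<in> co_basic S V \<and>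
    (\<forall>f\<in>co_basic S V. (\<forall>x\<in>O'. f x = x) \<longrightarrow>
       (\<exists>f'\<in>co_basic S W. (f, f') \<in> isotopy_rel S \<and> (\<forall>x\<in>C \<union> \<kappa> ` cball 0 r. f' x = x)))"
proof -
  obtain F1 F2 where F1: "co_pairs S F1" "idS S \<in> co_basic S F1" and F2: "co_pairs S F2" "idS S \<in> co_basic S F2"
    and F12: "\<And>f k. f \<in> co_basic S F1 \<Longrightarrow> k \<in> co_basic S F2 \<Longrightarrow> compose (topspace S) k f \<in> co_basic S W"
    using co_compose_nbhd[OF S(1) W] by blast
  obtain \<eta>1 where \<eta>1: "0 < \<eta>1" "\<And>g. (\<And>z. dist (g z) z \<le> \<eta>1) \<Longrightarrow> (\<And>z. z \<notin> ball 0 R \<Longrightarrow> g z = z) \<Longrightarrow>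
      restrict (lift g) (topspace S) \<in> homeos S \<Longrightarrow> restrict (lift g) (topspace S) \<in> co_basic S F2"
    using lift_in_co_basic[OF F2, of R] by blast
  obtain \<eta>2 where \<eta>2: "0 < \<eta>2" "\<And>z w. z \<in> cball 0 R \<Longrightarrow> \<kappa> z \<in> C \<Longrightarrow> dist z w \<le> \<eta>2 \<Longrightarrow> \<kappa> w \<in> O'"
    using compact_margin[OF C O', of R] by blast
  define \<eta> where "\<eta> = min \<eta>1 \<eta>2"
  have \<eta>: "0 < \<eta>" "\<eta> \<le> \<eta>1" "\<eta> \<le> \<eta>2" using \<eta>1 \<eta>2 by (auto simp: \<eta>_def)
  obtain \<delta> where \<delta>: "0 < \<delta>"
    "\<And>f. continuous_on (cball 0 R) f \<Longrightarrow> inj_on f (cball 0 R) \<Longrightarrow> (\<And>x. x \<in> cball 0 R \<Longrightarrow> dist (f x) x \<le> \<delta>) \<Longrightarrow>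
       \<exists>g g'. homeomorphism UNIV UNIV g g' \<and> (\<forall>x\<in>cball 0 r. g x = f x) \<and> (\<forall>x. x \<notin> ball (0::complex) R \<longrightarrow> g x = x) \<and>
         (\<forall>x. dist (g x) x \<le> \<eta>) \<and> (\<forall>x. (\<forall>y\<in>ball x \<eta> \<inter> cball 0 R. f y = y) \<longrightarrow> g x = x)"
    using local_correction[OF r \<eta>(1)] by blast
  obtain F3 where F3: "co_pairs S F3" "idS S \<in> co_basic S F3"
    "\<And>f z. f \<in> co_basic S F3 \<Longrightarrow> z \<in> cball 0 R \<Longrightarrow> f (\<kappa> z) \<in> U \<and> dist (\<psi> (f (\<kappa> z))) z \<le> \<delta>"
    using chart_close_nbhd[OF \<delta>(1), of R] by blast
  have *: "\<exists>f'\<in>co_basic S W. (f, f') \<in> isotopy_rel S \<and> (\<forall>x\<in>C \<union> \<kappa> ` cball 0 r. f' x = x)"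
    if f: "f \<in> co_basic S F1" "f \<in> co_basic S F3" and fO: "\<And>x. x \<in> O' \<Longrightarrow> f x = x" for f
  proof -
    have fh: "f \<in> homeos S" using f by (simp add: co_basic_def)
    define fc where "fc z = \<psi> (f (\<kappa> z))" for z
    have fU: "f (\<kappa> z) \<in> U" "dist (fc z) z \<le> \<delta>" "f (\<kappa> z) = \<kappa> (fc z)" if "z \<in> cball 0 R" for z
      using F3(3)[OF f(2) that] \<kappa>\<psi> by (auto simp: fc_def)
    have "continuous_map (top_of_set (cball 0 R)) (subtopology S U) (f \<circ> \<kappa>)"
      using fU(1) continuous_map_compose[OF cont_\<kappa> homeosD(4)[OF fh]]
      by (auto simp: continuous_map_in_subtopology intro: continuous_map_from_subtopology)
    from continuous_map_compose[OF this cont_\<psi>] have "continuous_on (cball 0 R) fc"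
      by (simp add: o_def fc_def[abs_def])
    moreover have "inj_on fc (cball 0 R)"
    proof (rule inj_onI)
      fix z w assume zw: "z \<in> cball 0 R" "w \<in> cball 0 R" "fc z = fc w"
      then have "f (\<kappa> z) = f (\<kappa> w)" using fU(3) by simp
      then have "\<kappa> z = \<kappa> w" using inj_onD[OF homeosD(5)[OF fh]] US \<kappa>_in by blast
      then show "z = w" by simp
    qed
    ultimately obtain g g' where g: "homeomorphism UNIV UNIV g g'" "\<And>x. x \<in> cball 0 r \<Longrightarrow> g x = fc x"
      "\<And>x. x \<notin> ball 0 R \<Longrightarrow> g x = x" "\<And>x. dist (g x) x \<le> \<eta>"
      "\<And>x. (\<And>y. y \<in> ball x \<eta> \<Longrightarrow> y \<in> cball 0 R \<Longrightarrow> fc y = y) \<Longrightarrow> g x = x"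
      using \<delta>(2)[of fc] fU(2) by (metis (no_types, lifting) IntE)
    have gg: "g' (g z) = z" "g (g' z) = z" for z using g(1) by (auto simp: homeomorphism_def)
    have g'1: "homeomorphism UNIV UNIV g' g" using g(1) homeomorphism_sym by blast
    have g'2: "g' z = z" if "z \<notin> ball 0 R" for z using g(3)[OF that] gg by metis
    have g'3: "dist (g' z) z \<le> \<eta>" for z using g(4)[of "g' z"] gg(2) by (simp add: dist_commute)
    define k where "k = restrict (lift g') (topspace S)"
    have hom: "homotopic_with (\<lambda>h. homeomorphic_map S S h \<and> (\<forall>x. x \<notin> \<kappa> ` ball 0 R \<longrightarrow> h x = x)) S S id (lift g')"
      by (rule lift_isotopy[OF g'1 g'2 g'3])
    have hom': "homotopic_with (homeomorphic_map S S) S S id (lift g')"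
      using hom by (rule homotopic_with_mono) simp
    have kh: "k \<in> homeos S" unfolding k_def
      using homotopic_with_imp_property[OF hom'] lift_orientation_preserving[OF S g'1 g'2 g'3] by (intro restrict_homeos) auto
    have kF2: "k \<in> co_basic S F2"
      unfolding k_def using g'2 kh \<eta> by (intro \<eta>1(2)) (auto simp: k_def intro: order_trans[OF g'3])
    define f' where "f' = compose (topspace S) k f"
    have f'W: "f' \<in> co_basic S W" unfolding f'_def by (rule F12[OF f(1) kF2])
    have "homotopic_with (homeomorphic_map S S) S S (id \<circ> f) (lift g' \<circ> f)"
      using hom' homeosD(4)[OF fh] by (rule homotopic_with_compose_continuous_map_right)
        (use homeosD(2)[OF fh] homeomorphic_map_compose in blast)
    then have "homotopic_with (homeomorphic_map S S) S S f f'"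
      by (rule homotopic_homeos_eq) (auto simp: f'_def compose_def k_def homeosD(7)[OF fh])
    then have iso: "(f, f') \<in> isotopy_rel S"
      using fh f'W by (simp add: isotopic_iff co_basic_def)
    have f'x: "f' x = lift g' (f x)" if "x \<in> topspace S" for x
      using that homeosD(7)[OF fh that] by (simp add: f'_def compose_def k_def)
    have "f' x = x" if x: "x \<in> C" for x
    proof -
      have xS: "x \<in> topspace S" using x C compactin_subset_topspace by blast
      have fx: "f x = x" using fO x O' by blast
      have "g' (\<psi> x) = \<psi> x" if xU: "x \<in> U"
      proof (cases "\<psi> x \<in> ball 0 R")
        case True
        have "g (\<psi> x) = \<psi> x"
        proof (rule g(5))
          fix y assume y: "y \<in> ball (\<psi> x) \<eta>" "y \<in> cball 0 R"
          have "\<kappa> y \<in> O'" using \<eta>2(2)[of "\<psi> x" y] True \<kappa>\<psi>[OF xU] x y \<eta> by auto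
          then show "fc y = y" using fO by (simp add: fc_def)
        qed
        then show ?thesis using gg by metis
      qed (use g'2 in auto)
      then show ?thesis using f'x[OF xS] fx \<kappa>\<psi> by (auto simp: lift_def)
    qed
    moreover have "f' x = x" if "x \<in> \<kappa> ` cball 0 r" for x
    proof -
      obtain z where z: "x = \<kappa> z" "z \<in> cball 0 r" using \<open>x \<in> \<kappa> ` cball 0 r\<close> by blast
      then have zR: "z \<in> cball 0 R" using r by simp
      have xS: "x \<in> topspace S" using z US \<kappa>_in by blast
      have "f x = \<kappa> (g z)" using fU(3)[OF zR] g(2) z by simp
      then show ?thesis using f'x[OF xS] z gg by (simp add: lift_def)
    qed
    ultimately show ?thesis using f'W iso by blast
  qed
  show ?thesis
  proof (intro exI[of _ "F1 \<union> F3"] conjI ballI impI)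
    show "co_pairs S (F1 \<union> F3)" by (rule co_pairs_Un[OF F1(1) F3(1)])
    show "idS S \<in> co_basic S (F1 \<union> F3)" unfolding co_basic_Un by (rule IntI[OF F1(2) F3(2)])
    fix f assume "f \<in> co_basic S (F1 \<union> F3)" and fO: "\<forall>x\<in>O'. f x = x"
    then have "f \<in> co_basic S F1" "f \<in> co_basic S F3" unfolding co_basic_Un by blast+
    then show "\<exists>f'\<in>co_basic S W. (f, f') \<in> isotopy_rel S \<and> (\<forall>x\<in>C \<union> \<kappa> ` cball 0 r. f' x = x)"
      by (rule *) (rule bspec[OF fO])
  qed
qed

end

lemma isotopic_trans: "(f, g) \<in> isotopy_rel S \<Longrightarrow> (g, h) \<in> isotopy_rel S \<Longrightarrow> (f, h) \<in> isotopy_rel S"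
  using equiv_isotopy[of S] unfolding equiv_def by (blast dest: transD)

text \<open>
  By induction on the set of charts. Each step needs the earlier discs fixed on slightly larger radii than it
  keeps, which is the reason for proving the statement for all radii below 3.
\<close>
lemma charts_correction:
  assumes S: "surface S" "connected_space S" and I: "finite I"
    and charts: "\<And>U \<psi> \<kappa>. (U, \<psi>, \<kappa>) \<in> I \<Longrightarrow> hausdorff_chart S U \<psi> \<kappa>"
    and "0 \<le> r" "r < (3::real)" and W: "co_pairs S W" "idS S \<in> co_basic S W"
  shows "\<exists>V. co_pairs S V \<and> idS S \<in> co_basic S V \<and>
    (\<forall>f\<in>co_basic S V. \<exists>f'\<in>co_basic S W. (f, f') \<in> isotopy_rel S \<and>
       (\<forall>d\<in>I. \<forall>z\<in>cball (0::complex) r. f' (snd (snd d) z) = snd (snd d) z))"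
  using I charts assms(5-8)
proof (induction I arbitrary: r W rule: finite_induct)
  case empty
  have "(f, f) \<in> isotopy_rel S" if "f \<in> co_basic S W" for f
    using that self_in_cls[of f S] by (auto simp: co_basic_def)
  then have "\<forall>f\<in>co_basic S W. \<exists>f'\<in>co_basic S W. (f, f') \<in> isotopy_rel S \<and>
      (\<forall>d\<in>{}. \<forall>z\<in>cball (0::complex) r. f' (snd (snd d) z) = snd (snd d) z)" by blast
  then show ?case using empty.prems(4,5) by (intro exI[of _ W] conjI)
next
  case (insert c I)
  obtain U \<psi> \<kappa> where c: "c = (U, \<psi>, \<kappa>)" by (cases c)
  interpret hausdorff_chart S U \<psi> \<kappa> using insert.prems(1) c by simp
  \<comment> \<open>room between the radius to be kept and the bound 3\<close>
  define r' where "r' = (r + 3) / 2"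
  have r': "r < r'" "r' < 3" "0 \<le> r'" using insert.prems by (auto simp: r'_def)
  have ch: "hausdorff_chart S (fst d) (fst (snd d)) (snd (snd d))" if "d \<in> I" for d
    using insert.prems(1)[of "fst d" "fst (snd d)" "snd (snd d)"] that by simp
  define C where "C = \<Union> ((\<lambda>d. snd (snd d) ` cball 0 r) ` I)"
  define O' where "O' = \<Union> ((\<lambda>d. snd (snd d) ` ball 0 r') ` I)"
  have cC: "compactin S C" unfolding C_def
    using insert.hyps(1) hausdorff_chart.compact_\<kappa>[OF ch] by (intro compactin_Union) auto
  have oO: "openin S O'" unfolding O'_def
    using hausdorff_chart.open_\<kappa>[OF ch] by (intro openin_Union) auto
  have "cball (0::complex) r \<subseteq> ball 0 r'" using r' by auto
  then have CO: "C \<subseteq> O'" unfolding C_def O'_def by blast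
  from chart_correction[OF S insert.prems(2,3) cC oO CO insert.prems(4,5)]
  obtain V1 where V1: "co_pairs S V1" "idS S \<in> co_basic S V1"
    "\<forall>f\<in>co_basic S V1. (\<forall>x\<in>O'. f x = x) \<longrightarrow>
       (\<exists>f'\<in>co_basic S W. (f, f') \<in> isotopy_rel S \<and> (\<forall>x\<in>C \<union> \<kappa> ` cball 0 r. f' x = x))"
    by (elim exE conjE)
  have "\<exists>V. co_pairs S V \<and> idS S \<in> co_basic S V \<and>
    (\<forall>f\<in>co_basic S V. \<exists>f'\<in>co_basic S V1. (f, f') \<in> isotopy_rel S \<and>
       (\<forall>d\<in>I. \<forall>z\<in>cball (0::complex) r'. f' (snd (snd d) z) = snd (snd d) z))"
    by (rule insert.IH[OF _ r'(3,2) V1(1,2)]) (rule insert.prems(1), rule insertI2)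
  then obtain V where V: "co_pairs S V" "idS S \<in> co_basic S V"
    "\<forall>f\<in>co_basic S V. \<exists>f'\<in>co_basic S V1. (f, f') \<in> isotopy_rel S \<and>
       (\<forall>d\<in>I. \<forall>z\<in>cball (0::complex) r'. f' (snd (snd d) z) = snd (snd d) z)"
    by (elim exE conjE)
  have "\<exists>f'\<in>co_basic S W. (f, f') \<in> isotopy_rel S \<and> (\<forall>d\<in>insert c I. \<forall>z\<in>cball (0::complex) r. f' (snd (snd d) z) = snd (snd d) z)"
    if f: "f \<in> co_basic S V" for f
  proof -
    obtain f1 where f1: "f1 \<in> co_basic S V1" "(f, f1) \<in> isotopy_rel S"
      "\<And>d z. d \<in> I \<Longrightarrow> z \<in> cball 0 r' \<Longrightarrow> f1 (snd (snd d) z) = snd (snd d) z"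
      using bspec[OF V(3) f] by (elim bexE conjE) blast
    have "\<forall>x\<in>O'. f1 x = x"
    proof
      fix x assume "x \<in> O'"
      then obtain d z where "d \<in> I" "z \<in> ball 0 r'" "x = snd (snd d) z" unfolding O'_def by blast
      then show "f1 x = x" using f1(3)[of d z] by simp
    qed
    then obtain f' where f': "f' \<in> co_basic S W" "(f1, f') \<in> isotopy_rel S" "\<And>x. x \<in> C \<union> \<kappa> ` cball 0 r \<Longrightarrow> f' x = x"
      using bspec[OF V1(3) f1(1)] by (elim impE bexE conjE) blast+
    have "f' (snd (snd d) z) = snd (snd d) z" if "d \<in> insert c I" "z \<in> cball 0 r" for d z
    proof (cases "d = c")
      case True
      then show ?thesis using that f'(3)[of "\<kappa> z"] unfolding c by auto
    next
      case False
      then have "snd (snd d) z \<in> C" using that unfolding C_def by blast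
      then show ?thesis using f'(3) by blast
    qed
    then show ?thesis using f'(1) isotopic_trans[OF f1(2) f'(2)] by blast
  qed
  then show ?case using V(1,2) by (intro exI[of _ V] conjI ballI)
qed

text \<open>
  Cover \<open>K\<close> by unit discs in finitely many charts.
\<close>
theorem near_identity_isotopic_to_fixing:
  assumes S: "surface S" "connected_space S" and K: "compactin S K"
  shows "\<exists>V. openin (compact_open_topology S) V \<and> idS S \<in> V \<and>
    (\<forall>f\<in>V. \<exists>f'. (f, f') \<in> isotopy_rel S \<and> (\<forall>x\<in>K. f' x = x))"
proof -
  have "\<exists>U \<psi> \<kappa>. hausdorff_chart S U \<psi> \<kappa> \<and> x = \<kappa> 0" if "x \<in> K" for x
    using surface_centered_chart[OF S(1), of x] that K compactin_subset_topspace by (metis subsetD)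
  then obtain U \<psi> \<kappa> where ch: "\<And>x. x \<in> K \<Longrightarrow> hausdorff_chart S (U x) (\<psi> x) (\<kappa> x) \<and> x = \<kappa> x 0" by metis
  have nb: "openin S (\<kappa> x ` ball 0 1) \<and> x \<in> \<kappa> x ` ball 0 1" if "x \<in> K" for x
  proof -
    interpret hausdorff_chart S "U x" "\<psi> x" "\<kappa> x" using ch[OF that] by blast
    have "x = \<kappa> x 0" using ch[OF that] by blast
    then show ?thesis using open_\<kappa>[of "ball 0 1"] by (metis centre_in_ball image_eqI open_ball zero_less_one)
  qed
  obtain T where T: "finite T" "T \<subseteq> K" "K \<subseteq> (\<Union>x\<in>T. \<kappa> x ` ball 0 1)"
    using finite_subcover_by_nbhds[OF K nb] by blast
  define I where "I = (\<lambda>x. (U x, \<psi> x, \<kappa> x)) ` T"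
  have "\<exists>V. co_pairs S V \<and> idS S \<in> co_basic S V \<and>
    (\<forall>f\<in>co_basic S V. \<exists>f'\<in>co_basic S {}. (f, f') \<in> isotopy_rel S \<and>
       (\<forall>d\<in>I. \<forall>z\<in>cball (0::complex) 1. f' (snd (snd d) z) = snd (snd d) z))"
    by (rule charts_correction[OF S]) (use T ch one_homeos in \<open>auto simp: I_def co_pairs_def co_basic_def\<close>)
  then obtain V where V: "co_pairs S V" "idS S \<in> co_basic S V"
    "\<And>f. f \<in> co_basic S V \<Longrightarrow> \<exists>f'. (f, f') \<in> isotopy_rel S \<and> (\<forall>d\<in>I. \<forall>z\<in>cball (0::complex) 1. f' (snd (snd d) z) = snd (snd d) z)"
    by blast
  have "\<exists>f'. (f, f') \<in> isotopy_rel S \<and> (\<forall>x\<in>K. f' x = x)" if f: "f \<in> co_basic S V" for f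
  proof -
    obtain f' where f': "(f, f') \<in> isotopy_rel S" "\<forall>d\<in>I. \<forall>z\<in>cball (0::complex) 1. f' (snd (snd d) z) = snd (snd d) z"
      using V(3)[OF f] by blast
    have "f' x = x" if "x \<in> K" for x
    proof -
      obtain y z where "y \<in> T" "x = \<kappa> y z" "z \<in> ball 0 1" using T(3) \<open>x \<in> K\<close> by blast
      moreover have "\<forall>z\<in>cball (0::complex) 1. f' (snd (snd (U y, \<psi> y, \<kappa> y)) z) = snd (snd (U y, \<psi> y, \<kappa> y)) z"
        using f'(2) \<open>y \<in> T\<close> unfolding I_def by blast
      ultimately show ?thesis by simp
    qed
    then show ?thesis using f'(1) by blast
  qed
  then show ?thesis using openin_co_basic[OF V(1)] V(2) by blast
qed

section \<open>The action on grand arcs\<close>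
text \<open>
  The action of the homeomorphism \<open>f\<close> with inverse \<open>g\<close> on ends.
\<close>
definition push_end :: "'a topology \<Rightarrow> ('a \<Rightarrow> 'a) \<Rightarrow> ('a \<Rightarrow> 'a) \<Rightarrow> ('a set \<Rightarrow> 'a set) \<Rightarrow> 'a set \<Rightarrow> 'a set" where
  "push_end S f g e = (\<lambda>K\<in>{K. compactin S K}. f ` e (g ` K))"

text \<open>
  Keeping the inverse as a parameter makes the situation symmetric, so that one inclusion proves an equality.
\<close>
locale self_homeomorphism =
  fixes S :: "'a topology" and f g :: "'a \<Rightarrow> 'a"
  assumes maps: "homeomorphic_maps S S f g"
begin

lemma inverse: "self_homeomorphism S g f"
  by unfold_locales (rule maps[unfolded homeomorphic_maps_sym[of S S f g]])

lemma homeo: "homeomorphic_map S S f" "homeomorphic_map S S g"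
  using maps unfolding homeomorphic_maps_map by auto

lemma cancel: "x \<in> topspace S \<Longrightarrow> g (f x) = x" "x \<in> topspace S \<Longrightarrow> f (g x) = x"
  using maps by (auto simp: homeomorphic_maps_def)

lemma into: "x \<in> topspace S \<Longrightarrow> f x \<in> topspace S" "x \<in> topspace S \<Longrightarrow> g x \<in> topspace S"
  using maps by (auto simp: homeomorphic_maps_def dest: continuous_map_funspace)

lemma image_cancel: "A \<subseteq> topspace S \<Longrightarrow> g ` f ` A = A" "A \<subseteq> topspace S \<Longrightarrow> f ` g ` A = A"
  using cancel by (force simp: image_image)+

lemma compact_image: "compactin S K \<Longrightarrow> compactin S (f ` K)" "compactin S K \<Longrightarrow> compactin S (g ` K)"
  using image_compactin[OF _ homeomorphic_imp_continuous_map] homeo by auto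

lemma end_component: "e \<in> ends S \<Longrightarrow> compactin S K \<Longrightarrow> e K \<in> connected_components_of (subtopology S (topspace S - K))"
  by (auto simp: ends_def PiE_def Pi_def)

lemma end_subset: "e \<in> ends S \<Longrightarrow> compactin S K \<Longrightarrow> e K \<subseteq> topspace S"
  using end_component[of e K] connected_components_of_subset by fastforce

lemma push_end_in:
  assumes e: "e \<in> ends S" shows "push_end S f g e \<in> ends S"
proof -
  have comp: "f ` e (g ` K) \<in> connected_components_of (subtopology S (topspace S - K))" if K: "compactin S K" for K
  proof -
    have KT: "K \<subseteq> topspace S" using K compactin_subset_topspace by blast
    have "f ` (topspace S \<inter> (topspace S - g ` K)) = topspace S \<inter> (topspace S - K)"
    proof (intro equalityI subsetI)
      fix y assume y: "y \<in> topspace S \<inter> (topspace S - K)"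
      have "g y \<notin> g ` K"
      proof
        assume "g y \<in> g ` K"
        then obtain k where k: "k \<in> K" "g y = g k" by blast
        then have "y = k" using cancel(2)[of y] cancel(2)[of k] KT y by auto
        then show False using k y by blast
      qed
      then have "g y \<in> topspace S - g ` K" using into(2)[of y] y by blast
      then show "y \<in> f ` (topspace S \<inter> (topspace S - g ` K))" using y cancel(2)[of y] by (intro image_eqI[of _ _ "g y"]) auto
    next
      fix y assume "y \<in> f ` (topspace S \<inter> (topspace S - g ` K))"
      then obtain x where "x \<in> topspace S" "x \<notin> g ` K" "y = f x" by blast
      then show "y \<in> topspace S \<inter> (topspace S - K)" using into(1)[of x] cancel(1)[of x] by force
    qed
    then have hm: "homeomorphic_map (subtopology S (topspace S - g ` K)) (subtopology S (topspace S - K)) f"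
      by (rule homeomorphic_map_subtopologies[OF homeo(1)])
    show ?thesis
      unfolding homeomorphic_map_connected_components_of[OF hm]
      by (intro imageI end_component[OF e compact_image(2)[OF K]])
  qed
  have "f ` e (g ` L) \<subseteq> f ` e (g ` K)" if KL: "compactin S K" "compactin S L" "K \<subseteq> L" for K L
  proof -
    have "e (g ` L) \<subseteq> e (g ` K)"
      using e compact_image(2)[OF KL(1)] compact_image(2)[OF KL(2)] image_mono[OF KL(3), of g] by (simp add: ends_def)
    then show ?thesis by blast
  qed
  then show ?thesis using comp by (simp add: ends_def push_end_def)
qed

lemma push_end_cancel:
  assumes e: "e \<in> ends S" shows "push_end S g f (push_end S f g e) = e"
proof
  fix K show "push_end S g f (push_end S f g e) K = e K"
  proof (cases "compactin S K")
    case True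
    have "g ` f ` e (g ` f ` K) = e K"
      using image_cancel(1) compactin_subset_topspace[OF True] end_subset[OF e True] by simp
    then show ?thesis using True compact_image by (simp add: push_end_def)
  next
    case False
    then show ?thesis using e by (auto simp: push_end_def ends_def PiE_def extensional_def)
  qed
qed

lemma topspace_ends: "topspace (ends_topology S) = ends S"
proof -
  have "\<Union> {{e \<in> ends S. e K = C} |K C. compactin S K} = ends S"
    using compactin_empty[of S] by blast
  then show ?thesis by (simp add: ends_topology_def topology_generated_by_topspace)
qed

text \<open>
  The preimage of a basic open set is a union of basic open sets, one for each component that \<open>f\<close>
  maps to the given one.
\<close>
lemma continuous_push_end: "continuous_map (ends_topology S) (ends_topology S) (push_end S f g)"
proof -
  let ?B = "{{e \<in> ends S. e K = C} |K C. compactin S K}"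
  have "openin (ends_topology S) (push_end S f g -` U \<inter> ends S)" if U: "U \<in> ?B" for U
  proof -
    obtain K C where K: "U = {e \<in> ends S. e K = C}" "compactin S K" using U by blast
    have "push_end S f g -` U \<inter> ends S = (\<Union>D\<in>{D. f ` D = C}. {e \<in> ends S. e (g ` K) = D})"
      using K push_end_in by (auto simp: push_end_def)
    moreover have "openin (ends_topology S) {e \<in> ends S. e (g ` K) = D}" for D
      unfolding ends_topology_def using compact_image(2)[OF K(2)] by (intro topology_generated_by_Basis) blast
    ultimately show ?thesis by (auto intro!: openin_Union)
  qed
  moreover have "push_end S f g ` ends S \<subseteq> \<Union> ?B" using push_end_in compactin_empty[of S] by blast
  ultimately show ?thesis
    using continuous_on_generated_topo_iff[of "ends_topology S" ?B "push_end S f g"] topspace_ends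
    by (simp add: ends_topology_def)
qed

lemma homeomorphic_push_end: "homeomorphic_maps (ends_topology S) (ends_topology S) (push_end S f g) (push_end S g f)"
  using continuous_push_end self_homeomorphism.continuous_push_end[OF inverse] push_end_cancel
    self_homeomorphism.push_end_cancel[OF inverse]
  by (simp add: homeomorphic_maps_def topspace_ends)

lemma planar_push_end:
  assumes e: "e \<in> ends S" and p: "planar_end S e" shows "planar_end S (push_end S f g e)"
proof -
  obtain K and P :: "(real^2) set" where K: "compactin S K" "subtopology S (e K) homeomorphic_space top_of_set P"
    using p unfolding planar_end_def by blast
  have eK: "e K \<subseteq> topspace S" by (rule end_subset[OF e K(1)])
  have "f ` (topspace S \<inter> e K) = topspace S \<inter> f ` e K" using eK into(1) by (auto simp: Int_absorb1 subset_iff)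
  then have "homeomorphic_map (subtopology S (e K)) (subtopology S (f ` e K)) f"
    by (rule homeomorphic_map_subtopologies[OF homeo(1)])
  then have "subtopology S (f ` e K) homeomorphic_space subtopology S (e K)"
    using homeomorphic_map_imp_homeomorphic_space homeomorphic_space_sym by blast
  moreover have "push_end S f g e (f ` K) = f ` e K"
    using image_cancel(1)[OF compactin_subset_topspace[OF K(1)]] compact_image(1)[OF K(1)] by (simp add: push_end_def)
  ultimately show ?thesis unfolding planar_end_def
    using K(2) homeomorphic_space_trans compact_image(1)[OF K(1)] by metis
qed

lemma nonplanar_push_end:
  assumes e: "e \<in> ends S" shows "push_end S f g e \<in> nonplanar_ends S \<longleftrightarrow> e \<in> nonplanar_ends S"
  using e push_end_in[OF e] planar_push_end[OF e] self_homeomorphism.planar_push_end[OF inverse push_end_in[OF e]] push_end_cancel[OF e]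
  by (auto simp: nonplanar_ends_def)

lemma clopen_push_end:
  "openin (ends_topology S) U \<Longrightarrow> openin (ends_topology S) (push_end S f g ` U)"
  "closedin (ends_topology S) U \<Longrightarrow> closedin (ends_topology S) (push_end S f g ` U)"
proof -
  have h: "homeomorphic_map (ends_topology S) (ends_topology S) (push_end S f g)"
    using homeomorphic_push_end unfolding homeomorphic_maps_map by simp
  show "openin (ends_topology S) U \<Longrightarrow> openin (ends_topology S) (push_end S f g ` U)"
    using homeomorphic_map_openness_eq[OF h] by blast
  show "closedin (ends_topology S) U \<Longrightarrow> closedin (ends_topology S) (push_end S f g ` U)"
    using homeomorphic_map_closedness_eq[OF h] by blast
qed

lemma homeomorphic_end_sets_push:
  assumes V: "V \<subseteq> ends S" shows "homeomorphic_end_sets S V (push_end S f g ` V)"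
proof -
  have "push_end S f g ` (topspace (ends_topology S) \<inter> V) = topspace (ends_topology S) \<inter> push_end S f g ` V"
    using V push_end_in by (auto simp: topspace_ends subset_iff)
  then have "homeomorphic_map (subtopology (ends_topology S) V) (subtopology (ends_topology S) (push_end S f g ` V)) (push_end S f g)"
    using homeomorphic_push_end homeomorphic_map_subtopologies unfolding homeomorphic_maps_map by auto
  moreover have "push_end S f g ` (V \<inter> nonplanar_ends S) = push_end S f g ` V \<inter> nonplanar_ends S"
    using V nonplanar_push_end by blast
  ultimately show ?thesis unfolding homeomorphic_end_sets_def by blast
qed

end

lemma homeomorphic_end_sets_trans:
  assumes "homeomorphic_end_sets S U V" "homeomorphic_end_sets S V W"
  shows "homeomorphic_end_sets S U W"
proof -
  obtain h where h: "homeomorphic_map (subtopology (ends_topology S) U) (subtopology (ends_topology S) V) h"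
    "h ` (U \<inter> nonplanar_ends S) = V \<inter> nonplanar_ends S" using assms(1) unfolding homeomorphic_end_sets_def by blast
  obtain k where k: "homeomorphic_map (subtopology (ends_topology S) V) (subtopology (ends_topology S) W) k"
    "k ` (V \<inter> nonplanar_ends S) = W \<inter> nonplanar_ends S" using assms(2) unfolding homeomorphic_end_sets_def by blast
  have "(k \<circ> h) ` (U \<inter> nonplanar_ends S) = W \<inter> nonplanar_ends S" unfolding image_comp[symmetric] h(2) k(2) ..
  then show ?thesis unfolding homeomorphic_end_sets_def using homeomorphic_map_compose[OF h(1) k(1)] by blast
qed

context self_homeomorphism
begin

text \<open>
  Conjugate the homeomorphism of end sets by the action of \<open>f\<close> on the space of ends.
\<close>
lemma end_le_push:
  assumes y: "y \<in> ends S" and x: "x \<in> ends S" and le: "end_le S y x"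
  shows "end_le S (push_end S f g y) (push_end S f g x)"
  unfolding end_le_def
proof (intro allI impI)
  interpret i: self_homeomorphism S g f by (rule inverse)
  let ?h = "push_end S f g" and ?k = "push_end S g f"
  fix U assume U: "clopen_end_nbhd S (?h x) U"
  then have UE: "U \<subseteq> ends S" "?h x \<in> U"
    using openin_subset[of "ends_topology S" U] unfolding clopen_end_nbhd_def topspace_ends by simp_all
  have "x \<in> ?k ` U" using push_end_cancel[OF x] UE(2) by (metis imageI)
  then have "clopen_end_nbhd S x (?k ` U)" using U i.clopen_push_end by (simp add: clopen_end_nbhd_def)
  then obtain V W where V: "clopen_end_nbhd S y V" and W: "W \<subseteq> ?k ` U" "openin (ends_topology S) W" "closedin (ends_topology S) W"
    and VW: "homeomorphic_end_sets S V W"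
    using le unfolding end_le_def by blast
  have VE: "V \<subseteq> ends S" "W \<subseteq> ends S" 
    using V openin_subset[of "ends_topology S" V] openin_subset[OF W(2)] unfolding clopen_end_nbhd_def topspace_ends by simp_all
  have hV: "clopen_end_nbhd S (?h y) (?h ` V)" using V clopen_push_end by (auto simp: clopen_end_nbhd_def)
  have "?h ` W \<subseteq> U"
  proof
    fix z assume "z \<in> ?h ` W"
    then obtain u where "u \<in> U" "z = ?h (?k u)" using W(1) by blast
    then show "z \<in> U" using i.push_end_cancel UE(1) by auto
  qed
  moreover have "homeomorphic_end_sets S (?h ` V) (?h ` W)"
  proof -
    have "?k ` ?h ` V = V" using push_end_cancel VE(1) by (force simp: image_image)
    moreover have "?h ` V \<subseteq> ends S" using VE(1) push_end_in by blast
    ultimately have "homeomorphic_end_sets S (?h ` V) V" using i.homeomorphic_end_sets_push[of "?h ` V"] by simp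
    then show ?thesis using VW homeomorphic_end_sets_push[OF VE(2)] homeomorphic_end_sets_trans by blast
  qed
  ultimately show "\<exists>V W. clopen_end_nbhd S (?h y) V \<and> W \<subseteq> U \<and> openin (ends_topology S) W \<and> closedin (ends_topology S) W \<and> homeomorphic_end_sets S V W"
    using hV clopen_push_end(1)[OF W(2)] clopen_push_end(2)[OF W(3)] by blast
qed

lemma end_le_push_iff:
  assumes y: "y \<in> ends S" and x: "x \<in> ends S"
  shows "end_le S (push_end S f g y) (push_end S f g x) \<longleftrightarrow> end_le S y x"
  using end_le_push[OF y x] self_homeomorphism.end_le_push[OF inverse push_end_in[OF y] push_end_in[OF x]]
    push_end_cancel[OF y] push_end_cancel[OF x] by auto

lemma maximal_push_end:
  assumes "maximal_end S x" shows "maximal_end S (push_end S f g x)"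
proof -
  interpret i: self_homeomorphism S g f by (rule inverse)
  have x: "x \<in> ends S" using assms by (simp add: maximal_end_def)
  have "end_le S y (push_end S f g x)" if y: "y \<in> ends S" "end_le S (push_end S f g x) y" for y
  proof -
    have "end_le S x (push_end S g f y)"
      using i.end_le_push[OF push_end_in[OF x] y] push_end_cancel[OF x] by simp
    then have "end_le S (push_end S g f y) x" using assms i.push_end_in[OF y(1)] by (simp add: maximal_end_def)
    from end_le_push[OF i.push_end_in[OF y(1)] x this] show ?thesis using i.push_end_cancel[OF y(1)] by simp
  qed
  then show ?thesis using push_end_in[OF x] by (simp add: maximal_end_def)
qed

lemma converges_push:
  assumes "converges_to_end S \<alpha> e F" shows "converges_to_end S (f \<circ> \<alpha>) (push_end S f g e) F"
  unfolding converges_to_end_def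
proof (intro allI impI)
  fix K assume K: "compactin S K"
  have "\<forall>\<^sub>F t in F. \<alpha> t \<in> e (g ` K)" using assms compact_image(2)[OF K] by (simp add: converges_to_end_def)
  then show "\<forall>\<^sub>F t in F. (f \<circ> \<alpha>) t \<in> push_end S f g e K"
    by (rule eventually_mono) (use K in \<open>simp add: push_end_def\<close>)
qed

lemma grand_arc_image:
  assumes "grand_arc S A" shows "grand_arc S (f ` A)"
proof -
  obtain \<alpha> x y where a: "continuous_map euclideanreal S \<alpha>" "inj \<alpha>" "proper_map euclideanreal S \<alpha>" "A = range \<alpha>"
    and e: "maximal_end S x" "maximal_end S y" "\<not> same_end_type S x y"
    and c: "converges_to_end S \<alpha> x at_bot" "converges_to_end S \<alpha> y at_top"
    using assms unfolding grand_arc_def by (elim exE conjE)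
  have E: "x \<in> ends S" "y \<in> ends S" using e by (auto simp: maximal_end_def)
  have "\<alpha> t \<in> topspace S" for t using continuous_map_funspace[OF a(1)] by auto
  then have "inj (f \<circ> \<alpha>)" using a(2) cancel(1) unfolding inj_def by (metis comp_apply)
  moreover have "f ` A = range (f \<circ> \<alpha>)" using a(4) by (simp add: image_comp)
  moreover have "\<not> same_end_type S (push_end S f g x) (push_end S f g y)"
    using e(3) end_le_push_iff[OF E] end_le_push_iff[OF E(2,1)] by (simp add: same_end_type_def)
  ultimately show ?thesis unfolding grand_arc_def
    using continuous_map_compose[OF a(1) homeomorphic_imp_continuous_map[OF homeo(1)]]
      proper_map_compose[OF a(3) homeomorphic_imp_proper_map[OF homeo(1)]]
      maximal_push_end[OF e(1)] maximal_push_end[OF e(2)] converges_push[OF c(1)] converges_push[OF c(2)]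
    by blast
qed

end

lemma homeos_self_homeomorphism:
  assumes f: "f \<in> homeos S" shows "self_homeomorphism S f (hinv S f)"
  using homeosD(4)[OF f] homeosD(4)[OF hinv_homeos[OF f]] hinv_apply[OF f]
  by unfold_locales (simp add: homeomorphic_maps_def del: restrict_apply)

lemma grand_arc_homeo: "f \<in> homeos S \<Longrightarrow> grand_arc S A \<Longrightarrow> grand_arc S (f ` A)"
  using self_homeomorphism.grand_arc_image[OF homeos_self_homeomorphism] by blast

lemma grand_arc_subset: "grand_arc S A \<Longrightarrow> A \<subseteq> topspace S"
  unfolding grand_arc_def using continuous_map_funspace by fastforce

lemma compose_image: "A \<subseteq> topspace S \<Longrightarrow> compose (topspace S) f g ` A = f ` g ` A"
  by (force simp: compose_def image_image)

lemma idS_image: "A \<subseteq> topspace S \<Longrightarrow> (\<lambda>x\<in>topspace S. x) ` A = A"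
  by (force simp: subset_iff)

abbreviation arc_cls :: "'a topology \<Rightarrow> 'a set \<Rightarrow> 'a set set" where
  "arc_cls S A \<equiv> arc_isotopy_rel S `` {A}"

lemma arc_isotopy_iff:
  "(A, B) \<in> arc_isotopy_rel S \<longleftrightarrow> grand_arc S A \<and> grand_arc S B \<and> (\<exists>j \<in> cls S (\<lambda>x\<in>topspace S. x). j ` A = B)"
  by (simp add: arc_isotopy_rel_def homeo_group_simps)

lemma isotopic_hinv:
  assumes "f' \<in> cls S f" shows "compose (topspace S) f' (hinv S f) \<in> cls S (\<lambda>x\<in>topspace S. x)"
proof -
  have f: "f \<in> homeos S" "f' \<in> homeos S" "(f, f') \<in> isotopy_rel S" using in_cls_homeos[OF assms] assms by auto
  have "(hinv S f, hinv S f) \<in> isotopy_rel S" using self_in_cls[OF hinv_homeos[OF f(1)]] by simp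
  from isotopic_compose[OF f(3) this] have "(compose (topspace S) f (hinv S f), compose (topspace S) f' (hinv S f)) \<in> isotopy_rel S" .
  moreover have "compose (topspace S) f (hinv S f) = (\<lambda>x\<in>topspace S. x)"
    using hinv_apply(2)[OF f(1)] by (auto simp: compose_def fun_eq_iff)
  ultimately show ?thesis by simp
qed

text \<open>
  The ambient isotopy that carries \<open>f ` A\<close> to \<open>f' ` A\<close> ends with \<open>f' f\<^sup>-\<^sup>1\<close>.
\<close>
lemma image_isotopic:
  assumes "f' \<in> cls S f" "grand_arc S A" shows "(f ` A, f' ` A) \<in> arc_isotopy_rel S"
proof -
  have f: "f \<in> homeos S" "f' \<in> homeos S" using in_cls_homeos[OF assms(1)] by auto
  note AT = grand_arc_subset[OF assms(2)]
  have fA: "f ` A \<subseteq> topspace S" using AT homeosD(7)[OF f(1)] by blast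
  have "hinv S f ` f ` A = A" using AT hinv_apply(1)[OF f(1)] by (force simp: image_image simp del: restrict_apply)
  then have "compose (topspace S) f' (hinv S f) ` f ` A = f' ` A" using compose_image[OF fA] by metis
  then show ?thesis using isotopic_hinv[OF assms(1)] grand_arc_homeo f assms(2) unfolding arc_isotopy_iff by blast
qed

text \<open>
  An isotopy of the arc is absorbed into the homeomorphism.
\<close>
lemma arc_isotopy_image:
  assumes AB: "(A, B) \<in> arc_isotopy_rel S" and f: "f \<in> homeos S"
  shows "\<exists>f'\<in>cls S f. f ` B = f' ` A"
proof -
  obtain j where A: "grand_arc S A" and j: "j \<in> cls S (\<lambda>x\<in>topspace S. x)" "j ` A = B" using AB unfolding arc_isotopy_iff by blast
  have "(f, f) \<in> isotopy_rel S" using self_in_cls[OF f] by simp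
  moreover have "(\<lambda>x\<in>topspace S. x, j) \<in> isotopy_rel S" using j(1) by simp
  ultimately have "(compose (topspace S) f (\<lambda>x\<in>topspace S. x), compose (topspace S) f j) \<in> isotopy_rel S"
    by (rule isotopic_compose)
  moreover have "compose (topspace S) f (\<lambda>x\<in>topspace S. x) = f"
    using homeosD(1)[OF f] by (auto simp: compose_def fun_eq_iff extensional_def)
  ultimately have "compose (topspace S) f j \<in> cls S f" by simp
  moreover have "f ` B = compose (topspace S) f j ` A" using compose_image[OF grand_arc_subset[OF A]] j(2) by metis
  ultimately show ?thesis by blast
qed

lemma equiv_arc_isotopy: "equiv {A. grand_arc S A} (arc_isotopy_rel S)"
proof (rule equivI)
  show "arc_isotopy_rel S \<subseteq> {A. grand_arc S A} \<times> {A. grand_arc S A}" by (auto simp: arc_isotopy_iff)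
  have r: "(A, A) \<in> arc_isotopy_rel S" if "grand_arc S A" for A
    using that self_in_cls[OF one_homeos] idS_image[OF grand_arc_subset[OF that]] unfolding arc_isotopy_iff by blast
  then show "refl_on {A. grand_arc S A} (arc_isotopy_rel S)" by (auto simp: refl_on_def arc_isotopy_iff)
  have s: "(B, A) \<in> arc_isotopy_rel S" if AB: "(A, B) \<in> arc_isotopy_rel S" for A B
  proof -
    obtain j where A: "grand_arc S A" "grand_arc S B" and j: "j \<in> cls S (\<lambda>x\<in>topspace S. x)" "j ` A = B" using AB unfolding arc_isotopy_iff by blast
    have "(\<lambda>x\<in>topspace S. x) \<in> cls S j" using in_cls_homeos[OF j(1)] self_in_cls by blast
    from image_isotopic[OF this A(1)] show ?thesis using idS_image[OF grand_arc_subset[OF A(1)]] j(2) by simp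
  qed
  then show "sym (arc_isotopy_rel S)" by (auto intro: symI)
  show "trans (arc_isotopy_rel S)"
  proof (rule transI)
    fix A B C assume AB: "(A, B) \<in> arc_isotopy_rel S" and BC: "(B, C) \<in> arc_isotopy_rel S"
    have g: "grand_arc S A" "grand_arc S B" "grand_arc S C" using AB BC by (auto simp: arc_isotopy_iff)
    obtain j where j: "j \<in> cls S (\<lambda>x\<in>topspace S. x)" "j ` B = C" using BC unfolding arc_isotopy_iff by blast
    obtain f' where f': "f' \<in> cls S j" "j ` B = f' ` A" using arc_isotopy_image[OF AB, of j] in_cls_homeos[OF j(1)] by blast
    then have "f' \<in> cls S (\<lambda>x\<in>topspace S. x)" using in_cls_homeos[OF j(1)] by blast
    then show "(A, C) \<in> arc_isotopy_rel S" using g f'(2) j(2) unfolding arc_isotopy_iff by metis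
  qed
qed

lemma verts_grand_arc_graph: "verts (grand_arc_graph S) = arc_cls S ` {A. grand_arc S A}"
  by (auto simp: grand_arc_graph_def quotient_def)

lemma grand_arc_action_cls:
  assumes f: "f \<in> homeos S" and A: "grand_arc S A"
  shows "grand_arc_action S (cls S f) (arc_cls S A) = arc_cls S (f ` A)"
proof -
  note fA = grand_arc_homeo[OF f A]
  have "{h ` B |h B. h \<in> cls S f \<and> B \<in> arc_cls S A} = arc_cls S (f ` A)"
  proof (intro equalityI subsetI)
    fix C assume "C \<in> {h ` B |h B. h \<in> cls S f \<and> B \<in> arc_cls S A}"
    then obtain h B where h: "C = h ` B" "h \<in> cls S f" "(A, B) \<in> arc_isotopy_rel S" by blast
    have hh: "h \<in> homeos S" "cls S h = cls S f" using in_cls_homeos[OF h(2)] by auto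
    obtain f' where "f' \<in> cls S h" "h ` B = f' ` A" using arc_isotopy_image[OF h(3) hh(1)] by blast
    then show "C \<in> arc_cls S (f ` A)" using image_isotopic[of f' S f A] A hh(2) h(1) by simp
  next
    fix C assume C: "C \<in> arc_cls S (f ` A)"
    then obtain j where j: "j \<in> cls S (\<lambda>x\<in>topspace S. x)" "j ` f ` A = C" by (auto simp: arc_isotopy_iff)
    have "(\<lambda>x\<in>topspace S. x, j) \<in> isotopy_rel S" "(f, f) \<in> isotopy_rel S" using j(1) self_in_cls[OF f] by auto
    from isotopic_compose[OF this] have "(compose (topspace S) (\<lambda>x\<in>topspace S. x) f, compose (topspace S) j f) \<in> isotopy_rel S" .
    moreover have "compose (topspace S) (\<lambda>x\<in>topspace S. x) f = f"
      using homeosD(1)[OF f] homeosD(7)[OF f] by (auto simp: compose_def fun_eq_iff extensional_def)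
    ultimately have "compose (topspace S) j f \<in> cls S f" by simp
    moreover have "A \<in> arc_cls S A" using A equiv_class_self[OF equiv_arc_isotopy] by blast
    moreover have "C = compose (topspace S) j f ` A" using j(2) compose_image[OF grand_arc_subset[OF A]] by metis
    ultimately show "C \<in> {h ` B |h B. h \<in> cls S f \<and> B \<in> arc_cls S A}" by blast
  qed
  then show ?thesis using A by (simp add: grand_arc_action_def verts_grand_arc_graph)
qed

lemma grand_arc_action_closed:
  "g \<in> carrier (Map S) \<Longrightarrow> v \<in> verts (grand_arc_graph S) \<Longrightarrow> grand_arc_action S g v \<in> verts (grand_arc_graph S)"
  using grand_arc_action_cls grand_arc_homeo by (fastforce simp: carrier_Map verts_grand_arc_graph)

lemma grand_arc_action_mult:
  assumes "g \<in> carrier (Map S)" "h \<in> carrier (Map S)" "v \<in> verts (grand_arc_graph S)"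
  shows "grand_arc_action S (g \<otimes>\<^bsub>Map S\<^esub> h) v = grand_arc_action S g (grand_arc_action S h v)"
proof -
  obtain a b A where r: "g = cls S a" "a \<in> homeos S" "h = cls S b" "b \<in> homeos S" "v = arc_cls S A" "grand_arc S A"
    using assms unfolding carrier_Map verts_grand_arc_graph by blast
  show ?thesis unfolding r(1,3,5) cls_mult[OF r(2,4)]
    grand_arc_action_cls[OF compose_homeos[OF r(2,4)] r(6)] grand_arc_action_cls[OF r(4,6)]
    grand_arc_action_cls[OF r(2) grand_arc_homeo[OF r(4,6)]] compose_image[OF grand_arc_subset[OF r(6)]] ..
qed

lemma grand_arc_action_one:
  assumes "v \<in> verts (grand_arc_graph S)" shows "grand_arc_action S \<one>\<^bsub>Map S\<^esub> v = v"
proof -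
  obtain A where r: "v = arc_cls S A" "grand_arc S A" using assms unfolding verts_grand_arc_graph by blast
  show ?thesis unfolding r(1) one_Map grand_arc_action_cls[OF one_homeos r(2)] idS_image[OF grand_arc_subset[OF r(2)]] ..
qed

lemma grand_arc_action_cancel:
  assumes g: "g \<in> carrier (Map S)" and v: "v \<in> verts (grand_arc_graph S)"
  shows "grand_arc_action S (inv\<^bsub>Map S\<^esub> g) (grand_arc_action S g v) = v"
  using grand_arc_action_mult[OF group.inv_closed[OF group_Map g] g v] grand_arc_action_one[OF v]
    group.l_inv[OF group_Map g] by simp

lemma simple_grand_arc_graph: "simple_graph (grand_arc_graph S)"
  unfolding simple_graph_def grand_arc_graph_def by auto

lemma grand_arc_adjacency:
  "(u, v) \<in> adjacency (grand_arc_graph S) \<longleftrightarrow>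
    u \<in> verts (grand_arc_graph S) \<and> v \<in> verts (grand_arc_graph S) \<and> u \<noteq> v \<and> (\<exists>A\<in>u. \<exists>B\<in>v. A \<inter> B = {})"
proof -
  have "{u, v} \<in> {{a, b} |a b. a \<in> Q \<and> b \<in> Q \<and> a \<noteq> b \<and> (\<exists>A\<in>a. \<exists>B\<in>b. A \<inter> B = {})} \<longleftrightarrow>
      u \<in> Q \<and> v \<in> Q \<and> u \<noteq> v \<and> (\<exists>A\<in>u. \<exists>B\<in>v. A \<inter> B = {})" (is "?l \<longleftrightarrow> ?r") for Q
  proof
    assume ?l
    then obtain a b where ab: "{u, v} = {a, b}" "a \<in> Q" "b \<in> Q" "a \<noteq> b" and d: "\<exists>A\<in>a. \<exists>B\<in>b. A \<inter> B = {}" by blast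
    have d': "\<exists>B\<in>b. \<exists>A\<in>a. B \<inter> A = {}" using d by (metis Int_commute)
    from ab(1) have "u = a \<and> v = b \<or> u = b \<and> v = a" by (simp add: doubleton_eq_iff)
    then show ?r using ab(2-4) d d' by (elim disjE conjE) simp_all
  qed blast
  then show ?thesis by (simp add: adjacency_def grand_arc_graph_def)
qed

lemma grand_arc_action_adjacency:
  assumes g: "g \<in> carrier (Map S)" and uv: "(u, v) \<in> adjacency (grand_arc_graph S)"
  shows "(grand_arc_action S g u, grand_arc_action S g v) \<in> adjacency (grand_arc_graph S)"
proof -
  have V: "u \<in> verts (grand_arc_graph S)" "v \<in> verts (grand_arc_graph S)" "u \<noteq> v"
    using uv unfolding grand_arc_adjacency by simp_all
  obtain A B where AB: "A \<in> u" "B \<in> v" "A \<inter> B = {}" using uv unfolding grand_arc_adjacency by blast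
  obtain f where f: "g = cls S f" "f \<in> homeos S" using g by (auto simp: carrier_Map)
  have rep: "grand_arc S C \<and> w = arc_cls S C" if w: "w \<in> verts (grand_arc_graph S)" "C \<in> w" for w C
  proof -
    obtain D where D: "w = arc_cls S D" "grand_arc S D" using w(1) unfolding verts_grand_arc_graph by blast
    then have DC: "(D, C) \<in> arc_isotopy_rel S" using w(2) by simp
    then show ?thesis using D(1) equiv_class_eq[OF equiv_arc_isotopy DC] by (simp add: arc_isotopy_iff)
  qed
  have A: "grand_arc S A" "u = arc_cls S A" and B: "grand_arc S B" "v = arc_cls S B" using rep V AB by blast+
  have img: "grand_arc_action S g u = arc_cls S (f ` A)" "grand_arc_action S g v = arc_cls S (f ` B)"
    using grand_arc_action_cls f A B by auto
  have mem: "f ` A \<in> grand_arc_action S g u" "f ` B \<in> grand_arc_action S g v"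
    unfolding img using equiv_class_self[OF equiv_arc_isotopy] grand_arc_homeo[OF f(2)] A(1) B(1) by auto
  have disj: "f ` A \<inter> f ` B = {}"
    unfolding inj_on_image_Int[OF homeosD(5)[OF f(2)] grand_arc_subset[OF A(1)] grand_arc_subset[OF B(1)], symmetric]
      AB(3) by (rule image_empty)
  have ne: "grand_arc_action S g u \<noteq> grand_arc_action S g v"
  proof
    assume eq: "grand_arc_action S g u = grand_arc_action S g v"
    show False
      using V(3) grand_arc_action_cancel[OF g V(1)] unfolding eq grand_arc_action_cancel[OF g V(2)] by (rule notE[OF _ sym])
  qed
  show ?thesis
    unfolding grand_arc_adjacency
    by (intro conjI grand_arc_action_closed[OF g] V(1,2) ne bexI[OF _ mem(1)] bexI[OF _ mem(2)] disj)
qed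

lemma grand_arc_action_isometric:
  assumes g: "g \<in> carrier (Map S)" and V: "u \<in> verts (grand_arc_graph S)" "v \<in> verts (grand_arc_graph S)"
  shows "graph_dist (grand_arc_graph S) (grand_arc_action S g u) (grand_arc_action S g v) = graph_dist (grand_arc_graph S) u v"
proof -
  interpret M: group "Map S" by (rule group_Map)
  let ?R = "adjacency (grand_arc_graph S)" and ?a = "grand_arc_action S"
  have pow: "(?a h u, ?a h v) \<in> ?R ^^ n" if "h \<in> carrier (Map S)" "(u, v) \<in> ?R ^^ n" for h u v n
    using that(2)
  proof (induction n arbitrary: v)
    case (Suc n)
    then obtain w where "(u, w) \<in> ?R ^^ n" "(w, v) \<in> ?R" by auto
    then show ?case using Suc.IH[of w] grand_arc_action_adjacency[OF that(1), of w v] by auto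
  qed simp
  have "(?a g u, ?a g v) \<in> ?R ^^ n \<longleftrightarrow> (u, v) \<in> ?R ^^ n" for n
    using pow[OF g, of u v n] pow[OF M.inv_closed[OF g], of "?a g u" "?a g v" n] grand_arc_action_cancel[OF g V(1)] grand_arc_action_cancel[OF g V(2)] by auto
  then show ?thesis by (simp add: graph_dist_def)
qed

section \<open>Hyperbolic graphs and quasi-geodesics\<close>
text \<open>
  A discrete geodesic: an isometric embedding of \<open>{0..n}\<close>.
\<close>
definition geodesic_in :: "'v set \<Rightarrow> ('v \<Rightarrow> 'v \<Rightarrow> real) \<Rightarrow> (nat \<Rightarrow> 'v) \<Rightarrow> nat \<Rightarrow> 'v \<Rightarrow> 'v \<Rightarrow> bool" where
  "geodesic_in V d p n x y \<longleftrightarrow> p 0 = x \<and> p n = y \<and> (\<forall>i\<le>n. p i \<in> V) \<and> (\<forall>i\<le>n. \<forall>j\<le>n. d (p i) (p j) = \<bar>real i - real j\<bar>)"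

locale discrete_geodesic =
  fixes V :: "'v set" and d :: "'v \<Rightarrow> 'v \<Rightarrow> real"
  assumes d_sym: "x \<in> V \<Longrightarrow> y \<in> V \<Longrightarrow> d x y = d y x"
    and d_tri: "x \<in> V \<Longrightarrow> y \<in> V \<Longrightarrow> z \<in> V \<Longrightarrow> d x z \<le> d x y + d y z"
    and d_zero: "x \<in> V \<Longrightarrow> y \<in> V \<Longrightarrow> d x y = 0 \<longleftrightarrow> x = y"
    and d_nonneg: "0 \<le> d x y"
    and geodesic_exists: "x \<in> V \<Longrightarrow> y \<in> V \<Longrightarrow> \<exists>p n. geodesic_in V d p n x y"
begin

abbreviation "geodesic \<equiv> geodesic_in V d"

lemma geodesicD:
  assumes "geodesic p n x y"
  shows "p 0 = x" "p n = y" "\<And>i. i \<le> n \<Longrightarrow> p i \<in> V" "\<And>i j. i \<le> n \<Longrightarrow> j \<le> n \<Longrightarrow> d (p i) (p j) = \<bar>real i - real j\<bar>"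
    "x \<in> V" "y \<in> V" "d x y = real n"
    "\<And>i. i \<le> n \<Longrightarrow> d x (p i) = real i" "\<And>i. i \<le> n \<Longrightarrow> d (p i) y = real n - real i"
proof -
  show g: "p 0 = x" "p n = y" "\<And>i. i \<le> n \<Longrightarrow> p i \<in> V" "\<And>i j. i \<le> n \<Longrightarrow> j \<le> n \<Longrightarrow> d (p i) (p j) = \<bar>real i - real j\<bar>"
    using assms by (auto simp: geodesic_in_def)
  show "x \<in> V" "y \<in> V" using g(3)[of 0] g(3)[of n] g(1,2) by auto
  show "d x y = real n" using g(4)[of 0 n] g(1,2) by simp
  show "d x (p i) = real i" if "i \<le> n" for i using g(4)[of 0 i] g(1) that by simp
  show "d (p i) y = real n - real i" if "i \<le> n" for i using g(4)[of i n] g(2) that by simp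
qed

abbreviation "gp \<equiv> gromov_product d"

lemma gp_sym: "x \<in> V \<Longrightarrow> y \<in> V \<Longrightarrow> gp w x y = gp w y x"
  by (simp add: gromov_product_def d_sym)

lemma gp_on_geodesic: "geodesic p n x y \<Longrightarrow> i \<le> n \<Longrightarrow> j \<le> n \<Longrightarrow> k \<le> n \<Longrightarrow> i \<le> j \<Longrightarrow> j \<le> k \<Longrightarrow> gp (p j) (p i) (p k) = 0"
  by (simp add: gromov_product_def geodesicD(4))

lemma gp_le_dist_geodesic:
  assumes g: "geodesic p n x y" and "i \<le> n" "w \<in> V"
  shows "gp w x y \<le> d w (p i)"
proof -
  have V: "p i \<in> V" "x \<in> V" "y \<in> V" using geodesicD[OF g] assms by auto
  have "d x w \<le> d x (p i) + d (p i) w" "d y w \<le> d y (p i) + d (p i) w" using V assms d_tri by blast+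
  moreover have "d x y = d x (p i) + d y (p i)"
    using geodesicD(7-9)[OF g] assms d_sym[OF V(3,1)] by simp
  ultimately show ?thesis using d_sym[OF V(1) assms(3)] by (simp add: gromov_product_def)
qed

text \<open>
  Thin triangles in Rips' sense. Sides may be any geodesics, and need not be unique.
\<close>
definition thin :: "real \<Rightarrow> bool" where
  "thin C \<longleftrightarrow> (\<forall>x y z p n q m r l. geodesic p n x z \<longrightarrow> geodesic q m x y \<longrightarrow> geodesic r l y z \<longrightarrow>
      (\<forall>i\<le>n. (\<exists>j\<le>m. d (p i) (q j) \<le> C) \<or> (\<exists>j\<le>l. d (p i) (r j) \<le> C)))"

end

text \<open>
  A discrete intermediate value argument.
\<close>
lemma switch_point:
  fixes P Q :: "nat \<Rightarrow> bool"
  assumes "P 0" "Q n" "\<And>t. t \<le> n \<Longrightarrow> P t \<or> Q t"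
  shows "\<exists>s t. s \<le> n \<and> t \<le> n \<and> P s \<and> Q t \<and> s \<le> t \<and> t \<le> s + 1"
proof (cases "P n")
  case True
  then show ?thesis using assms(2) by (intro exI[of _ n]) auto
next
  case False
  define t where "t = (LEAST t. \<not> P t)"
  have t: "\<not> P t" "t \<le> n" unfolding t_def using LeastI[of "\<lambda>t. \<not> P t"] Least_le[of "\<lambda>t. \<not> P t"] False by blast+
  then have "t \<noteq> 0" using assms(1) by metis
  note t = t this
  then have "P (t - 1)" using not_less_Least[of "t - 1" "\<lambda>t. \<not> P t"] t_def by auto
  moreover have "Q t" using t assms(3) by blast
  ultimately show ?thesis using t by (intro exI[of _ "t - 1"] exI[of _ t]) auto
qed

context discrete_geodesic
begin

text \<open>
  On a side \<open>x z\<close> of the triangle \<open>x w z\<close> there is a point \<open>c\<close> close to both other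
  sides. Its distance from \<open>w\<close> is about the Gromov product of \<open>x\<close> and \<open>z\<close>, and \<open>c\<close> is also close to a side of the triangle \<open>x y z\<close>.
\<close>
lemma thin_imp_hyperbolic:
  assumes "thin C" "0 \<le> C"
  shows "gromov_hyperbolic V d (3 * C + 2)"
  unfolding gromov_hyperbolic_def
proof (intro ballI)
  fix w x y z assume V: "w \<in> V" "x \<in> V" "y \<in> V" "z \<in> V"
  have T: "(\<exists>j\<le>m. d (p i) (q j) \<le> C) \<or> (\<exists>j\<le>l. d (p i) (r j) \<le> C)"
    if "geodesic p n x z" "geodesic q m x y" "geodesic r l y z" "i \<le> n" for x y z p n q m r l i
    using assms(1) that unfolding thin_def by blast
  obtain p n where p: "geodesic p n x z" using geodesic_exists V by blast
  obtain a m where a: "geodesic a m x w" using geodesic_exists V by blast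
  obtain b l where b: "geodesic b l w z" using geodesic_exists V by blast
  have "\<exists>s t. s \<le> n \<and> t \<le> n \<and> (\<exists>j\<le>m. d (p s) (a j) \<le> C) \<and> (\<exists>j\<le>l. d (p t) (b j) \<le> C) \<and> s \<le> t \<and> t \<le> s + 1"
  proof (rule switch_point)
    show "\<exists>j\<le>m. d (p 0) (a j) \<le> C"
      using geodesicD(1)[OF p] geodesicD(1,5)[OF a] d_zero[of x x] assms(2) by (intro exI[of _ 0]) auto
    show "\<exists>j\<le>l. d (p n) (b j) \<le> C"
      using geodesicD(2)[OF p] geodesicD(2,6)[OF b] d_zero[of z z] assms(2) by (intro exI[of _ l]) auto
  qed (rule T[OF p a b])
  then obtain s t i j where st: "s \<le> n" "t \<le> n" "s \<le> t" "t \<le> s + 1" "i \<le> m" "j \<le> l"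
    "d (p s) (a i) \<le> C" "d (p t) (b j) \<le> C" by blast
  define c where "c = p s"
  have cV: "c \<in> V" "a i \<in> V" "b j \<in> V" "p t \<in> V" using geodesicD(3) p a b st by (auto simp: c_def)
  have "d c (p t) \<le> 1" using geodesicD(4)[OF p st(1,2)] st by (simp add: c_def)
  then have cb: "d c (b j) \<le> C + 1" using d_tri[OF cV(1,4,3)] st(8) by simp
  have ca: "d c (a i) \<le> C" using st by (simp add: c_def)
  have e1: "d x w = d x (a i) + d (a i) w" using geodesicD(7-9)[OF a] st(5) by simp
  have e2: "d z w = d z (b j) + d (b j) w"
    using geodesicD(7-9)[OF b] st(6) d_sym[of z w] d_sym[of z "b j"] d_sym[of "b j" w] V cV by simp
  have e3: "d x z = d x c + d z c"
    using geodesicD(7-9)[OF p] st(1) d_sym[of z c] V cV by (simp add: c_def)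
  have "d x c \<le> d x (a i) + d (a i) c" "d c w \<le> d c (a i) + d (a i) w"
    "d z c \<le> d z (b j) + d (b j) c" "d c w \<le> d c (b j) + d (b j) w"
    using d_tri V cV by blast+
  then have center: "gp w x z \<ge> d w c - 2 * C - 1"
    using ca cb e1 e2 e3 d_sym[of "a i" c] d_sym[of "b j" c] d_sym[of w c] V cV
    unfolding gromov_product_def by (simp add: field_simps)
  obtain q k where q: "geodesic q k x y" using geodesic_exists V by blast
  obtain r h where r: "geodesic r h y z" using geodesic_exists V by blast
  have "(\<exists>j\<le>k. d c (q j) \<le> C) \<or> (\<exists>j\<le>h. d c (r j) \<le> C)" using T[OF p q r st(1)] by (simp add: c_def)
  then have "d w c \<ge> gp w x y - C \<or> d w c \<ge> gp w y z - C"
  proof (elim disjE exE conjE)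
    fix j assume j: "j \<le> k" "d c (q j) \<le> C"
    then have "d w (q j) \<le> d w c + C" using d_tri[of w c "q j"] V cV geodesicD(3)[OF q j(1)] by simp
    then show ?thesis using gp_le_dist_geodesic[OF q j(1) V(1)] by simp
  next
    fix j assume j: "j \<le> h" "d c (r j) \<le> C"
    then have "d w (r j) \<le> d w c + C" using d_tri[of w c "r j"] V cV geodesicD(3)[OF r j(1)] by simp
    then show ?thesis using gp_le_dist_geodesic[OF r j(1) V(1)] by simp
  qed
  then show "min (gp w x y) (gp w y z) - (3 * C + 2) \<le> gp w x z" using center assms(2) by auto
qed

end

locale discrete_hyperbolic = discrete_geodesic +
  fixes \<delta> :: real
  assumes hyp: "w \<in> V \<Longrightarrow> x \<in> V \<Longrightarrow> y \<in> V \<Longrightarrow> z \<in> V \<Longrightarrow> gp w x z \<ge> min (gp w x y) (gp w y z) - \<delta>"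
    and \<delta>: "0 \<le> \<delta>"
begin

text \<open>
  Take the point of the geodesic at the distance from \<open>x\<close> given by a Gromov product.
\<close>
lemma near_geodesic:
  assumes g: "geodesic q n x y" and p: "p \<in> V"
  shows "\<exists>i\<le>n. d p (q i) \<le> 2 * \<delta> + 1 + gp p x y"
proof -
  note G = geodesicD[OF g]
  define c where "c = gp x p y"
  have c0: "0 \<le> c" unfolding c_def gromov_product_def
    using d_tri[OF p G(5,6)] d_sym[OF G(5) G(6)] by simp
  have cn: "c \<le> real n" unfolding c_def gromov_product_def
    using d_tri[OF p G(6,5)] d_sym[OF G(5,6)] G(7) by simp
  define i where "i = nat \<lfloor>c\<rfloor>"
  have i: "real i \<le> c" "c < real i + 1" "i \<le> n" using c0 cn unfolding i_def by linarith+
  have V: "q i \<in> V" using G(3) i by blast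
  have "min (gp (q i) x p) (gp (q i) p y) \<le> \<delta>"
    using hyp[OF V G(5) p G(6)] gp_on_geodesic[OF g _ i(3), of 0 n] G(1,2) i by simp
  moreover have s: "d (q i) p = d p (q i)" "d p x = d x p" "d y p = d p y" "d y x = d x y" "d y (q i) = d (q i) y"
    using d_sym V p G by blast+
  ultimately have "d p (q i) \<le> 2 * \<delta> + 1 + gp p x y"
    using i G(7) G(8,9)[OF i(3)] unfolding c_def gromov_product_def min_def
    by (auto simp: field_simps split: if_splits)
  then show ?thesis using i by blast
qed

lemma thin_hyperbolic: "thin (3 * \<delta> + 1)"
  unfolding thin_def
proof (intro allI impI)
  fix x y z p n q m r l i
  assume g: "geodesic p n x z" "geodesic q m x y" "geodesic r l y z" and i: "i \<le> n"
  have V: "p i \<in> V" "x \<in> V" "y \<in> V" "z \<in> V" using geodesicD(3,5,6) g i by blast+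
  have "min (gp (p i) x y) (gp (p i) y z) \<le> \<delta>"
    using hyp[OF V] gp_on_geodesic[OF g(1) _ i, of 0 n] geodesicD(1,2)[OF g(1)] i by simp
  then have "gp (p i) x y \<le> \<delta> \<or> gp (p i) y z \<le> \<delta>" by (auto simp: min_def split: if_splits)
  then show "(\<exists>j\<le>m. d (p i) (q j) \<le> 3 * \<delta> + 1) \<or> (\<exists>j\<le>l. d (p i) (r j) \<le> 3 * \<delta> + 1)"
  proof
    assume "gp (p i) x y \<le> \<delta>"
    then show ?thesis using near_geodesic[OF g(2) V(1)] by fastforce
  next
    assume "gp (p i) y z \<le> \<delta>"
    then show ?thesis using near_geodesic[OF g(3) V(1)] by fastforce
  qed
qed

text \<open>
  Halving the chain loses \<open>\<delta>\<close> at each of the \<open>k\<close> levels.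
\<close>
lemma gp_chain:
  assumes "w \<in> V" "\<And>i. i \<le> m \<Longrightarrow> x i \<in> V" "1 \<le> m" "m \<le> 2 ^ k"
    and "\<And>i. i < m \<Longrightarrow> gp w (x i) (x (Suc i)) \<ge> c"
  shows "gp w (x 0) (x m) \<ge> c - real k * \<delta>"
  using assms(2-5)
proof (induction k arbitrary: m x)
  case 0
  then have "m = 1" by simp
  then show ?case using "0.prems"(4)[of 0] by simp
next
  case (Suc k)
  show ?case
  proof (cases "m = 1")
    case True
    then have "c \<le> gp w (x 0) (x m)" using Suc.prems(4)[of 0] by simp
    then show ?thesis using \<delta> mult_nonneg_nonneg[of "real (Suc k)" \<delta>] by linarith
  next
    case False
    define h where "h = m div 2"
    have h: "1 \<le> h" "h \<le> 2^k" "1 \<le> m - h" "m - h \<le> 2^k" "h \<le> m" using False Suc.prems(2,3) by (auto simp: h_def)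
    have "gp w (x 0) (x h) \<ge> c - real k * \<delta>"
      using Suc.prems h by (intro Suc.IH) auto
    moreover have "gp w (x (h + 0)) (x (h + (m - h))) \<ge> c - real k * \<delta>"
      using Suc.prems h by (intro Suc.IH[of "m - h" "\<lambda>i. x (h + i)"]) auto
    moreover have "gp w (x 0) (x m) \<ge> min (gp w (x 0) (x h)) (gp w (x h) (x m)) - \<delta>"
      using Suc.prems(1) h assms(1) by (intro hyp) auto
    ultimately show ?thesis using h by (auto simp: algebra_simps)
  qed
qed

definition quasi_path :: "real \<Rightarrow> (nat \<Rightarrow> 'a) \<Rightarrow> nat \<Rightarrow> bool" where
  "quasi_path L x n \<longleftrightarrow> (\<forall>i\<le>n. x i \<in> V) \<and> (\<forall>i\<le>n. \<forall>j\<le>n. d (x i) (x j) \<le> L * \<bar>real i - real j\<bar> \<and>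
     \<bar>real i - real j\<bar> \<le> d (x i) (x j) + 1)"

text \<open>
  The Morse lemma, by the usual detour argument. Let \<open>p\<close> be a point of the geodesic at maximal distance
  \<open>m\<close> from the quasi-path. Walk \<open>2m\<close> along the geodesic in both directions, cross over to the quasi-path
  and follow it. All steps of this chain of length \<open>O(m)\<close> have Gromov product at least \<open>m - L\<close> at
  \<open>p\<close>, while its ends have Gromov product 0; so \<open>m\<close> is bounded by \<open>L\<close> plus a
  logarithm of \<open>m\<close>.
\<close>
lemma geodesic_near_quasi_path_aux:
  assumes qp: "quasi_path L x n" and g: "geodesic q l (x 0) (x n)" and L: "0 \<le> L"
    and t: "t \<le> l" and far: "\<And>i. i \<le> n \<Longrightarrow> real m \<le> d (q t) (x i)"
    and near: "\<And>s. s \<le> l \<Longrightarrow> \<exists>i\<le>n. d (q s) (x i) \<le> real m"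
    and k: "6 * m + 3 \<le> 2 ^ k"
  shows "real m \<le> L + real k * \<delta>"
proof -
  note G = geodesicD[OF g]
  have xV: "x i \<in> V" if "i \<le> n" for i using qp that by (simp add: quasi_path_def)
  define p where "p = q t"
  have pV: "p \<in> V" using G(3) t by (simp add: p_def)
  have far': "real m \<le> d (x i) p" if "i \<le> n" for i using far[OF that] d_sym[OF pV xV[OF that]] by (simp add: p_def)
  \<comment> \<open>Truncated subtraction on purpose: near an end of the geodesic the chain starts at that end.\<close>
  define a where "a = t - 2 * m"
  define b where "b = min l (t + 2 * m)"
  have ab: "a \<le> t" "t \<le> b" "b \<le> l" "a \<le> l" using t by (auto simp: a_def b_def)
  have abV: "q a \<in> V" "q b \<in> V" using G(3) ab by auto
  have dab: "d (q a) (q b) \<le> 4 * real m" using G(4)[OF ab(4,3)] ab by (auto simp: a_def b_def)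
  have "\<exists>i\<le>n. d (q a) (x i) \<le> real m \<and> gp p (q a) (x i) \<ge> real m"
  proof (cases "t \<le> 2 * m")
    case True
    then have "q a = x 0" using G(1) by (simp add: a_def)
    then show ?thesis using xV[of 0] d_zero[of "x 0" "x 0"] far'[of 0]
      by (intro exI[of _ 0]) (auto simp: gromov_product_def)
  next
    case False
    obtain i where i: "i \<le> n" "d (q a) (x i) \<le> real m" using near ab by blast
    have "d (q a) p = 2 * real m" using G(4)[OF ab(4) t] False by (simp add: a_def p_def)
    then show ?thesis using i far'[OF i(1)] by (intro exI[of _ i]) (auto simp: gromov_product_def)
  qed
  then obtain i where i: "i \<le> n" "d (q a) (x i) \<le> real m" "gp p (q a) (x i) \<ge> real m" by blast
  have "\<exists>j\<le>n. d (q b) (x j) \<le> real m \<and> gp p (q b) (x j) \<ge> real m"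
  proof (cases "l \<le> t + 2 * m")
    case True
    then have "q b = x n" using G(2) by (simp add: b_def min_def)
    then show ?thesis using xV[of n] d_zero[of "x n" "x n"] far'[of n]
      by (intro exI[of _ n]) (auto simp: gromov_product_def)
  next
    case False
    obtain j where j: "j \<le> n" "d (q b) (x j) \<le> real m" using near ab by blast
    have "d (q b) p = 2 * real m" using G(4)[OF ab(3) t] False by (simp add: b_def p_def)
    then show ?thesis using j far'[OF j(1)] by (intro exI[of _ j]) (auto simp: gromov_product_def)
  qed
  then obtain j where j: "j \<le> n" "d (q b) (x j) \<le> real m" "gp p (q b) (x j) \<ge> real m" by blast
  define N where "N = (if i \<le> j then j - i else i - j)"
  define \<iota> where "\<iota> k = (if i \<le> j then i + k else i - k)" for k
  have \<iota>: "\<iota> k \<le> n" "\<bar>real (\<iota> k) - real (\<iota> (Suc k))\<bar> \<le> 1" if "k \<le> N" for k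
    using that i(1) j(1) by (auto simp: \<iota>_def N_def of_nat_diff split: if_splits)
  have \<iota>0N: "\<iota> 0 = i" "\<iota> N = j" by (auto simp: \<iota>_def N_def)
  have "d (x i) (x j) \<le> d (x i) (q a) + d (q a) (q b) + d (q b) (x j)"
    using d_tri[OF xV[OF i(1)] abV(1) xV[OF j(1)]] d_tri[OF abV xV[OF j(1)]] by simp
  then have "d (x i) (x j) \<le> 6 * real m" using i j dab d_sym[OF xV[OF i(1)] abV(1)] by simp
  moreover have "\<bar>real i - real j\<bar> \<le> d (x i) (x j) + 1" using qp i j by (simp add: quasi_path_def)
  ultimately have "real N \<le> 6 * real m + 1" by (auto simp: N_def of_nat_diff split: if_splits)
  then have N: "N + 2 \<le> 2 ^ k" using k by linarith
  define c where "c s = (if s = 0 then q a else if s \<le> Suc N then x (\<iota> (s - 1)) else q b)" for s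
  have "gp p (c 0) (c (N + 2)) \<ge> (real m - L) - real k * \<delta>"
  proof (rule gp_chain[OF pV _ _ N])
    show "c s \<in> V" if "s \<le> N + 2" for s
      using that abV xV[OF \<iota>(1)[of "s - 1"]] by (auto simp: c_def)
    show "real m - L \<le> gp p (c s) (c (Suc s))" if s: "s < N + 2" for s
    proof -
      consider "s = 0" | "s = Suc N" | "1 \<le> s" "s \<le> N" using s by linarith
      then show ?thesis
      proof cases
        case 1
        then show ?thesis using i(3) L \<iota>0N by (simp add: c_def)
      next
        case 2
        then show ?thesis using j L \<iota>0N gp_sym[OF xV[OF j(1)] abV(2), of p] by (simp add: c_def)
      next
        case 3
        define u v where "u = \<iota> (s - 1)" and "v = \<iota> s"
        have uv: "u \<le> n" "v \<le> n" "\<bar>real u - real v\<bar> \<le> 1"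
          using \<iota>(1)[of "s - 1"] \<iota>(2)[of "s - 1"] \<iota>(1)[of s] 3 by (auto simp: u_def v_def)
        have "d (x u) (x v) \<le> L * \<bar>real u - real v\<bar>" using qp uv by (simp add: quasi_path_def)
        also have "\<dots> \<le> L * 1" using L uv by (intro mult_left_mono) auto
        finally have "gp p (x u) (x v) \<ge> real m - L"
          using far'[OF uv(1)] far'[OF uv(2)] L by (simp add: gromov_product_def)
        then show ?thesis using 3 by (simp add: c_def u_def v_def)
      qed
    qed
  qed simp
  moreover have "gp p (c 0) (c (N + 2)) = 0"
    using gp_on_geodesic[OF g ab(4) t ab(3) ab(1,2)] by (simp add: c_def p_def)
  ultimately show ?thesis by simp
qed

lemma geodesic_near_quasi_path:
  assumes L: "0 \<le> L"
  shows "\<exists>D\<ge>0. \<forall>x n q l t. quasi_path L x n \<longrightarrow> geodesic q l (x 0) (x n) \<longrightarrow> t \<le> l \<longrightarrow> (\<exists>i\<le>n. d (q t) (x i) \<le> D)"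
proof -
  have "eventually (\<lambda>m::real. L + (log 2 (6 * m + 3) + 1) * \<delta> < m) at_top" by real_asymp
  then obtain D0 where D0: "\<And>m. m \<ge> D0 \<Longrightarrow> L + (log 2 (6 * m + 3) + 1) * \<delta> < m"
    by (auto simp: eventually_at_top_linorder)
  define D where "D = max D0 0"
  have "\<exists>i\<le>n. d (q t) (x i) \<le> D" if qp: "quasi_path L x n" and g: "geodesic q l (x 0) (x n)" and t: "t \<le> l" for x n q l t
  proof -
    note G = geodesicD[OF g]
    have xV: "x i \<in> V" if "i \<le> n" for i using qp that by (simp add: quasi_path_def)
    have int: "\<exists>k. d (q s) (x i) = real k" if "s \<le> l" "i \<le> n" for s i
      using geodesic_exists[OF G(3)[OF that(1)] xV[OF that(2)]] geodesicD(7) by blast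
    define \<nu> where "\<nu> s = Min ((\<lambda>i. d (q s) (x i)) ` {..n})" for s
    have \<nu>: "\<nu> s \<in> (\<lambda>i. d (q s) (x i)) ` {..n}" "\<And>i. i \<le> n \<Longrightarrow> \<nu> s \<le> d (q s) (x i)" for s
      unfolding \<nu>_def by (rule Min_in) auto
    define M where "M = Max (\<nu> ` {..l})"
    have M: "M \<in> \<nu> ` {..l}" "\<And>s. s \<le> l \<Longrightarrow> \<nu> s \<le> M" unfolding M_def by (rule Max_in) auto
    obtain s where s: "s \<le> l" "M = \<nu> s" using M(1) by auto
    obtain i where i: "i \<le> n" "M = d (q s) (x i)" using \<nu>(1)[of s] s by auto
    obtain m where m: "M = real m" using int[OF s(1) i(1)] i by auto
    define k where "k = nat \<lceil>log 2 (real (6 * m + 3))\<rceil>"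
    have pos: "0 \<le> log 2 (real (6 * m + 3))" by simp
    have "log 2 (real (6 * m + 3)) \<le> real k" unfolding k_def by linarith
    then have "real (6 * m + 3) \<le> 2 powr real k" by (simp add: log_le_iff)
    then have k2: "6 * m + 3 \<le> 2 ^ k"
      by (metis of_nat_le_iff of_nat_numeral of_nat_power powr_realpow zero_less_numeral)
    have kl: "real k \<le> log 2 (6 * real m + 3) + 1" unfolding k_def using pos by (simp, linarith?)
    have "real m \<le> L + real k * \<delta>"
    proof (rule geodesic_near_quasi_path_aux[OF qp g L s(1) _ _ k2])
      show "real m \<le> d (q s) (x i)" if "i \<le> n" for i using \<nu>(2)[OF that, of s] s m by simp
      show "\<exists>i\<le>n. d (q u) (x i) \<le> real m" if "u \<le> l" for u using \<nu>(1)[of u] M(2)[OF that] m by auto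
    qed
    also have "\<dots> \<le> L + (log 2 (6 * real m + 3) + 1) * \<delta>" using kl \<delta> by (intro add_left_mono mult_right_mono)
    finally have "\<not> real m \<ge> D0" using D0[of "real m"] by linarith
    then have "M \<le> D" using m by (simp add: D_def)
    moreover obtain j where "j \<le> n" "\<nu> t = d (q t) (x j)" using \<nu>(1)[of t] by auto
    ultimately show ?thesis using M(2)[OF t] by auto
  qed
  then show ?thesis by (intro exI[of _ D]) (auto simp: D_def)
qed

text \<open>
  Each point of the geodesic is close to the quasi-path before or after the index \<open>k\<close>. At a switch between the two
  alternatives there are a point before and a point after \<open>k\<close> that are close to each other, so the indices
  differ by a bounded amount.
\<close>
lemma quasi_path_near_geodesic:
  assumes L: "0 \<le> L"
  shows "\<exists>D\<ge>0. \<forall>x n q l k. quasi_path L x n \<longrightarrow> geodesic q l (x 0) (x n) \<longrightarrow> k \<le> n \<longrightarrow> (\<exists>t\<le>l. d (x k) (q t) \<le> D)"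
proof -
  obtain D where D: "0 \<le> D" "\<And>x n q l t. quasi_path L x n \<Longrightarrow> geodesic q l (x 0) (x n) \<Longrightarrow> t \<le> l \<Longrightarrow> \<exists>i\<le>n. d (q t) (x i) \<le> D"
    using geodesic_near_quasi_path[OF L] by blast
  have "\<exists>t\<le>l. d (x k) (q t) \<le> L * (2 * D + 2) + D"
    if qp: "quasi_path L x n" and g: "geodesic q l (x 0) (x n)" and k: "k \<le> n" for x n q l k
  proof -
    note G = geodesicD[OF g]
    have xV: "x i \<in> V" if "i \<le> n" for i using qp that by (simp add: quasi_path_def)
    have "\<exists>s t. s \<le> l \<and> t \<le> l \<and> (\<exists>i\<le>k. d (q s) (x i) \<le> D) \<and> (\<exists>j\<le>n. k \<le> j \<and> d (q t) (x j) \<le> D) \<and> s \<le> t \<and> t \<le> s + 1"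
    proof (rule switch_point)
      show "\<exists>i\<le>k. d (q 0) (x i) \<le> D" using G(1,5) d_zero[of "x 0" "x 0"] D(1) by (intro exI[of _ 0]) auto
      show "\<exists>j\<le>n. k \<le> j \<and> d (q l) (x j) \<le> D" using G(2,6) d_zero[of "x n" "x n"] D(1) k by (intro exI[of _ n]) auto
      show "(\<exists>i\<le>k. d (q t) (x i) \<le> D) \<or> (\<exists>j\<le>n. k \<le> j \<and> d (q t) (x j) \<le> D)" if "t \<le> l" for t
        using D(2)[OF qp g that] by (meson linear)
    qed
    then obtain s t i j where st: "s \<le> l" "t \<le> l" "i \<le> k" "d (q s) (x i) \<le> D" "j \<le> n" "k \<le> j" "d (q t) (x j) \<le> D" "s \<le> t" "t \<le> s + 1"
      by blast
    have V: "q s \<in> V" "q t \<in> V" "x i \<in> V" "x j \<in> V" "x k \<in> V" using G(3) xV st k by auto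
    have "d (q s) (q t) \<le> 1" using G(4)[OF st(1,2)] st by simp
    then have "d (x i) (x j) \<le> 2 * D + 1"
      using d_tri[OF V(3,1,4)] d_tri[OF V(1,2,4)] d_sym[OF V(3,1)] st by simp
    moreover have "\<bar>real i - real j\<bar> \<le> d (x i) (x j) + 1"
      using qp st(5) order_trans[OF st(3) k] unfolding quasi_path_def by blast
    ultimately have "\<bar>real k - real i\<bar> \<le> 2 * D + 2" using st by simp
    moreover have "d (x k) (x i) \<le> L * \<bar>real k - real i\<bar>"
      using qp k order_trans[OF st(3) k] unfolding quasi_path_def by blast
    ultimately have "d (x k) (x i) \<le> L * (2 * D + 2)" using L by (meson mult_left_mono order_trans)
    then have "d (x k) (q s) \<le> L * (2 * D + 2) + D"
      using d_tri[OF V(5,3,1)] d_sym[OF V(3,1)] st by simp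
    then show ?thesis using st(1) by blast
  qed
  then show ?thesis using D(1) L by (intro exI[of _ "L * (2 * D + 2) + D"]) auto
qed

text \<open>
  Geodesics of the source are mapped to quasi-paths, which are close to geodesics with the same ends. Since
  triangles of geodesics are thin in the target, they are thin in the source.
\<close>
theorem hyperbolic_transfer:
  fixes W :: "'w set" and e :: "'w \<Rightarrow> 'w \<Rightarrow> real"
  assumes W: "discrete_geodesic W e" and f: "\<And>u. u \<in> W \<Longrightarrow> f u \<in> V" and L: "0 \<le> L"
    and up: "\<And>u v. u \<in> W \<Longrightarrow> v \<in> W \<Longrightarrow> d (f u) (f v) \<le> L * e u v"
    and low: "\<And>u v. u \<in> W \<Longrightarrow> v \<in> W \<Longrightarrow> e u v \<le> d (f u) (f v) + 1"
  shows "\<exists>\<delta>'. gromov_hyperbolic W e \<delta>'"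
proof -
  interpret W: discrete_geodesic W e by fact
  obtain B where B: "0 \<le> B" "\<And>x n q l t. quasi_path L x n \<Longrightarrow> geodesic q l (x 0) (x n) \<Longrightarrow> t \<le> l \<Longrightarrow> \<exists>i\<le>n. d (q t) (x i) \<le> B"
    using geodesic_near_quasi_path[OF L] by blast
  obtain A where A: "0 \<le> A" "\<And>x n q l k. quasi_path L x n \<Longrightarrow> geodesic q l (x 0) (x n) \<Longrightarrow> k \<le> n \<Longrightarrow> \<exists>t\<le>l. d (x k) (q t) \<le> A"
    using quasi_path_near_geodesic[OF L] by blast
  have qp: "quasi_path L (\<lambda>i. f (p i)) n" if g: "W.geodesic p n x y" for p n x y
    unfolding quasi_path_def
  proof (intro conjI allI impI)
    fix i j assume ij: "i \<le> n" "j \<le> n"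
    have pW: "p i \<in> W" "p j \<in> W" using W.geodesicD(3)[OF g] ij by auto
    show "d (f (p i)) (f (p j)) \<le> L * \<bar>real i - real j\<bar>" "\<bar>real i - real j\<bar> \<le> d (f (p i)) (f (p j)) + 1"
      using up[OF pW] low[OF pW] W.geodesicD(4)[OF g ij] by auto
  qed (use f W.geodesicD(3)[OF g] in auto)
  define C where "C = A + (3 * \<delta> + 1) + B + 1"
  have close: "\<exists>j\<le>m. e u (q j) \<le> C"
    if g: "W.geodesic q m x y" and h: "geodesic h k (f x) (f y)" and s: "s \<le> k" and u: "u \<in> W" "d (f u) (h s) \<le> A + (3 * \<delta> + 1)"
    for q m x y h k s u
  proof -
    have ends: "(\<lambda>i. f (q i)) 0 = f x" "(\<lambda>i. f (q i)) m = f y" using W.geodesicD(1,2)[OF g] by auto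
    obtain j where j: "j \<le> m" "d (h s) (f (q j)) \<le> B"
      using B(2)[OF qp[OF g], of h k s] h s ends by auto
    have qW: "q j \<in> W" using W.geodesicD(3)[OF g j(1)] .
    have "d (f u) (f (q j)) \<le> d (f u) (h s) + d (h s) (f (q j))"
      using f u(1) qW geodesicD(3)[OF h s] by (intro d_tri) auto
    then have "e u (q j) \<le> C" using low[OF u(1) qW] u(2) j(2) by (simp add: C_def)
    then show ?thesis using j(1) by blast
  qed
  have "W.thin C"
    unfolding W.thin_def
  proof (intro allI impI)
    fix x y z p n q m r l i
    assume g: "W.geodesic p n x z" "W.geodesic q m x y" "W.geodesic r l y z" and i: "i \<le> n"
    have xyz: "x \<in> W" "y \<in> W" "z \<in> W" using W.geodesicD(5,6) g by blast+
    obtain a na where a: "geodesic a na (f x) (f z)" using geodesic_exists f xyz by blast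
    obtain b nb where b: "geodesic b nb (f x) (f y)" using geodesic_exists f xyz by blast
    obtain c nc where c: "geodesic c nc (f y) (f z)" using geodesic_exists f xyz by blast
    have pW: "p i \<in> W" using W.geodesicD(3)[OF g(1) i] .
    obtain t where t: "t \<le> na" "d (f (p i)) (a t) \<le> A"
      using A(2)[OF qp[OF g(1)], of a na i] a i W.geodesicD(1,2)[OF g(1)] by auto
    have V: "f (p i) \<in> V" "a t \<in> V" using f pW geodesicD(3)[OF a t(1)] by auto
    have "(\<exists>s\<le>nb. d (a t) (b s) \<le> 3 * \<delta> + 1) \<or> (\<exists>s\<le>nc. d (a t) (c s) \<le> 3 * \<delta> + 1)"
      using thin_hyperbolic a b c t(1) unfolding thin_def by blast
    then show "(\<exists>j\<le>m. e (p i) (q j) \<le> C) \<or> (\<exists>j\<le>l. e (p i) (r j) \<le> C)"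
    proof (elim disjE exE conjE)
      fix s assume s: "s \<le> nb" "d (a t) (b s) \<le> 3 * \<delta> + 1"
      have "d (f (p i)) (b s) \<le> A + (3 * \<delta> + 1)"
        using d_tri[OF V geodesicD(3)[OF b s(1)]] t s by simp
      then show ?thesis using close[OF g(2) b s(1) pW] by blast
    next
      fix s assume s: "s \<le> nc" "d (a t) (c s) \<le> 3 * \<delta> + 1"
      have "d (f (p i)) (c s) \<le> A + (3 * \<delta> + 1)"
        using d_tri[OF V geodesicD(3)[OF c s(1)]] t s by simp
      then show ?thesis using close[OF g(3) c s(1) pW] by blast
    qed
  qed
  moreover have "0 \<le> C" using A(1) B(1) \<delta> by (simp add: C_def)
  ultimately show ?thesis using W.thin_imp_hyperbolic by blast
qed

end

lemma adjacency_sym: "(u, v) \<in> adjacency \<Gamma> \<longleftrightarrow> (v, u) \<in> adjacency \<Gamma>"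
  by (simp add: adjacency_def insert_commute)

lemma graph_discrete_geodesic:
  assumes simple: "simple_graph \<Gamma>" and conn: "connected_graph \<Gamma>"
  shows "discrete_geodesic (verts \<Gamma>) (graph_dist \<Gamma>)"
    and "\<And>u v. (u, v) \<in> adjacency \<Gamma> \<Longrightarrow> graph_dist \<Gamma> u v \<le> 1"
    and "\<And>u v n. (u, v) \<in> adjacency \<Gamma> ^^ n \<Longrightarrow> graph_dist \<Gamma> u v \<le> real n"
    and "\<And>u v. u \<in> verts \<Gamma> \<Longrightarrow> v \<in> verts \<Gamma> \<Longrightarrow> \<exists>n. (u, v) \<in> adjacency \<Gamma> ^^ n \<and> graph_dist \<Gamma> u v = real n"
proof -
  define nd where "nd u v = (LEAST n. (u, v) \<in> adjacency \<Gamma> ^^ n)" for u v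
  have gd: "graph_dist \<Gamma> u v = real (nd u v)" for u v by (simp add: graph_dist_def nd_def)
  have V: "u \<in> verts \<Gamma> \<and> v \<in> verts \<Gamma>" if "(u, v) \<in> adjacency \<Gamma>" for u v
    using that simple unfolding simple_graph_def adjacency_def by (auto simp: doubleton_eq_iff)
  have rel: "(u, v) \<in> adjacency \<Gamma> ^^ nd u v" if "u \<in> verts \<Gamma>" "v \<in> verts \<Gamma>" for u v
  proof -
    have "(u, v) \<in> (adjacency \<Gamma>)\<^sup>*" using conn that unfolding connected_graph_def by blast
    then obtain n where "(u, v) \<in> adjacency \<Gamma> ^^ n" using rtrancl_imp_relpow by blast
    then show ?thesis unfolding nd_def by (rule LeastI)
  qed
  have le: "nd u v \<le> n" if "(u, v) \<in> adjacency \<Gamma> ^^ n" for u v n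
    unfolding nd_def using that by (rule Least_le)
  have sym: "(v, u) \<in> adjacency \<Gamma> ^^ n" if "(u, v) \<in> adjacency \<Gamma> ^^ n" for u v n
    using that
  proof (induction n arbitrary: v)
    case (Suc n)
    then obtain w where "(u, w) \<in> adjacency \<Gamma> ^^ n" "(w, v) \<in> adjacency \<Gamma>" by auto
    then show ?case using Suc.IH[of w] adjacency_sym relpow_Suc_I2 by metis
  qed simp
  show "graph_dist \<Gamma> u v \<le> real n" if "(u, v) \<in> adjacency \<Gamma> ^^ n" for u v n
    using le[OF that] by (simp add: gd)
  show "graph_dist \<Gamma> u v \<le> 1" if "(u, v) \<in> adjacency \<Gamma>" for u v
    using le[of u v 1] that by (simp add: gd)
  show "\<exists>n. (u, v) \<in> adjacency \<Gamma> ^^ n \<and> graph_dist \<Gamma> u v = real n" if "u \<in> verts \<Gamma>" "v \<in> verts \<Gamma>" for u v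
    using rel[OF that] gd by blast
  show "discrete_geodesic (verts \<Gamma>) (graph_dist \<Gamma>)"
  proof
    fix x y assume xy: "x \<in> verts \<Gamma>" "y \<in> verts \<Gamma>"
    show "graph_dist \<Gamma> x y = graph_dist \<Gamma> y x"
      using le[OF sym[OF rel[OF xy]]] le[OF sym[OF rel[OF xy(2,1)]]] by (simp add: gd)
    show "graph_dist \<Gamma> x y = 0 \<longleftrightarrow> x = y"
      using rel[OF xy] le[of x x 0] by (auto simp: gd)
    obtain p where p: "p 0 = x" "p (nd x y) = y" "\<And>i. i < nd x y \<Longrightarrow> (p i, p (Suc i)) \<in> adjacency \<Gamma>"
      using rel[OF xy] unfolding relpow_fun_conv by blast
    have pV: "p i \<in> verts \<Gamma>" if "i \<le> nd x y" for i
      using p(1) xy V[OF p(3)] that by (cases i) auto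
    have seg: "(p i, p (i + k)) \<in> adjacency \<Gamma> ^^ k" if "i + k \<le> nd x y" for i k
      using that
    proof (induction k)
      case (Suc k)
      then show ?case using relpow_Suc_I[of "p i" "p (i + k)" k _ "p (Suc (i + k))"] p(3)[of "i + k"] by auto
    qed simp
    have dseg: "nd (p i) (p j) = j - i" if "i \<le> j" "j \<le> nd x y" for i j
    proof (rule antisym)
      show "nd (p i) (p j) \<le> j - i" using le[OF seg[of i "j - i"]] that by simp
      have "(x, y) \<in> adjacency \<Gamma> ^^ (i + nd (p i) (p j) + (nd x y - j))"
      proof -
        have "(x, p i) \<in> adjacency \<Gamma> ^^ i" "(p j, y) \<in> adjacency \<Gamma> ^^ (nd x y - j)"
          using seg[of 0 i] seg[of j "nd x y - j"] that p(1,2) by auto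
        moreover have "(p i, p j) \<in> adjacency \<Gamma> ^^ nd (p i) (p j)" using rel[OF pV pV, of i j] that by simp
        ultimately show ?thesis unfolding relpow_add by (blast intro: relcompI)
      qed
      from le[OF this] show "j - i \<le> nd (p i) (p j)" using that by linarith
    qed
    have "nd u v = nd v u" if "u \<in> verts \<Gamma>" "v \<in> verts \<Gamma>" for u v
      using le[OF sym[OF rel[OF that]]] le[OF sym[OF rel[OF that(2,1)]]] by simp
    then have "nd (p i) (p j) = (if i \<le> j then j - i else i - j)" if "i \<le> nd x y" "j \<le> nd x y" for i j
      using dseg[of i j] dseg[of j i] pV that by auto
    then have "geodesic_in (verts \<Gamma>) (graph_dist \<Gamma>) p (nd x y) x y"
      unfolding geodesic_in_def using p(1,2) pV by (auto simp: gd of_nat_diff)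
    then show "\<exists>p n. geodesic_in (verts \<Gamma>) (graph_dist \<Gamma>) p n x y" by blast
  next
    fix x y z assume "x \<in> verts \<Gamma>" "y \<in> verts \<Gamma>" "z \<in> verts \<Gamma>"
    then have "(x, z) \<in> adjacency \<Gamma> ^^ (nd x y + nd y z)" using rel by (auto simp: relpow_add intro!: relcompI)
    from le[OF this] show "graph_dist \<Gamma> x z \<le> graph_dist \<Gamma> x y + graph_dist \<Gamma> y z" by (simp add: gd)
  qed (simp add: gd)
qed

lemma graph_dist_commute: "graph_dist \<Gamma> u v = graph_dist \<Gamma> v u"
proof -
  have "(v, u) \<in> adjacency \<Gamma> ^^ n" if "(u, v) \<in> adjacency \<Gamma> ^^ n" for u v n
    using that
  proof (induction n arbitrary: v)
    case (Suc n)
    then obtain w where w: "(u, w) \<in> adjacency \<Gamma> ^^ n" "(w, v) \<in> adjacency \<Gamma>" by auto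
    then have "(v, w) \<in> adjacency \<Gamma>" by (simp add: adjacency_def insert_commute)
    then show ?case using Suc.IH[OF w(1)] by (rule relpow_Suc_I2)
  qed simp
  then have "(u, v) \<in> adjacency \<Gamma> ^^ n \<longleftrightarrow> (v, u) \<in> adjacency \<Gamma> ^^ n" for n by blast
  then show ?thesis by (simp add: graph_dist_def)
qed

lemma graph_Metric_space:
  assumes "simple_graph \<Gamma>" "connected_graph \<Gamma>" shows "Metric_space (verts \<Gamma>) (graph_dist \<Gamma>)"
proof -
  interpret discrete_geodesic "verts \<Gamma>" "graph_dist \<Gamma>" by (rule graph_discrete_geodesic(1)[OF assms])
  show ?thesis by unfold_locales (use d_nonneg d_tri d_zero graph_dist_commute in auto)
qed

lemma graph_mtopology:
  assumes "simple_graph \<Gamma>" "connected_graph \<Gamma>"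
  shows "Metric_space.mtopology (verts \<Gamma>) (graph_dist \<Gamma>) = discrete_topology (verts \<Gamma>)"
proof -
  interpret Metric_space "verts \<Gamma>" "graph_dist \<Gamma>" by (rule graph_Metric_space[OF assms])
  have "mball x 1 \<subseteq> {x}" for x
  proof
    fix y assume "y \<in> mball x 1"
    then have xy: "x \<in> verts \<Gamma>" "y \<in> verts \<Gamma>" "graph_dist \<Gamma> x y < 1" by auto
    then have "graph_dist \<Gamma> x y = 0" by (simp add: graph_dist_def)
    then show "y \<in> {x}" using zero[OF xy(1,2)] by simp
  qed
  then have "openin mtopology U" if "U \<subseteq> verts \<Gamma>" for U
    unfolding openin_mtopology using that by (meson insert_subset order_trans singletonI subsetI subset_singletonD zero_less_one empty_subsetI)
  then show ?thesis
    unfolding topology_eq by (auto simp: openin_mtopology)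
qed

section \<open>The graph of cosets\<close>
text \<open>
  The situation of the main theorem with all topology of surfaces removed.
\<close>
locale coarse_action = group G + discrete_hyperbolic V d \<delta> + H: subgroup H G
  for G (structure) and V :: "'v set" and d \<delta> and H +
  fixes T :: "'a topology" and act :: "'a \<Rightarrow> 'v \<Rightarrow> 'v" and x0 :: 'v and R \<epsilon> :: real
  assumes topspace: "topspace T = carrier G"
    and left_continuous: "g \<in> carrier G \<Longrightarrow> openin T U \<Longrightarrow> openin T {h \<in> carrier G. g \<otimes> h \<in> U}"
    and right_continuous: "g \<in> carrier G \<Longrightarrow> openin T U \<Longrightarrow> openin T {h \<in> carrier G. h \<otimes> g \<in> U}"
    and H_open: "openin T H"
    and act_closed: "g \<in> carrier G \<Longrightarrow> x \<in> V \<Longrightarrow> act g x \<in> V"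
    and act_mult: "g \<in> carrier G \<Longrightarrow> h \<in> carrier G \<Longrightarrow> x \<in> V \<Longrightarrow> act (g \<otimes> h) x = act g (act h x)"
    and act_one: "x \<in> V \<Longrightarrow> act \<one> x = x"
    and act_isometry: "g \<in> carrier G \<Longrightarrow> x \<in> V \<Longrightarrow> y \<in> V \<Longrightarrow> d (act g x) (act g y) = d x y"
    and x0: "x0 \<in> V"
    and H_small: "h \<in> H \<Longrightarrow> d x0 (act h x0) \<le> \<epsilon>"
    and orbit_dense: "x \<in> V \<Longrightarrow> \<exists>g\<in>carrier G. d x (act g x0) \<le> R"
begin

abbreviation orb :: "'a \<Rightarrow> 'v" where "orb g \<equiv> act g x0"

text \<open>
  The bound \<open>2 * R + 1\<close> allows for two consecutive points of a geodesic, each within \<open>R\<close> of the orbit.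
\<close>
definition coset_graph :: "'a set graph" where
  "coset_graph = \<lparr>verts = (\<lambda>a. a <# H) ` carrier G,
     edges = {{a <# H, b <# H} |a b. a \<in> carrier G \<and> b \<in> carrier G \<and> a <# H \<noteq> b <# H \<and> d (orb a) (orb b) \<le> 2 * R + 1}\<rparr>"

definition coset_action :: "'a \<Rightarrow> 'a set \<Rightarrow> 'a set" where
  "coset_action g = (\<lambda>C\<in>verts coset_graph. g <# C)"

lemma verts_coset: "verts coset_graph = (\<lambda>a. a <# H) ` carrier G"
  by (simp add: coset_graph_def)

lemma adjacency_coset:
  "(u, v) \<in> adjacency coset_graph \<longleftrightarrow>
    u \<noteq> v \<and> (\<exists>a\<in>carrier G. \<exists>b\<in>carrier G. u = a <# H \<and> v = b <# H \<and> d (orb a) (orb b) \<le> 2 * R + 1)"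
proof
  assume "(u, v) \<in> adjacency coset_graph"
  then obtain a b where ab: "{u, v} = {a <# H, b <# H}" "a \<in> carrier G" "b \<in> carrier G" "a <# H \<noteq> b <# H" "d (orb a) (orb b) \<le> 2 * R + 1"
    by (auto simp: adjacency_def coset_graph_def)
  then have "u = a <# H \<and> v = b <# H \<or> u = b <# H \<and> v = a <# H" by (auto simp: doubleton_eq_iff)
  moreover have "d (orb b) (orb a) \<le> 2 * R + 1" using ab(2,3,5) d_sym act_closed x0 by metis
  ultimately show "u \<noteq> v \<and> (\<exists>a\<in>carrier G. \<exists>b\<in>carrier G. u = a <# H \<and> v = b <# H \<and> d (orb a) (orb b) \<le> 2 * R + 1)"
    using ab(2-5) by metis
qed (auto simp: adjacency_def coset_graph_def)

lemma coset_eqI: "a \<in> carrier G \<Longrightarrow> b \<in> a <# H \<Longrightarrow> b <# H = a <# H"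
  using l_repr_independence[OF _ _ H.subgroup_axioms] by simp

lemma coset_self: "a \<in> carrier G \<Longrightarrow> a \<in> a <# H"
  using H.one_closed by (force simp: l_coset_def)

lemma coset_eq_iff: "a \<in> carrier G \<Longrightarrow> b \<in> carrier G \<Longrightarrow> b <# H = a <# H \<longleftrightarrow> inv a \<otimes> b \<in> H"
proof
  assume ab: "a \<in> carrier G" "b \<in> carrier G"
  show "inv a \<otimes> b \<in> H" if "b <# H = a <# H"
  proof -
    have "b \<in> a <# H" using coset_self[OF ab(2)] that by blast
    then obtain h where h: "h \<in> H" "b = a \<otimes> h" unfolding l_coset_def by blast
    then have "inv a \<otimes> b = h" using ab H.mem_carrier inv_solve_left' by metis
    then show ?thesis using h by simp
  qed
  show "b <# H = a <# H" if "inv a \<otimes> b \<in> H"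
    using H.lcos_module_rev[OF is_group ab that] coset_eqI[OF ab(1)] by blast
qed

lemma orb_in_coset:
  assumes a: "a \<in> carrier G" and b: "b \<in> a <# H" shows "d (orb a) (orb b) \<le> \<epsilon>"
proof -
  obtain h where h: "h \<in> H" "b = a \<otimes> h" using b by (auto simp: l_coset_def)
  have hG: "h \<in> carrier G" using h(1) H.mem_carrier by blast
  have "orb b = act a (orb h)" using act_mult[OF a hG x0] h(2) by simp
  then show ?thesis using act_isometry[OF a x0 act_closed[OF hG x0]] H_small[OF h(1)] by simp
qed

lemma eps_nonneg: "0 \<le> \<epsilon>"
  using H_small[OF H.one_closed] d_nonneg[of x0 "orb \<one>"] by linarith

lemma R_nonneg: "0 \<le> R"
  using orbit_dense[OF x0] d_nonneg by (meson order_trans)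

text \<open>
  The choice of a representative matters only up to \<open>\<epsilon>\<close>.
\<close>
definition orbit_map :: "'a set \<Rightarrow> 'v" where
  "orbit_map u = orb (SOME a. a \<in> u)"

lemma orbit_map_coset:
  assumes a: "a \<in> carrier G"
  shows "\<exists>b\<in>carrier G. a <# H = b <# H \<and> orbit_map (a <# H) = orb b" "d (orb a) (orbit_map (a <# H)) \<le> \<epsilon>"
    "orbit_map (a <# H) \<in> V"
proof -
  define b where "b = (SOME b. b \<in> a <# H)"
  have b: "b \<in> a <# H" unfolding b_def using coset_self[OF a] by (rule someI)
  have bG: "b \<in> carrier G" using l_coset_carrier[OF b a H.subgroup_axioms] .
  have o: "orbit_map (a <# H) = orb b" by (simp add: orbit_map_def b_def)
  show "\<exists>b\<in>carrier G. a <# H = b <# H \<and> orbit_map (a <# H) = orb b" using bG o coset_eqI[OF a b] by metis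
  show "d (orb a) (orbit_map (a <# H)) \<le> \<epsilon>" using orb_in_coset[OF a b] o by simp
  show "orbit_map (a <# H) \<in> V" using o act_closed[OF bG x0] by simp
qed

lemma orbit_map_in: "u \<in> verts coset_graph \<Longrightarrow> orbit_map u \<in> V"
  using orbit_map_coset(3) by (auto simp: verts_coset)

lemma simple_coset_graph: "simple_graph coset_graph"
  unfolding simple_graph_def coset_graph_def by auto

lemma orbit_map_adjacent:
  assumes "(u, v) \<in> adjacency coset_graph"
  shows "d (orbit_map u) (orbit_map v) \<le> 2 * R + 1 + 2 * \<epsilon>"
proof -
  obtain a b where ab: "a \<in> carrier G" "b \<in> carrier G" "u = a <# H" "v = b <# H" "d (orb a) (orb b) \<le> 2 * R + 1"
    using assms unfolding adjacency_coset by blast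
  have V: "orb a \<in> V" "orb b \<in> V" "orbit_map u \<in> V" "orbit_map v \<in> V" using ab act_closed x0 orbit_map_coset(3) by auto
  have "d (orbit_map u) (orb a) \<le> \<epsilon>" "d (orb b) (orbit_map v) \<le> \<epsilon>"
    using orbit_map_coset(2)[OF ab(1)] orbit_map_coset(2)[OF ab(2)] ab(3,4) d_sym[OF V(3,1)] by auto
  then show ?thesis using d_tri[OF V(3,1,4)] d_tri[OF V(1,2,4)] ab(5) by linarith
qed

text \<open>
  Replace the points of a geodesic by nearby orbit points. The additional step is needed because two different cosets can have
  the same orbit point.
\<close>
lemma coset_walk:
  assumes u: "u \<in> verts coset_graph" and v: "v \<in> verts coset_graph"
  shows "\<exists>m. real m \<le> d (orbit_map u) (orbit_map v) + 1 \<and> (u, v) \<in> adjacency coset_graph ^^ m"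
proof -
  obtain a where a: "a \<in> carrier G" "u = a <# H" "orbit_map u = orb a" using u orbit_map_coset(1) unfolding verts_coset by blast
  obtain b where b: "b \<in> carrier G" "v = b <# H" "orbit_map v = orb b" using v orbit_map_coset(1) unfolding verts_coset by blast
  obtain p n where p: "geodesic p n (orb a) (orb b)" using geodesic_exists act_closed x0 a(1) b(1) by blast
  note P = geodesicD[OF p]
  have "\<forall>i. \<exists>c. c \<in> carrier G \<and> (i \<le> n \<longrightarrow> d (p i) (orb c) \<le> R)"
    using orbit_dense P(3) a(1) by blast
  then obtain c where c: "\<And>i. c i \<in> carrier G" "\<And>i. i \<le> n \<Longrightarrow> d (p i) (orb (c i)) \<le> R" using choice by metis
  \<comment> \<open>Both ends of the geodesic are themselves orbit points; the index \<open>Suc n\<close> returns to the coset of \<open>b\<close>.\<close>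
  define q where "q i = (if i = 0 then a else if i \<le> n then c i else b)" for i
  define r where "r i = p (min i n)" for i
  have qG: "q i \<in> carrier G" for i using a(1) b(1) c(1) by (simp add: q_def)
  have V: "r i \<in> V" "orb (q i) \<in> V" for i using P(3) act_closed[OF qG x0] by (auto simp: r_def)
  have near: "d (r i) (orb (q i)) \<le> R" for i
    using c(2)[of i] P(1,2,5,6) R_nonneg d_zero[of "orb a" "orb a"] d_zero[of "orb b" "orb b"] by (auto simp: q_def r_def min_def)
  have step: "d (orb (q i)) (orb (q (Suc i))) \<le> 2 * R + 1" for i
  proof -
    have "d (r i) (r (Suc i)) \<le> 1" unfolding r_def using P(4)[of "min i n" "min (Suc i) n"] by (simp add: min_def split: if_splits)
    then show ?thesis
      using d_tri[OF V(2)[of i] V(1)[of i] V(2)[of "Suc i"]] d_tri[OF V(1)[of i] V(1)[of "Suc i"] V(2)[of "Suc i"]]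
        near[of i] near[of "Suc i"] d_sym[OF V(2,1), of i i] by linarith
  qed
  have walk: "\<exists>m\<le>i. (u, q i <# H) \<in> adjacency coset_graph ^^ m" for i
  proof (induction i)
    case 0
    show ?case using a(2) by (simp add: q_def)
  next
    case (Suc i)
    then obtain m where m: "m \<le> i" "(u, q i <# H) \<in> adjacency coset_graph ^^ m" by blast
    show ?case
    proof (cases "q i <# H = q (Suc i) <# H")
      case True
      then show ?thesis using m by (intro exI[of _ m]) auto
    next
      case False
      then have "(q i <# H, q (Suc i) <# H) \<in> adjacency coset_graph"
        unfolding adjacency_coset using qG step by blast
      then show ?thesis using m by (intro exI[of _ "Suc m"]) auto
    qed
  qed
  obtain m where m: "m \<le> Suc n" "(u, q (Suc n) <# H) \<in> adjacency coset_graph ^^ m" using walk by blast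
  then show ?thesis using P(7) a(3) b(2,3) by (intro exI[of _ m]) (auto simp: q_def)
qed

lemma connected_coset_graph: "connected_graph coset_graph"
  unfolding connected_graph_def using coset_walk by (auto dest: relpow_imp_rtrancl)

lemmas coset_dist = graph_discrete_geodesic[OF simple_coset_graph connected_coset_graph]

lemma orbit_map_upper:
  assumes u: "u \<in> verts coset_graph" and v: "v \<in> verts coset_graph"
  shows "d (orbit_map u) (orbit_map v) \<le> (2 * R + 1 + 2 * \<epsilon>) * graph_dist coset_graph u v"
proof -
  obtain n where n: "(u, v) \<in> adjacency coset_graph ^^ n" "graph_dist coset_graph u v = real n" using coset_dist(4)[OF u v] by blast
  have "d (orbit_map u) (orbit_map v) \<le> (2 * R + 1 + 2 * \<epsilon>) * real n"
    if "(u, v) \<in> adjacency coset_graph ^^ n" "v \<in> verts coset_graph" for n v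
    using that
  proof (induction n arbitrary: v)
    case 0
    then show ?case using d_zero[of "orbit_map u" "orbit_map u"] orbit_map_in[OF u] by simp
  next
    case (Suc n)
    then obtain w where w: "(u, w) \<in> adjacency coset_graph ^^ n" "(w, v) \<in> adjacency coset_graph" by auto
    then have wV: "w \<in> verts coset_graph" by (auto simp: adjacency_coset verts_coset)
    show ?case
      using Suc.IH[OF w(1) wV] orbit_map_adjacent[OF w(2)] d_tri[OF orbit_map_in orbit_map_in orbit_map_in, OF u wV Suc.prems(2)]
      by (simp add: algebra_simps)
  qed
  then show ?thesis using n v by simp
qed

lemma orbit_map_lower:
  assumes u: "u \<in> verts coset_graph" and v: "v \<in> verts coset_graph"
  shows "graph_dist coset_graph u v \<le> d (orbit_map u) (orbit_map v) + 1"
  using coset_walk[OF assms] coset_dist(3) order_trans by blast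

lemma quasi_isometric_coset: "quasi_isometric (verts coset_graph) (graph_dist coset_graph) V d"
proof -
  define L where "L = 2 * R + 1 + 2 * \<epsilon>"
  have L: "1 \<le> L" using R_nonneg eps_nonneg by (simp add: L_def)
  have low: "graph_dist coset_graph u v / L - (R + \<epsilon> + 1) \<le> d (orbit_map u) (orbit_map v)"
    and up: "d (orbit_map u) (orbit_map v) \<le> L * graph_dist coset_graph u v + (R + \<epsilon> + 1)"
    if uv: "u \<in> verts coset_graph" "v \<in> verts coset_graph" for u v
  proof -
    have "0 \<le> graph_dist coset_graph u v" by (simp add: graph_dist_def)
    then have "graph_dist coset_graph u v / L \<le> graph_dist coset_graph u v" using L by (simp add: divide_le_eq mult_left_le mult_le_cancel_left1)
    then show "graph_dist coset_graph u v / L - (R + \<epsilon> + 1) \<le> d (orbit_map u) (orbit_map v)"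
      using orbit_map_lower[OF uv] R_nonneg eps_nonneg by linarith
    show "d (orbit_map u) (orbit_map v) \<le> L * graph_dist coset_graph u v + (R + \<epsilon> + 1)"
      using orbit_map_upper[OF uv] R_nonneg eps_nonneg by (simp add: L_def)
  qed
  have onto: "\<exists>u\<in>verts coset_graph. d y (orbit_map u) \<le> R + \<epsilon> + 1" if y: "y \<in> V" for y
  proof -
    obtain a where a: "a \<in> carrier G" "d y (orb a) \<le> R" using orbit_dense[OF y] by blast
    have "d y (orbit_map (a <# H)) \<le> d y (orb a) + d (orb a) (orbit_map (a <# H))"
      using d_tri[OF y act_closed[OF a(1) x0] orbit_map_coset(3)[OF a(1)]] .
    then show ?thesis using a orbit_map_coset(2)[OF a(1)] by (intro bexI[of _ "a <# H"]) (auto simp: verts_coset)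
  qed
  have "orbit_map \<in> verts coset_graph \<rightarrow> V" using orbit_map_in by blast
  moreover have "0 \<le> R + \<epsilon> + 1" using R_nonneg eps_nonneg by simp
  ultimately show ?thesis unfolding quasi_isometric_def using L low up onto by blast
qed

lemma hyperbolic_coset: "\<exists>\<delta>'. hyperbolic_graph coset_graph \<delta>'"
  unfolding hyperbolic_graph_def
  using hyperbolic_transfer[OF coset_dist(1) orbit_map_in _ orbit_map_upper orbit_map_lower] R_nonneg eps_nonneg
    connected_coset_graph by simp

lemma coset_action_apply: "g \<in> carrier G \<Longrightarrow> a \<in> carrier G \<Longrightarrow> coset_action g (a <# H) = (g \<otimes> a) <# H"
  by (simp add: coset_action_def verts_coset lcos_m_assoc H.subset)

lemma graph_action_coset: "graph_action G coset_graph coset_action"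
proof -
  let ?E = "verts coset_graph"
  have closed: "coset_action g u \<in> ?E" if "g \<in> carrier G" "u \<in> ?E" for g u
    using that coset_action_apply by (auto simp: verts_coset)
  have mult: "coset_action (g \<otimes> h) u = coset_action g (coset_action h u)" if "g \<in> carrier G" "h \<in> carrier G" "u \<in> ?E" for g h u
    using that coset_action_apply m_assoc by (auto simp: verts_coset)
  have one: "coset_action \<one> u = u" if "u \<in> ?E" for u
    using that coset_action_apply by (auto simp: verts_coset)
  have inv: "coset_action (inv g) (coset_action g u) = u" "coset_action g (coset_action (inv g) u) = u" if "g \<in> carrier G" "u \<in> ?E" for g u
    using mult[of "inv g" g u] mult[of g "inv g" u] that one by auto
  have bij: "coset_action g \<in> Bij ?E" if g: "g \<in> carrier G" for g
  proof -
    have "bij_betw (coset_action g) ?E ?E"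
      by (rule bij_betw_byWitness[where f' = "coset_action (inv g)"]) (use g closed inv in auto)
    then show ?thesis by (simp add: Bij_def coset_action_def)
  qed
  have "coset_action (g \<otimes> h) = compose ?E (coset_action g) (coset_action h)" if "g \<in> carrier G" "h \<in> carrier G" for g h
  proof
    fix u show "coset_action (g \<otimes> h) u = compose ?E (coset_action g) (coset_action h) u"
      using mult[OF that, of u] by (cases "u \<in> ?E") (auto simp: compose_def coset_action_def)
  qed
  then have "coset_action \<in> hom G (BijGroup ?E)"
    using bij by (auto simp: hom_def BijGroup_def)
  then have "group_action G ?E coset_action"
    unfolding group_action_def group_hom_def group_hom_axioms_def using is_group group_BijGroup by blast
  moreover have edge: "{coset_action g u, coset_action g v} \<in> edges coset_graph" if g: "g \<in> carrier G" and e: "{u, v} \<in> edges coset_graph" for g u v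
  proof -
    have uv: "(u, v) \<in> adjacency coset_graph" using e by (simp add: adjacency_def)
    then obtain a b where ab: "a \<in> carrier G" "b \<in> carrier G" "u = a <# H" "v = b <# H" "d (orb a) (orb b) \<le> 2 * R + 1" "u \<noteq> v"
      unfolding adjacency_coset by blast
    have E: "u \<in> ?E" "v \<in> ?E" using ab by (auto simp: verts_coset)
    have ne: "coset_action g u \<noteq> coset_action g v" using inv(1)[OF g E(1)] inv(1)[OF g E(2)] ab(6) by metis
    have "d (orb (g \<otimes> a)) (orb (g \<otimes> b)) \<le> 2 * R + 1"
      using act_mult[OF g ab(1) x0] act_mult[OF g ab(2) x0] act_isometry[OF g act_closed[OF ab(1) x0] act_closed[OF ab(2) x0]] ab(5) by simp
    then have "(coset_action g u, coset_action g v) \<in> adjacency coset_graph"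
      unfolding adjacency_coset using ne ab coset_action_apply[OF g ab(1)] coset_action_apply[OF g ab(2)] m_closed[OF g ab(1)] m_closed[OF g ab(2)] by blast
    then show ?thesis by (simp add: adjacency_def)
  qed
  moreover have "{u, v} \<in> edges coset_graph" if g: "g \<in> carrier G" and uv: "u \<in> ?E" "v \<in> ?E" and "{coset_action g u, coset_action g v} \<in> edges coset_graph" for g u v
    using edge[OF inv_closed[OF g] that(4)] inv(1)[OF g uv(1)] inv(1)[OF g uv(2)] by simp
  ultimately show ?thesis unfolding graph_action_def by blast
qed

lemma transitive_coset: "transitive_action G (verts coset_graph) coset_action"
proof -
  have "\<exists>g\<in>carrier G. coset_action g u = v" if uv: "u \<in> verts coset_graph" "v \<in> verts coset_graph" for u v
  proof -
    obtain a b where ab: "a \<in> carrier G" "b \<in> carrier G" "u = a <# H" "v = b <# H" using uv by (auto simp: verts_coset)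
    have "coset_action (b \<otimes> inv a) u = v" using ab coset_action_apply[of "b \<otimes> inv a" a] by (simp add: m_assoc)
    then show ?thesis using ab by blast
  qed
  then show ?thesis using graph_action_coset
    unfolding transitive_action_def transitive_action_axioms_def graph_action_def by blast
qed

lemma continuous_coset: "continuous_action T (verts coset_graph) (graph_dist coset_graph) coset_action"
proof -
  let ?E = "verts coset_graph"
  have disc: "Metric_space.mtopology ?E (graph_dist coset_graph) = discrete_topology ?E"
    by (rule graph_mtopology[OF simple_coset_graph connected_coset_graph])
  have "continuous_map (prod_topology T (discrete_topology ?E)) (discrete_topology ?E) (\<lambda>(g, u). coset_action g u)"
    unfolding continuous_map
  proof (intro conjI allI impI)
    show "(\<lambda>(g, u). coset_action g u) ` topspace (prod_topology T (discrete_topology ?E)) \<subseteq> topspace (discrete_topology ?E)"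
      using coset_action_apply by (auto simp: topspace verts_coset)
    fix W assume "openin (discrete_topology ?E) W"
    let ?P = "{p \<in> topspace (prod_topology T (discrete_topology ?E)). (case p of (g, u) \<Rightarrow> coset_action g u) \<in> W}"
    show "openin (prod_topology T (discrete_topology ?E)) ?P"
      unfolding openin_prod_topology_alt
    proof (intro allI impI)
      fix g u assume "(g, u) \<in> ?P"
      then have g: "g \<in> carrier G" "u \<in> ?E" "coset_action g u \<in> W" by (auto simp: topspace)
      then obtain a where a: "a \<in> carrier G" "u = a <# H" by (auto simp: verts_coset)
      \<comment> \<open>the elements that map \<open>a H\<close> to \<open>g a H\<close>, a translate of the open stabilizer of \<open>a H\<close>\<close>
      define O' where "O' = {h \<in> carrier G. h \<otimes> a \<in> {k \<in> carrier G. inv (g \<otimes> a) \<otimes> k \<in> H}}"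
      have "openin T O'"
        unfolding O'_def using a g by (intro right_continuous left_continuous H_open) auto
      moreover have "g \<in> O'" using a g H.one_closed by (simp add: O'_def l_inv)
      moreover have "O' \<times> {u} \<subseteq> ?P"
      proof
        fix p assume "p \<in> O' \<times> {u}"
        then obtain h where h: "p = (h, u)" "h \<in> carrier G" "inv (g \<otimes> a) \<otimes> (h \<otimes> a) \<in> H" by (auto simp: O'_def)
        have "(h \<otimes> a) <# H = (g \<otimes> a) <# H" using coset_eq_iff[of "g \<otimes> a" "h \<otimes> a"] h a g by simp
        then show "p \<in> ?P" using h(1,2) g a by (simp add: coset_action_apply topspace)
      qed
      moreover have "openin (discrete_topology ?E) {u}" using g(2) by simp
      ultimately show "\<exists>A B. openin T A \<and> openin (discrete_topology ?E) B \<and> g \<in> A \<and> u \<in> B \<and> A \<times> B \<subseteq> ?P"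
        by (intro exI[of _ O'] exI[of _ "{u}"]) auto
    qed
  qed
  then show ?thesis unfolding continuous_action_def disc .
qed

end

section \<open>Open subgroups of the mapping class group\<close>
lemma openin_Map_preimage:
  "openin (Map_topology S) U \<longleftrightarrow> U \<subseteq> carrier (Map S) \<and> openin (compact_open_topology S) {f \<in> homeos S. cls S f \<in> U}"
  by (rule openin_Map_topology)

lemma topspace_Map: "topspace (Map_topology S) = carrier (Map S)"
proof -
  have "{f \<in> homeos S. cls S f \<in> carrier (Map S)} = homeos S" unfolding carrier_Map by blast
  then have "openin (Map_topology S) (carrier (Map S))"
    unfolding openin_Map_preimage using openin_topspace[of "compact_open_topology S"]
    by (simp only: topspace_compact_open_topology subset_refl simp_thms)
  moreover have "topspace (Map_topology S) \<subseteq> carrier (Map S)"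
    using openin_topspace[of "Map_topology S"] unfolding openin_Map_preimage by (rule conjunct1)
  ultimately show ?thesis by (intro equalityI openin_subset)
qed

lemma Map_left_continuous:
  assumes g: "g \<in> carrier (Map S)" and U: "openin (Map_topology S) U"
  shows "openin (Map_topology S) {h \<in> carrier (Map S). g \<otimes>\<^bsub>Map S\<^esub> h \<in> U}"
proof -
  obtain a where a: "g = cls S a" "a \<in> homeos S" using g by (auto simp: carrier_Map)
  let ?W = "{f \<in> homeos S. cls S f \<in> U}"
  have "openin (compact_open_topology S) ?W" using U unfolding openin_Map_preimage by blast
  from openin_continuous_map_preimage[OF left_translation_continuous[OF a(2)] this]
  have "openin (compact_open_topology S) {f \<in> homeos S. compose (topspace S) a f \<in> ?W}"
    unfolding topspace_compact_open_topology .
  moreover have "{f \<in> homeos S. compose (topspace S) a f \<in> ?W} = {f \<in> homeos S. cls S f \<in> {h \<in> carrier (Map S). g \<otimes>\<^bsub>Map S\<^esub> h \<in> U}}"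
    unfolding a(1) carrier_Map using cls_mult[OF a(2)] compose_homeos[OF a(2)] by (intro Collect_cong) (simp cong: conj_cong)
  ultimately show ?thesis unfolding openin_Map_preimage by (intro conjI Collect_restrict) (simp only:)
qed

lemma Map_right_continuous:
  assumes g: "g \<in> carrier (Map S)" and U: "openin (Map_topology S) U"
  shows "openin (Map_topology S) {h \<in> carrier (Map S). h \<otimes>\<^bsub>Map S\<^esub> g \<in> U}"
proof -
  obtain a where a: "g = cls S a" "a \<in> homeos S" using g by (auto simp: carrier_Map)
  let ?W = "{f \<in> homeos S. cls S f \<in> U}"
  have "openin (compact_open_topology S) ?W" using U unfolding openin_Map_preimage by blast
  from openin_continuous_map_preimage[OF right_translation_continuous[OF a(2)] this]
  have "openin (compact_open_topology S) {f \<in> homeos S. compose (topspace S) f a \<in> ?W}"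
    unfolding topspace_compact_open_topology .
  moreover have "{f \<in> homeos S. compose (topspace S) f a \<in> ?W} = {f \<in> homeos S. cls S f \<in> {h \<in> carrier (Map S). h \<otimes>\<^bsub>Map S\<^esub> g \<in> U}}"
    unfolding a(1) carrier_Map using cls_mult[OF _ a(2)] compose_homeos[OF _ a(2)] by (intro Collect_cong) (simp cong: conj_cong)
  ultimately show ?thesis unfolding openin_Map_preimage by (intro conjI Collect_restrict) (simp only:)
qed

text \<open>
  Only one representative has to fix \<open>K\<close>.
\<close>
definition fixing_classes :: "'a topology \<Rightarrow> 'a set \<Rightarrow> ('a \<Rightarrow> 'a) set set" where
  "fixing_classes S K = cls S ` {f \<in> homeos S. \<forall>x\<in>K. f x = x}"

lemma subgroup_fixing_classes:
  assumes K: "K \<subseteq> topspace S" shows "subgroup (fixing_classes S K) (Map S)"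
proof -
  interpret M: group "Map S" by (rule group_Map)
  have mult: "a \<otimes>\<^bsub>Map S\<^esub> b \<in> fixing_classes S K" if ab: "a \<in> fixing_classes S K" "b \<in> fixing_classes S K" for a b
  proof -
    obtain f g where f: "a = cls S f" "f \<in> homeos S" "\<forall>x\<in>K. f x = x" and g: "b = cls S g" "g \<in> homeos S" "\<forall>x\<in>K. g x = x"
      using ab unfolding fixing_classes_def by blast
    have "\<forall>x\<in>K. compose (topspace S) f g x = x" using f(3) g(3) K by (auto simp: compose_def)
    then show ?thesis using cls_mult[OF f(2) g(2)] compose_homeos[OF f(2) g(2)] f(1) g(1) unfolding fixing_classes_def by blast
  qed
  have inv: "inv\<^bsub>Map S\<^esub> a \<in> fixing_classes S K" if a: "a \<in> fixing_classes S K" for a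
  proof -
    obtain f where f: "a = cls S f" "f \<in> homeos S" "\<forall>x\<in>K. f x = x" using a unfolding fixing_classes_def by blast
    have "\<forall>x\<in>K. hinv S f x = x" using hinv_apply(1)[OF f(2)] f(3) K by (metis subsetD)
    moreover have "compose (topspace S) (hinv S f) f = (\<lambda>x\<in>topspace S. x)"
      using hinv_apply(1)[OF f(2)] by (auto simp: compose_def fun_eq_iff)
    then have "cls S (hinv S f) \<otimes>\<^bsub>Map S\<^esub> a = \<one>\<^bsub>Map S\<^esub>"
      using cls_mult[OF hinv_homeos[OF f(2)] f(2)] by (simp add: f(1) one_Map)
    then have "inv\<^bsub>Map S\<^esub> a = cls S (hinv S f)"
      by (rule M.inv_equality) (use f hinv_homeos[OF f(2)] in \<open>auto simp: carrier_Map\<close>)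
    ultimately show ?thesis using hinv_homeos[OF f(2)] unfolding fixing_classes_def by blast
  qed
  have one: "\<one>\<^bsub>Map S\<^esub> \<in> fixing_classes S K"
  proof -
    have "\<forall>x\<in>K. (\<lambda>x\<in>topspace S. x) x = x" using K by auto
    then show ?thesis unfolding fixing_classes_def one_Map using one_homeos[of S] by blast
  qed
  have "fixing_classes S K \<subseteq> carrier (Map S)" unfolding fixing_classes_def carrier_Map by blast
  then show ?thesis using one inv mult by (intro M.subgroupI) auto
qed

text \<open>
  It contains a neighbourhood of the identity, and translation does the rest.
\<close>
lemma open_fixing_classes:
  assumes S: "surface S" "connected_space S" and K: "compactin S K"
  shows "openin (Map_topology S) (fixing_classes S K)"
proof -
  interpret M: group "Map S" by (rule group_Map)
  interpret H: subgroup "fixing_classes S K" "Map S"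
    by (rule subgroup_fixing_classes[OF compactin_subset_topspace[OF K]])
  obtain V where V: "openin (compact_open_topology S) V" "idS S \<in> V"
    "\<forall>f\<in>V. \<exists>f'. (f, f') \<in> isotopy_rel S \<and> (\<forall>x\<in>K. f' x = x)"
    using near_identity_isotopic_to_fixing[OF S K] by blast
  have VH: "f \<in> homeos S \<and> cls S f \<in> fixing_classes S K" if f: "f \<in> V" for f
  proof -
    obtain f' where f': "(f, f') \<in> isotopy_rel S" "\<forall>x\<in>K. f' x = x" using V(3) f by blast
    then have "f \<in> homeos S" "f' \<in> homeos S" "cls S f = cls S f'" using cls_eq_iff[of f S f'] f'(1) unfolding isotopic_iff by simp_all
    then show ?thesis unfolding fixing_classes_def using f'(2) by blast
  qed
  let ?P = "{f \<in> homeos S. cls S f \<in> fixing_classes S K}"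
  have "openin (compact_open_topology S) ?P"
  proof (subst openin_subopen, intro ballI)
    fix h assume h: "h \<in> ?P"
    then have hS: "h \<in> homeos S" "cls S h \<in> fixing_classes S K" by auto
    let ?N = "{f \<in> homeos S. compose (topspace S) (hinv S h) f \<in> V}"
    have "openin (compact_open_topology S) ?N"
      using openin_continuous_map_preimage[OF left_translation_continuous[OF hinv_homeos[OF hS(1)]] V(1)]
      unfolding topspace_compact_open_topology .
    moreover have "compose (topspace S) (hinv S h) h = idS S"
      using hinv_apply(1)[OF hS(1)] by (auto simp: compose_def fun_eq_iff)
    then have "h \<in> ?N" using hS(1) V(2) by simp
    moreover have "?N \<subseteq> ?P"
    proof
      fix f assume f: "f \<in> ?N"
      let ?k = "compose (topspace S) (hinv S h) f"
      have k: "?k \<in> homeos S" "cls S ?k \<in> fixing_classes S K" using VH f by auto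
      have fS: "f \<in> homeos S" using f by simp
      have "compose (topspace S) h ?k = f"
        using hinv_apply(2)[OF hS(1)] homeosD(7)[OF fS] homeosD(1)[OF fS] by (auto simp: compose_def fun_eq_iff extensional_def)
      then have "cls S f = cls S h \<otimes>\<^bsub>Map S\<^esub> cls S ?k" using cls_mult[OF hS(1) k(1)] by simp
      then show "f \<in> ?P" using H.m_closed[OF hS(2) k(2)] fS by simp
    qed
    ultimately show "\<exists>N. openin (compact_open_topology S) N \<and> h \<in> N \<and> N \<subseteq> ?P" by blast
  qed
  then show ?thesis unfolding openin_Map_preimage using H.subset by blast
qed

text \<open>
  A basic neighbourhood of the identity restricts a homeomorphism only on finitely many compact sets.
\<close>
lemma fixing_classes_small:
  assumes U: "openin (Map_topology S) U" and one: "\<one>\<^bsub>Map S\<^esub> \<in> U"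
  shows "\<exists>K. compactin S K \<and> fixing_classes S K \<subseteq> U"
proof -
  let ?W = "{f \<in> homeos S. cls S f \<in> U}"
  have "openin (compact_open_topology S) ?W" "idS S \<in> ?W"
    using U one one_homeos[of S] unfolding openin_Map_preimage one_Map by auto
  then obtain F where F: "co_pairs S F" "idS S \<in> co_basic S F" "co_basic S F \<subseteq> ?W"
    using co_basic_nbhd by blast
  have fin: "finite F" and cpt: "\<And>p. p \<in> F \<Longrightarrow> compactin S (fst p)" using F(1) by (auto simp: co_pairs_def)
  define K where "K = \<Union> (fst ` F)"
  have "compactin S K" unfolding K_def by (rule compactin_Union) (use fin cpt in auto)
  moreover have "fixing_classes S K \<subseteq> U"
  proof
    fix a assume "a \<in> fixing_classes S K"
    then obtain f where f: "a = cls S f" "f \<in> homeos S" "\<forall>x\<in>K. f x = x" unfolding fixing_classes_def by blast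
    have "f ` fst p \<subseteq> snd p" if p: "p \<in> F" for p
    proof -
      have "idS S ` fst p \<subseteq> snd p" using F(2) p by (simp add: co_basic_def)
      moreover have "f ` fst p = idS S ` fst p"
        using f(3) p compactin_subset_topspace[OF cpt[OF p]] by (intro image_cong) (auto simp: K_def)
      ultimately show ?thesis by simp
    qed
    then have "f \<in> co_basic S F" using f(2) by (simp add: co_basic_def)
    then show "a \<in> U" using F(3) f(1) by blast
  qed
  ultimately show ?thesis by blast
qed

section \<open>The transitive model of the grand arc graph\<close>

theorem corollaryD:
  fixes S :: "'a topology"
  assumes "infinite_type_surface S"
    and "\<exists>\<delta>. hyperbolic_graph (grand_arc_graph S) \<delta>"
    and "quasi_continuous_action (Map S) (Map_topology S)
           (verts (grand_arc_graph S)) (graph_dist (grand_arc_graph S)) (grand_arc_action S)"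
    and "cobounded_action (Map S)
           (verts (grand_arc_graph S)) (graph_dist (grand_arc_graph S)) (grand_arc_action S)"
  shows "\<exists>(\<Gamma> :: ('a \<Rightarrow> 'a) set set graph) \<phi>.
           simple_graph \<Gamma> \<and> connected_graph \<Gamma> \<and>
           quasi_isometric (verts \<Gamma>) (graph_dist \<Gamma>)
             (verts (grand_arc_graph S)) (graph_dist (grand_arc_graph S)) \<and>
           (\<exists>\<delta>. hyperbolic_graph \<Gamma> \<delta>) \<and>
           graph_action (Map S) \<Gamma> \<phi> \<and>
           continuous_action (Map_topology S) (verts \<Gamma>) (graph_dist \<Gamma>) \<phi> \<and>
           transitive_action (Map S) (verts \<Gamma>) \<phi>"
proof -
  let ?V = "verts (grand_arc_graph S)" and ?d = "graph_dist (grand_arc_graph S)" and ?act = "grand_arc_action S"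
  have S: "surface S" "connected_space S" using assms(1) by (auto simp: infinite_type_surface_def)
  obtain \<delta> where conn: "connected_graph (grand_arc_graph S)" and hyp: "gromov_hyperbolic ?V ?d \<delta>"
    using assms(2) unfolding hyperbolic_graph_def by blast
  interpret X: discrete_geodesic ?V ?d
    by (rule graph_discrete_geodesic(1)[OF simple_grand_arc_graph conn])
  interpret X: discrete_hyperbolic ?V ?d "max \<delta> 0"
  proof
    fix w x y z assume "w \<in> ?V" "x \<in> ?V" "y \<in> ?V" "z \<in> ?V"
    then have "gromov_product ?d w x z \<ge> min (gromov_product ?d w x y) (gromov_product ?d w y z) - \<delta>"
      using hyp unfolding gromov_hyperbolic_def by blast
    then show "gromov_product ?d w x z \<ge> min (gromov_product ?d w x y) (gromov_product ?d w y z) - max \<delta> 0" by linarith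
  qed simp
  interpret M: Metric_space ?V ?d by (rule graph_Metric_space[OF simple_grand_arc_graph conn])
  interpret G: group "Map S" by (rule group_Map)
  obtain x0 R where x0: "x0 \<in> ?V" and orbit: "(\<Union>g\<in>carrier (Map S). ?act g ` M.mball x0 R) = ?V"
    using assms(4) unfolding cobounded_action_def by blast
  obtain \<epsilon> U where U: "openin (Map_topology S) U" "\<one>\<^bsub>Map S\<^esub> \<in> U" "\<forall>g\<in>U. ?d x0 (?act g x0) \<le> \<epsilon>"
    using assms(3) x0 unfolding quasi_continuous_action_def by blast
  obtain K where K: "compactin S K" "fixing_classes S K \<subseteq> U" using fixing_classes_small[OF U(1,2)] by blast
  have dense: "\<exists>g\<in>carrier (Map S). ?d x (?act g x0) \<le> R" if x: "x \<in> ?V" for x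
  proof -
    have "x \<in> (\<Union>g\<in>carrier (Map S). ?act g ` M.mball x0 R)" unfolding orbit by (rule x)
    then obtain g z where g: "g \<in> carrier (Map S)" "z \<in> ?V" "?d x0 z < R" "x = ?act g z" by auto
    then have "?d x (?act g x0) \<le> R"
      using grand_arc_action_isometric[OF g(1,2) x0] graph_dist_commute[of "grand_arc_graph S" z x0] by simp
    then show ?thesis using g(1) by blast
  qed
  interpret H: subgroup "fixing_classes S K" "Map S"
    by (rule subgroup_fixing_classes[OF compactin_subset_topspace[OF K(1)]])
  interpret coarse_action "Map S" ?V ?d "max \<delta> 0" "fixing_classes S K" "Map_topology S" ?act x0 R \<epsilon>
  proof
    show "topspace (Map_topology S) = carrier (Map S)" by (rule topspace_Map)
    show "openin (Map_topology S) (fixing_classes S K)" by (rule open_fixing_classes[OF S K(1)])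
    show "x0 \<in> ?V" by (rule x0)
    show "?d x0 (?act h x0) \<le> \<epsilon>" if "h \<in> fixing_classes S K" for h using that K(2) U(3) by blast
  qed (fact Map_left_continuous Map_right_continuous grand_arc_action_closed grand_arc_action_mult
      grand_arc_action_one grand_arc_action_isometric dense)+
  show ?thesis
    by (intro exI[of _ coset_graph] exI[of _ coset_action] conjI simple_coset_graph connected_coset_graph
        quasi_isometric_coset hyperbolic_coset graph_action_coset continuous_coset transitive_coset)
qed

end
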